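(* Let $\Delta\subset M_{\mathbb R}$ be a reflexive polytope with dual polytope $\Delta^*=\{n\in N_{\mathbb R}\mid\langle m,n\rangle\ge-1\ \forall m\in\Delta\}$, let $\Sigma_\Delta$ be the fan in $N_{\mathbb R}$ whose cones are generated by the proper faces of $\Delta^*$, and let $\Delta^*=\Delta_0^*+\Delta_1^*+\cdots+\Delta_k^*$ be a Minkowski sum decomposition into lattice polytopes in $N_{\mathbb R}$. For each proper face $\Gamma^*$ of $\Delta^*$ let $\Gamma^*=\Gamma_0^*+\Gamma_1^*+\cdots+\Gamma_k^*$ be the induced decomposition ($\Gamma_i^*$ a face of $\Delta_i^*$), and let $\tilde\Sigma_\Delta$ be the fan in $N_{\mathbb R}\oplus\mathbb R^k$ formed by the cones $$\tilde\sigma_{\Gamma^*}=\langle\Gamma_0^*-e_1-\cdots-e_k,\ \Gamma_1^*+e_1,\dots,\Gamma_k^*+e_k\rangle$$ (and their faces). Then the morphism of toric varieties $X_{\Sigma_\Delta}\to X_{\tilde\Sigma_\Delta}$ associated to the map of the fan $\Sigma_\Delta$ to $\tilde\Sigma_\Delta$ is an embedding, whose image is a complete intersection given by the equations $$\prod_{\langle e_i^*,v_\xi\rangle>0}x_\xi-\prod_{\langle e_i^*,v_\xi\rangle<0}x_\xi=0,\qquad i=1,\dots,k,$$ where $x_\xi$ are the homogeneous coordinates of $X_{\tilde\Sigma_\Delta}$ and $v_\xi$ are the primitive lattice generators of the one-dimensional cones $\xi\in\tilde\Sigma_\Delta(1)$.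
   Context: $N$ is a lattice, $M=\mathrm{Hom}(N,\mathbb Z)$; $\tilde N=N\oplus\mathbb Z^k$ where $\mathbb Z^k$ has standard basis $e_1,\dots,e_k$, and $e_1^*,\dots,e_k^*$ is the dual basis of the second summand of $\tilde M=M\oplus\mathbb Z^k$. $\langle\cdots\rangle$ applied to sets denotes the convex cone they generate. The map of fans is induced by the inclusion $N\subset\tilde N$. The empty face of $\Delta^*$ corresponds to the zero cone. Homogeneous coordinates: for a fan $\Sigma$ whose rays span the ambient space $N_{\mathbb R}$, $S(\Sigma)=\mathbb C[x_\rho\mid\rho\in\Sigma(1)]$ is graded by $\mathrm{Cl}(\Sigma)=\mathrm{coker}(M\to\mathbb Z^{\Sigma(1)},\,m\mapsto(\langle m,v_\rho\rangle)_\rho)$, $Z(\Sigma)\subset\mathbb C^{\Sigma(1)}$ is the zero set of the monomials $\prod_{\rho\not\subseteq\sigma}x_\rho$, $\sigma\in\Sigma$, and $\pi:\mathbb C^{\Sigma(1)}\setminus Z(\Sigma)\to X_\Sigma$ is Cox's quotient morphism. A homogeneous ideal $I\subseteq S(\Sigma)$ defines $\mathbf V(I)=\{p\in X_\Sigma\mid\exists x\in\pi^{-1}(p): f(x)=0\ \forall f\in I\}$. A complete intersection in $X_\Sigma$ (in homogeneous coordinates) is a subvariety $\mathbf V(I)$ where $I\subseteq S(\Sigma)$ is a radical homogeneous ideal generated by a regular sequence of homogeneous polynomials $f_1,\dots,f_k$ with $k=\dim X_\Sigma-\dim\mathbf V(I)$; it is said to be given by the equations $f_i=0$. *)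

theory Defs
  imports
    "HOL-Analysis.Analysis"
    "HOL-Algebra.Ideal"
    "HOL-Library.Poly_Mapping"
    "HOL-Library.Set_Algebras"
begin

section \<open>Lattices and lattice polytopes\<close>

text \<open>
  A lattice is the integral span of a linearly independent subset of a Euclidean space; it need not
  have full rank.  The inner product identifies \<open>span L\<close> with its dual, and thereby
  \<open>Hom(L, \<int>)\<close> with \<open>dual_lattice L\<close>.
\<close>

definition int_span :: "'a::real_vector set \<Rightarrow> 'a set" where
  "int_span B = {\<Sum>b\<in>B. of_int (c b) *\<^sub>R b | c. True}"

definition is_lattice :: "'a::euclidean_space set \<Rightarrow> bool" where
  "is_lattice L \<longleftrightarrow> (\<exists>B. independent B \<and> L = int_span B)"

definition dual_lattice :: "'a::euclidean_space set \<Rightarrow> 'a set" where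
  "dual_lattice L = {m \<in> span L. \<forall>n\<in>L. m \<bullet> n \<in> \<int>}"

definition lattice_polytope :: "'a::euclidean_space set \<Rightarrow> 'a set \<Rightarrow> bool" where
  "lattice_polytope L P \<longleftrightarrow> (\<exists>V. finite V \<and> V \<subseteq> L \<and> P = convex hull V)"

definition dual_polytope :: "'a::euclidean_space set \<Rightarrow> 'a set" where
  "dual_polytope \<Delta> = {n. \<forall>m\<in>\<Delta>. m \<bullet> n \<ge> -1}"

definition reflexive_polytope :: "'a::euclidean_space set \<Rightarrow> 'a set \<Rightarrow> bool" where
  "reflexive_polytope N \<Delta> \<longleftrightarrow>
     lattice_polytope (dual_lattice N) \<Delta> \<and> 0 \<in> interior \<Delta> \<and>
     lattice_polytope N (dual_polytope \<Delta>)"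


section \<open>Spaces with functions\<close>

text \<open>
  A complex variety is represented by its Zariski topology together with its sheaf of
  complex-valued regular functions: \<open>regular X W f\<close> says that \<open>f\<close> restricted to the open set
  \<open>W\<close> is regular, and does not depend on the values of \<open>f\<close> outside \<open>W\<close>.
\<close>

record 'p variety =
  zariski :: "'p topology"
  regular :: "'p set \<Rightarrow> ('p \<Rightarrow> complex) \<Rightarrow> bool"

abbreviation points :: "'p variety \<Rightarrow> 'p set" where
  "points X \<equiv> topspace (zariski X)"

definition is_morphism :: "'p variety \<Rightarrow> 'q variety \<Rightarrow> ('p \<Rightarrow> 'q) \<Rightarrow> bool" where
  "is_morphism X Y \<phi> \<longleftrightarrow>
     continuous_map (zariski X) (zariski Y) \<phi> \<and>
     (\<forall>W f. openin (zariski Y) W \<and> regular Y W f \<longrightarrow>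
        regular X {p \<in> points X. \<phi> p \<in> W} (f \<circ> \<phi>))"

definition is_isomorphism :: "'p variety \<Rightarrow> 'q variety \<Rightarrow> ('p \<Rightarrow> 'q) \<Rightarrow> bool" where
  "is_isomorphism X Y \<phi> \<longleftrightarrow>
     is_morphism X Y \<phi> \<and>
     (\<exists>\<psi>. is_morphism Y X \<psi> \<and> (\<forall>p\<in>points X. \<psi> (\<phi> p) = p) \<and> (\<forall>q\<in>points Y. \<phi> (\<psi> q) = q))"

text \<open>The induced reduced structure: regular functions are locally restrictions of regular
  functions of the ambient variety.\<close>

definition subvariety :: "'p variety \<Rightarrow> 'p set \<Rightarrow> 'p variety" where
  "subvariety Y Z =
     \<lparr>zariski = subtopology (zariski Y) Z,
      regular = (\<lambda>W f. \<forall>p\<in>W. \<exists>W' g. openin (zariski Y) W' \<and> p \<in> W' \<and> regular Y W' g \<and>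
                                   (\<forall>q\<in>W \<inter> W'. f q = g q))\<rparr>"

definition is_closed_embedding :: "'p variety \<Rightarrow> 'q variety \<Rightarrow> ('p \<Rightarrow> 'q) \<Rightarrow> bool" where
  "is_closed_embedding X Y \<phi> \<longleftrightarrow>
     closedin (zariski Y) (\<phi> ` points X) \<and>
     is_isomorphism X (subvariety Y (\<phi> ` points X)) \<phi>"

definition irreducible_closedin :: "'p topology \<Rightarrow> 'p set \<Rightarrow> bool" where
  "irreducible_closedin T Z \<longleftrightarrow>
     closedin T Z \<and> Z \<noteq> {} \<and>
     (\<forall>A B. closedin T A \<and> closedin T B \<and> Z \<subseteq> A \<union> B \<longrightarrow> Z \<subseteq> A \<or> Z \<subseteq> B)"

definition krull_dim :: "'p topology \<Rightarrow> enat" where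
  "krull_dim T =
     Sup {enat d | d. \<exists>Z. (\<forall>i\<le>d. irreducible_closedin T (Z i)) \<and> (\<forall>i<d. Z i \<subset> Z (Suc i))}"


section \<open>Toric varieties\<close>

text \<open>A fan is represented by the set of its cones.  In all definitions below, \<open>L\<close> is the lattice
  and \<open>\<Sigma>\<close> the fan.\<close>

definition dual_monoid :: "'a::euclidean_space set \<Rightarrow> 'a set \<Rightarrow> 'a set" where
  "dual_monoid L \<sigma> = {m \<in> dual_lattice L. \<forall>v\<in>\<sigma>. 0 \<le> m \<bullet> v}"

text \<open>The points of the affine chart \<open>U\<^sub>\<sigma>\<close>: monoid homomorphisms from
  \<open>\<sigma>\<^sup>\<or> \<inter> M\<close> to the multiplicative monoid of \<open>\<complex>\<close>.\<close>

definition chart :: "'a::euclidean_space set \<Rightarrow> 'a set \<Rightarrow> ('a \<Rightarrow> complex) set" where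
  "chart L \<sigma> =
     {\<gamma> \<in> extensional (dual_monoid L \<sigma>).
        \<gamma> 0 = 1 \<and> (\<forall>m\<in>dual_monoid L \<sigma>. \<forall>m'\<in>dual_monoid L \<sigma>. \<gamma> (m + m') = \<gamma> m * \<gamma> m')}"

text \<open>The semigroup algebra \<open>\<complex>[\<sigma>\<^sup>\<or> \<inter> M]\<close>, acting as functions on the chart.\<close>

definition chart_functions :: "'a::euclidean_space set \<Rightarrow> 'a set \<Rightarrow> (('a \<Rightarrow> complex) \<Rightarrow> complex) set" where
  "chart_functions L \<sigma> = {\<lambda>\<gamma>. \<Sum>m\<in>A. c m * \<gamma> m | A c. finite A \<and> A \<subseteq> dual_monoid L \<sigma>}"

definition chart_topology :: "'a::euclidean_space set \<Rightarrow> 'a set \<Rightarrow> ('a \<Rightarrow> complex) topology" where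
  "chart_topology L \<sigma> =
     topology_generated_by {{\<gamma> \<in> chart L \<sigma>. f \<gamma> \<noteq> 0} | f. f \<in> chart_functions L \<sigma>}"

text \<open>The toric variety is the quotient of the disjoint union of the charts which glues
  \<open>U\<^sub>\<sigma>\<close> and \<open>U\<^sub>\<sigma>\<^sub>'\<close> along \<open>U\<close> of \<open>\<sigma> \<inter> \<sigma>'\<close>.\<close>

type_synonym 'a toric_point = "('a set \<times> ('a \<Rightarrow> complex)) set"

definition gluing :: "'a::euclidean_space set \<Rightarrow> 'a set set \<Rightarrow>
    (('a set \<times> ('a \<Rightarrow> complex)) \<times> ('a set \<times> ('a \<Rightarrow> complex))) set" where
  "gluing L \<Sigma> =
     {((\<sigma>, \<gamma>), (\<sigma>', \<gamma>')) | \<sigma> \<gamma> \<sigma>' \<gamma>'. \<sigma> \<in> \<Sigma> \<and> \<gamma> \<in> chart L \<sigma> \<and> \<sigma>' \<in> \<Sigma> \<and> \<gamma>' \<in> chart L \<sigma>' \<and>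
        (\<exists>\<delta>\<in>chart L (\<sigma> \<inter> \<sigma>').
           restrict \<delta> (dual_monoid L \<sigma>) = \<gamma> \<and> restrict \<delta> (dual_monoid L \<sigma>') = \<gamma>')}"

definition toric_points :: "'a::euclidean_space set \<Rightarrow> 'a set set \<Rightarrow> 'a toric_point set" where
  "toric_points L \<Sigma> = (SIGMA \<sigma>:\<Sigma>. chart L \<sigma>) // gluing L \<Sigma>"

definition chart_point :: "'a::euclidean_space set \<Rightarrow> 'a set set \<Rightarrow> 'a set \<Rightarrow> ('a \<Rightarrow> complex) \<Rightarrow> 'a toric_point" where
  "chart_point L \<Sigma> \<sigma> \<gamma> = gluing L \<Sigma> `` {(\<sigma>, \<gamma>)}"

definition toric_topology :: "'a::euclidean_space set \<Rightarrow> 'a set set \<Rightarrow> 'a toric_point topology" where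
  "toric_topology L \<Sigma> =
     topology (\<lambda>W. W \<subseteq> toric_points L \<Sigma> \<and>
       (\<forall>\<sigma>\<in>\<Sigma>. openin (chart_topology L \<sigma>) {\<gamma> \<in> chart L \<sigma>. chart_point L \<Sigma> \<sigma> \<gamma> \<in> W}))"

lemma openin_toric_topology:
  "openin (toric_topology L \<Sigma>) W \<longleftrightarrow> W \<subseteq> toric_points L \<Sigma> \<and>
     (\<forall>\<sigma>\<in>\<Sigma>. openin (chart_topology L \<sigma>) {\<gamma> \<in> chart L \<sigma>. chart_point L \<Sigma> \<sigma> \<gamma> \<in> W})"
proof -
  let ?A = "\<lambda>\<sigma> W. {\<gamma> \<in> chart L \<sigma>. chart_point L \<Sigma> \<sigma> \<gamma> \<in> W}"
  have int: "?A \<sigma> (S \<inter> T) = ?A \<sigma> S \<inter> ?A \<sigma> T" for \<sigma> S T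
    by auto
  have un: "?A \<sigma> (\<Union>K) = (\<Union>S\<in>K. ?A \<sigma> S)" for \<sigma> K
    by auto
  have "istopology (\<lambda>W. W \<subseteq> toric_points L \<Sigma> \<and> (\<forall>\<sigma>\<in>\<Sigma>. openin (chart_topology L \<sigma>) (?A \<sigma> W)))"
    unfolding istopology_def int un by (auto intro!: openin_Int openin_Union)
  then show ?thesis
    by (simp add: toric_topology_def)
qed

definition toric_variety :: "'a::euclidean_space set \<Rightarrow> 'a set set \<Rightarrow> 'a toric_point variety" where
  "toric_variety L \<Sigma> =
     \<lparr>zariski = toric_topology L \<Sigma>,
      regular = (\<lambda>W f. \<forall>\<sigma>\<in>\<Sigma>. \<forall>\<gamma>\<in>chart L \<sigma>. chart_point L \<Sigma> \<sigma> \<gamma> \<in> W \<longrightarrow>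
        (\<exists>g\<in>chart_functions L \<sigma>. \<exists>h\<in>chart_functions L \<sigma>. h \<gamma> \<noteq> 0 \<and>
           (\<forall>\<delta>\<in>chart L \<sigma>. chart_point L \<Sigma> \<sigma> \<delta> \<in> W \<and> h \<delta> \<noteq> 0 \<longrightarrow>
              f (chart_point L \<Sigma> \<sigma> \<delta>) = g \<delta> / h \<delta>)))\<rparr>"

text \<open>The map \<open>Hom(L', \<int>) \<rightarrow> Hom(L, \<int>)\<close> dual to a homomorphism \<open>\<phi>: L \<rightarrow> L'\<close>, and the toric morphism
  of a map of fans \<open>(L, \<Sigma>) \<rightarrow> (L', \<Sigma>')\<close>: if \<open>\<phi>\<close> maps \<open>\<sigma>\<close> into \<open>\<sigma>'\<close>, then \<open>U\<^sub>\<sigma>\<close> is mapped into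
  \<open>U\<^sub>\<sigma>\<^sub>'\<close> by composing with the dual map.\<close>

definition dual_map :: "'a::euclidean_space set \<Rightarrow> ('a \<Rightarrow> 'b::euclidean_space) \<Rightarrow> 'b \<Rightarrow> 'a" where
  "dual_map L \<phi> m' = (THE m. m \<in> dual_lattice L \<and> (\<forall>n\<in>L. m \<bullet> n = m' \<bullet> \<phi> n))"

definition toric_morphism :: "'a::euclidean_space set \<Rightarrow> 'a set set \<Rightarrow> 'b::euclidean_space set \<Rightarrow> 'b set set \<Rightarrow>
    ('a \<Rightarrow> 'b) \<Rightarrow> 'a toric_point \<Rightarrow> 'b toric_point" where
  "toric_morphism L \<Sigma> L' \<Sigma>' \<phi> p =
     (THE q. \<exists>\<sigma>\<in>\<Sigma>. \<exists>\<gamma>\<in>chart L \<sigma>. \<exists>\<sigma>'\<in>\<Sigma>'.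
        p = chart_point L \<Sigma> \<sigma> \<gamma> \<and> \<phi> ` \<sigma> \<subseteq> \<sigma>' \<and>
        q = chart_point L' \<Sigma>' \<sigma>' (\<lambda>m'\<in>dual_monoid L' \<sigma>'. \<gamma> (dual_map L \<phi> m')))"


section \<open>Homogeneous coordinates\<close>

definition rays :: "'a::euclidean_space set set \<Rightarrow> 'a set set" where
  "rays \<Sigma> = {\<rho> \<in> \<Sigma>. dim \<rho> = 1}"

definition primitive_generator :: "'a::euclidean_space set \<Rightarrow> 'a set \<Rightarrow> 'a" where
  "primitive_generator L \<rho> = (THE v. v \<noteq> 0 \<and> \<rho> \<inter> L = range (\<lambda>n::nat. real n *\<^sub>R v))"

text \<open>Polynomials with variables indexed by cones; \<open>S(\<Sigma>)\<close> consists of those in which only the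
  variables indexed by rays of \<open>\<Sigma>\<close> occur.\<close>

type_synonym 'a cone_poly = "('a set \<Rightarrow>\<^sub>0 nat) \<Rightarrow>\<^sub>0 complex"

definition coord :: "'a set \<Rightarrow> 'a cone_poly" where
  "coord \<rho> = Poly_Mapping.single (Poly_Mapping.single \<rho> 1) 1"

definition eval_poly :: "'a cone_poly \<Rightarrow> ('a set \<Rightarrow> complex) \<Rightarrow> complex" where
  "eval_poly f x = (\<Sum>a\<in>Poly_Mapping.keys f. Poly_Mapping.lookup f a * (\<Prod>\<rho>\<in>Poly_Mapping.keys a. x \<rho> ^ Poly_Mapping.lookup a \<rho>))"

definition cox_ring :: "'a::euclidean_space set set \<Rightarrow> 'a cone_poly ring" where
  "cox_ring \<Sigma> =
     \<lparr>carrier = {f. \<forall>a\<in>Poly_Mapping.keys f. Poly_Mapping.keys a \<subseteq> rays \<Sigma>},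
      monoid.mult = (*), one = 1, zero = 0, add = (+)\<rparr>"

text \<open>The class of an exponent vector in the cokernel \<open>Cl(\<Sigma>)\<close> of \<open>M \<rightarrow> \<int>\<^bsup>\<Sigma>(1)\<^esup>\<close>, as a coset.\<close>

definition class_degree :: "'a::euclidean_space set \<Rightarrow> 'a set set \<Rightarrow> ('a set \<Rightarrow>\<^sub>0 nat) \<Rightarrow> ('a set \<Rightarrow> int) set" where
  "class_degree L \<Sigma> a =
     (\<lambda>m. \<lambda>\<rho>\<in>rays \<Sigma>. int (Poly_Mapping.lookup a \<rho>) + \<lfloor>m \<bullet> primitive_generator L \<rho>\<rfloor>) ` dual_lattice L"

definition homogeneous :: "'a::euclidean_space set \<Rightarrow> 'a set set \<Rightarrow> 'a cone_poly \<Rightarrow> bool" where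
  "homogeneous L \<Sigma> f \<longleftrightarrow> (\<exists>d. \<forall>a\<in>Poly_Mapping.keys f. class_degree L \<Sigma> a = d)"

definition exceptional_set :: "'a::euclidean_space set set \<Rightarrow> ('a set \<Rightarrow> complex) set" where
  "exceptional_set \<Sigma> =
     {x \<in> rays \<Sigma> \<rightarrow>\<^sub>E UNIV. \<forall>\<sigma>\<in>\<Sigma>. (\<Prod>\<rho>\<in>{\<rho> \<in> rays \<Sigma>. \<not> \<rho> \<subseteq> \<sigma>}. x \<rho>) = 0}"

text \<open>Cox's quotient morphism, as the toric morphism sending \<open>x\<close> to the point of \<open>U\<^sub>\<sigma>\<close> at which the
  character of \<open>m\<close> takes the value \<open>\<Prod>\<^sub>\<rho> x\<^sub>\<rho>\<close> to the power \<open>\<langle>m, v\<^sub>\<rho>\<rangle>\<close>.  For \<open>m\<close> in \<open>\<sigma>\<^sup>\<or>\<close>,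
  negative exponents occur only at coordinates that are required not to vanish.\<close>

definition cox_quotient :: "'a::euclidean_space set \<Rightarrow> 'a set set \<Rightarrow> ('a set \<Rightarrow> complex) \<Rightarrow> 'a toric_point" where
  "cox_quotient L \<Sigma> x =
     (THE p. \<exists>\<sigma>\<in>\<Sigma>. (\<Prod>\<rho>\<in>{\<rho> \<in> rays \<Sigma>. \<not> \<rho> \<subseteq> \<sigma>}. x \<rho>) \<noteq> 0 \<and>
        p = chart_point L \<Sigma> \<sigma>
              (\<lambda>m\<in>dual_monoid L \<sigma>. \<Prod>\<rho>\<in>rays \<Sigma>. x \<rho> powi \<lfloor>m \<bullet> primitive_generator L \<rho>\<rfloor>))"

definition zero_locus :: "'a::euclidean_space set \<Rightarrow> 'a set set \<Rightarrow> 'a cone_poly set \<Rightarrow> 'a toric_point set" where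
  "zero_locus L \<Sigma> I =
     {p \<in> toric_points L \<Sigma>. \<exists>x \<in> (rays \<Sigma> \<rightarrow>\<^sub>E UNIV) - exceptional_set \<Sigma>.
        cox_quotient L \<Sigma> x = p \<and> (\<forall>f\<in>I. eval_poly f x = 0)}"

definition regular_sequence :: "('r, 'm) ring_scheme \<Rightarrow> nat \<Rightarrow> (nat \<Rightarrow> 'r) \<Rightarrow> bool" where
  "regular_sequence R k f \<longleftrightarrow>
     (\<forall>i\<in>{1..k}. \<forall>g\<in>carrier R.
        f i \<otimes>\<^bsub>R\<^esub> g \<in> Idl\<^bsub>R\<^esub> (f ` {1..<i}) \<longrightarrow> g \<in> Idl\<^bsub>R\<^esub> (f ` {1..<i})) \<and>
     Idl\<^bsub>R\<^esub> (f ` {1..k}) \<noteq> carrier R"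

definition radical_ideal :: "('r, 'm) ring_scheme \<Rightarrow> 'r set \<Rightarrow> bool" where
  "radical_ideal R I \<longleftrightarrow>
     ideal I R \<and> (\<forall>g\<in>carrier R. \<forall>n::nat. g [^]\<^bsub>R\<^esub> n \<in> I \<longrightarrow> g \<in> I)"

text \<open>\<open>Y\<close> is the complete intersection in the toric variety of \<open>\<Sigma>\<close> given by the equations
  \<open>f i = 0\<close> for \<open>i = 1, ..., k\<close>.  The ideal is homogeneous because its generators are.\<close>

definition complete_intersection ::
    "'a::euclidean_space set \<Rightarrow> 'a set set \<Rightarrow> nat \<Rightarrow> (nat \<Rightarrow> 'a cone_poly) \<Rightarrow> 'a toric_point set \<Rightarrow> bool" where
  "complete_intersection L \<Sigma> k f Y \<longleftrightarrow>
     (\<forall>i\<in>{1..k}. f i \<in> carrier (cox_ring \<Sigma>) \<and> homogeneous L \<Sigma> (f i)) \<and>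
     regular_sequence (cox_ring \<Sigma>) k f \<and>
     radical_ideal (cox_ring \<Sigma>) (Idl\<^bsub>cox_ring \<Sigma>\<^esub> (f ` {1..k})) \<and>
     Y = zero_locus L \<Sigma> (Idl\<^bsub>cox_ring \<Sigma>\<^esub> (f ` {1..k})) \<and>
     closedin (toric_topology L \<Sigma>) Y \<and>
     (\<exists>d::nat. krull_dim (subtopology (toric_topology L \<Sigma>) Y) = enat d \<and>
               krull_dim (toric_topology L \<Sigma>) = enat (d + k))"


section \<open>The fans of a reflexive polytope and of a Minkowski decomposition\<close>

text \<open>The empty face is a proper face; it contributes the cone \<open>convex_cone hull {} = {0}\<close>.\<close>

definition proper_faces :: "'a::euclidean_space set \<Rightarrow> 'a set set" where
  "proper_faces P = {\<Gamma>. \<Gamma> face_of P \<and> \<Gamma> \<noteq> P}"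

definition face_fan :: "'a::euclidean_space set \<Rightarrow> 'a set set" where
  "face_fan P = {convex_cone hull \<Gamma> | \<Gamma>. \<Gamma> \<in> proper_faces P}"

text \<open>For nonempty \<open>\<Gamma>\<close> the faces \<open>F i\<close> are determined by \<open>\<Gamma>\<close>; the empty face is decomposed into
  empty faces, so that it corresponds to the zero cone.\<close>

definition induced_decomposition ::
    "nat \<Rightarrow> (nat \<Rightarrow> 'a::euclidean_space set) \<Rightarrow> 'a set \<Rightarrow> (nat \<Rightarrow> 'a set) \<Rightarrow> bool" where
  "induced_decomposition k D \<Gamma> F \<longleftrightarrow>
     (\<forall>i\<le>k. F i face_of D i) \<and> \<Gamma> = (\<Sum>i\<le>k. F i) \<and> (\<Gamma> = {} \<longrightarrow> (\<forall>i\<le>k. F i = {}))"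

definition cayley_cone ::
    "nat \<Rightarrow> (nat \<Rightarrow> 'b::euclidean_space) \<Rightarrow> (nat \<Rightarrow> 'a::euclidean_space set) \<Rightarrow> ('a \<times> 'b) set" where
  "cayley_cone k e F =
     convex_cone hull ((\<lambda>v. (v, - (\<Sum>i=1..k. e i))) ` F 0 \<union> (\<Union>i\<in>{1..k}. (\<lambda>v. (v, e i)) ` F i))"

definition cayley_fan ::
    "nat \<Rightarrow> (nat \<Rightarrow> 'b::euclidean_space) \<Rightarrow> (nat \<Rightarrow> 'a::euclidean_space set) \<Rightarrow> ('a \<times> 'b) set set" where
  "cayley_fan k e D =
     {\<tau>. \<tau> \<noteq> {} \<and> (\<exists>\<Gamma>\<in>proper_faces (\<Sum>i\<le>k. D i). \<exists>F.
            induced_decomposition k D \<Gamma> F \<and> \<tau> face_of cayley_cone k e F)}"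

definition cayley_equation ::
    "('a::euclidean_space \<times> 'b::euclidean_space) set \<Rightarrow> ('a \<times> 'b) set set \<Rightarrow> (nat \<Rightarrow> 'b) \<Rightarrow> nat \<Rightarrow> ('a \<times> 'b) cone_poly" where
  "cayley_equation L \<Sigma> e i =
     (\<Prod>\<xi>\<in>{\<xi> \<in> rays \<Sigma>. (0, e i) \<bullet> primitive_generator L \<xi> > 0}. coord \<xi>) -
     (\<Prod>\<xi>\<in>{\<xi> \<in> rays \<Sigma>. (0, e i) \<bullet> primitive_generator L \<xi> < 0}. coord \<xi>)"

end

theory Submission
  imports Defs "HOL-Complex_Analysis.Complex_Analysis"
begin

text \<open>
  Write \<open>\<epsilon>\<^sub>0 = - e\<^sub>1 - \<dots> - e\<^sub>k\<close> and \<open>\<epsilon>\<^sub>i = e\<^sub>i\<close>.  The rays of the target fan are spanned by the \<open>(v, \<epsilon>\<^sub>i)\<close> with \<open>v\<close> a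
  vertex of the \<open>i\<close>-th summand, and these generators are primitive, so the \<open>i\<close>-th equation says that the
  products \<open>M\<^sub>i\<close> and \<open>M\<^sub>0\<close> of the coordinates of level \<open>i\<close> and of level \<open>0\<close> agree.

  Closed embedding: a character that is nonnegative on the cone of a face extends to the cone over it by
  subtracting its minima on the summands, so the restriction map between the dual monoids is onto and the
  image in a chart consists of the homomorphisms that factor through it.

  Image: if all \<open>M\<^sub>i\<close> have the same nonzero value, it cancels from every character value because
  \<open>\<Sum>\<^sub>i \<epsilon>\<^sub>i = 0\<close>; if they all vanish, a vanishing coordinate of each level forces the second component of the
  characters that do not vanish at the point.  Conversely, a point of the torus orbit of a cone has coordinates
  obtained from a logarithm of its character.

  Radical regular sequence: the ideal of the first \<open>j\<close> binomials consists of all polynomials that vanish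
  on the points of the torus satisfying these equations, by reduction to normal monomials, which restrict to
  distinct characters of this group, and Dedekind's theorem.  The next binomial is a nonzerodivisor since it
  is nonzero at points arbitrarily close to any given one.  The dimension statement follows since the Krull dimension of a
  toric variety is the rank of its lattice: independent functions along a chain of irreducible closed
  sets are bounded by counting characters.
\<close>

section \<open>Lattices and cones\<close>

text \<open>Cones are handled through finite sets of generators, and the geometry of a fan enters as
  a real functional separating two such sets. Approximation by lattice functionals turns it into a
  character whose inversion describes the overlap of two charts. For the Cayley fan the functional
  compares the support functions of two faces; since arbitrary faces of the cones belong to the fan
  as well, it is corrected by the functionals that cut these faces out.

  Supporting functionals \<open>m\<close> are normalized to minimum -1 on the polytope. Their minima
  on the summands then sum to -1, so that arbitrary constants can be prescribed at the levels even
  though the vectors \<open>\<epsilon> i\<close> sum to zero.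

  The target fan need not be simplicial, so a fibre of Cox's quotient may contain several orbits,
  while membership in the zero locus asks for one zero in the fibre. Hence one inclusion must start
  from an arbitrary zero, and the other constructs a particular representative.\<close>

lemma int_span_0: "0 \<in> int_span B"
  unfolding int_span_def by (auto intro!: exI[of _ "\<lambda>_. 0"])

lemma int_span_add:
  assumes "x \<in> int_span B" "y \<in> int_span B"
  shows "x + y \<in> int_span B"
proof -
  from assms obtain c d where "x = (\<Sum>b\<in>B. of_int (c b) *\<^sub>R b)" "y = (\<Sum>b\<in>B. of_int (d b) *\<^sub>R b)"
    unfolding int_span_def by blast
  then have "x + y = (\<Sum>b\<in>B. of_int (c b + d b) *\<^sub>R b)"
    by (simp add: sum.distrib scaleR_add_left)
  then show ?thesis unfolding int_span_def by fast
qed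

lemma int_span_scale:
  assumes "x \<in> int_span B"
  shows "of_int n *\<^sub>R x \<in> int_span B"
proof -
  from assms obtain c where "x = (\<Sum>b\<in>B. of_int (c b) *\<^sub>R b)"
    unfolding int_span_def by blast
  then have "of_int n *\<^sub>R x = (\<Sum>b\<in>B. of_int (n * c b) *\<^sub>R b)"
    by (simp add: scaleR_sum_right)
  then show ?thesis unfolding int_span_def by fast
qed

lemma int_span_base: "finite B \<Longrightarrow> b \<in> B \<Longrightarrow> b \<in> int_span B"
  unfolding int_span_def
  by (auto intro!: exI[of _ "\<lambda>x. if x = b then 1 else 0"] simp: if_distrib[of of_int] if_distrib[of "\<lambda>x. x *\<^sub>R _"]
      sum.delta cong: if_cong)

lemma int_span_subset_span: "int_span B \<subseteq> span B"
  unfolding int_span_def by (auto intro: span_sum span_scale span_base)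

lemma span_int_span: "finite B \<Longrightarrow> span (int_span B) = span B"
  by (metis int_span_base int_span_subset_span span_mono span_span subsetI subset_antisym)

lemma dual_lattice_subset_span: "m \<in> dual_lattice L \<Longrightarrow> m \<in> span L"
  by (simp add: dual_lattice_def)

lemma dual_lattice_inner: "m \<in> dual_lattice L \<Longrightarrow> n \<in> L \<Longrightarrow> m \<bullet> n \<in> \<int>"
  by (simp add: dual_lattice_def)

lemma dual_lattice_floor: "m \<in> dual_lattice L \<Longrightarrow> n \<in> L \<Longrightarrow> of_int \<lfloor>m \<bullet> n\<rfloor> = m \<bullet> n"
  using dual_lattice_inner by (metis Ints_cases floor_of_int)

lemma dual_lattice_0: "0 \<in> dual_lattice L"
  by (simp add: dual_lattice_def span_zero)

lemma dual_lattice_add: "m \<in> dual_lattice L \<Longrightarrow> m' \<in> dual_lattice L \<Longrightarrow> m + m' \<in> dual_lattice L"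
  by (simp add: dual_lattice_def inner_add_left span_add)

lemma dual_lattice_scale: "m \<in> dual_lattice L \<Longrightarrow> r \<in> \<int> \<Longrightarrow> r *\<^sub>R m \<in> dual_lattice L"
  by (simp add: dual_lattice_def span_scale)

lemma dual_lattice_minus: "m \<in> dual_lattice L \<Longrightarrow> - m \<in> dual_lattice L"
  by (simp add: dual_lattice_def span_neg)

lemma dual_lattice_diff: "m \<in> dual_lattice L \<Longrightarrow> m' \<in> dual_lattice L \<Longrightarrow> m - m' \<in> dual_lattice L"
  by (simp add: dual_lattice_def inner_diff_left span_diff)

lemma dual_lattice_sum: "(\<And>x. x \<in> A \<Longrightarrow> f x \<in> dual_lattice L) \<Longrightarrow> sum f A \<in> dual_lattice L"
  by (induction A rule: infinite_finite_induct) (auto simp: dual_lattice_0 dual_lattice_add)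

text \<open>The difference lies in the span of \<open>L\<close> and is orthogonal to
  \<open>L\<close>, hence to itself.\<close>

lemma eq_on_span_if_inner_eq:
  fixes x y :: "'a::euclidean_space"
  assumes "x \<in> span L" "y \<in> span L" "\<And>n. n \<in> L \<Longrightarrow> x \<bullet> n = y \<bullet> n"
  shows "x = y"
proof -
  have "(x - y) \<bullet> n = 0" if "n \<in> span L" for n
    using that
  proof (induction rule: span_induct_alt)
    case (step c b z)
    then show ?case using assms(3)[of b] by (simp add: inner_diff_left inner_add_right)
  qed auto
  from this[OF span_diff[OF assms(1,2)]] show ?thesis by simp
qed

locale lattice =
  fixes L :: "'a::euclidean_space set"
  assumes is_lattice: "is_lattice L"
begin

definition basis :: "'a set" where
  "basis = (SOME B. independent B \<and> L = int_span B)"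

lemma basis: "independent basis" "L = int_span basis"
  using someI_ex[of "\<lambda>B. independent B \<and> L = int_span B"] is_lattice
  unfolding is_lattice_def basis_def by auto

lemma finite_basis: "finite basis"
  using basis(1) independent_imp_finite by blast

lemma basis_subset: "basis \<subseteq> L"
  using basis(2) finite_basis int_span_base by blast

lemma span_lattice: "span L = span basis"
  using basis(2) finite_basis span_int_span by metis

lemma card_basis: "card basis = dim L"
  by (metis basis(1) dim_eq_card span_lattice)

text \<open>Each coordinate function on the basis extends linearly to the ambient space and is
  represented there by a vector. Only its component in the span is kept, since dual vectors have to
  lie in \<open>span L\<close> and the lattice may have smaller rank.\<close>

lemma ex_dual_basis:
  "\<exists>d. \<forall>b\<in>basis. d b \<in> dual_lattice L \<and> (\<forall>b'\<in>basis. d b \<bullet> b' = (if b = b' then 1 else 0))"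
proof (intro bchoice ballI)
  fix b assume b: "b \<in> basis"
  obtain g :: "'a \<Rightarrow> real" where g: "linear g" "\<And>x. x \<in> basis \<Longrightarrow> g x = (if b = x then 1 else 0)"
    using linear_independent_extend[OF basis(1), of "\<lambda>x. if b = x then 1 else 0"] by auto
  obtain y z where yz: "y \<in> span basis" "\<And>w. w \<in> span basis \<Longrightarrow> orthogonal z w"
      "adjoint g 1 = y + z"
    using orthogonal_subspace_decomp_exists[of basis "adjoint g 1"] by metis
  have y: "y \<bullet> x = g x" if "x \<in> span basis" for x
  proof -
    have "y \<bullet> x = (y + z) \<bullet> x" using yz(2)[OF that] by (simp add: inner_add_left orthogonal_def)
    also have "\<dots> = g x"
      using adjoint_works[OF g(1), of x 1] yz(3) by (simp add: inner_commute)
    finally show ?thesis .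
  qed
  have "y \<bullet> n \<in> \<int>" if n: "n \<in> L" for n
  proof -
    obtain c where c: "n = (\<Sum>x\<in>basis. of_int (c x) *\<^sub>R x)"
      using n basis(2) unfolding int_span_def by auto
    have "y \<bullet> n = (\<Sum>x\<in>basis. of_int (c x) * (y \<bullet> x))" by (simp add: c inner_sum_right)
    also have "\<dots> \<in> \<int>" using y g(2) by (intro Ints_sum) (auto simp: span_base)
    finally show ?thesis .
  qed
  then show "\<exists>y. y \<in> dual_lattice L \<and> (\<forall>b'\<in>basis. y \<bullet> b' = (if b = b' then 1 else 0))"
    using y g(2) yz(1) by (auto simp: dual_lattice_def span_lattice span_base intro!: exI[of _ y])
qed

definition dual_basis :: "'a \<Rightarrow> 'a" where
  "dual_basis = (SOME d. \<forall>b\<in>basis. d b \<in> dual_lattice L \<and> (\<forall>b'\<in>basis. d b \<bullet> b' = (if b = b' then 1 else 0)))"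

lemma dual_basis: "b \<in> basis \<Longrightarrow> dual_basis b \<in> dual_lattice L"
  and dual_basis_inner: "b \<in> basis \<Longrightarrow> b' \<in> basis \<Longrightarrow> dual_basis b \<bullet> b' = (if b = b' then 1 else 0)"
  using someI_ex[OF ex_dual_basis] unfolding dual_basis_def[symmetric] by auto

lemma span_expansion: "x \<in> span L \<Longrightarrow> x = (\<Sum>b\<in>basis. (x \<bullet> b) *\<^sub>R dual_basis b)"
proof -
  assume x: "x \<in> span L"
  have "dual_basis b \<in> span basis" if "b \<in> basis" for b
    using dual_basis[OF that] by (simp add: dual_lattice_def span_lattice)
  then have "(\<Sum>b\<in>basis. (x \<bullet> b) *\<^sub>R dual_basis b) \<in> span basis"
    by (auto intro: span_sum span_scale)
  moreover have "(\<Sum>b\<in>basis. (x \<bullet> b) *\<^sub>R dual_basis b) \<bullet> b' = x \<bullet> b'" if "b' \<in> basis" for b'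
    using that finite_basis
    by (simp add: inner_sum_left dual_basis_inner if_distrib[of "\<lambda>y. _ * y"] sum.delta cong: if_cong sum.cong)
  ultimately show ?thesis
    using x eq_on_span_if_inner_eq[of x basis] by (metis span_lattice)
qed

lemma lattice_0: "0 \<in> L" using basis(2) int_span_0 by metis

lemma lattice_scale: "x \<in> L \<Longrightarrow> of_int n *\<^sub>R x \<in> L"
  using basis(2) int_span_scale by metis

text \<open>Integral linear equations have a real solution space spanned by integral solutions. The
  equations are added one at a time, and an integral \<open>u\<close> that violates the new one
  serves as a pivot.\<close>

lemma orthogonal_complement_rational:
  assumes "finite W" "W \<subseteq> L"
  shows "{x \<in> span L. \<forall>w\<in>W. x \<bullet> w = 0} \<subseteq> span {m \<in> dual_lattice L. \<forall>w\<in>W. m \<bullet> w = 0}"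
  using assms
proof (induction W rule: finite_induct)
  case empty
  have "x \<in> span (dual_lattice L)" if "x \<in> span L" for x
    by (subst span_expansion[OF that]) (auto intro: span_sum span_scale span_base dual_basis)
  then show ?case by auto
next
  case (insert w W)
  let ?U = "{m \<in> dual_lattice L. \<forall>w\<in>W. m \<bullet> w = 0}"
  let ?V = "{m \<in> dual_lattice L. \<forall>w\<in>insert w W. m \<bullet> w = 0}"
  show ?case
  proof (cases "\<forall>u\<in>?U. u \<bullet> w = 0")
    case True
    then have "?U = ?V" by auto
    then show ?thesis using insert by auto
  next
    case False
    then obtain u where u: "u \<in> ?U" "u \<bullet> w \<noteq> 0" by blast
    \<comment> \<open>For integral \<open>x\<close> both coefficients are integers, and the result
      is orthogonal to \<open>w\<close>. On vectors already orthogonal to \<open>w\<close> the map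
      is multiplication by the nonzero number \<open>u \<bullet> w\<close>.\<close>
    define T where "T x = (u \<bullet> w) *\<^sub>R x - (x \<bullet> w) *\<^sub>R u" for x
    have lin: "linear T"
      by (rule linearI) (auto simp: T_def algebra_simps inner_add_left)
    have "w \<in> L" using insert.prems by auto
    then have TU: "T x \<in> ?V" if "x \<in> ?U" for x
      using that u by (auto simp: T_def inner_diff_left intro!: dual_lattice_diff dual_lattice_scale dual_lattice_inner)
    show ?thesis
    proof
      fix x assume x: "x \<in> {x \<in> span L. \<forall>w\<in>insert w W. x \<bullet> w = 0}"
      then have "x \<in> span ?U" using insert by auto
      then have "T x \<in> T ` span ?U" by simp
      also have "\<dots> = span (T ` ?U)" using span_linear_image[OF lin] by metis
      also have "\<dots> \<subseteq> span ?V" using TU by (intro span_mono) auto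
      finally have "(u \<bullet> w) *\<^sub>R x \<in> span ?V" using x by (simp add: T_def)
      then have "(1 / (u \<bullet> w)) *\<^sub>R ((u \<bullet> w) *\<^sub>R x) \<in> span ?V" by (rule span_scale)
      then show "x \<in> span ?V" using u by simp
    qed
  qed
qed

text \<open>The equations define a rational subspace, so a real solution is a real combination of
  integral ones. Rounding the coefficients of a large multiple keeps the equations and is too small
  an error to change the strict signs.\<close>

lemma lattice_functional:
  assumes W0: "finite W0" "W0 \<subseteq> L" and W1: "finite W1" "W1 \<subseteq> L"
    and a0: "\<And>w. w \<in> W0 \<Longrightarrow> a \<bullet> w = 0" and a1: "\<And>w. w \<in> W1 \<Longrightarrow> 0 < a \<bullet> w"
  obtains m where "m \<in> dual_lattice L" "\<And>w. w \<in> W0 \<Longrightarrow> m \<bullet> w = 0" "\<And>w. w \<in> W1 \<Longrightarrow> 0 < m \<bullet> w"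
proof -
  let ?U = "{m \<in> dual_lattice L. \<forall>w\<in>W0. m \<bullet> w = 0}"
  obtain y z where yz: "y \<in> span L" "\<And>w. w \<in> span L \<Longrightarrow> orthogonal z w" "a = y + z"
    using orthogonal_subspace_decomp_exists[of L a] by metis
  have y: "y \<bullet> w = a \<bullet> w" if "w \<in> L" for w
    using yz(2)[of w] yz(3) that by (simp add: inner_add_left orthogonal_def span_base)
  then have "y \<in> span ?U"
    using orthogonal_complement_rational[OF W0] yz(1) a0 W0(2) by (auto simp: subset_iff)
  then obtain F c where F: "finite F" "F \<subseteq> ?U" "y = (\<Sum>u\<in>F. c u *\<^sub>R u)"
    unfolding span_explicit by blast
  define C where "C w = (\<Sum>u\<in>F. \<bar>u \<bullet> w\<bar>)" for w
  \<comment> \<open>The factor \<open>q\<close> exceeds every ratio of the rounding bound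
    \<open>C w\<close> to \<open>a \<bullet> w\<close>; the summand 1 makes the comparison
    strict.\<close>
  define q where "q = (\<Sum>w\<in>W1. C w / (a \<bullet> w)) + 1"
  have C0: "0 \<le> C w" for w by (simp add: C_def sum_nonneg)
  define m where "m = (\<Sum>u\<in>F. of_int \<lfloor>q * c u\<rfloor> *\<^sub>R u)"
  have "m \<in> dual_lattice L" unfolding m_def using F(2) by (auto intro!: dual_lattice_sum dual_lattice_scale)
  moreover have "m \<bullet> w = 0" if "w \<in> W0" for w
    unfolding m_def using F(2) that by (auto simp: inner_sum_left intro!: sum.neutral)
  moreover have "0 < m \<bullet> w" if w: "w \<in> W1" for w
  proof -
    have aw: "0 < a \<bullet> w" using a1 w by auto
    have "C w / (a \<bullet> w) \<le> (\<Sum>w\<in>W1. C w / (a \<bullet> w))"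
      using w W1(1) a1 C0 by (intro member_le_sum) (auto intro!: divide_nonneg_pos)
    then have "C w / (a \<bullet> w) < q" by (simp add: q_def)
    then have "C w < q * (a \<bullet> w)" using aw by (simp add: field_simps)
    moreover have "q * (a \<bullet> w) - m \<bullet> w = (\<Sum>u\<in>F. (q * c u - of_int \<lfloor>q * c u\<rfloor>) * (u \<bullet> w))"
    proof -
      have "a \<bullet> w = (\<Sum>u\<in>F. c u * (u \<bullet> w))"
        using w W1(2) y[of w] by (auto simp: F(3) inner_sum_left)
      then show ?thesis
        by (simp add: m_def inner_sum_left sum_distrib_left sum_subtractf[symmetric] algebra_simps)
    qed
    moreover have "\<dots> \<le> C w"
      unfolding C_def
    proof (rule sum_mono)
      fix u
      have "0 \<le> q * c u - of_int \<lfloor>q * c u\<rfloor>" "q * c u - of_int \<lfloor>q * c u\<rfloor> \<le> 1" by linarith+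
      then have "\<bar>(q * c u - of_int \<lfloor>q * c u\<rfloor>) * (u \<bullet> w)\<bar> \<le> 1 * \<bar>u \<bullet> w\<bar>"
        unfolding abs_mult by (intro mult_right_mono) auto
      then show "(q * c u - of_int \<lfloor>q * c u\<rfloor>) * (u \<bullet> w) \<le> \<bar>u \<bullet> w\<bar>" by linarith
    qed
    ultimately show ?thesis by linarith
  qed
  ultimately show ?thesis using that by blast
qed

end

section \<open>Cones generated by finite sets\<close>

lemma convex_cone_hull_finite:
  fixes S :: "'a::real_vector set"
  assumes "finite S"
  shows "convex_cone hull S = {\<Sum>w\<in>S. c w *\<^sub>R w | c. \<forall>w\<in>S. 0 \<le> c w}" (is "_ = ?R")
proof (rule hull_unique)
  show "S \<subseteq> ?R"
  proof
    fix x assume "x \<in> S"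
    then have "x = (\<Sum>w\<in>S. (if w = x then 1 else 0) *\<^sub>R w)"
      using assms by (simp add: if_distrib[of "\<lambda>c. c *\<^sub>R _"] sum.delta cong: if_cong)
    then show "x \<in> ?R" by force
  qed
  show "convex_cone ?R"
    unfolding convex_cone_iff
  proof (intro conjI ballI allI impI)
    show "0 \<in> ?R" by (auto intro!: exI[of _ "\<lambda>_. 0"])
    show "x + y \<in> ?R" if "x \<in> ?R" "y \<in> ?R" for x y
    proof -
      from that obtain c d where "x = (\<Sum>w\<in>S. c w *\<^sub>R w)" "y = (\<Sum>w\<in>S. d w *\<^sub>R w)"
        "\<forall>w\<in>S. 0 \<le> c w" "\<forall>w\<in>S. 0 \<le> d w" by blast
      then show ?thesis
        by (auto intro!: exI[of _ "\<lambda>w. c w + d w"] simp: sum.distrib scaleR_add_left)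
    qed
    show "r *\<^sub>R x \<in> ?R" if "x \<in> ?R" "0 \<le> r" for x r
    proof -
      from that obtain c where "x = (\<Sum>w\<in>S. c w *\<^sub>R w)" "\<forall>w\<in>S. 0 \<le> c w" by blast
      then show ?thesis
        using that by (auto intro!: exI[of _ "\<lambda>w. r * c w"] simp: scaleR_sum_right)
    qed
  qed
  show "?R \<subseteq> T" if "S \<subseteq> T" "convex_cone T" for T
  proof
    fix x assume "x \<in> ?R"
    then obtain c where "x = (\<Sum>w\<in>S. c w *\<^sub>R w)" "\<forall>w\<in>S. 0 \<le> c w" by blast
    moreover have "(\<Sum>w\<in>F. c w *\<^sub>R w) \<in> T" if "F \<subseteq> S" "\<forall>w\<in>S. 0 \<le> c w" for F c
      using finite_subset[OF that(1) assms] that \<open>S \<subseteq> T\<close>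
      by (induction F rule: finite_induct)
        (auto intro!: convex_cone_add[OF \<open>convex_cone T\<close>] convex_cone_scaleR[OF \<open>convex_cone T\<close>]
          convex_cone_contains_0[OF \<open>convex_cone T\<close>])
    ultimately show "x \<in> T" by auto
  qed
qed

lemma convex_cone_hull_nonneg:
  assumes "x \<in> convex_cone hull S" "\<And>w. w \<in> S \<Longrightarrow> 0 \<le> a \<bullet> w"
  shows "0 \<le> a \<bullet> x"
proof -
  have "convex_cone hull S \<subseteq> {x. a \<bullet> x \<ge> 0}"
    by (intro hull_minimal convex_cone_halfspace_ge) (auto simp: assms(2))
  then show ?thesis using assms(1) by auto
qed

text \<open>In a nonnegative combination annihilated by \<open>a\<close> no cancellation is
  possible, so every term with a nonzero coefficient is itself annihilated.\<close>

lemma convex_cone_hull_Int_hyperplane: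
  assumes "finite S" "\<And>w. w \<in> S \<Longrightarrow> 0 \<le> a \<bullet> w"
  shows "convex_cone hull S \<inter> {x. a \<bullet> x = 0} = convex_cone hull {w \<in> S. a \<bullet> w = 0}"
proof
  show "convex_cone hull S \<inter> {x. a \<bullet> x = 0} \<subseteq> convex_cone hull {w \<in> S. a \<bullet> w = 0}"
  proof clarify
    fix x assume "x \<in> convex_cone hull S" and ax: "a \<bullet> x = 0"
    then obtain c where x: "x = (\<Sum>w\<in>S. c w *\<^sub>R w)" and c: "\<forall>w\<in>S. 0 \<le> c w"
      using convex_cone_hull_finite[OF assms(1)] by auto
    have "(\<Sum>w\<in>S. c w * (a \<bullet> w)) = 0" using ax by (simp add: x inner_sum_right)
    then have "\<forall>w\<in>S. c w * (a \<bullet> w) = 0"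
      using assms c by (subst (asm) sum_nonneg_eq_0_iff) auto
    then have "x = (\<Sum>w\<in>{w \<in> S. a \<bullet> w = 0}. c w *\<^sub>R w)"
      unfolding x using assms(1) by (intro sum.mono_neutral_right) auto
    moreover have "finite {w \<in> S. a \<bullet> w = 0}" using assms(1) by auto
    ultimately show "x \<in> convex_cone hull {w \<in> S. a \<bullet> w = 0}"
      using c by (auto simp: convex_cone_hull_finite)
  qed
  have "convex_cone hull {w \<in> S. a \<bullet> w = 0} \<subseteq> convex_cone hull S"
    by (rule hull_mono) auto
  moreover have "a \<bullet> x = 0" if "x \<in> convex_cone hull {w \<in> S. a \<bullet> w = 0}" for x
    using convex_cone_hull_nonneg[OF that, of a] convex_cone_hull_nonneg[OF that, of "-a"]
    by (simp add: inner_minus_left) 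
  ultimately show "convex_cone hull {w \<in> S. a \<bullet> w = 0} \<subseteq> convex_cone hull S \<inter> {x. a \<bullet> x = 0}"
    by auto
qed

section \<open>Extension of characters\<close>

text \<open>The domain is an explicit subgroup because characters are extended by adjoining one
  generator at a time.\<close>

definition is_character :: "'a::real_vector set \<Rightarrow> ('a \<Rightarrow> complex) \<Rightarrow> bool" where
  "is_character A \<eta> \<longleftrightarrow> 0 \<in> A \<and> (\<forall>x\<in>A. -x \<in> A) \<and> (\<forall>x\<in>A. \<forall>y\<in>A. x + y \<in> A) \<and>
     (\<forall>x\<in>A. \<eta> x \<noteq> 0) \<and> (\<forall>x\<in>A. \<forall>y\<in>A. \<eta> (x + y) = \<eta> x * \<eta> y)"

lemma is_characterD:
  assumes "is_character A \<eta>"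
  shows "0 \<in> A" "x \<in> A \<Longrightarrow> -x \<in> A" "x \<in> A \<Longrightarrow> y \<in> A \<Longrightarrow> x + y \<in> A" "x \<in> A \<Longrightarrow> y \<in> A \<Longrightarrow> x - y \<in> A"
    "x \<in> A \<Longrightarrow> \<eta> x \<noteq> 0" "x \<in> A \<Longrightarrow> y \<in> A \<Longrightarrow> \<eta> (x + y) = \<eta> x * \<eta> y" "\<eta> 0 = 1"
proof -
  note * = assms[unfolded is_character_def]
  show "0 \<in> A" "x \<in> A \<Longrightarrow> -x \<in> A" "x \<in> A \<Longrightarrow> y \<in> A \<Longrightarrow> x + y \<in> A"
    "x \<in> A \<Longrightarrow> \<eta> x \<noteq> 0" "x \<in> A \<Longrightarrow> y \<in> A \<Longrightarrow> \<eta> (x + y) = \<eta> x * \<eta> y"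
    using * by auto
  show "x \<in> A \<Longrightarrow> y \<in> A \<Longrightarrow> x - y \<in> A" using * by (metis diff_conv_add_uminus)
  have "\<eta> 0 = \<eta> 0 * \<eta> 0" "\<eta> 0 \<noteq> 0" using * by (metis add.right_neutral)+
  then show "\<eta> 0 = 1" by simp
qed

lemma is_character_scale:
  assumes "is_character A \<eta>" "x \<in> A"
  shows "of_int n *\<^sub>R x \<in> A" "\<eta> (of_int n *\<^sub>R x) = \<eta> x powi n"
proof -
  note ch = is_characterD[OF assms(1)]
  have nat: "of_nat k *\<^sub>R x \<in> A \<and> \<eta> (of_nat k *\<^sub>R x) = \<eta> x ^ k" for k
    using assms(2) by (induction k) (auto simp: ch scaleR_add_left)
  have neg: "\<eta> (- y) = inverse (\<eta> y)" if "y \<in> A" for y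
    using ch(6)[OF that ch(2)[OF that]] ch(5)[OF that] ch(7) by (simp add: field_simps)
  have "of_int n *\<^sub>R x \<in> A \<and> \<eta> (of_int n *\<^sub>R x) = \<eta> x powi n"
  proof (cases "n \<ge> 0")
    case True
    then show ?thesis using nat[of "nat n"] by (simp add: power_int_def)
  next
    case False
    then have e: "of_int n *\<^sub>R x = - (of_nat (nat (- n)) *\<^sub>R x)" by simp
    show ?thesis
      unfolding e using False nat[of "nat (-n)"] ch(2) neg[of "of_nat (nat (- n)) *\<^sub>R x"]
      by (simp only: power_int_def power_inverse) simp
  qed
  then show "of_int n *\<^sub>R x \<in> A" "\<eta> (of_int n *\<^sub>R x) = \<eta> x powi n" by auto
qed

text \<open>The multiples of \<open>b\<close> in \<open>A\<close> form a subgroup of the integers.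
  If it is nonzero, its least positive element \<open>p\<close> generates it, and a
  \<open>p\<close>-th root of the given value at \<open>p\<close> times \<open>b\<close> serves as
  the value at \<open>b\<close>.\<close>

lemma is_character_root:
  fixes b :: "'a::real_vector"
  assumes "is_character A \<eta>"
  obtains z where "z \<noteq> 0" "\<And>n. of_int n *\<^sub>R b \<in> A \<Longrightarrow> \<eta> (of_int n *\<^sub>R b) = z powi n"
proof (cases "\<exists>p::nat. p > 0 \<and> of_nat p *\<^sub>R b \<in> A")
  case True
  note ch = is_characterD[OF assms]
  define p where "p = (LEAST p::nat. p > 0 \<and> of_nat p *\<^sub>R b \<in> A)"
  have p: "p > 0" "of_nat p *\<^sub>R b \<in> A"
    using LeastI_ex[OF True] unfolding p_def by auto
  have pmin: "p \<le> q" if "q > 0" "of_nat q *\<^sub>R b \<in> A" for q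
    unfolding p_def using that by (intro Least_le) auto
  define z where "z = exp (Ln (\<eta> (of_nat p *\<^sub>R b)) / of_nat p)"
  have zp: "z ^ p = \<eta> (of_nat p *\<^sub>R b)"
    using p ch(5)[OF p(2)] by (simp add: z_def exp_of_nat_mult[symmetric])
  show ?thesis
  proof
    show "z \<noteq> 0" by (simp add: z_def)
    fix n assume n: "of_int n *\<^sub>R b \<in> A"
    \<comment> \<open>Division with remainder: the remainder times \<open>b\<close> lies in
      \<open>A\<close> as well, and minimality of \<open>p\<close> makes the remainder zero.\<close>
    define q r where "q = n div int p" and "r = nat (n mod int p)"
    have nqr: "n = q * int p + int r" and r: "r < p"
      using p(1) by (auto simp: q_def r_def nat_less_iff)
    have nb: "of_int n *\<^sub>R b = of_int q *\<^sub>R (of_nat p *\<^sub>R b) + of_nat r *\<^sub>R b"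
      by (simp add: nqr scaleR_add_left)
    have "of_nat r *\<^sub>R b = of_int n *\<^sub>R b - of_int q *\<^sub>R (of_nat p *\<^sub>R b)" using nb by simp
    then have "of_nat r *\<^sub>R b \<in> A"
      using ch(4)[OF n is_character_scale(1)[OF assms p(2)]] by metis
    then have "r = 0" using pmin[of r] r by auto
    then have "\<eta> (of_int n *\<^sub>R b) = (z ^ p) powi q"
      using is_character_scale(2)[OF assms p(2), of q] zp by (simp add: nb)
    also have "\<dots> = z powi (int p * q)" by (simp add: power_int_mult)
    also have "int p * q = n" using \<open>r = 0\<close> by (simp add: nqr)
    finally show "\<eta> (of_int n *\<^sub>R b) = z powi n" .
  qed
next
  case False
  have "n = 0" if n: "of_int n *\<^sub>R b \<in> A" for n
  proof (rule ccontr)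
    assume "n \<noteq> 0"
    have "of_nat (nat \<bar>n\<bar>) *\<^sub>R b \<in> A"
      using n is_characterD(2)[OF assms n] by (cases "n \<ge> 0") (auto simp: abs_if)
    moreover have "0 < nat \<bar>n\<bar>" using \<open>n \<noteq> 0\<close> by simp
    ultimately show False using False by blast
  qed
  \<comment> \<open>Only the zero multiple of \<open>b\<close> lies in \<open>A\<close>, so the
    value at \<open>b\<close> is arbitrary and 1 is taken.\<close>
  then show ?thesis using that[of 1] is_characterD(7)[OF assms] by force
qed

text \<open>The value \<open>z\<close> at \<open>b\<close> agrees with \<open>\<eta>\<close> on all
  multiples of \<open>b\<close> in \<open>A\<close>, so the product formula does not depend on how
  an element of the larger group is written.\<close>

lemma is_character_extend1:
  assumes "is_character A \<eta>"
  shows "\<exists>A' \<eta>'. is_character A' \<eta>' \<and> A \<subseteq> A' \<and> b \<in> A' \<and> (\<forall>x\<in>A. \<eta>' x = \<eta> x)"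
proof -
  note ch = is_characterD[OF assms]
  obtain z where z: "z \<noteq> 0" "\<And>n. of_int n *\<^sub>R b \<in> A \<Longrightarrow> \<eta> (of_int n *\<^sub>R b) = z powi n"
    using is_character_root[OF assms] by metis
  define A' where "A' = {x + of_int n *\<^sub>R b | x n. x \<in> A}"
  define \<eta>' where "\<eta>' y = (SOME v. \<exists>x n. x \<in> A \<and> y = x + of_int n *\<^sub>R b \<and> v = \<eta> x * z powi n)" for y
  have \<eta>': "\<eta>' (x + of_int n *\<^sub>R b) = \<eta> x * z powi n" if x: "x \<in> A" for x n
  proof -
    have "\<exists>v x' n'. x' \<in> A \<and> x + of_int n *\<^sub>R b = x' + of_int n' *\<^sub>R b \<and> v = \<eta> x' * z powi n'"
      using x by blast
    from someI_ex[OF this] obtain x' n' where x': "x' \<in> A" "x + of_int n *\<^sub>R b = x' + of_int n' *\<^sub>R b"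
      "\<eta>' (x + of_int n *\<^sub>R b) = \<eta> x' * z powi n'" unfolding \<eta>'_def by blast
    have d: "of_int (n - n') *\<^sub>R b = x' - x" using x'(2) by (simp add: scaleR_diff_left algebra_simps)
    then have "\<eta> (x' - x) = z powi (n - n')" using z(2)[of "n - n'"] ch(4)[OF x'(1) x] by metis
    then have "\<eta> x' = \<eta> x * z powi (n - n')"
      using ch(6)[OF x ch(4)[OF x'(1) x]] by simp
    then show ?thesis using x'(3) z(1) by (simp add: power_int_diff)
  qed
  have "is_character A' \<eta>'"
    unfolding is_character_def
  proof (intro conjI ballI)
    have "0 = 0 + of_int 0 *\<^sub>R b \<and> 0 \<in> A" using ch(1) by simp
    then show "0 \<in> A'" unfolding A'_def by blast
    show "- y \<in> A'" if y: "y \<in> A'" for y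
    proof -
      obtain x n where "y = x + of_int n *\<^sub>R b" "x \<in> A" using y unfolding A'_def by blast
      then have "- y = - x + of_int (- n) *\<^sub>R b \<and> - x \<in> A" using ch(2) by simp
      then show ?thesis unfolding A'_def by blast
    qed
    fix y assume "y \<in> A'"
    then obtain x n where y: "y = x + of_int n *\<^sub>R b" "x \<in> A" unfolding A'_def by blast
    show "\<eta>' y \<noteq> 0" using y \<eta>' ch(5) z(1) by simp
    fix y' assume "y' \<in> A'"
    then obtain x' n' where y': "y' = x' + of_int n' *\<^sub>R b" "x' \<in> A" unfolding A'_def by blast
    have s: "y + y' = (x + x') + of_int (n + n') *\<^sub>R b"
      by (simp add: y y' scaleR_add_left algebra_simps)
    show "y + y' \<in> A'" unfolding s A'_def using ch(3)[OF y(2) y'(2)] by blast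
    show "\<eta>' (y + y') = \<eta>' y * \<eta>' y'"
      unfolding s \<eta>'[OF ch(3)[OF y(2) y'(2)]] ch(6)[OF y(2) y'(2)]
      using z(1) by (simp add: y \<eta>'[OF y(2)] y' \<eta>'[OF y'(2)] power_int_add)
  qed
  moreover have "A \<subseteq> A'"
  proof
    fix x assume "x \<in> A"
    then have "x = x + of_int 0 *\<^sub>R b \<and> x \<in> A" by simp
    then show "x \<in> A'" unfolding A'_def by blast
  qed
  moreover have "b \<in> A'"
  proof -
    have "b = 0 + of_int 1 *\<^sub>R b \<and> 0 \<in> A" using ch(1) by simp
    then show ?thesis unfolding A'_def by blast
  qed
  moreover have "\<eta>' x = \<eta> x" if "x \<in> A" for x using \<eta>'[OF that, of 0] by simp
  ultimately show ?thesis by blast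
qed

lemma is_character_extend:
  assumes "is_character A \<eta>" "finite F"
  shows "\<exists>A' \<eta>'. is_character A' \<eta>' \<and> A \<subseteq> A' \<and> F \<subseteq> A' \<and> (\<forall>x\<in>A. \<eta>' x = \<eta> x)"
  using assms(2)
proof (induction F rule: finite_induct)
  case empty
  then show ?case using assms(1) by blast
next
  case (insert b F)
  then obtain A' \<eta>' where A': "is_character A' \<eta>'" "A \<subseteq> A'" "F \<subseteq> A'" "\<forall>x\<in>A. \<eta>' x = \<eta> x" by blast
  from is_character_extend1[OF A'(1), of b] obtain A'' \<eta>'' where
    "is_character A'' \<eta>''" "A' \<subseteq> A''" "b \<in> A''" "\<forall>x\<in>A'. \<eta>'' x = \<eta>' x" by blast
  then show ?case using A' by (intro exI[of _ A''] exI[of _ \<eta>'']) auto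
qed

lemma is_character_sum:
  assumes "is_character A \<eta>" "finite F" "\<And>b. b \<in> F \<Longrightarrow> d b \<in> A"
  shows "(\<Sum>b\<in>F. of_int (n b) *\<^sub>R d b) \<in> A \<and>
         \<eta> (\<Sum>b\<in>F. of_int (n b) *\<^sub>R d b) = (\<Prod>b\<in>F. \<eta> (d b) powi n b)"
  using assms(2,3)
  by (induction F rule: finite_induct)
    (auto simp: is_characterD[OF assms(1)] is_character_scale[OF assms(1)])

text \<open>After extension to the dual basis, which generates the dual lattice, the character is
  determined by finitely many nonzero values; their logarithms are the exponents
  \<open>z\<close>.\<close>

lemma (in lattice) character_exp:
  assumes "is_character A \<eta>" "A \<subseteq> dual_lattice L"
  obtains z where "\<And>m. m \<in> A \<Longrightarrow> \<eta> m = exp (\<Sum>b\<in>basis. of_real (m \<bullet> b) * z b)"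
proof -
  from is_character_extend[OF assms(1), of "dual_basis ` basis"] finite_basis
  obtain A' \<eta>' where A': "is_character A' \<eta>'" "A \<subseteq> A'" "dual_basis ` basis \<subseteq> A'" "\<forall>x\<in>A. \<eta>' x = \<eta> x"
    by auto
  show ?thesis
  proof
    fix m assume m: "m \<in> A"
    then have mM: "m \<in> dual_lattice L" using assms(2) by auto
    have fl: "of_int \<lfloor>m \<bullet> b\<rfloor> = m \<bullet> b" if "b \<in> basis" for b
      using dual_lattice_floor[OF mM] basis_subset that by auto
    have me: "m = (\<Sum>b\<in>basis. of_int \<lfloor>m \<bullet> b\<rfloor> *\<^sub>R dual_basis b)"
    proof -
      have "(\<Sum>b\<in>basis. of_int \<lfloor>m \<bullet> b\<rfloor> *\<^sub>R dual_basis b) = (\<Sum>b\<in>basis. (m \<bullet> b) *\<^sub>R dual_basis b)"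
        by (intro sum.cong refl) (simp only: fl)
      with span_expansion[OF dual_lattice_subset_span[OF mM]] show ?thesis by (rule trans[OF _ sym])
    qed
    have "\<eta> m = \<eta>' m" using A'(4) m by simp
    also have "\<dots> = \<eta>' (\<Sum>b\<in>basis. of_int \<lfloor>m \<bullet> b\<rfloor> *\<^sub>R dual_basis b)" by (rule arg_cong[OF me])
    also have "\<dots> = (\<Prod>b\<in>basis. \<eta>' (dual_basis b) powi \<lfloor>m \<bullet> b\<rfloor>)"
      using A'(3) by (intro conjunct2[OF is_character_sum[OF A'(1) finite_basis]]) auto
    also have "\<dots> = (\<Prod>b\<in>basis. exp (of_real (m \<bullet> b) * Ln (\<eta>' (dual_basis b))))"
    proof (rule prod.cong[OF refl])
      fix b assume b: "b \<in> basis"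
      then have "\<eta>' (dual_basis b) \<noteq> 0" using A'(3) is_characterD(5)[OF A'(1)] by auto
      then have "\<eta>' (dual_basis b) powi \<lfloor>m \<bullet> b\<rfloor> = exp (Ln (\<eta>' (dual_basis b))) powi \<lfloor>m \<bullet> b\<rfloor>" by simp
      also have "\<dots> = exp (of_int \<lfloor>m \<bullet> b\<rfloor> * Ln (\<eta>' (dual_basis b)))" by (simp add: exp_power_int)
      also have "(of_int \<lfloor>m \<bullet> b\<rfloor> :: complex) = of_real (m \<bullet> b)" using fl[OF b] by (metis of_real_of_int_eq)
      finally show "\<eta>' (dual_basis b) powi \<lfloor>m \<bullet> b\<rfloor> = exp (of_real (m \<bullet> b) * Ln (\<eta>' (dual_basis b)))" .
    qed
    also have "\<dots> = exp (\<Sum>b\<in>basis. of_real (m \<bullet> b) * Ln (\<eta>' (dual_basis b)))"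
      by (simp add: exp_sum finite_basis)
    finally show "\<eta> m = exp (\<Sum>b\<in>basis. of_real (m \<bullet> b) * Ln (\<eta>' (dual_basis b)))" .
  qed
qed

section \<open>Charts and their gluing\<close>

lemma dual_monoid_dual_lattice: "m \<in> dual_monoid L \<sigma> \<Longrightarrow> m \<in> dual_lattice L"
  by (simp add: dual_monoid_def)

lemma dual_monoid_0: "0 \<in> dual_monoid L \<sigma>"
  by (simp add: dual_monoid_def dual_lattice_0)

lemma dual_monoid_add: "m \<in> dual_monoid L \<sigma> \<Longrightarrow> m' \<in> dual_monoid L \<sigma> \<Longrightarrow> m + m' \<in> dual_monoid L \<sigma>"
  by (simp add: dual_monoid_def dual_lattice_add inner_add_left)

lemma dual_monoid_scale: "m \<in> dual_monoid L \<sigma> \<Longrightarrow> of_nat c *\<^sub>R m \<in> dual_monoid L \<sigma>"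
  by (simp add: dual_monoid_def dual_lattice_scale)

lemma dual_monoid_antimono: "\<tau> \<subseteq> \<sigma> \<Longrightarrow> dual_monoid L \<sigma> \<subseteq> dual_monoid L \<tau>"
  by (auto simp: dual_monoid_def)

lemma chartD:
  assumes "\<gamma> \<in> chart L \<sigma>"
  shows "\<gamma> 0 = 1" "m \<in> dual_monoid L \<sigma> \<Longrightarrow> m' \<in> dual_monoid L \<sigma> \<Longrightarrow> \<gamma> (m + m') = \<gamma> m * \<gamma> m'"
    "\<gamma> \<in> extensional (dual_monoid L \<sigma>)"
  using assms by (auto simp: chart_def)

lemma chart_scale:
  assumes "\<gamma> \<in> chart L \<sigma>" "m \<in> dual_monoid L \<sigma>"
  shows "\<gamma> (of_nat c *\<^sub>R m) = \<gamma> m ^ c"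
proof (induction c)
  case (Suc c)
  have e: "of_nat (Suc c) *\<^sub>R m = m + of_nat c *\<^sub>R m" by (simp add: scaleR_add_left)
  show ?case unfolding e chartD(2)[OF assms(1,2) dual_monoid_scale[OF assms(2)]] by (simp add: Suc)
qed (use chartD[OF assms(1)] in auto)

lemma chart_eqI:
  "\<gamma> \<in> chart L \<sigma> \<Longrightarrow> \<gamma>' \<in> chart L \<sigma> \<Longrightarrow> (\<And>m. m \<in> dual_monoid L \<sigma> \<Longrightarrow> \<gamma> m = \<gamma>' m) \<Longrightarrow> \<gamma> = \<gamma>'"
  using chartD(3) extensionalityI by metis

lemma chartI:
  "\<lbrakk>g 0 = 1; \<And>m m'. m \<in> dual_monoid L \<sigma> \<Longrightarrow> m' \<in> dual_monoid L \<sigma> \<Longrightarrow> g (m + m') = g m * g m'\<rbrakk>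
    \<Longrightarrow> restrict g (dual_monoid L \<sigma>) \<in> chart L \<sigma>"
  by (simp add: chart_def dual_monoid_0 dual_monoid_add)

lemma restrict_chart:
  assumes "\<gamma> \<in> chart L \<tau>" "\<tau> \<subseteq> \<sigma>"
  shows "restrict \<gamma> (dual_monoid L \<sigma>) \<in> chart L \<sigma>"
  using dual_monoid_antimono[OF assms(2), of L]
  by (intro chartI chartD(1)[OF assms(1)] chartD(2)[OF assms(1)]) auto

lemma restrict_chart_self: "\<gamma> \<in> chart L \<sigma> \<Longrightarrow> restrict \<gamma> (dual_monoid L \<sigma>) = \<gamma>"
  using chartD(3) by (metis extensional_restrict)

text \<open>Equal exponents are merged, because a chart function is given by a set of characters
  with one coefficient each.\<close>

lemma chart_functionsI:
  fixes L :: "'a::euclidean_space set"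
  assumes "finite I" "\<And>i. i \<in> I \<Longrightarrow> e i \<in> dual_monoid L \<sigma>"
  shows "(\<lambda>\<gamma>. \<Sum>i\<in>I. c i * \<gamma> (e i)) \<in> chart_functions L \<sigma>"
proof -
  have "(\<Sum>i\<in>I. c i * \<gamma> (e i)) = (\<Sum>m\<in>e ` I. (\<Sum>i\<in>{i\<in>I. e i = m}. c i) * \<gamma> m)" for \<gamma> :: "'a \<Rightarrow> complex"
    by (subst sum.image_gen[OF assms(1), of _ e]) (auto simp: sum_distrib_right intro!: sum.cong)
  then show ?thesis
    unfolding chart_functions_def using assms
    by (intro CollectI exI[of _ "e ` I"] exI[of _ "\<lambda>m. \<Sum>i\<in>{i\<in>I. e i = m}. c i"]) auto
qed

lemma chart_functionsE:
  assumes "f \<in> chart_functions L \<sigma>"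
  obtains A c where "finite A" "A \<subseteq> dual_monoid L \<sigma>" "f = (\<lambda>\<gamma>. \<Sum>m\<in>A. c m * \<gamma> m)"
  using assms unfolding chart_functions_def by blast

lemma chart_functions_character: "m \<in> dual_monoid L \<sigma> \<Longrightarrow> (\<lambda>\<gamma>. \<gamma> m) \<in> chart_functions L \<sigma>"
  using chart_functionsI[of "{m}" "\<lambda>x. x" L \<sigma> "\<lambda>_. 1"] by simp

lemma chart_functions_one: "\<exists>f\<in>chart_functions L \<sigma>. \<forall>\<gamma>\<in>chart L \<sigma>. f \<gamma> = 1"
  using chart_functions_character[OF dual_monoid_0] by (intro bexI[of _ "\<lambda>\<gamma>. \<gamma> 0"]) (auto dest: chartD(1))

lemma chart_functions_diff_characters:
  assumes "m \<in> dual_monoid L \<sigma>" "m' \<in> dual_monoid L \<sigma>"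
  shows "(\<lambda>\<gamma>. \<gamma> m - \<gamma> m') \<in> chart_functions L \<sigma>"
  using chart_functionsI[of "UNIV :: bool set" "\<lambda>b. if b then m else m'" L \<sigma> "\<lambda>b. if b then 1 else -1"] assms
  by (simp add: UNIV_bool algebra_simps)

lemma chart_functions_mult:
  assumes "f \<in> chart_functions L \<sigma>" "g \<in> chart_functions L \<sigma>"
  obtains h where "h \<in> chart_functions L \<sigma>" "\<And>\<gamma>. \<gamma> \<in> chart L \<sigma> \<Longrightarrow> h \<gamma> = f \<gamma> * g \<gamma>"
proof -
  obtain A c where f: "finite A" "A \<subseteq> dual_monoid L \<sigma>" "f = (\<lambda>\<gamma>. \<Sum>m\<in>A. c m * \<gamma> m)"
    using chart_functionsE[OF assms(1)] .
  obtain B d where g: "finite B" "B \<subseteq> dual_monoid L \<sigma>" "g = (\<lambda>\<gamma>. \<Sum>m\<in>B. d m * \<gamma> m)"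
    using chart_functionsE[OF assms(2)] .
  show ?thesis
  proof
    show "(\<lambda>\<gamma>. \<Sum>p\<in>A \<times> B. (c (fst p) * d (snd p)) * \<gamma> (fst p + snd p)) \<in> chart_functions L \<sigma>"
      using f g by (intro chart_functionsI) (auto intro!: dual_monoid_add)
    fix \<gamma> assume \<gamma>: "\<gamma> \<in> chart L \<sigma>"
    have "(\<Sum>p\<in>A \<times> B. (c (fst p) * d (snd p)) * \<gamma> (fst p + snd p))
        = (\<Sum>p\<in>A \<times> B. (c (fst p) * \<gamma> (fst p)) * (d (snd p) * \<gamma> (snd p)))"
      using f g \<gamma> by (intro sum.cong) (auto simp: chartD(2)[OF \<gamma>] subset_iff)
    then show "(\<Sum>p\<in>A \<times> B. (c (fst p) * d (snd p)) * \<gamma> (fst p + snd p)) = f \<gamma> * g \<gamma>"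
      unfolding f g by (simp add: sum_product sum.cartesian_product case_prod_beta)
  qed
qed

text \<open>The nonvanishing sets of chart functions form a base and not just a subbase, since on
  the chart a product of chart functions is a chart function.\<close>

lemma openin_chart_topology:
  "openin (chart_topology L \<sigma>) U \<longleftrightarrow> U \<subseteq> chart L \<sigma> \<and>
     (\<forall>\<gamma>\<in>U. \<exists>f\<in>chart_functions L \<sigma>. f \<gamma> \<noteq> 0 \<and> {\<delta> \<in> chart L \<sigma>. f \<delta> \<noteq> 0} \<subseteq> U)" (is "?L \<longleftrightarrow> ?R")
proof
  assume ?L
  then have "generate_topology_on {{\<gamma> \<in> chart L \<sigma>. f \<gamma> \<noteq> 0} | f. f \<in> chart_functions L \<sigma>} U"
    by (simp add: chart_topology_def openin_topology_generated_by_iff)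
  then show ?R
  proof (induction rule: generate_topology_on.induct)
    case (Int U V)
    have "\<exists>f\<in>chart_functions L \<sigma>. f \<gamma> \<noteq> 0 \<and> {\<delta> \<in> chart L \<sigma>. f \<delta> \<noteq> 0} \<subseteq> U \<inter> V" if \<gamma>: "\<gamma> \<in> U \<inter> V" for \<gamma>
    proof -
      obtain f where f: "f \<in> chart_functions L \<sigma>" "f \<gamma> \<noteq> 0" "{\<delta> \<in> chart L \<sigma>. f \<delta> \<noteq> 0} \<subseteq> U" using Int \<gamma> by blast
      obtain g where g: "g \<in> chart_functions L \<sigma>" "g \<gamma> \<noteq> 0" "{\<delta> \<in> chart L \<sigma>. g \<delta> \<noteq> 0} \<subseteq> V" using Int \<gamma> by blast
      obtain h where h: "h \<in> chart_functions L \<sigma>" "\<And>\<gamma>. \<gamma> \<in> chart L \<sigma> \<Longrightarrow> h \<gamma> = f \<gamma> * g \<gamma>"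
        using chart_functions_mult[OF f(1) g(1)] by blast
      have "\<gamma> \<in> chart L \<sigma>" using Int \<gamma> by auto
      then show ?thesis using f g h by (intro bexI[of _ h]) (auto simp: subset_iff)
    qed
    then show ?case using Int by auto
  next
    case (UN K)
    show ?case
    proof (intro conjI ballI)
      show "\<Union>K \<subseteq> chart L \<sigma>" using UN by blast
      fix \<gamma> assume "\<gamma> \<in> \<Union>K"
      then obtain k where k: "k \<in> K" "\<gamma> \<in> k" by blast
      with UN(2)[OF k(1)] obtain f where "f\<in>chart_functions L \<sigma>" "f \<gamma> \<noteq> 0" "{\<delta> \<in> chart L \<sigma>. f \<delta> \<noteq> 0} \<subseteq> k" by blast
      then show "\<exists>f\<in>chart_functions L \<sigma>. f \<gamma> \<noteq> 0 \<and> {\<delta> \<in> chart L \<sigma>. f \<delta> \<noteq> 0} \<subseteq> \<Union>K" using k(1) by blast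
    qed
  qed auto
next
  assume R: ?R
  show ?L
    unfolding chart_topology_def
  proof (subst openin_subopen, intro ballI)
    fix \<gamma> assume \<gamma>: "\<gamma> \<in> U"
    then obtain f where f: "f \<in> chart_functions L \<sigma>" "f \<gamma> \<noteq> 0" "{\<delta> \<in> chart L \<sigma>. f \<delta> \<noteq> 0} \<subseteq> U" using R by blast
    then show "\<exists>T. openin (topology_generated_by {{\<gamma> \<in> chart L \<sigma>. f \<gamma> \<noteq> 0} |f. f \<in> chart_functions L \<sigma>}) T \<and> \<gamma> \<in> T \<and> T \<subseteq> U"
      using R \<gamma> by (intro exI[of _ "{\<delta> \<in> chart L \<sigma>. f \<delta> \<noteq> 0}"]) (auto intro: topology_generated_by_Basis)
  qed
qed

text \<open>\<open>localizes L \<sigma> \<tau> m\<close>: the monoid of \<open>\<tau>\<close> arises from that of \<open>\<sigma>\<close> by inverting \<open>m\<close>, so that \<open>U\<^sub>\<tau>\<close> is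
  the principal open subset of \<open>U\<^sub>\<sigma>\<close> on which the character \<open>m\<close> does not vanish.\<close>

definition localizes :: "'a::euclidean_space set \<Rightarrow> 'a set \<Rightarrow> 'a set \<Rightarrow> 'a \<Rightarrow> bool" where
  "localizes L \<sigma> \<tau> m \<longleftrightarrow> \<tau> \<subseteq> \<sigma> \<and> m \<in> dual_monoid L \<sigma> \<and> - m \<in> dual_monoid L \<tau> \<and>
     (\<forall>n\<in>dual_monoid L \<tau>. \<exists>c::nat. n + of_nat c *\<^sub>R m \<in> dual_monoid L \<sigma>)"

lemma localizesD:
  assumes "localizes L \<sigma> \<tau> m"
  shows "\<tau> \<subseteq> \<sigma>" "m \<in> dual_monoid L \<sigma>" "m \<in> dual_monoid L \<tau>" "- m \<in> dual_monoid L \<tau>"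
  using assms dual_monoid_antimono by (auto simp: localizes_def)

lemma localizes_ge:
  assumes "localizes L \<sigma> \<tau> m" "n \<in> dual_monoid L \<tau>"
  obtains c0 :: nat where "\<And>c. c \<ge> c0 \<Longrightarrow> n + of_nat c *\<^sub>R m \<in> dual_monoid L \<sigma>"
proof -
  obtain c0 :: nat where c0: "n + of_nat c0 *\<^sub>R m \<in> dual_monoid L \<sigma>" using assms by (auto simp: localizes_def)
  have "n + of_nat c *\<^sub>R m \<in> dual_monoid L \<sigma>" if "c \<ge> c0" for c
  proof -
    have "n + of_nat c *\<^sub>R m = (n + of_nat c0 *\<^sub>R m) + of_nat (c - c0) *\<^sub>R m"
      using that by (simp add: of_nat_diff scaleR_diff_left)
    then show ?thesis using dual_monoid_add[OF c0 dual_monoid_scale[OF localizesD(2)[OF assms(1)]]] by metis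
  qed
  then show ?thesis using that by blast
qed

lemma localizes_ge_finite:
  assumes "localizes L \<sigma> \<tau> m" "finite A" "A \<subseteq> dual_monoid L \<tau>"
  obtains c0 :: nat where "\<And>n c. n \<in> A \<Longrightarrow> c \<ge> c0 \<Longrightarrow> n + of_nat c *\<^sub>R m \<in> dual_monoid L \<sigma>"
proof -
  have "\<exists>c0::nat. \<forall>n\<in>A. \<forall>c\<ge>c0. n + of_nat c *\<^sub>R m \<in> dual_monoid L \<sigma>"
    using assms(2,3)
  proof (induction A rule: finite_induct)
    case (insert n A)
    obtain c0 :: nat where c0: "\<And>n c. n \<in> A \<Longrightarrow> c \<ge> c0 \<Longrightarrow> n + of_nat c *\<^sub>R m \<in> dual_monoid L \<sigma>"
      using insert by auto
    obtain c1 :: nat where "\<And>c. c \<ge> c1 \<Longrightarrow> n + of_nat c *\<^sub>R m \<in> dual_monoid L \<sigma>"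
      using localizes_ge[OF assms(1), of n] insert.prems by auto
    then show ?case using c0 by (intro exI[of _ "max c0 c1"]) auto
  qed auto
  then show ?thesis using that by blast
qed

lemma chart_unit:
  assumes "\<delta> \<in> chart L \<tau>" "m \<in> dual_monoid L \<tau>" "- m \<in> dual_monoid L \<tau>"
  shows "\<delta> m \<noteq> 0"
  using chartD(2)[OF assms] chartD(1)[OF assms(1)] by auto

lemma localizes_unit: "localizes L \<sigma> \<tau> m \<Longrightarrow> \<delta> \<in> chart L \<tau> \<Longrightarrow> \<delta> m \<noteq> 0"
  using chart_unit localizesD(3,4) by blast

text \<open>The value of the extension at \<open>n\<close> is forced: for any admissible
  \<open>c\<close>, the value at \<open>n\<close> plus \<open>c\<close> times \<open>m\<close>,
  divided by the \<open>c\<close>-th power of the value at \<open>m\<close>. Evaluating the sum of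
  two shifts in both ways shows independence of \<open>c\<close>.\<close>

lemma localizes_extend:
  assumes loc: "localizes L \<sigma> \<tau> m" and \<gamma>: "\<gamma> \<in> chart L \<sigma>" and nz: "\<gamma> m \<noteq> 0"
  obtains \<delta> where "\<delta> \<in> chart L \<tau>" "restrict \<delta> (dual_monoid L \<sigma>) = \<gamma>"
proof -
  note mS = localizesD(2)[OF loc]
  have sub: "dual_monoid L \<sigma> \<subseteq> dual_monoid L \<tau>" using loc dual_monoid_antimono localizesD(1) by blast
  define g where "g n = (SOME v. \<exists>c::nat. n + of_nat c *\<^sub>R m \<in> dual_monoid L \<sigma> \<and>
     v = \<gamma> (n + of_nat c *\<^sub>R m) / \<gamma> m ^ c)" for n
  have g: "g n = \<gamma> (n + of_nat c *\<^sub>R m) / \<gamma> m ^ c" if nc: "n + of_nat c *\<^sub>R m \<in> dual_monoid L \<sigma>" for n and c :: nat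
  proof -
    have "\<exists>v. \<exists>c::nat. n + of_nat c *\<^sub>R m \<in> dual_monoid L \<sigma> \<and> v = \<gamma> (n + of_nat c *\<^sub>R m) / \<gamma> m ^ c"
      using nc by blast
    from someI_ex[OF this] obtain d :: nat where d: "n + of_nat d *\<^sub>R m \<in> dual_monoid L \<sigma>"
      "g n = \<gamma> (n + of_nat d *\<^sub>R m) / \<gamma> m ^ d" unfolding g_def by blast
    have "(n + of_nat c *\<^sub>R m) + of_nat d *\<^sub>R m = (n + of_nat d *\<^sub>R m) + of_nat c *\<^sub>R m" by simp
    then have "\<gamma> (n + of_nat c *\<^sub>R m) * \<gamma> m ^ d = \<gamma> (n + of_nat d *\<^sub>R m) * \<gamma> m ^ c"
      using chartD(2)[OF \<gamma> nc dual_monoid_scale[OF mS]] chartD(2)[OF \<gamma> d(1) dual_monoid_scale[OF mS]]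
        chart_scale[OF \<gamma> mS] by metis
    then show ?thesis using d(2) nz by (simp add: frac_eq_eq)
  qed
  have g': "g n = \<gamma> n" if "n \<in> dual_monoid L \<sigma>" for n
    using g[of n 0] that by simp
  show ?thesis
  proof
    show "restrict g (dual_monoid L \<tau>) \<in> chart L \<tau>"
    proof (rule chartI)
      show "g 0 = 1" using g'[OF dual_monoid_0] chartD(1)[OF \<gamma>] by simp
      fix n n' assume "n \<in> dual_monoid L \<tau>" "n' \<in> dual_monoid L \<tau>"
      then obtain c c' :: nat where c: "n + of_nat c *\<^sub>R m \<in> dual_monoid L \<sigma>" "n' + of_nat c' *\<^sub>R m \<in> dual_monoid L \<sigma>"
        using loc unfolding localizes_def by blast
      have s: "(n + n') + of_nat (c + c') *\<^sub>R m = (n + of_nat c *\<^sub>R m) + (n' + of_nat c' *\<^sub>R m)"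
        by (simp add: scaleR_add_left)
      have "(n + n') + of_nat (c + c') *\<^sub>R m \<in> dual_monoid L \<sigma>" unfolding s by (intro dual_monoid_add c)
      from g[OF this] show "g (n + n') = g n * g n'"
        unfolding s chartD(2)[OF \<gamma> c] by (simp add: g[OF c(1)] g[OF c(2)] power_add)
    qed
    show "restrict (restrict g (dual_monoid L \<tau>)) (dual_monoid L \<sigma>) = \<gamma>"
      using g' sub by (intro extensionalityI[OF restrict_extensional chartD(3)[OF \<gamma>]]) auto
  qed
qed

text \<open>Multiplication by a power of the unit \<open>\<delta> m\<close> moves every argument
  into the monoid of \<open>\<sigma>\<close>, where the two homomorphisms agree.\<close>

lemma localizes_unique:
  assumes loc: "localizes L \<sigma> \<tau> m" and \<delta>: "\<delta> \<in> chart L \<tau>" "\<delta>' \<in> chart L \<tau>"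
    and eq: "\<And>n. n \<in> dual_monoid L \<sigma> \<Longrightarrow> \<delta> n = \<delta>' n"
  shows "\<delta> = \<delta>'"
proof (rule chart_eqI[OF \<delta>])
  fix n assume n: "n \<in> dual_monoid L \<tau>"
  then obtain c :: nat where c: "n + of_nat c *\<^sub>R m \<in> dual_monoid L \<sigma>" using loc unfolding localizes_def by blast
  have "\<delta> n * \<delta> m ^ c = \<delta>' n * \<delta>' m ^ c"
    using eq[OF c] chartD(2)[OF \<delta>(1) n dual_monoid_scale[OF localizesD(3)[OF loc]]]
      chartD(2)[OF \<delta>(2) n dual_monoid_scale[OF localizesD(3)[OF loc]]]
      chart_scale[OF \<delta>(1) localizesD(3)[OF loc]] chart_scale[OF \<delta>(2) localizesD(3)[OF loc]]
    by simp
  then show "\<delta> n = \<delta>' n"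
    using eq[OF localizesD(2)[OF loc]] localizes_unit[OF loc \<delta>(1)] by simp
qed

text \<open>A fan, reduced to the properties used in the gluing of its charts.\<close>

locale chart_fan =
  fixes L :: "'a::euclidean_space set" and \<Sigma> :: "'a set set"
  assumes Int_fan: "\<sigma> \<in> \<Sigma> \<Longrightarrow> \<sigma>' \<in> \<Sigma> \<Longrightarrow> \<sigma> \<inter> \<sigma>' \<in> \<Sigma>"
    and separation: "\<sigma> \<in> \<Sigma> \<Longrightarrow> \<sigma>' \<in> \<Sigma> \<Longrightarrow>
      \<exists>m. localizes L \<sigma> (\<sigma> \<inter> \<sigma>') m \<and> localizes L \<sigma>' (\<sigma> \<inter> \<sigma>') (- m)"
begin

lemma gluingI:
  "\<lbrakk>\<sigma> \<in> \<Sigma>; \<sigma>' \<in> \<Sigma>; \<delta> \<in> chart L (\<sigma> \<inter> \<sigma>')\<rbrakk>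
    \<Longrightarrow> ((\<sigma>, restrict \<delta> (dual_monoid L \<sigma>)), (\<sigma>', restrict \<delta> (dual_monoid L \<sigma>'))) \<in> gluing L \<Sigma>"
  unfolding gluing_def by (auto intro!: restrict_chart bexI[of _ \<delta>])

text \<open>The two overlap points have to be completed to a point over the triple intersection. It
  suffices that \<open>\<delta>12\<close> does not vanish at the character \<open>m\<close>
  separating \<open>\<sigma>1 \<inter> \<sigma>2\<close> from \<open>\<sigma>3\<close>.\<close>

lemma gluing_trans:
  assumes "((\<sigma>1, \<gamma>1), (\<sigma>2, \<gamma>2)) \<in> gluing L \<Sigma>" "((\<sigma>2, \<gamma>2), (\<sigma>3, \<gamma>3)) \<in> gluing L \<Sigma>"
  shows "((\<sigma>1, \<gamma>1), (\<sigma>3, \<gamma>3)) \<in> gluing L \<Sigma>"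
proof -
  from assms(1) obtain \<delta>12 where 1: "\<sigma>1 \<in> \<Sigma>" "\<sigma>2 \<in> \<Sigma>" "\<delta>12 \<in> chart L (\<sigma>1 \<inter> \<sigma>2)"
    "restrict \<delta>12 (dual_monoid L \<sigma>1) = \<gamma>1" "restrict \<delta>12 (dual_monoid L \<sigma>2) = \<gamma>2" "\<gamma>2 \<in> chart L \<sigma>2"
    unfolding gluing_def by auto
  from assms(2) obtain \<delta>23 where 2: "\<sigma>3 \<in> \<Sigma>" "\<delta>23 \<in> chart L (\<sigma>2 \<inter> \<sigma>3)"
    "restrict \<delta>23 (dual_monoid L \<sigma>2) = \<gamma>2" "restrict \<delta>23 (dual_monoid L \<sigma>3) = \<gamma>3"
    unfolding gluing_def by auto
  obtain m1 where m1: "localizes L \<sigma>2 (\<sigma>1 \<inter> \<sigma>2) m1"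
    using separation[of \<sigma>2 \<sigma>1] 1 by (auto simp: Int_commute)
  obtain m3 where m3: "localizes L \<sigma>2 (\<sigma>2 \<inter> \<sigma>3) m3"
    using separation[of \<sigma>2 \<sigma>3] 1 2 by auto
  obtain m where m: "localizes L (\<sigma>1 \<inter> \<sigma>2) (\<sigma>1 \<inter> \<sigma>2 \<inter> \<sigma>3) m" "localizes L \<sigma>3 (\<sigma>1 \<inter> \<sigma>2 \<inter> \<sigma>3) (- m)"
    using separation[of "\<sigma>1 \<inter> \<sigma>2" \<sigma>3] Int_fan 1 2 by auto
  have s12: "dual_monoid L \<sigma>2 \<subseteq> dual_monoid L (\<sigma>1 \<inter> \<sigma>2)" and s23: "dual_monoid L \<sigma>2 \<subseteq> dual_monoid L (\<sigma>2 \<inter> \<sigma>3)"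
    and s3: "dual_monoid L \<sigma>3 \<subseteq> dual_monoid L (\<sigma>2 \<inter> \<sigma>3)"
    by (intro dual_monoid_antimono; blast)+
  have g12: "\<delta>12 n = \<gamma>2 n" and g23: "\<delta>23 n = \<gamma>2 n" if "n \<in> dual_monoid L \<sigma>2" for n
    using 1(5) 2(3) that by (metis restrict_apply')+
  \<comment> \<open>The character \<open>m\<close> is defined over the first overlap and
    \<open>- m\<close> over the second. After a shift by a multiple of \<open>m1\<close> they can be
    compared through \<open>\<sigma>2\<close>; vanishing at \<open>m\<close> would contradict that
    \<open>m1\<close> is a unit on the first overlap.\<close>
  have "\<delta>12 m \<noteq> 0"
  proof -
    obtain c :: nat where c: "m + of_nat c *\<^sub>R m1 \<in> dual_monoid L \<sigma>2"
      using m1 localizesD(2)[OF m(1)] unfolding localizes_def by blast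
    have m1c: "of_nat c *\<^sub>R m1 \<in> dual_monoid L \<sigma>2" using dual_monoid_scale[OF localizesD(2)[OF m1]] .
    have "\<delta>23 (of_nat c *\<^sub>R m1) = \<delta>23 (- m + (m + of_nat c *\<^sub>R m1))" by simp
    also have "\<dots> = \<delta>23 (- m) * \<delta>23 (m + of_nat c *\<^sub>R m1)"
      using c s23 s3 localizesD(2)[OF m(2)] by (intro chartD(2)[OF 2(2)]) auto
    finally have "\<delta>12 (of_nat c *\<^sub>R m1) = \<delta>23 (- m) * \<delta>12 (m + of_nat c *\<^sub>R m1)"
      using g12 g23 c m1c by metis
    moreover have "\<delta>12 (of_nat c *\<^sub>R m1) = \<delta>12 m1 ^ c" by (rule chart_scale[OF 1(3) localizesD(3)[OF m1]])
    moreover have "\<delta>12 m1 \<noteq> 0" by (rule localizes_unit[OF m1 1(3)])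
    moreover have "\<delta>12 (m + of_nat c *\<^sub>R m1) = \<delta>12 m * \<delta>12 (of_nat c *\<^sub>R m1)"
      using s12 m1c by (intro chartD(2)[OF 1(3) localizesD(2)[OF m(1)]]) auto
    ultimately show ?thesis by auto
  qed
  then obtain \<delta> where \<delta>: "\<delta> \<in> chart L (\<sigma>1 \<inter> \<sigma>2 \<inter> \<sigma>3)" "restrict \<delta> (dual_monoid L (\<sigma>1 \<inter> \<sigma>2)) = \<delta>12"
    using localizes_extend[OF m(1) 1(3)] by blast
  have d12: "\<delta> n = \<delta>12 n" if "n \<in> dual_monoid L (\<sigma>1 \<inter> \<sigma>2)" for n
    using \<delta>(2) that by (metis restrict_apply')
  \<comment> \<open>Both points restrict to \<open>\<gamma>2\<close>, and a point over
    \<open>\<sigma>2 \<inter> \<sigma>3\<close> is determined by its restriction to the monoid of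
    \<open>\<sigma>2\<close>.\<close>
  have "restrict \<delta> (dual_monoid L (\<sigma>2 \<inter> \<sigma>3)) = \<delta>23"
  proof (rule localizes_unique[OF m3 _ 2(2)])
    show "restrict \<delta> (dual_monoid L (\<sigma>2 \<inter> \<sigma>3)) \<in> chart L (\<sigma>2 \<inter> \<sigma>3)"
      by (rule restrict_chart[OF \<delta>(1)]) auto
    fix n assume "n \<in> dual_monoid L \<sigma>2"
    then show "restrict \<delta> (dual_monoid L (\<sigma>2 \<inter> \<sigma>3)) n = \<delta>23 n"
      using s12 s23 d12 g12 g23 by auto
  qed
  then have d23: "\<delta> n = \<delta>23 n" if "n \<in> dual_monoid L (\<sigma>2 \<inter> \<sigma>3)" for n using that by (metis restrict_apply')
  define \<delta>' where "\<delta>' = restrict \<delta> (dual_monoid L (\<sigma>1 \<inter> \<sigma>3))"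
  have "\<delta>' \<in> chart L (\<sigma>1 \<inter> \<sigma>3)" unfolding \<delta>'_def by (rule restrict_chart[OF \<delta>(1)]) auto
  moreover have "restrict \<delta>' (dual_monoid L \<sigma>1) = \<gamma>1"
  proof -
    have "n \<in> dual_monoid L (\<sigma>1 \<inter> \<sigma>3) \<and> n \<in> dual_monoid L (\<sigma>1 \<inter> \<sigma>2)" if "n \<in> dual_monoid L \<sigma>1" for n
      using that by (auto simp: dual_monoid_def)
    then show ?thesis unfolding 1(4)[symmetric] \<delta>'_def using d12 by (intro restrict_ext) auto
  qed
  moreover have "restrict \<delta>' (dual_monoid L \<sigma>3) = \<gamma>3"
  proof -
    have "n \<in> dual_monoid L (\<sigma>1 \<inter> \<sigma>3) \<and> n \<in> dual_monoid L (\<sigma>2 \<inter> \<sigma>3)" if "n \<in> dual_monoid L \<sigma>3" for n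
      using that by (auto simp: dual_monoid_def)
    then show ?thesis unfolding 2(4)[symmetric] \<delta>'_def using d23 by (intro restrict_ext) auto
  qed
  ultimately show ?thesis using gluingI[OF 1(1) 2(1)] by metis
qed

lemma equiv_gluing: "equiv (SIGMA \<sigma>:\<Sigma>. chart L \<sigma>) (gluing L \<Sigma>)"
proof (rule equivI)
  show "gluing L \<Sigma> \<subseteq> (SIGMA \<sigma>:\<Sigma>. chart L \<sigma>) \<times> (SIGMA \<sigma>:\<Sigma>. chart L \<sigma>)"
    by (auto simp: gluing_def)
  show "refl_on (SIGMA \<sigma>:\<Sigma>. chart L \<sigma>) (gluing L \<Sigma>)"
  proof (rule refl_onI)
    fix p assume "p \<in> (SIGMA \<sigma>:\<Sigma>. chart L \<sigma>)"
    then obtain \<sigma> \<gamma> where p: "p = (\<sigma>, \<gamma>)" "\<sigma> \<in> \<Sigma>" "\<gamma> \<in> chart L \<sigma>" by auto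
    then show "(p, p) \<in> gluing L \<Sigma>"
      using gluingI[of \<sigma> \<sigma> \<gamma>] by (simp add: restrict_chart_self)
  qed
  show "sym (gluing L \<Sigma>)"
    unfolding sym_def gluing_def by (auto simp: Int_commute)
  show "trans (gluing L \<Sigma>)"
  proof (rule transI)
    fix p q r assume "(p, q) \<in> gluing L \<Sigma>" "(q, r) \<in> gluing L \<Sigma>"
    then show "(p, r) \<in> gluing L \<Sigma>" by (cases p; cases q; cases r) (simp only: gluing_trans)
  qed
qed

lemma chart_point_eq_iff:
  assumes "\<sigma> \<in> \<Sigma>" "\<gamma> \<in> chart L \<sigma>" "\<sigma>' \<in> \<Sigma>" "\<gamma>' \<in> chart L \<sigma>'"
  shows "chart_point L \<Sigma> \<sigma> \<gamma> = chart_point L \<Sigma> \<sigma>' \<gamma>' \<longleftrightarrow>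
    (\<exists>\<delta>\<in>chart L (\<sigma> \<inter> \<sigma>'). restrict \<delta> (dual_monoid L \<sigma>) = \<gamma> \<and> restrict \<delta> (dual_monoid L \<sigma>') = \<gamma>')"
proof -
  have "chart_point L \<Sigma> \<sigma> \<gamma> = chart_point L \<Sigma> \<sigma>' \<gamma>' \<longleftrightarrow> ((\<sigma>, \<gamma>), (\<sigma>', \<gamma>')) \<in> gluing L \<Sigma>"
    unfolding chart_point_def using eq_equiv_class_iff[OF equiv_gluing] assms by auto
  then show ?thesis using assms by (auto simp: gluing_def)
qed

lemma chart_point_in_points: "\<sigma> \<in> \<Sigma> \<Longrightarrow> \<gamma> \<in> chart L \<sigma> \<Longrightarrow> chart_point L \<Sigma> \<sigma> \<gamma> \<in> toric_points L \<Sigma>"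
  unfolding toric_points_def chart_point_def by (auto intro: quotientI)

lemma toric_pointsE:
  assumes "p \<in> toric_points L \<Sigma>"
  obtains \<sigma> \<gamma> where "\<sigma> \<in> \<Sigma>" "\<gamma> \<in> chart L \<sigma>" "p = chart_point L \<Sigma> \<sigma> \<gamma>"
  using assms unfolding toric_points_def chart_point_def by (auto elim!: quotientE)

lemma chart_point_inj:
  assumes "\<sigma> \<in> \<Sigma>" "\<gamma> \<in> chart L \<sigma>" "\<gamma>' \<in> chart L \<sigma>" "chart_point L \<Sigma> \<sigma> \<gamma> = chart_point L \<Sigma> \<sigma> \<gamma>'"
  shows "\<gamma> = \<gamma>'"
  using assms chart_point_eq_iff by metis

lemma chart_point_restrict:
  assumes "\<sigma> \<in> \<Sigma>" "\<tau> \<in> \<Sigma>" "\<tau> \<subseteq> \<sigma>" "\<delta> \<in> chart L \<tau>"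
  shows "chart_point L \<Sigma> \<sigma> (restrict \<delta> (dual_monoid L \<sigma>)) = chart_point L \<Sigma> \<tau> \<delta>"
proof -
  have "\<sigma> \<inter> \<tau> = \<tau>" using assms by auto
  then show ?thesis
    using assms by (subst chart_point_eq_iff) (auto intro!: restrict_chart bexI[of _ \<delta>] simp: restrict_chart_self)
qed

lemma openin_toric_points: "openin (toric_topology L \<Sigma>) (toric_points L \<Sigma>)"
  unfolding openin_toric_topology
proof (intro conjI ballI subset_refl)
  fix \<sigma> assume \<sigma>: "\<sigma> \<in> \<Sigma>"
  obtain f where "f \<in> chart_functions L \<sigma>" "\<forall>\<gamma>\<in>chart L \<sigma>. f \<gamma> = 1" using chart_functions_one by blast
  then show "openin (chart_topology L \<sigma>) {\<gamma> \<in> chart L \<sigma>. chart_point L \<Sigma> \<sigma> \<gamma> \<in> toric_points L \<Sigma>}"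
    using \<sigma> chart_point_in_points unfolding openin_chart_topology by (auto intro!: bexI[of _ f])
qed

lemma topspace_toric: "topspace (toric_topology L \<Sigma>) = toric_points L \<Sigma>"
  using openin_toric_points openin_toric_topology by (metis openin_subset openin_topspace subset_antisym)

lemma openin_toric_iff:
  "openin (toric_topology L \<Sigma>) W \<longleftrightarrow> W \<subseteq> toric_points L \<Sigma> \<and>
     (\<forall>\<sigma>\<in>\<Sigma>. \<forall>\<gamma>\<in>chart L \<sigma>. chart_point L \<Sigma> \<sigma> \<gamma> \<in> W \<longrightarrow>
        (\<exists>f\<in>chart_functions L \<sigma>. f \<gamma> \<noteq> 0 \<and> (\<forall>\<delta>\<in>chart L \<sigma>. f \<delta> \<noteq> 0 \<longrightarrow> chart_point L \<Sigma> \<sigma> \<delta> \<in> W)))"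
proof -
  have "openin (chart_topology L \<sigma>) {\<gamma> \<in> chart L \<sigma>. chart_point L \<Sigma> \<sigma> \<gamma> \<in> W} \<longleftrightarrow>
      (\<forall>\<gamma>\<in>chart L \<sigma>. chart_point L \<Sigma> \<sigma> \<gamma> \<in> W \<longrightarrow>
        (\<exists>f\<in>chart_functions L \<sigma>. f \<gamma> \<noteq> 0 \<and> (\<forall>\<delta>\<in>chart L \<sigma>. f \<delta> \<noteq> 0 \<longrightarrow> chart_point L \<Sigma> \<sigma> \<delta> \<in> W)))" for \<sigma>
  proof -
    have "(\<exists>f\<in>chart_functions L \<sigma>. f \<gamma> \<noteq> 0 \<and> {\<delta> \<in> chart L \<sigma>. f \<delta> \<noteq> 0} \<subseteq> {\<gamma> \<in> chart L \<sigma>. chart_point L \<Sigma> \<sigma> \<gamma> \<in> W})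
      \<longleftrightarrow> (\<exists>f\<in>chart_functions L \<sigma>. f \<gamma> \<noteq> 0 \<and> (\<forall>\<delta>\<in>chart L \<sigma>. f \<delta> \<noteq> 0 \<longrightarrow> chart_point L \<Sigma> \<sigma> \<delta> \<in> W))" for \<gamma>
      by (intro bex_cong conj_cong refl) blast
    then show ?thesis unfolding openin_chart_topology by (simp add: Ball_def imp_conjL)
  qed
  then show ?thesis unfolding openin_toric_topology by simp
qed

text \<open>Multiplying by a power of the inverted character \<open>m'\<close> extends a function from the overlap of
  two charts to the other chart.\<close>

lemma chart_function_transfer:
  assumes loc: "localizes L \<sigma>' \<tau> m'" and "\<tau> \<subseteq> \<sigma>" and "f \<in> chart_functions L \<sigma>"
  obtains c0 :: nat where "\<And>c. c \<ge> c0 \<Longrightarrow> \<exists>f'\<in>chart_functions L \<sigma>'. \<forall>\<delta>\<in>chart L \<tau>.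
       f' (restrict \<delta> (dual_monoid L \<sigma>')) = \<delta> m' ^ c * f (restrict \<delta> (dual_monoid L \<sigma>))"
proof -
  obtain A a where f: "finite A" "A \<subseteq> dual_monoid L \<sigma>" "f = (\<lambda>\<gamma>. \<Sum>m\<in>A. a m * \<gamma> m)"
    using chart_functionsE[OF assms(3)] .
  have A\<tau>: "A \<subseteq> dual_monoid L \<tau>" using f(2) dual_monoid_antimono[OF assms(2)] by auto
  obtain c0 :: nat where c0: "\<And>n c. n \<in> A \<Longrightarrow> c \<ge> c0 \<Longrightarrow> n + of_nat c *\<^sub>R m' \<in> dual_monoid L \<sigma>'"
    using localizes_ge_finite[OF loc f(1) A\<tau>] by blast
  show ?thesis
  proof
    fix c assume c: "c \<ge> c0"
    show "\<exists>f'\<in>chart_functions L \<sigma>'. \<forall>\<delta>\<in>chart L \<tau>.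
       f' (restrict \<delta> (dual_monoid L \<sigma>')) = \<delta> m' ^ c * f (restrict \<delta> (dual_monoid L \<sigma>))"
    proof (intro bexI ballI)
      show "(\<lambda>\<gamma>. \<Sum>n\<in>A. a n * \<gamma> (n + of_nat c *\<^sub>R m')) \<in> chart_functions L \<sigma>'"
        using c0 c f(1) by (intro chart_functionsI) auto
      fix \<delta> assume \<delta>: "\<delta> \<in> chart L \<tau>"
      have "\<delta> (n + of_nat c *\<^sub>R m') = \<delta> m' ^ c * \<delta> n" if "n \<in> A" for n
        using chartD(2)[OF \<delta> _ dual_monoid_scale[OF localizesD(3)[OF loc]], of n c] that A\<tau>
          chart_scale[OF \<delta> localizesD(3)[OF loc]] by auto
      then show "(\<Sum>n\<in>A. a n * restrict \<delta> (dual_monoid L \<sigma>') (n + of_nat c *\<^sub>R m')) =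
          \<delta> m' ^ c * f (restrict \<delta> (dual_monoid L \<sigma>))"
        using c0 c f(2) unfolding f(3) sum_distrib_left by (intro sum.cong) auto
    qed
  qed
qed

definition principal_open :: "'a set \<Rightarrow> (('a \<Rightarrow> complex) \<Rightarrow> complex) \<Rightarrow> 'a toric_point set" where
  "principal_open \<sigma> f = {chart_point L \<Sigma> \<sigma> \<gamma> | \<gamma>. \<gamma> \<in> chart L \<sigma> \<and> f \<gamma> \<noteq> 0}"

lemma chart_point_in_principal_open:
  "\<sigma> \<in> \<Sigma> \<Longrightarrow> \<gamma> \<in> chart L \<sigma> \<Longrightarrow> chart_point L \<Sigma> \<sigma> \<gamma> \<in> principal_open \<sigma> f \<longleftrightarrow> f \<gamma> \<noteq> 0"
  unfolding principal_open_def using chart_point_inj by blast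

text \<open>Both functions are multiplied by the same power of the inverted character, so their
  quotient is preserved. One further factor \<open>m'\<close> makes \<open>h'\<close> vanish outside
  the overlap.\<close>

lemma overlap_transfer:
  assumes \<sigma>: "\<sigma> \<in> \<Sigma>" "\<sigma>' \<in> \<Sigma>" and g: "g \<in> chart_functions L \<sigma>" and h: "h \<in> chart_functions L \<sigma>"
  obtains g' h' where "g' \<in> chart_functions L \<sigma>'" "h' \<in> chart_functions L \<sigma>'"
    "\<And>\<gamma> \<gamma>'. \<gamma> \<in> chart L \<sigma> \<Longrightarrow> \<gamma>' \<in> chart L \<sigma>' \<Longrightarrow> chart_point L \<Sigma> \<sigma> \<gamma> = chart_point L \<Sigma> \<sigma>' \<gamma>' \<Longrightarrow>
       \<exists>u. u \<noteq> 0 \<and> g' \<gamma>' = u * g \<gamma> \<and> h' \<gamma>' = u * h \<gamma>"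
    "\<And>\<gamma>'. \<gamma>' \<in> chart L \<sigma>' \<Longrightarrow> h' \<gamma>' \<noteq> 0 \<Longrightarrow> \<exists>\<gamma>\<in>chart L \<sigma>. chart_point L \<Sigma> \<sigma> \<gamma> = chart_point L \<Sigma> \<sigma>' \<gamma>'"
proof -
  obtain m' where m': "localizes L \<sigma>' (\<sigma> \<inter> \<sigma>') m'" using separation \<sigma> by blast
  obtain cg where cg: "\<And>c. c \<ge> cg \<Longrightarrow> \<exists>f'\<in>chart_functions L \<sigma>'. \<forall>\<delta>\<in>chart L (\<sigma> \<inter> \<sigma>').
       f' (restrict \<delta> (dual_monoid L \<sigma>')) = \<delta> m' ^ c * g (restrict \<delta> (dual_monoid L \<sigma>))"
    using chart_function_transfer[OF m' _ g] by blast
  obtain ch where ch: "\<And>c. c \<ge> ch \<Longrightarrow> \<exists>f'\<in>chart_functions L \<sigma>'. \<forall>\<delta>\<in>chart L (\<sigma> \<inter> \<sigma>').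
       f' (restrict \<delta> (dual_monoid L \<sigma>')) = \<delta> m' ^ c * h (restrict \<delta> (dual_monoid L \<sigma>))"
    using chart_function_transfer[OF m' _ h] by blast
  define c where "c = max cg ch"
  obtain g1 where g1: "g1 \<in> chart_functions L \<sigma>'" "\<And>\<delta>. \<delta>\<in>chart L (\<sigma> \<inter> \<sigma>') \<Longrightarrow>
       g1 (restrict \<delta> (dual_monoid L \<sigma>')) = \<delta> m' ^ c * g (restrict \<delta> (dual_monoid L \<sigma>))"
    using cg[of c] by (auto simp: c_def)
  obtain h1 where h1: "h1 \<in> chart_functions L \<sigma>'" "\<And>\<delta>. \<delta>\<in>chart L (\<sigma> \<inter> \<sigma>') \<Longrightarrow>
       h1 (restrict \<delta> (dual_monoid L \<sigma>')) = \<delta> m' ^ c * h (restrict \<delta> (dual_monoid L \<sigma>))"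
    using ch[of c] by (auto simp: c_def)
  note m'cf = chart_functions_character[OF localizesD(2)[OF m']]
  obtain g' where g': "g' \<in> chart_functions L \<sigma>'" "\<And>\<gamma>. \<gamma> \<in> chart L \<sigma>' \<Longrightarrow> g' \<gamma> = \<gamma> m' * g1 \<gamma>"
    using chart_functions_mult[OF m'cf g1(1)] by blast
  obtain h' where h': "h' \<in> chart_functions L \<sigma>'" "\<And>\<gamma>. \<gamma> \<in> chart L \<sigma>' \<Longrightarrow> h' \<gamma> = \<gamma> m' * h1 \<gamma>"
    using chart_functions_mult[OF m'cf h1(1)] by blast
  show ?thesis
  proof (rule that[OF g'(1) h'(1)])
    fix \<gamma> \<gamma>' assume \<gamma>: "\<gamma> \<in> chart L \<sigma>" "\<gamma>' \<in> chart L \<sigma>'" "chart_point L \<Sigma> \<sigma> \<gamma> = chart_point L \<Sigma> \<sigma>' \<gamma>'"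
    then obtain \<delta> where \<delta>: "\<delta>\<in>chart L (\<sigma> \<inter> \<sigma>')" "restrict \<delta> (dual_monoid L \<sigma>) = \<gamma>" "restrict \<delta> (dual_monoid L \<sigma>') = \<gamma>'"
      using chart_point_eq_iff[OF \<sigma>(1) \<gamma>(1) \<sigma>(2) \<gamma>(2)] by auto
    have "\<gamma>' m' = \<delta> m'" using \<delta>(3) localizesD(2)[OF m'] by auto
    then show "\<exists>u. u \<noteq> 0 \<and> g' \<gamma>' = u * g \<gamma> \<and> h' \<gamma>' = u * h \<gamma>"
      using g1(2)[OF \<delta>(1)] h1(2)[OF \<delta>(1)] g'(2)[OF \<gamma>(2)] h'(2)[OF \<gamma>(2)] localizes_unit[OF m' \<delta>(1)]
      unfolding \<delta> by (intro exI[of _ "\<delta> m' * \<delta> m' ^ c"]) auto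
  next
    fix \<gamma>' assume \<gamma>': "\<gamma>' \<in> chart L \<sigma>'" "h' \<gamma>' \<noteq> 0"
    then have "\<gamma>' m' \<noteq> 0" using h'(2) by auto
    then obtain \<delta> where \<delta>: "\<delta> \<in> chart L (\<sigma> \<inter> \<sigma>')" "restrict \<delta> (dual_monoid L \<sigma>') = \<gamma>'"
      using localizes_extend[OF m' \<gamma>'(1)] by blast
    then show "\<exists>\<gamma>\<in>chart L \<sigma>. chart_point L \<Sigma> \<sigma> \<gamma> = chart_point L \<Sigma> \<sigma>' \<gamma>'"
      using chart_point_eq_iff[OF \<sigma>(1) _ \<sigma>(2) \<gamma>'(1)]
      by (intro bexI[of _ "restrict \<delta> (dual_monoid L \<sigma>)"]) (auto intro!: restrict_chart)
  qed
qed

lemma openin_principal_open: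
  assumes \<sigma>: "\<sigma> \<in> \<Sigma>" and f: "f \<in> chart_functions L \<sigma>"
  shows "openin (toric_topology L \<Sigma>) (principal_open \<sigma> f)"
  unfolding openin_toric_iff
proof (intro conjI ballI impI)
  show "principal_open \<sigma> f \<subseteq> toric_points L \<Sigma>"
    using chart_point_in_points[OF \<sigma>] by (auto simp: principal_open_def)
  fix \<sigma>' \<gamma>' assume \<sigma>': "\<sigma>' \<in> \<Sigma>" "\<gamma>' \<in> chart L \<sigma>'" and "chart_point L \<Sigma> \<sigma>' \<gamma>' \<in> principal_open \<sigma> f"
  then obtain \<gamma> where \<gamma>: "\<gamma> \<in> chart L \<sigma>" "f \<gamma> \<noteq> 0" "chart_point L \<Sigma> \<sigma> \<gamma> = chart_point L \<Sigma> \<sigma>' \<gamma>'"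
    by (auto simp: principal_open_def)
  obtain g' h' where h': "g' \<in> chart_functions L \<sigma>'" "h' \<in> chart_functions L \<sigma>'"
    "\<And>\<gamma> \<gamma>'. \<gamma> \<in> chart L \<sigma> \<Longrightarrow> \<gamma>' \<in> chart L \<sigma>' \<Longrightarrow> chart_point L \<Sigma> \<sigma> \<gamma> = chart_point L \<Sigma> \<sigma>' \<gamma>' \<Longrightarrow>
       \<exists>u. u \<noteq> 0 \<and> g' \<gamma>' = u * f \<gamma> \<and> h' \<gamma>' = u * f \<gamma>"
    "\<And>\<gamma>'. \<gamma>' \<in> chart L \<sigma>' \<Longrightarrow> h' \<gamma>' \<noteq> 0 \<Longrightarrow> \<exists>\<gamma>\<in>chart L \<sigma>. chart_point L \<Sigma> \<sigma> \<gamma> = chart_point L \<Sigma> \<sigma>' \<gamma>'"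
    by (rule overlap_transfer[OF \<sigma> \<sigma>'(1) f f]) (rule that; assumption)
  show "\<exists>f'\<in>chart_functions L \<sigma>'. f' \<gamma>' \<noteq> 0 \<and> (\<forall>\<delta>\<in>chart L \<sigma>'. f' \<delta> \<noteq> 0 \<longrightarrow> chart_point L \<Sigma> \<sigma>' \<delta> \<in> principal_open \<sigma> f)"
  proof (intro bexI conjI ballI impI)
    show "h' \<in> chart_functions L \<sigma>'" by (rule h'(2))
    show "h' \<gamma>' \<noteq> 0" using h'(3)[OF \<gamma>(1) \<sigma>'(2) \<gamma>(3)] \<gamma>(2) by auto
    fix \<delta> assume \<delta>: "\<delta> \<in> chart L \<sigma>'" "h' \<delta> \<noteq> 0"
    obtain \<gamma> where \<gamma>: "\<gamma> \<in> chart L \<sigma>" "chart_point L \<Sigma> \<sigma> \<gamma> = chart_point L \<Sigma> \<sigma>' \<delta>" using h'(4)[OF \<delta>] by blast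
    have "f \<gamma> \<noteq> 0" using h'(3)[OF \<gamma>(1) \<delta>(1) \<gamma>(2)] \<delta>(2) by auto
    then show "chart_point L \<Sigma> \<sigma>' \<delta> \<in> principal_open \<sigma> f" using \<gamma> by (auto simp: principal_open_def)
  qed
qed

lemma regular_quotient:
  assumes \<sigma>: "\<sigma> \<in> \<Sigma>" and g: "g \<in> chart_functions L \<sigma>" and h: "h \<in> chart_functions L \<sigma>"
    and W: "W \<subseteq> principal_open \<sigma> h"
    and F: "\<And>\<gamma>. \<gamma> \<in> chart L \<sigma> \<Longrightarrow> h \<gamma> \<noteq> 0 \<Longrightarrow> F (chart_point L \<Sigma> \<sigma> \<gamma>) = g \<gamma> / h \<gamma>"
  shows "regular (toric_variety L \<Sigma>) W F"
  unfolding toric_variety_def variety.select_convs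
proof (intro ballI impI)
  fix \<sigma>' \<gamma>' assume \<sigma>': "\<sigma>' \<in> \<Sigma>" "\<gamma>' \<in> chart L \<sigma>'" and "chart_point L \<Sigma> \<sigma>' \<gamma>' \<in> W"
  then obtain \<gamma> where \<gamma>: "\<gamma> \<in> chart L \<sigma>" "h \<gamma> \<noteq> 0" "chart_point L \<Sigma> \<sigma> \<gamma> = chart_point L \<Sigma> \<sigma>' \<gamma>'"
    using W by (auto simp: principal_open_def)
  obtain g' h' where h': "g' \<in> chart_functions L \<sigma>'" "h' \<in> chart_functions L \<sigma>'"
    "\<And>\<gamma> \<gamma>'. \<gamma> \<in> chart L \<sigma> \<Longrightarrow> \<gamma>' \<in> chart L \<sigma>' \<Longrightarrow> chart_point L \<Sigma> \<sigma> \<gamma> = chart_point L \<Sigma> \<sigma>' \<gamma>' \<Longrightarrow>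
       \<exists>u. u \<noteq> 0 \<and> g' \<gamma>' = u * g \<gamma> \<and> h' \<gamma>' = u * h \<gamma>"
    "\<And>\<gamma>'. \<gamma>' \<in> chart L \<sigma>' \<Longrightarrow> h' \<gamma>' \<noteq> 0 \<Longrightarrow> \<exists>\<gamma>\<in>chart L \<sigma>. chart_point L \<Sigma> \<sigma> \<gamma> = chart_point L \<Sigma> \<sigma>' \<gamma>'"
    by (rule overlap_transfer[OF \<sigma> \<sigma>'(1) g h]) (rule that; assumption)
  show "\<exists>g'\<in>chart_functions L \<sigma>'. \<exists>h'\<in>chart_functions L \<sigma>'. h' \<gamma>' \<noteq> 0 \<and>
     (\<forall>\<delta>\<in>chart L \<sigma>'. chart_point L \<Sigma> \<sigma>' \<delta> \<in> W \<and> h' \<delta> \<noteq> 0 \<longrightarrow> F (chart_point L \<Sigma> \<sigma>' \<delta>) = g' \<delta> / h' \<delta>)"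
  proof (rule bexI[of _ g'], rule bexI[of _ h'], intro conjI ballI impI)
    show "g' \<in> chart_functions L \<sigma>'" "h' \<in> chart_functions L \<sigma>'" by (rule h')+
    show "h' \<gamma>' \<noteq> 0" using h'(3)[OF \<gamma>(1) \<sigma>'(2) \<gamma>(3)] \<gamma>(2) by auto
    fix \<delta> assume \<delta>: "\<delta> \<in> chart L \<sigma>'" "chart_point L \<Sigma> \<sigma>' \<delta> \<in> W \<and> h' \<delta> \<noteq> 0"
    obtain \<gamma> where \<gamma>: "\<gamma> \<in> chart L \<sigma>" "chart_point L \<Sigma> \<sigma> \<gamma> = chart_point L \<Sigma> \<sigma>' \<delta>" using h'(4)[of \<delta>] \<delta> by blast
    from h'(3)[OF \<gamma>(1) \<delta>(1) \<gamma>(2)] obtain u where u: "u \<noteq> 0" "g' \<delta> = u * g \<gamma>" "h' \<delta> = u * h \<gamma>" by blast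
    then show "F (chart_point L \<Sigma> \<sigma>' \<delta>) = g' \<delta> / h' \<delta>" using F[OF \<gamma>(1)] \<gamma>(2) \<delta> by auto
  qed
qed

end

section \<open>Krull dimension\<close>

lemma irreducible_closedin_homeomorphic:
  assumes hm: "homeomorphic_maps T T' f g" and Z: "irreducible_closedin T Z"
  shows "irreducible_closedin T' (f ` Z)"
  unfolding irreducible_closedin_def
proof (intro conjI allI impI)
  have cl: "closedin T Z" and ZT: "Z \<subseteq> topspace T"
    using Z closedin_subset by (auto simp: irreducible_closedin_def)
  show "closedin T' (f ` Z)"
    using homeomorphic_map_closedness[OF homeomorphic_maps_imp_map[OF hm] ZT] cl by simp
  show "f ` Z \<noteq> {}" using Z by (auto simp: irreducible_closedin_def)
  fix A B assume AB: "closedin T' A \<and> closedin T' B \<and> f ` Z \<subseteq> A \<union> B"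
  have f: "continuous_map T T' f" using hm by (simp add: homeomorphic_maps_def)
  let ?p = "\<lambda>C. {x \<in> topspace T. f x \<in> C}"
  have "closedin T (?p A)" "closedin T (?p B)" "Z \<subseteq> ?p A \<union> ?p B"
    using AB ZT by (auto intro: closedin_continuous_map_preimage[OF f])
  then have "Z \<subseteq> ?p A \<or> Z \<subseteq> ?p B" using Z unfolding irreducible_closedin_def by blast
  then show "f ` Z \<subseteq> A \<or> f ` Z \<subseteq> B" by blast
qed

lemma krull_dim_le_homeomorphic:
  assumes hm: "homeomorphic_maps T T' f g"
  shows "krull_dim T \<le> krull_dim T'"
  unfolding krull_dim_def
proof (rule Sup_mono, clarify)
  fix d :: nat and Z assume Z: "\<forall>i\<le>d. irreducible_closedin T (Z i)" "\<forall>i<d. Z i \<subset> Z (Suc i)"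
  have inj: "inj_on f (topspace T)"
    using hm by (auto simp: homeomorphic_maps_def intro: inj_on_inverseI[of _ g])
  have ZT: "Z i \<subseteq> topspace T" if "i \<le> d" for i
    using Z(1) that closedin_subset unfolding irreducible_closedin_def by blast
  have "f ` Z i \<subset> f ` Z (Suc i)" if "i < d" for i
    using Z(2) that ZT[of "Suc i"] ZT[of i] inj_on_image_eq_iff[OF inj] by (metis Suc_leI image_mono less_imp_le psubset_eq)
  then have "(\<forall>i\<le>d. irreducible_closedin T' (f ` Z i)) \<and> (\<forall>i<d. f ` Z i \<subset> f ` Z (Suc i))"
    using Z(1) irreducible_closedin_homeomorphic[OF hm] by simp
  then show "\<exists>a\<in>{enat d |d. \<exists>Z. (\<forall>i\<le>d. irreducible_closedin T' (Z i)) \<and> (\<forall>i<d. Z i \<subset> Z (Suc i))}. enat d \<le> a"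
    by (intro bexI[of _ "enat d"] CollectI exI[of _ d] conjI[OF refl] exI[of _ "\<lambda>i. f ` Z i"]) auto
qed

lemma krull_dim_homeomorphic: "homeomorphic_maps T T' f g \<Longrightarrow> krull_dim T = krull_dim T'"
  using krull_dim_le_homeomorphic homeomorphic_maps_sym antisym by metis

text \<open>Gaussian elimination: a nonzero coefficient of equation \<open>j\<close> at
  \<open>i0\<close> eliminates this unknown from the other equations.\<close>

lemma homogeneous_system_nontrivial_solution:
  fixes A :: "'j \<Rightarrow> 'i \<Rightarrow> 'f::field"
  assumes "finite J" "finite I" "card J < card I"
  shows "\<exists>c. (\<exists>i\<in>I. c i \<noteq> 0) \<and> (\<forall>j\<in>J. (\<Sum>i\<in>I. A j i * c i) = 0)"
  using assms
proof (induction J arbitrary: I A rule: finite_induct)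
  case empty
  then show ?case by (auto intro!: exI[of _ "\<lambda>_. 1"] simp: card_gt_0_iff)
next
  case (insert j J)
  show ?case
  proof (cases "\<forall>i\<in>I. A j i = 0")
    case True
    from insert.IH[of I A] insert.prems insert.hyps
    obtain c where "\<exists>i\<in>I. c i \<noteq> 0" "\<forall>j\<in>J. (\<Sum>i\<in>I. A j i * c i) = 0" by auto
    then show ?thesis using True by (intro exI[of _ c]) auto
  next
    case False
    then obtain i0 where i0: "i0 \<in> I" "A j i0 \<noteq> 0" by blast
    define A' where "A' j' i = A j' i - A j' i0 * A j i / A j i0" for j' i
    have "card J < card (I - {i0})" using insert.prems insert.hyps i0 by simp
    from insert.IH[OF _ this, of A'] insert.prems
    obtain c' where c': "\<exists>i\<in>I - {i0}. c' i \<noteq> 0" "\<And>j'. j' \<in> J \<Longrightarrow> (\<Sum>i\<in>I - {i0}. A' j' i * c' i) = 0" by auto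
    \<comment> \<open>The eliminated unknown is recovered from equation \<open>j\<close>.\<close>
    define c where "c = c'(i0 := - (\<Sum>i\<in>I - {i0}. A j i * c' i) / A j i0)"
    have sumc: "(\<Sum>i\<in>I. A j' i * c i) = A j' i0 * c i0 + (\<Sum>i\<in>I - {i0}. A j' i * c' i)" for j'
      using i0 insert.prems by (subst sum.remove[of I i0]) (auto simp: c_def intro!: sum.cong)
    show ?thesis
    proof (intro exI[of _ c] conjI ballI)
      show "\<exists>i\<in>I. c i \<noteq> 0" using c'(1) by (auto simp: c_def)
      fix j' assume "j' \<in> insert j J"
      then consider "j' = j" | "j' \<in> J" by auto
      then show "(\<Sum>i\<in>I. A j' i * c i) = 0"
      proof cases
        case 1
        then show ?thesis using i0 by (simp add: sumc) (simp add: c_def)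
      next
        case 2
        have "0 = (\<Sum>i\<in>I - {i0}. A j' i * c' i) - A j' i0 / A j i0 * (\<Sum>i\<in>I - {i0}. A j i * c' i)"
          unfolding c'(2)[OF 2, symmetric] A'_def
          by (simp add: left_diff_distrib sum_subtractf sum_distrib_left mult.assoc)
        then show ?thesis using i0 by (simp add: sumc) (simp add: c_def field_simps)
      qed
    qed
  qed
qed

text \<open>A chain of length \<open>d\<close> yields \<open>d\<close> algebraically independent functions: cancel the largest power of
  the last one from a relation, and restrict to its zeros.\<close>

lemma chain_algebraically_independent:
  fixes Y :: "nat \<Rightarrow> 'x set" and f :: "nat \<Rightarrow> 'x \<Rightarrow> complex"
  assumes alg: "(\<lambda>_. 1) \<in> \<A>" "\<And>F G. F \<in> \<A> \<Longrightarrow> G \<in> \<A> \<Longrightarrow> (\<lambda>x. F x + G x) \<in> \<A>"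
      "\<And>F G. F \<in> \<A> \<Longrightarrow> G \<in> \<A> \<Longrightarrow> (\<lambda>x. F x * G x) \<in> \<A>" "\<And>r F. F \<in> \<A> \<Longrightarrow> (\<lambda>x. r * F x) \<in> \<A>"
    and irr: "\<And>i F G. i \<le> d \<Longrightarrow> F \<in> \<A> \<Longrightarrow> G \<in> \<A> \<Longrightarrow> \<forall>x\<in>Y i. F x * G x = 0 \<Longrightarrow>
        (\<forall>x\<in>Y i. F x = 0) \<or> (\<forall>x\<in>Y i. G x = 0)"
    and f: "\<And>i. i < d \<Longrightarrow> f i \<in> \<A>" "\<And>i x. i < d \<Longrightarrow> x \<in> Y i \<Longrightarrow> f i x = 0"
      "\<And>i. i < d \<Longrightarrow> \<exists>x\<in>Y (Suc i). f i x \<noteq> 0"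
    and Y: "Y 0 \<noteq> {}" "\<And>i. i < d \<Longrightarrow> Y i \<subseteq> Y (Suc i)"
    and S: "finite S" "S \<subseteq> {..<d} \<rightarrow>\<^sub>E UNIV" "\<And>x. x \<in> Y d \<Longrightarrow> (\<Sum>a\<in>S. c a * (\<Prod>i<d. f i x ^ a i)) = 0"
  shows "\<forall>a\<in>S. c a = 0"
  using irr f Y(2) S
proof (induction d arbitrary: S c)
  case 0
  obtain x where "x \<in> Y 0" using Y(1) by blast
  then have eq: "(\<Sum>a\<in>S. c a) = 0" using 0 by auto
  show ?case
  proof
    fix a assume a: "a \<in> S"
    have "b = a" if "b \<in> S" for b using that a "0.prems"(7) by auto
    then have "S = {a}" using a by blast
    then show "c a = 0" using eq by simp
  qed
next
  case (Suc d)
  have powA: "(\<lambda>x. F x ^ n) \<in> \<A>" if "F \<in> \<A>" for F n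
    using that by (induction n) (auto intro: alg)
  have sumA: "(\<lambda>x. \<Sum>j\<in>J. F j x) \<in> \<A>" if "finite J" "\<And>j. j \<in> J \<Longrightarrow> F j \<in> \<A>" for J :: "(nat \<Rightarrow> nat) set" and F
    using that
  proof (induction J rule: finite_induct)
    case empty
    then show ?case using alg(4)[OF alg(1), of 0] by simp
  qed (auto intro: alg)
  have prodA: "(\<lambda>x. \<Prod>j\<in>J. F j x) \<in> \<A>" if "finite J" "\<And>j. j \<in> J \<Longrightarrow> F j \<in> \<A>" for J :: "nat set" and F
    using that by (induction J rule: finite_induct) (auto intro: alg)
  define S' where "S' = {a \<in> S. c a \<noteq> 0}"
  have S'S: "S' \<subseteq> S" and fS': "finite S'" using Suc.prems(6) by (auto simp: S'_def)
  have "S' = {}"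
  proof (rule ccontr)
    assume ne: "S' \<noteq> {}"
    \<comment> \<open>The minimal exponent of the last function \<open>f d\<close> among the terms
      with nonzero coefficient; this power is factored out.\<close>
    define \<alpha> where "\<alpha> = Min ((\<lambda>a. a d) ` S')"
    have \<alpha>: "\<alpha> \<le> a d" if "a \<in> S'" for a using that fS' by (simp add: \<alpha>_def)
    have "\<alpha> \<in> (\<lambda>a. a d) ` S'" unfolding \<alpha>_def using ne fS' by (intro Min_in) auto
    then obtain a0 where a0: "a0 \<in> S'" "a0 d = \<alpha>" by auto
    define G where "G x = (\<Sum>a\<in>S'. c a * ((\<Prod>i<d. f i x ^ a i) * f d x ^ (a d - \<alpha>)))" for x
    have GA: "G \<in> \<A>"
      unfolding G_def using Suc.prems(2) fS' by (intro sumA alg(4) alg(3) prodA powA) auto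
    have "f d x ^ \<alpha> * G x = 0" if x: "x \<in> Y (Suc d)" for x
    proof -
      have "f d x ^ \<alpha> * G x = (\<Sum>a\<in>S'. c a * ((\<Prod>i<d. f i x ^ a i) * f d x ^ a d))"
        unfolding G_def sum_distrib_left
      proof (rule sum.cong[OF refl])
        fix a assume "a \<in> S'"
        then have "f d x ^ a d = f d x ^ \<alpha> * f d x ^ (a d - \<alpha>)" using \<alpha> by (simp flip: power_add)
        then show "f d x ^ \<alpha> * (c a * ((\<Prod>i<d. f i x ^ a i) * f d x ^ (a d - \<alpha>))) = c a * ((\<Prod>i<d. f i x ^ a i) * f d x ^ a d)"
          by simp
      qed
      also have "\<dots> = (\<Sum>a\<in>S'. c a * (\<Prod>i<Suc d. f i x ^ a i))" by (simp add: mult.commute)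
      also have "\<dots> = (\<Sum>a\<in>S. c a * (\<Prod>i<Suc d. f i x ^ a i))"
        using Suc.prems(6) by (intro sum.mono_neutral_left) (auto simp: S'_def)
      also have "\<dots> = 0" by (rule Suc.prems(8)[OF x])
      finally show ?thesis .
    qed
    \<comment> \<open>The functions on \<open>Y (Suc d)\<close> have no zero divisors and
      \<open>f d\<close> is not identically zero there, so the cofactor \<open>G\<close>
      vanishes.\<close>
    then have "(\<forall>x\<in>Y (Suc d). f d x ^ \<alpha> = 0) \<or> (\<forall>x\<in>Y (Suc d). G x = 0)"
      using Suc.prems(1)[of "Suc d" "\<lambda>x. f d x ^ \<alpha>" G] GA powA[OF Suc.prems(2)] by auto
    then have G0: "\<forall>x\<in>Y (Suc d). G x = 0" using Suc.prems(4)[of d] by auto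
    define S1 where "S1 = {a \<in> S'. a d = \<alpha>}"
    define r where "r a = restrict a {..<d}" for a :: "nat \<Rightarrow> nat"
    have r_back: "(r a)(d := \<alpha>) = a" if "a \<in> S1" for a
    proof
      fix i
      have "a \<in> {..<Suc d} \<rightarrow>\<^sub>E UNIV" using that S'S Suc.prems(7) by (auto simp: S1_def)
      then show "((r a)(d := \<alpha>)) i = a i"
        using that by (cases "i < d"; cases "i = d") (auto simp: r_def S1_def PiE_def extensional_def)
    qed
    have inj: "inj_on r S1" using r_back by (metis inj_onI)
    have "\<forall>a\<in>r ` S1. c (a(d := \<alpha>)) = 0"
    proof (rule Suc.IH)
      show "(\<forall>x\<in>Y i. F x = 0) \<or> (\<forall>x\<in>Y i. H x = 0)"
        if "i \<le> d" "F \<in> \<A>" "H \<in> \<A>" "\<forall>x\<in>Y i. F x * H x = 0" for i F H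
        using Suc.prems(1) that by simp
      show "finite (r ` S1)" using fS' by (simp add: S1_def)
      show "r ` S1 \<subseteq> {..<d} \<rightarrow>\<^sub>E UNIV" by (auto simp: r_def PiE_def)
      fix x assume x: "x \<in> Y d"
      then have "G x = 0" using G0 Suc.prems(5)[of d] by auto
      moreover have "G x = (\<Sum>a\<in>S1. c a * (\<Prod>i<d. f i x ^ a i))"
        unfolding G_def S1_def
      proof (rule sum.mono_neutral_cong_right[OF fS'])
        show "\<forall>a\<in>S' - {a \<in> S'. a d = \<alpha>}. c a * ((\<Prod>i<d. f i x ^ a i) * f d x ^ (a d - \<alpha>)) = 0"
        proof
          fix a assume "a \<in> S' - {a \<in> S'. a d = \<alpha>}"
          then have "a d - \<alpha> > 0" using \<alpha>[of a] by auto
          then show "c a * ((\<Prod>i<d. f i x ^ a i) * f d x ^ (a d - \<alpha>)) = 0" using Suc.prems(3)[of d x] x by simp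
        qed
      qed auto
      moreover have "(\<Sum>a\<in>r ` S1. c (a(d := \<alpha>)) * (\<Prod>i<d. f i x ^ a i)) = (\<Sum>a\<in>S1. c a * (\<Prod>i<d. f i x ^ a i))"
      proof (subst sum.reindex[OF inj], rule sum.cong[OF refl])
        fix a assume "a \<in> S1"
        then have "((\<lambda>b. c (b(d := \<alpha>)) * (\<Prod>i<d. f i x ^ b i)) \<circ> r) a = c a * (\<Prod>i<d. f i x ^ r a i)"
          by (simp add: r_back)
        also have "(\<Prod>i<d. f i x ^ r a i) = (\<Prod>i<d. f i x ^ a i)" by (simp add: r_def)
        finally show "((\<lambda>b. c (b(d := \<alpha>)) * (\<Prod>i<d. f i x ^ b i)) \<circ> r) a = c a * (\<Prod>i<d. f i x ^ a i)" .
      qed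
      ultimately show "(\<Sum>a\<in>r ` S1. c (a(d := \<alpha>)) * (\<Prod>i<d. f i x ^ a i)) = 0" by simp
    qed (use Suc.prems(2-5) in auto)
    then have "c a0 = 0" using a0 r_back by (auto simp: S1_def)
    then show False using a0 by (simp add: S'_def)
  qed
  then show ?case by (auto simp: S'_def)
qed

section \<open>Counting characters of bounded size\<close>

context lattice
begin

definition box :: "'a set \<Rightarrow> nat \<Rightarrow> 'a set" where
  "box \<sigma> K = {m \<in> dual_monoid L \<sigma>. \<forall>b\<in>basis. \<bar>m \<bullet> b\<bar> \<le> real K}"

text \<open>Equality is asked only on the chart, where the product of two characters is the
  character of the sum.\<close>

definition box_span :: "'a set \<Rightarrow> nat \<Rightarrow> (('a \<Rightarrow> complex) \<Rightarrow> complex) \<Rightarrow> bool" where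
  "box_span \<sigma> K F \<longleftrightarrow> (\<exists>c. \<forall>\<gamma>\<in>chart L \<sigma>. F \<gamma> = (\<Sum>m\<in>box \<sigma> K. c m * \<gamma> m))"

text \<open>A character is determined by its integral pairings with the basis, each of which takes
  at most \<open>2 * K + 1\<close> values.\<close>

lemma box: "finite (box \<sigma> K)" "card (box \<sigma> K) \<le> (2 * K + 1) ^ dim L"
proof -
  let ?P = "basis \<rightarrow>\<^sub>E {- int K..int K}"
  define r where "r m = (\<lambda>b\<in>basis. \<lfloor>m \<bullet> b\<rfloor>)" for m :: 'a
  have "inj_on r (box \<sigma> K)"
  proof (rule inj_onI)
    fix m m' assume m: "m \<in> box \<sigma> K" "m' \<in> box \<sigma> K" "r m = r m'"
    have M: "m \<in> dual_lattice L" "m' \<in> dual_lattice L" using m by (auto simp: box_def dual_monoid_def)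
    have "m \<bullet> b = m' \<bullet> b" if b: "b \<in> basis" for b
    proof -
      have "\<lfloor>m \<bullet> b\<rfloor> = \<lfloor>m' \<bullet> b\<rfloor>" using m(3) b unfolding r_def by (metis restrict_apply')
      then show ?thesis using dual_lattice_floor M b basis_subset by (metis subsetD)
    qed
    then show "m = m'"
      using eq_on_span_if_inner_eq[of m basis m'] M by (simp add: dual_lattice_def span_lattice)
  qed
  moreover have "r ` box \<sigma> K \<subseteq> ?P"
    unfolding r_def box_def by (auto simp: abs_le_iff floor_le_iff le_floor_iff)
  moreover have "finite ?P" using finite_basis by (intro finite_PiE) auto
  moreover have "card ?P = (2 * K + 1) ^ dim L"
  proof -
    have "nat (2 * int K + 1) = 2 * K + 1" "nat (1 + 2 * int K) = 2 * K + 1" by auto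
    then show ?thesis using finite_basis by (simp add: card_PiE card_basis)
  qed
  ultimately show "finite (box \<sigma> K)" "card (box \<sigma> K) \<le> (2 * K + 1) ^ dim L"
    by (metis finite_imageD finite_subset) (metis \<open>inj_on r (box \<sigma> K)\<close> \<open>finite ?P\<close> \<open>r ` box \<sigma> K \<subseteq> ?P\<close> \<open>card ?P = (2 * K + 1) ^ dim L\<close> card_inj_on_le)
qed

lemma box_spanI:
  assumes "finite I" "\<And>i. i \<in> I \<Longrightarrow> e i \<in> box \<sigma> K" "\<And>\<gamma>. \<gamma> \<in> chart L \<sigma> \<Longrightarrow> F \<gamma> = (\<Sum>i\<in>I. c i * \<gamma> (e i))"
  shows "box_span \<sigma> K F"
  unfolding box_span_def
proof (intro exI ballI)
  fix \<gamma> assume "\<gamma> \<in> chart L \<sigma>"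
  then have "F \<gamma> = (\<Sum>i\<in>I. c i * \<gamma> (e i))" by (rule assms)
  also have "\<dots> = (\<Sum>m\<in>box \<sigma> K. \<Sum>i\<in>{i \<in> I. e i = m}. c i * \<gamma> (e i))"
    using assms box(1) by (intro sum.group[symmetric]) auto
  also have "\<dots> = (\<Sum>m\<in>box \<sigma> K. (\<Sum>i\<in>{i \<in> I. e i = m}. c i) * \<gamma> m)"
    by (intro sum.cong) (auto simp: sum_distrib_right)
  finally show "F \<gamma> = (\<Sum>m\<in>box \<sigma> K. (\<Sum>i\<in>{i \<in> I. e i = m}. c i) * \<gamma> m)" .
qed

lemma box_span_mono:
  assumes "box_span \<sigma> K F" "K \<le> K'"
  shows "box_span \<sigma> K' F"
proof -
  obtain c where c: "\<forall>\<gamma>\<in>chart L \<sigma>. F \<gamma> = (\<Sum>m\<in>box \<sigma> K. c m * \<gamma> m)" using assms(1) by (auto simp: box_span_def)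
  show ?thesis
    by (rule box_spanI[OF box(1)[of \<sigma> K], of "\<lambda>m. m" _ _ _ c]) (use assms(2) c in \<open>force simp: box_def\<close>)+
qed

lemma box_span_mult:
  assumes "box_span \<sigma> K F" "box_span \<sigma> K' G"
  shows "box_span \<sigma> (K + K') (\<lambda>\<gamma>. F \<gamma> * G \<gamma>)"
proof -
  obtain c where c: "\<And>\<gamma>. \<gamma>\<in>chart L \<sigma> \<Longrightarrow> F \<gamma> = (\<Sum>m\<in>box \<sigma> K. c m * \<gamma> m)" using assms(1) by (auto simp: box_span_def)
  obtain d where d: "\<And>\<gamma>. \<gamma>\<in>chart L \<sigma> \<Longrightarrow> G \<gamma> = (\<Sum>m\<in>box \<sigma> K'. d m * \<gamma> m)" using assms(2) by (auto simp: box_span_def)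
  show ?thesis
  proof (rule box_spanI[of "box \<sigma> K \<times> box \<sigma> K'" "\<lambda>p. fst p + snd p" _ _ _ "\<lambda>p. c (fst p) * d (snd p)"])
    show "finite (box \<sigma> K \<times> box \<sigma> K')" using box(1) by simp
    show "fst p + snd p \<in> box \<sigma> (K + K')" if p: "p \<in> box \<sigma> K \<times> box \<sigma> K'" for p
    proof -
      have "\<bar>(fst p + snd p) \<bullet> b\<bar> \<le> real (K + K')" if "b \<in> basis" for b
      proof -
        have "\<bar>fst p \<bullet> b\<bar> \<le> real K" "\<bar>snd p \<bullet> b\<bar> \<le> real K'" using p that by (auto simp: box_def)
        then show ?thesis by (simp add: inner_add_left)
      qed
      then show ?thesis using p by (auto simp: box_def intro!: dual_monoid_add)
    qed
    fix \<gamma> assume \<gamma>: "\<gamma> \<in> chart L \<sigma>"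
    have "(\<Sum>p\<in>box \<sigma> K \<times> box \<sigma> K'. c (fst p) * d (snd p) * \<gamma> (fst p + snd p))
        = (\<Sum>p\<in>box \<sigma> K \<times> box \<sigma> K'. (c (fst p) * \<gamma> (fst p)) * (d (snd p) * \<gamma> (snd p)))"
      using \<gamma> by (intro sum.cong) (auto simp: box_def chartD(2)[OF \<gamma>])
    then show "F \<gamma> * G \<gamma> = (\<Sum>p\<in>box \<sigma> K \<times> box \<sigma> K'. c (fst p) * d (snd p) * \<gamma> (fst p + snd p))"
      unfolding c[OF \<gamma>] d[OF \<gamma>] by (simp add: sum_product sum.cartesian_product case_prod_beta)
  qed
qed

lemma box_span_1: "box_span \<sigma> 0 (\<lambda>_. 1)"
  by (rule box_spanI[of "{()}" "\<lambda>_. 0" _ _ _ "\<lambda>_. 1"]) (auto simp: box_def dual_monoid_0 dest: chartD(1))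

lemma box_span_power: "box_span \<sigma> K F \<Longrightarrow> box_span \<sigma> (n * K) (\<lambda>\<gamma>. F \<gamma> ^ n)"
proof (induction n)
  case 0
  then show ?case using box_span_1 by simp
next
  case (Suc n)
  then show ?case using box_span_mult[OF Suc(2), of "n * K" "\<lambda>\<gamma>. F \<gamma> ^ n"] by simp
qed

lemma box_span_monomial:
  assumes "\<And>i. i < d \<Longrightarrow> box_span \<sigma> K (f i)" "\<And>i. i < d \<Longrightarrow> a i \<le> T"
  shows "box_span \<sigma> (d * (T * K)) (\<lambda>\<gamma>. \<Prod>i<d. f i \<gamma> ^ a i)"
  using assms
proof (induction d)
  case 0
  then show ?case using box_span_1 by simp
next
  case (Suc d)
  have "box_span \<sigma> (T * K) (\<lambda>\<gamma>. f d \<gamma> ^ a d)"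
    using Suc.prems(2)[of d] by (intro box_span_mono[OF box_span_power[OF Suc.prems(1)]]) auto
  moreover have "box_span \<sigma> (d * (T * K)) (\<lambda>\<gamma>. \<Prod>i<d. f i \<gamma> ^ a i)" using Suc by auto
  ultimately show ?case using box_span_mult by (fastforce simp: mult.commute add.commute)
qed

lemma box_span_chart_function:
  assumes "F \<in> chart_functions L \<sigma>"
  obtains K where "box_span \<sigma> K F"
proof -
  obtain A c where F: "finite A" "A \<subseteq> dual_monoid L \<sigma>" "F = (\<lambda>\<gamma>. \<Sum>m\<in>A. c m * \<gamma> m)"
    using chart_functionsE[OF assms] .
  define C where "C = (\<Sum>m\<in>A. \<Sum>b\<in>basis. \<bar>m \<bullet> b\<bar>)"
  have "\<bar>m \<bullet> b\<bar> \<le> C" if "m \<in> A" "b \<in> basis" for m b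
  proof -
    have "\<bar>m \<bullet> b\<bar> \<le> (\<Sum>b\<in>basis. \<bar>m \<bullet> b\<bar>)" using that finite_basis by (intro member_le_sum) auto
    also have "\<dots> \<le> C" unfolding C_def
      using that F(1) by (intro member_le_sum[of m A "\<lambda>m. \<Sum>b\<in>basis. \<bar>m \<bullet> b\<bar>"]) (auto intro: sum_nonneg)
    finally show ?thesis .
  qed
  moreover have "C \<le> real (nat \<lceil>C\<rceil>)" by linarith
  ultimately have "m \<in> box \<sigma> (nat \<lceil>C\<rceil>)" if "m \<in> A" for m
    using that F(2) unfolding box_def by (auto intro: order_trans)
  then have "box_span \<sigma> (nat \<lceil>C\<rceil>) F" using F by (intro box_spanI[of A "\<lambda>m. m" _ _ _ c]) auto
  then show ?thesis by (rule that)
qed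

text \<open>The monomials of degree at most \<open>T\<close> in each of \<open>dim L + 1\<close> functions outnumber the characters
  occurring in them once \<open>T\<close> is large.\<close>

lemma chart_functions_algebraically_dependent:
  assumes f: "\<And>i. i < Suc (dim L) \<Longrightarrow> f i \<in> chart_functions L \<sigma>"
  obtains S and c :: "(nat \<Rightarrow> nat) \<Rightarrow> complex"
  where "finite S" "S \<subseteq> {..<Suc (dim L)} \<rightarrow>\<^sub>E UNIV" "\<exists>a\<in>S. c a \<noteq> 0"
    "\<And>\<gamma>. \<gamma> \<in> chart L \<sigma> \<Longrightarrow> (\<Sum>a\<in>S. c a * (\<Prod>i<Suc (dim L). f i \<gamma> ^ a i)) = 0"
proof -
  define d where "d = Suc (dim L)"
  have "\<exists>K. box_span \<sigma> K (f i)" if "i < d" for i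
    using f that box_span_chart_function unfolding d_def by blast
  then obtain Kf where Kf: "\<And>i. i < d \<Longrightarrow> box_span \<sigma> (Kf i) (f i)" by metis
  define K where "K = (\<Sum>i<d. Kf i)"
  have K: "box_span \<sigma> K (f i)" if "i < d" for i
    using that unfolding K_def by (intro box_span_mono[OF Kf[OF that]] member_le_sum) auto
  \<comment> \<open>With this \<open>T\<close> the bound on the number of characters becomes
    \<open>T * (T + 1) ^ dim L\<close>, just below the number \<open>(T + 1) ^ Suc (dim L)\<close>
    of monomials.\<close>
  define T where "T = (2 * d * K + 1) ^ dim L"
  define S where "S = {..<d} \<rightarrow>\<^sub>E {..T}"
  define J where "J = box \<sigma> (d * (T * K))"
  have "finite S" unfolding S_def by (intro finite_PiE) auto
  have "card J < card S"
  proof -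
    have "card J \<le> (2 * (d * (T * K)) + 1) ^ dim L" unfolding J_def by (rule box)
    also have "\<dots> \<le> ((2 * d * K + 1) * (T + 1)) ^ dim L"
      by (intro power_mono) (auto simp: algebra_simps)
    also have "\<dots> = T * (T + 1) ^ dim L" by (simp only: power_mult_distrib T_def)
    also have "\<dots> < (T + 1) * (T + 1) ^ dim L" by simp
    also have "\<dots> = card S" unfolding S_def d_def by (subst card_PiE) auto
    finally show ?thesis .
  qed
  have "box_span \<sigma> (d * (T * K)) (\<lambda>\<gamma>. \<Prod>i<d. f i \<gamma> ^ a i)" if "a \<in> S" for a
    using that by (intro box_span_monomial K) (auto simp: S_def)
  then obtain v where v: "\<And>a \<gamma>. a \<in> S \<Longrightarrow> \<gamma> \<in> chart L \<sigma> \<Longrightarrow> (\<Prod>i<d. f i \<gamma> ^ a i) = (\<Sum>m\<in>J. v a m * \<gamma> m)"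
    unfolding box_span_def J_def by metis
  \<comment> \<open>There are more monomials than characters, so the expansions of the monomials are
    linearly dependent.\<close>
  obtain c where c: "\<exists>a\<in>S. c a \<noteq> 0" "\<And>m. m \<in> J \<Longrightarrow> (\<Sum>a\<in>S. v a m * c a) = 0"
    using homogeneous_system_nontrivial_solution[OF _ \<open>finite S\<close> \<open>card J < card S\<close>, of "\<lambda>m a. v a m"] box(1)
    unfolding J_def by auto
  show ?thesis
  proof (rule that[unfolded d_def[symmetric], of S c])
    show "finite S" "\<exists>a\<in>S. c a \<noteq> 0" by fact+
    show "S \<subseteq> {..<d} \<rightarrow>\<^sub>E UNIV" unfolding S_def by (rule PiE_mono) auto
    fix \<gamma> assume \<gamma>: "\<gamma> \<in> chart L \<sigma>"
    have "(\<Sum>a\<in>S. c a * (\<Prod>i<d. f i \<gamma> ^ a i)) = (\<Sum>a\<in>S. \<Sum>m\<in>J. v a m * c a * \<gamma> m)"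
      using \<gamma> by (intro sum.cong refl) (simp add: v sum_distrib_left mult_ac)
    also have "\<dots> = (\<Sum>m\<in>J. (\<Sum>a\<in>S. v a m * c a) * \<gamma> m)"
      by (subst sum.swap) (simp add: sum_distrib_right)
    also have "\<dots> = 0" using c(2) by simp
    finally show "(\<Sum>a\<in>S. c a * (\<Prod>i<d. f i \<gamma> ^ a i)) = 0" .
  qed
qed

end

locale toric_fan = lattice L + chart_fan L \<Sigma> for L :: "'a::euclidean_space set" and \<Sigma> +
  assumes zero_cone: "{0} \<in> \<Sigma>"
begin

text \<open>The open sets where \<open>F\<close> and \<open>G\<close> do not vanish have no common
  point in \<open>Z\<close>, so their closed complements cover \<open>Z\<close>.\<close>

lemma irreducible_chart_functions:
  assumes Z: "irreducible_closedin (toric_topology L \<Sigma>) Z" and \<sigma>: "\<sigma> \<in> \<Sigma>"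
    and F: "F \<in> chart_functions L \<sigma>" "G \<in> chart_functions L \<sigma>"
    and FG: "\<And>\<gamma>. \<gamma> \<in> chart L \<sigma> \<Longrightarrow> chart_point L \<Sigma> \<sigma> \<gamma> \<in> Z \<Longrightarrow> F \<gamma> * G \<gamma> = 0"
  shows "(\<forall>\<gamma>\<in>chart L \<sigma>. chart_point L \<Sigma> \<sigma> \<gamma> \<in> Z \<longrightarrow> F \<gamma> = 0) \<or>
         (\<forall>\<gamma>\<in>chart L \<sigma>. chart_point L \<Sigma> \<sigma> \<gamma> \<in> Z \<longrightarrow> G \<gamma> = 0)"
proof -
  let ?T = "toric_topology L \<Sigma>"
  have ZT: "Z \<subseteq> topspace ?T" using Z closedin_subset by (auto simp: irreducible_closedin_def)
  have cl: "closedin ?T (topspace ?T - principal_open \<sigma> F)" "closedin ?T (topspace ?T - principal_open \<sigma> G)"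
    using F \<sigma> by (auto intro!: openin_principal_open)
  have "p \<notin> principal_open \<sigma> F \<or> p \<notin> principal_open \<sigma> G" if "p \<in> Z" for p
  proof (rule ccontr)
    assume "\<not> ?thesis"
    then obtain \<gamma> where "\<gamma> \<in> chart L \<sigma>" "F \<gamma> \<noteq> 0" "p = chart_point L \<Sigma> \<sigma> \<gamma>" "p \<in> principal_open \<sigma> G"
      by (auto simp: principal_open_def)
    then show False using FG[of \<gamma>] that chart_point_in_principal_open[OF \<sigma>] by auto
  qed
  then have "Z \<subseteq> (topspace ?T - principal_open \<sigma> F) \<union> (topspace ?T - principal_open \<sigma> G)" using ZT by blast
  then have "Z \<subseteq> topspace ?T - principal_open \<sigma> F \<or> Z \<subseteq> topspace ?T - principal_open \<sigma> G"
    using Z cl unfolding irreducible_closedin_def by blast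
  then show ?thesis using chart_point_in_principal_open[OF \<sigma>] by blast
qed

text \<open>The chain is restricted to a chart around a point of its smallest member. Each inclusion
  stays strict there, because an irreducible set is not the union of a smaller member and its part
  outside the chart. Functions vanishing on one member but not on the next are algebraically
  independent, so there are at most as many as the rank.\<close>

lemma chain_length_le:
  assumes Z: "\<And>i. i \<le> d \<Longrightarrow> irreducible_closedin (toric_topology L \<Sigma>) (Z i)" "\<And>i. i < d \<Longrightarrow> Z i \<subset> Z (Suc i)"
  shows "d \<le> dim L"
proof (rule ccontr)
  assume "\<not> d \<le> dim L"
  then have le: "Suc (dim L) \<le> d" by simp
  define D where "D = Suc (dim L)"
  let ?T = "toric_topology L \<Sigma>"
  have cl: "closedin ?T (Z i)" if "i \<le> d" for i using Z(1)[OF that] by (simp add: irreducible_closedin_def)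
  have ZT: "Z i \<subseteq> toric_points L \<Sigma>" if "i \<le> d" for i using closedin_subset[OF cl[OF that]] topspace_toric by simp
  obtain p where p: "p \<in> Z 0" using Z(1)[of 0] by (auto simp: irreducible_closedin_def)
  then obtain \<sigma> \<gamma>0 where \<sigma>: "\<sigma> \<in> \<Sigma>" "\<gamma>0 \<in> chart L \<sigma>" "p = chart_point L \<Sigma> \<sigma> \<gamma>0"
    using ZT[of 0] toric_pointsE by blast
  define Y where "Y i = {\<gamma> \<in> chart L \<sigma>. chart_point L \<Sigma> \<sigma> \<gamma> \<in> Z i}" for i
  have pZ: "p \<in> Z i" if "i \<le> d" for i
    using that
  proof (induction i)
    case (Suc i)
    then show ?case using Z(2)[of i] by auto
  qed (rule p)
  have "\<exists>f\<in>chart_functions L \<sigma>. (\<forall>\<gamma>\<in>Y i. f \<gamma> = 0) \<and> (\<exists>\<gamma>\<in>Y (Suc i). f \<gamma> \<noteq> 0)" if i: "i < D" for i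
  proof -
    have id: "i < d" using i le by (simp add: D_def)
    obtain one where one: "one \<in> chart_functions L \<sigma>" "\<forall>\<gamma>\<in>chart L \<sigma>. one \<gamma> = 1" using chart_functions_one by blast
    have "\<exists>q\<in>Z (Suc i) - Z i. q \<in> principal_open \<sigma> one"
    proof (rule ccontr)
      assume "\<not> ?thesis"
      then have "Z (Suc i) \<subseteq> Z i \<union> (topspace ?T - principal_open \<sigma> one)"
        using ZT[of "Suc i"] id topspace_toric by auto
      moreover have "closedin ?T (topspace ?T - principal_open \<sigma> one)"
        using openin_principal_open[OF \<sigma>(1) one(1)] by auto
      ultimately have "Z (Suc i) \<subseteq> Z i \<or> Z (Suc i) \<subseteq> topspace ?T - principal_open \<sigma> one"
        using Z(1)[of "Suc i"] cl[of i] id unfolding irreducible_closedin_def by simp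
      moreover have "p \<in> principal_open \<sigma> one"
        using chart_point_in_principal_open[OF \<sigma>(1,2)] one(2) \<sigma> by auto
      ultimately show False using Z(2)[OF id] pZ[of "Suc i"] id by auto
    qed
    then obtain \<gamma> where \<gamma>: "\<gamma> \<in> chart L \<sigma>" "chart_point L \<Sigma> \<sigma> \<gamma> \<in> Z (Suc i)" "chart_point L \<Sigma> \<sigma> \<gamma> \<notin> Z i"
      by (auto simp: principal_open_def)
    have "openin ?T (topspace ?T - Z i)" using cl[of i] id by auto
    moreover have "chart_point L \<Sigma> \<sigma> \<gamma> \<in> topspace ?T - Z i" using \<gamma> ZT[of "Suc i"] id topspace_toric by auto
    ultimately obtain f where "f \<in> chart_functions L \<sigma>" "f \<gamma> \<noteq> 0"
      "\<forall>\<delta>\<in>chart L \<sigma>. f \<delta> \<noteq> 0 \<longrightarrow> chart_point L \<Sigma> \<sigma> \<delta> \<in> topspace ?T - Z i"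
      using \<sigma>(1) \<gamma>(1) unfolding openin_toric_iff by blast
    then show ?thesis using \<gamma> by (intro bexI[of _ f]) (auto simp: Y_def)
  qed
  then obtain f where f: "\<And>i. i < D \<Longrightarrow> f i \<in> chart_functions L \<sigma>" "\<And>i \<gamma>. i < D \<Longrightarrow> \<gamma> \<in> Y i \<Longrightarrow> f i \<gamma> = 0"
    "\<And>i. i < D \<Longrightarrow> \<exists>\<gamma>\<in>Y (Suc i). f i \<gamma> \<noteq> 0" by metis
  obtain S c where S: "finite S" "S \<subseteq> {..<D} \<rightarrow>\<^sub>E UNIV" "\<exists>a\<in>S. c a \<noteq> 0"
    "\<And>\<gamma>. \<gamma> \<in> chart L \<sigma> \<Longrightarrow> (\<Sum>a\<in>S. c a * (\<Prod>i<D. f i \<gamma> ^ a i)) = 0"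
    using chart_functions_algebraically_dependent[of f \<sigma>] f(1) unfolding D_def by blast
  \<comment> \<open>Functions are taken up to agreement on the chart: the constant 1 and products
    are chart functions only up to their values elsewhere.\<close>
  define \<A> where "\<A> = {F. \<exists>g\<in>chart_functions L \<sigma>. \<forall>\<gamma>\<in>chart L \<sigma>. F \<gamma> = g \<gamma>}"
  have "\<forall>a\<in>S. c a = 0"
  proof (rule chain_algebraically_independent[where \<A> = \<A> and Y = Y and d = D and f = f])
    show "(\<lambda>_. 1) \<in> \<A>" using chart_functions_one[of L \<sigma>] by (force simp: \<A>_def)
    show "(\<lambda>x. F x * G x) \<in> \<A>" if F: "F \<in> \<A>" "G \<in> \<A>" for F G
    proof -
      obtain g1 where g1: "g1 \<in> chart_functions L \<sigma>" "\<forall>\<gamma>\<in>chart L \<sigma>. F \<gamma> = g1 \<gamma>" using F(1) unfolding \<A>_def by blast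
      obtain g2 where g2: "g2 \<in> chart_functions L \<sigma>" "\<forall>\<gamma>\<in>chart L \<sigma>. G \<gamma> = g2 \<gamma>" using F(2) unfolding \<A>_def by blast
      obtain h where "h \<in> chart_functions L \<sigma>" "\<And>\<gamma>. \<gamma> \<in> chart L \<sigma> \<Longrightarrow> h \<gamma> = g1 \<gamma> * g2 \<gamma>"
        using chart_functions_mult[OF g1(1) g2(1)] by blast
      then show ?thesis using g1 g2 unfolding \<A>_def by (intro CollectI bexI[of _ h]) auto
    qed
    show "(\<lambda>x. r * F x) \<in> \<A>" if F: "F \<in> \<A>" for r F
    proof -
      obtain g where g: "g \<in> chart_functions L \<sigma>" "\<forall>\<gamma>\<in>chart L \<sigma>. F \<gamma> = g \<gamma>" using F unfolding \<A>_def by blast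
      obtain A a where A: "finite A" "A \<subseteq> dual_monoid L \<sigma>" "g = (\<lambda>\<gamma>. \<Sum>m\<in>A. a m * \<gamma> m)"
        using chart_functionsE[OF g(1)] .
      have "(\<lambda>\<gamma>. \<Sum>m\<in>A. (r * a m) * \<gamma> m) \<in> chart_functions L \<sigma>" using A by (intro chart_functionsI) auto
      then show ?thesis unfolding \<A>_def using g A
        by (intro CollectI bexI[of _ "\<lambda>\<gamma>. \<Sum>m\<in>A. (r * a m) * \<gamma> m"]) (simp_all add: sum_distrib_left mult.assoc)
    qed
    show "(\<lambda>x. F x + G x) \<in> \<A>" if F: "F \<in> \<A>" "G \<in> \<A>" for F G
    proof -
      obtain g where g: "g \<in> chart_functions L \<sigma>" "\<forall>\<gamma>\<in>chart L \<sigma>. F \<gamma> = g \<gamma>" using F(1) unfolding \<A>_def by blast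
      obtain h where h: "h \<in> chart_functions L \<sigma>" "\<forall>\<gamma>\<in>chart L \<sigma>. G \<gamma> = h \<gamma>" using F(2) unfolding \<A>_def by blast
      obtain A a where A: "finite A" "A \<subseteq> dual_monoid L \<sigma>" "g = (\<lambda>\<gamma>. \<Sum>m\<in>A. a m * \<gamma> m)"
        using chart_functionsE[OF g(1)] .
      obtain B b where B: "finite B" "B \<subseteq> dual_monoid L \<sigma>" "h = (\<lambda>\<gamma>. \<Sum>m\<in>B. b m * \<gamma> m)"
        using chart_functionsE[OF h(1)] .
      have "(\<lambda>\<gamma>. \<Sum>s\<in>A <+> B. case_sum a b s * \<gamma> (case_sum (\<lambda>x. x) (\<lambda>x. x) s)) \<in> chart_functions L \<sigma>"
        using A B by (intro chart_functionsI) auto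
      then show ?thesis unfolding \<A>_def using g A h B
        by (intro CollectI bexI[of _ "\<lambda>\<gamma>. \<Sum>s\<in>A <+> B. case_sum a b s * \<gamma> (case_sum (\<lambda>x. x) (\<lambda>x. x) s)"])
          (simp_all add: sum.Plus)
    qed
    show "(\<forall>x\<in>Y i. F x = 0) \<or> (\<forall>x\<in>Y i. G x = 0)"
      if F: "i \<le> D" "F \<in> \<A>" "G \<in> \<A>" "\<forall>x\<in>Y i. F x * G x = 0" for i F G
    proof -
      obtain g1 where g1: "g1 \<in> chart_functions L \<sigma>" "\<forall>\<gamma>\<in>chart L \<sigma>. F \<gamma> = g1 \<gamma>" using F(2) unfolding \<A>_def by blast
      obtain g2 where g2: "g2 \<in> chart_functions L \<sigma>" "\<forall>\<gamma>\<in>chart L \<sigma>. G \<gamma> = g2 \<gamma>" using F(3) unfolding \<A>_def by blast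
      have "irreducible_closedin ?T (Z i)" using F(1) le by (intro Z(1)) (simp add: D_def)
      from irreducible_chart_functions[OF this \<sigma>(1) g1(1) g2(1)] F(4) g1 g2 show ?thesis by (auto simp: Y_def)
    qed
    show "f i \<in> \<A>" if "i < D" for i using f(1)[OF that] by (auto simp: \<A>_def)
    show "Y 0 \<noteq> {}" using p \<sigma> by (auto simp: Y_def)
    show "Y i \<subseteq> Y (Suc i)" if "i < D" for i using Z(2)[of i] that le by (auto simp: Y_def D_def)
  qed (use f S in \<open>auto simp: Y_def\<close>)
  then show False using S(3) by auto
qed

lemma dual_monoid_zero_cone: "dual_monoid L {0} = dual_lattice L"
  by (auto simp: dual_monoid_def)

text \<open>The torus in exponential coordinates: a complex line of parameters turns chart functions
  into entire functions, to which the identity theorem applies.\<close>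

definition torus_point :: "('a \<Rightarrow> complex) \<Rightarrow> 'a \<Rightarrow> complex" where
  "torus_point z = (\<lambda>m\<in>dual_lattice L. exp (\<Sum>b\<in>basis. of_real (m \<bullet> b) * z b))"

lemma torus_point_chart: "torus_point z \<in> chart L {0}"
  unfolding torus_point_def dual_monoid_zero_cone[symmetric]
  by (rule chartI) (simp_all add: inner_add_left ring_distribs sum.distrib exp_add)

lemma torus_point_line_holomorphic:
  assumes "f \<in> chart_functions L {0}"
  shows "(\<lambda>s. f (torus_point (\<lambda>b. z b + s * w b))) holomorphic_on UNIV"
proof -
  obtain A c where f: "finite A" "A \<subseteq> dual_monoid L {0}" "f = (\<lambda>\<gamma>. \<Sum>m\<in>A. c m * \<gamma> m)"
    using chart_functionsE[OF assms] .
  have "f (torus_point (\<lambda>b. z b + s * w b)) = (\<Sum>m\<in>A. c m * exp (\<Sum>b\<in>basis. of_real (m \<bullet> b) * (z b + s * w b)))" for s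
    unfolding f torus_point_def using f(2) dual_monoid_zero_cone by (intro sum.cong) auto
  then show ?thesis by (simp only:) (intro holomorphic_intros)
qed

text \<open>By continuity \<open>F\<close> has no zero near \<open>a\<close>, so \<open>G\<close>
  vanishes on a ball and hence everywhere.\<close>

lemma entire_product_zero:
  assumes F: "F holomorphic_on UNIV" and G: "G holomorphic_on UNIV" and z: "\<And>s. F s * G s = 0" and nz: "F a \<noteq> 0"
  shows "G s = 0"
proof -
  have "isCont F a" using F holomorphic_on_imp_continuous_on continuous_on_eq_continuous_at by blast
  then obtain e where e: "e > 0" "\<And>s. dist a s < e \<Longrightarrow> F s \<noteq> 0"
    using continuous_at_avoid[of a F 0] nz by blast
  show ?thesis
  proof (rule analytic_continuation[OF G, of "ball a e" a])
    show "G s = 0" if "s \<in> ball a e" for s using e(2) z[of s] that by auto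
    show "a islimpt ball a e" using e(1) by (simp add: islimpt_ball)
  qed auto
qed

text \<open>\<open>Z j\<close> is the closure of the subtorus in which only the first
  \<open>j\<close> coordinates vary. Any two points of the subtorus come from a complex line of
  parameters, and entire functions on this line form a domain; this gives irreducibility.\<close>

lemma chain_exists:
  obtains Z where "\<And>i. i \<le> dim L \<Longrightarrow> irreducible_closedin (toric_topology L \<Sigma>) (Z i)"
    "\<And>i. i < dim L \<Longrightarrow> Z i \<subset> Z (Suc i)"
proof -
  let ?T = "toric_topology L \<Sigma>"
  obtain bs where bs: "bij_betw bs {..<dim L} basis"
    using ex_bij_betw_nat_finite[OF finite_basis] by (auto simp: card_basis atLeast0LessThan)
  define V where "V j = {z :: 'a \<Rightarrow> complex. \<forall>i. j \<le> i \<and> i < dim L \<longrightarrow> z (bs i) = 0}" for j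
  define P where "P z = chart_point L \<Sigma> {0} (torus_point z)" for z
  define Z where "Z j = ?T closure_of (P ` V j)" for j
  have PT: "P z \<in> topspace ?T" for z
    unfolding P_def topspace_toric by (rule chart_point_in_points[OF zero_cone torus_point_chart])
  then have sub: "P ` V j \<subseteq> Z j" for j unfolding Z_def by (intro closure_of_subset) auto
  have avoid: "\<exists>f\<in>chart_functions L {0}. f (torus_point z) \<noteq> 0 \<and> (\<forall>w. P w \<in> A \<longrightarrow> f (torus_point w) = 0)"
    if "closedin ?T A" "P z \<notin> A" for A z
  proof -
    have "openin ?T (topspace ?T - A)" "P z \<in> topspace ?T - A" using that PT by auto
    then obtain f where "f\<in>chart_functions L {0}" "f (torus_point z) \<noteq> 0"
      "\<forall>\<delta>\<in>chart L {0}. f \<delta> \<noteq> 0 \<longrightarrow> chart_point L \<Sigma> {0} \<delta> \<in> topspace ?T - A"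
      using zero_cone torus_point_chart unfolding openin_toric_iff P_def by blast
    then show ?thesis using torus_point_chart by (auto simp: P_def intro!: bexI[of _ f])
  qed
  show ?thesis
  proof (rule that[of Z])
    fix j
    show "irreducible_closedin ?T (Z j)"
      unfolding irreducible_closedin_def
    proof (intro conjI allI impI)
      show "closedin ?T (Z j)" by (simp add: Z_def)
      have "(\<lambda>_. 0) \<in> V j" by (simp add: V_def)
      then show "Z j \<noteq> {}" using sub by auto
      fix A B assume AB: "closedin ?T A \<and> closedin ?T B \<and> Z j \<subseteq> A \<union> B"
      show "Z j \<subseteq> A \<or> Z j \<subseteq> B"
      proof (rule ccontr)
        assume "\<not> ?thesis"
        then have "\<not> P ` V j \<subseteq> A" "\<not> P ` V j \<subseteq> B"
          using AB unfolding Z_def by (auto dest: closure_of_minimal)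
        then obtain z w where zw: "z \<in> V j" "P z \<notin> A" "w \<in> V j" "P w \<notin> B" by blast
        obtain f where f: "f \<in> chart_functions L {0}" "f (torus_point z) \<noteq> 0" "\<forall>w. P w \<in> A \<longrightarrow> f (torus_point w) = 0"
          using avoid AB zw by blast
        obtain g where g: "g \<in> chart_functions L {0}" "g (torus_point w) \<noteq> 0" "\<forall>w. P w \<in> B \<longrightarrow> g (torus_point w) = 0"
          using avoid AB zw by blast
        define l where "l s b = z b + s * (w b - z b)" for s b
        have "P (l s) \<in> A \<union> B" for s
        proof -
          have "l s \<in> V j" using zw by (auto simp: V_def l_def)
          then show ?thesis using sub AB by blast
        qed
        then have "f (torus_point (l s)) * g (torus_point (l s)) = 0" for s using f(3) g(3) by (metis UnE mult_eq_0_iff)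
        moreover have "f (torus_point (l 0)) \<noteq> 0" using f(2) by (simp add: l_def[abs_def])
        moreover have "(\<lambda>s. f (torus_point (l s))) holomorphic_on UNIV" "(\<lambda>s. g (torus_point (l s))) holomorphic_on UNIV"
          using torus_point_line_holomorphic[OF f(1), of z "\<lambda>b. w b - z b"]
            torus_point_line_holomorphic[OF g(1), of z "\<lambda>b. w b - z b"] unfolding l_def[abs_def] by blast+
        ultimately have "g (torus_point (l 1)) = 0"
          using entire_product_zero[of "\<lambda>s. f (torus_point (l s))" "\<lambda>s. g (torus_point (l s))" 0 1] by blast
        then show False using g(2) by (simp add: l_def[abs_def])
      qed
    qed
    assume j: "j < dim L"
    have b: "bs j \<in> basis" using bs j by (auto simp: bij_betw_def)
    \<comment> \<open>Within the torus chart this character is constantly 1 on \<open>Z j\<close>,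
      but it takes the value 2 at a point of \<open>Z (Suc j)\<close>.\<close>
    define m where "m = dual_basis (bs j)"
    have m: "m \<in> dual_monoid L {0}" using dual_basis[OF b] by (simp add: m_def dual_monoid_zero_cone)
    have tm: "torus_point z m = exp (z (bs j))" for z
      using dual_basis[OF b] finite_basis b
      by (simp add: torus_point_def m_def dual_basis_inner if_distrib[of of_real] if_distrib[of "\<lambda>x. x * _"] sum.delta'
          cong: if_cong sum.cong)
    define h where "h \<gamma> = \<gamma> m - \<gamma> 0" for \<gamma> :: "'a \<Rightarrow> complex"
    have h: "h \<in> chart_functions L {0}"
      unfolding h_def[abs_def] by (rule chart_functions_diff_characters[OF m dual_monoid_0])
    have hP: "P z \<in> principal_open {0} h \<longleftrightarrow> exp (z (bs j)) \<noteq> 1" for z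
      unfolding P_def chart_point_in_principal_open[OF zero_cone torus_point_chart]
      by (simp add: h_def tm chartD(1)[OF torus_point_chart])
    have "P ` V j \<subseteq> topspace ?T - principal_open {0} h" using PT hP j by (auto simp: V_def)
    then have ZD: "Z j \<subseteq> topspace ?T - principal_open {0} h"
      unfolding Z_def using openin_principal_open[OF zero_cone h] by (intro closure_of_minimal) auto
    define z where "z = (\<lambda>b. if b = bs j then complex_of_real (ln 2) else 0)"
    have "z \<in> V (Suc j)"
    proof -
      have "bs i \<noteq> bs j" if "Suc j \<le> i" "i < dim L" for i
        using that j bij_betw_imp_inj_on[OF bs] inj_onD[of bs "{..<dim L}" i j] by auto
      then show ?thesis by (simp add: V_def z_def)
    qed
    then have "P z \<in> Z (Suc j)" using sub by blast
    moreover have "exp (z (bs j)) = 2" unfolding z_def by (simp add: exp_of_real)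
    then have "P z \<notin> Z j" using ZD hP[of z] by auto
    moreover have "Z j \<subseteq> Z (Suc j)" unfolding Z_def by (intro closure_of_mono image_mono) (auto simp: V_def)
    ultimately show "Z j \<subset> Z (Suc j)" by blast
  qed
qed

theorem krull_dim_toric: "krull_dim (toric_topology L \<Sigma>) = enat (dim L)"
  unfolding krull_dim_def
proof (rule antisym)
  show "Sup {enat d |d. \<exists>Z. (\<forall>i\<le>d. irreducible_closedin (toric_topology L \<Sigma>) (Z i)) \<and> (\<forall>i<d. Z i \<subset> Z (Suc i))} \<le> enat (dim L)"
  proof (rule Sup_least, clarsimp)
    fix d :: nat and Z
    assume "\<forall>i\<le>d. irreducible_closedin (toric_topology L \<Sigma>) (Z i)" "\<forall>i<d. Z i \<subset> Z (Suc i)"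
    then show "d \<le> dim L" using chain_length_le[of d Z] by blast
  qed
  obtain Z where Z: "\<And>i. i \<le> dim L \<Longrightarrow> irreducible_closedin (toric_topology L \<Sigma>) (Z i)"
    "\<And>i. i < dim L \<Longrightarrow> Z i \<subset> Z (Suc i)"
    by (rule chain_exists) (rule that; assumption)
  show "enat (dim L) \<le> Sup {enat d |d. \<exists>Z. (\<forall>i\<le>d. irreducible_closedin (toric_topology L \<Sigma>) (Z i)) \<and> (\<forall>i<d. Z i \<subset> Z (Suc i))}"
    by (intro Sup_upper CollectI exI[of _ "dim L"] conjI[OF refl] exI[of _ Z]) (simp add: Z)
qed

end

section \<open>Binomial ideals in the Cox ring\<close>

definition monomial_value :: "('a set \<Rightarrow>\<^sub>0 nat) \<Rightarrow> ('a set \<Rightarrow> complex) \<Rightarrow> complex" where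
  "monomial_value a x = (\<Prod>\<rho>\<in>Poly_Mapping.keys a. x \<rho> ^ Poly_Mapping.lookup a \<rho>)"

lemma monomial_value_superset:
  assumes "finite K" "Poly_Mapping.keys a \<subseteq> K"
  shows "monomial_value a x = (\<Prod>\<rho>\<in>K. x \<rho> ^ Poly_Mapping.lookup a \<rho>)"
  unfolding monomial_value_def using assms
  by (intro prod.mono_neutral_left) (auto simp: not_in_keys_iff_lookup_eq_zero)

lemma monomial_value_0: "monomial_value 0 x = 1"
  by (simp add: monomial_value_def)

lemma monomial_value_add: "monomial_value (a + b) x = monomial_value a x * monomial_value b x"
proof -
  let ?K = "Poly_Mapping.keys a \<union> Poly_Mapping.keys b"
  have "monomial_value c x = (\<Prod>\<rho>\<in>?K. x \<rho> ^ Poly_Mapping.lookup c \<rho>)" if "c \<in> {a, b, a + b}" for c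
    using that Poly_Mapping.keys_add[of a b] by (intro monomial_value_superset) auto
  then show ?thesis by (simp add: lookup_add power_add prod.distrib)
qed

lemma monomial_value_mult:
  "monomial_value a (\<lambda>\<rho>. x \<rho> * y \<rho>) = monomial_value a x * monomial_value a y"
  by (simp add: monomial_value_def power_mult_distrib prod.distrib)

lemma eval_poly_monomial_value:
  "eval_poly f x = (\<Sum>a\<in>Poly_Mapping.keys f. Poly_Mapping.lookup f a * monomial_value a x)"
  by (simp add: eval_poly_def monomial_value_def)

lemma eval_poly_single: "eval_poly (Poly_Mapping.single a c) x = c * monomial_value a x"
  by (simp add: eval_poly_monomial_value)

lemma eval_poly_0: "eval_poly 0 x = 0"
  by (simp add: eval_poly_monomial_value)

lemma eval_poly_1: "eval_poly 1 x = 1"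
  by (simp add: eval_poly_monomial_value monomial_value_0)

lemma eval_poly_add: "eval_poly (f + g) x = eval_poly f x + eval_poly g x"
  unfolding eval_poly_monomial_value by (rule setsum_keys_plus_distrib) (auto simp: distrib_right)

lemma eval_poly_diff: "eval_poly (f - g) x = eval_poly f x - eval_poly g x"
  using eval_poly_add[of "f - g" g x] by simp

lemma eval_poly_sum: "eval_poly (sum f A) x = (\<Sum>i\<in>A. eval_poly (f i) x)"
  by (induction A rule: infinite_finite_induct) (auto simp: eval_poly_0 eval_poly_add)

lemma poly_mapping_expansion:
  "f = (\<Sum>a\<in>Poly_Mapping.keys f. Poly_Mapping.single a (Poly_Mapping.lookup f a))"
  by (rule poly_mapping_eqI)
    (simp add: lookup_sum lookup_single when_def sum.delta' in_keys_iff)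

lemma eval_poly_mult: "eval_poly (f * g) x = eval_poly f x * eval_poly g x"
proof -
  let ?s = "\<lambda>f a. Poly_Mapping.single a (Poly_Mapping.lookup f a)"
  have "f * g = (\<Sum>a\<in>Poly_Mapping.keys f. ?s f a) * (\<Sum>a\<in>Poly_Mapping.keys g. ?s g a)"
    using poly_mapping_expansion by metis
  then have "f * g = (\<Sum>a\<in>Poly_Mapping.keys f. \<Sum>b\<in>Poly_Mapping.keys g. ?s f a * ?s g b)"
    by (simp add: sum_product)
  then show ?thesis
    by (simp add: eval_poly_sum mult_single eval_poly_single monomial_value_add)
      (simp add: eval_poly_monomial_value sum_product mult_ac)
qed

lemma carrier_cox_ring: "f \<in> carrier (cox_ring \<Sigma>) \<longleftrightarrow> (\<forall>a\<in>Poly_Mapping.keys f. Poly_Mapping.keys a \<subseteq> rays \<Sigma>)"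
  by (simp add: cox_ring_def)

lemma cox_ring_simps [simp]:
  "x \<otimes>\<^bsub>cox_ring \<Sigma>\<^esub> y = x * y" "\<one>\<^bsub>cox_ring \<Sigma>\<^esub> = 1" "\<zero>\<^bsub>cox_ring \<Sigma>\<^esub> = 0" "x \<oplus>\<^bsub>cox_ring \<Sigma>\<^esub> y = x + y"
  by (simp_all add: cox_ring_def)

lemma cox_ring_closed:
  assumes "f \<in> carrier (cox_ring \<Sigma>)" "g \<in> carrier (cox_ring \<Sigma>)"
  shows "f + g \<in> carrier (cox_ring \<Sigma>)" "f * g \<in> carrier (cox_ring \<Sigma>)" "- f \<in> carrier (cox_ring \<Sigma>)"
    "f - g \<in> carrier (cox_ring \<Sigma>)"
proof -
  show "f + g \<in> carrier (cox_ring \<Sigma>)"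
    using assms Poly_Mapping.keys_add[of f g] unfolding carrier_cox_ring by blast
  have "Poly_Mapping.keys (- f) = Poly_Mapping.keys f" by (auto simp: in_keys_iff)
  then show "- f \<in> carrier (cox_ring \<Sigma>)" using assms unfolding carrier_cox_ring by simp
  have "Poly_Mapping.keys (f - g) \<subseteq> Poly_Mapping.keys f \<union> Poly_Mapping.keys g" by (auto simp: in_keys_iff lookup_minus)
  then show "f - g \<in> carrier (cox_ring \<Sigma>)" using assms unfolding carrier_cox_ring by blast
  show "f * g \<in> carrier (cox_ring \<Sigma>)"
    unfolding carrier_cox_ring
  proof
    fix c assume "c \<in> Poly_Mapping.keys (f * g)"
    then obtain a b where "c = a + b" "a \<in> Poly_Mapping.keys f" "b \<in> Poly_Mapping.keys g" using Poly_Mapping.keys_mult[of f g] by blast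
    then show "Poly_Mapping.keys c \<subseteq> rays \<Sigma>"
      using assms Poly_Mapping.keys_add[of a b] unfolding carrier_cox_ring by blast
  qed
qed

lemma cox_ring_0_1: "0 \<in> carrier (cox_ring \<Sigma>)" "1 \<in> carrier (cox_ring \<Sigma>)"
  by (simp_all add: carrier_cox_ring)

lemma cring_cox_ring: "cring (cox_ring \<Sigma>)"
proof (rule cringI)
  show "abelian_group (cox_ring \<Sigma>)"
  proof (rule abelian_groupI)
    fix x assume x: "x \<in> carrier (cox_ring \<Sigma>)"
    show "\<exists>y\<in>carrier (cox_ring \<Sigma>). y \<oplus>\<^bsub>cox_ring \<Sigma>\<^esub> x = \<zero>\<^bsub>cox_ring \<Sigma>\<^esub>"
      using cox_ring_closed(3)[OF x x] by (intro bexI[of _ "- x"]) auto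
  qed (auto simp: cox_ring_closed cox_ring_0_1 add_ac)
  show "comm_monoid (cox_ring \<Sigma>)"
    by (rule comm_monoidI) (auto simp: cox_ring_closed cox_ring_0_1 mult_ac)
qed (simp add: distrib_right)

lemma ring_cox_ring: "ring (cox_ring \<Sigma>)"
  using cring_cox_ring by (rule cring.axioms)

lemma cox_ring_pow: "g [^]\<^bsub>cox_ring \<Sigma>\<^esub> (n::nat) = g ^ n"
  by (induction n) (simp_all add: mult.commute)

lemma cox_ring_neg:
  assumes f: "f \<in> carrier (cox_ring \<Sigma>)"
  shows "\<ominus>\<^bsub>cox_ring \<Sigma>\<^esub> f = - f"
proof -
  interpret cring "cox_ring \<Sigma>" by (rule cring_cox_ring)
  show ?thesis using minus_equality[of "- f" f] cox_ring_closed(3)[OF f f] f by simp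
qed

lemma cox_ideal_diff:
  assumes "ideal I (cox_ring \<Sigma>)" "f \<in> I" "g \<in> I"
  shows "f - g \<in> I" "f + g \<in> I" "h \<in> carrier (cox_ring \<Sigma>) \<Longrightarrow> h * f \<in> I" "0 \<in> I"
proof -
  interpret ideal I "cox_ring \<Sigma>" by (rule assms)
  have "\<ominus>\<^bsub>cox_ring \<Sigma>\<^esub> g \<in> I" using assms by blast
  then have "- g \<in> I" using cox_ring_neg assms(3) a_subset by (metis subsetD)
  then show "f - g \<in> I" using additive_subgroup.a_closed[OF additive_subgroup_axioms assms(2), of "- g"] by simp
  show "f + g \<in> I" using additive_subgroup.a_closed[OF additive_subgroup_axioms assms(2,3)] by simp
  show "h \<in> carrier (cox_ring \<Sigma>) \<Longrightarrow> h * f \<in> I" using I_l_closed[OF assms(2)] by simp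
  show "0 \<in> I" using additive_subgroup.zero_closed[OF additive_subgroup_axioms] by simp
qed

lemma ideal_vanishing_at: "ideal {g \<in> carrier (cox_ring \<Sigma>). eval_poly g x = 0} (cox_ring \<Sigma>)"
proof (rule idealI[OF ring_cox_ring])
  interpret cring "cox_ring \<Sigma>" by (rule cring_cox_ring)
  show "subgroup {g \<in> carrier (cox_ring \<Sigma>). eval_poly g x = 0} (add_monoid (cox_ring \<Sigma>))"
  proof (rule add.subgroupI)
    show "{g \<in> carrier (cox_ring \<Sigma>). eval_poly g x = 0} \<noteq> {}"
      using zero_closed eval_poly_0 by fastforce
    fix a assume a: "a \<in> {g \<in> carrier (cox_ring \<Sigma>). eval_poly g x = 0}"
    then show "\<ominus>\<^bsub>cox_ring \<Sigma>\<^esub> a \<in> {g \<in> carrier (cox_ring \<Sigma>). eval_poly g x = 0}"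
      using eval_poly_diff[of 0 a x] cox_ring_closed(3)[of a \<Sigma> a] by (simp add: cox_ring_neg eval_poly_0)
  qed (auto simp: eval_poly_add cox_ring_closed)
qed (auto simp: eval_poly_mult cox_ring_closed)

text \<open>Dedekind's argument: from the relation translated by \<open>y\<close>, subtract
  \<open>\<eta> s y\<close> times the relation itself, and \<open>s\<close> drops out. The arguments
  \<open>m\<close> and \<open>u\<close> are the product and the unit of \<open>G\<close>.\<close>

lemma characters_independent:
  fixes \<eta> :: "'s \<Rightarrow> 'x \<Rightarrow> complex"
  assumes "finite S"
    and mult: "\<And>x y. x \<in> G \<Longrightarrow> y \<in> G \<Longrightarrow> m x y \<in> G"
      "\<And>s x y. s \<in> S \<Longrightarrow> x \<in> G \<Longrightarrow> y \<in> G \<Longrightarrow> \<eta> s (m x y) = \<eta> s x * \<eta> s y"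
    and one: "u \<in> G" "\<And>s. s \<in> S \<Longrightarrow> \<eta> s u = 1"
    and distinct: "\<And>s t. s \<in> S \<Longrightarrow> t \<in> S \<Longrightarrow> s \<noteq> t \<Longrightarrow> \<exists>x\<in>G. \<eta> s x \<noteq> \<eta> t x"
    and zero: "\<And>x. x \<in> G \<Longrightarrow> (\<Sum>s\<in>S. c s * \<eta> s x) = 0"
  shows "\<forall>s\<in>S. c s = 0"
  using assms(1) mult(2) one(2) distinct zero
proof (induction S arbitrary: c rule: finite_induct)
  case (insert s S)
  have "c t = 0" if t: "t \<in> S" for t
  proof -
    obtain y where y: "y \<in> G" "\<eta> t y \<noteq> \<eta> s y" using insert.prems(3)[of t s] t insert.hyps by auto
    have "\<forall>t\<in>S. c t * (\<eta> t y - \<eta> s y) = 0"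
    proof (rule insert.IH)
      fix x assume x: "x \<in> G"
      have "0 = (\<Sum>t\<in>insert s S. c t * \<eta> t (m x y)) - \<eta> s y * (\<Sum>t\<in>insert s S. c t * \<eta> t x)"
        using insert.prems(4) x mult(1)[OF x y(1)] by simp
      also have "\<dots> = (\<Sum>t\<in>insert s S. c t * (\<eta> t y - \<eta> s y) * \<eta> t x)"
        using insert.prems(1) x y unfolding sum_distrib_left sum_subtractf[symmetric]
        by (intro sum.cong) (auto simp: algebra_simps)
      also have "\<dots> = (\<Sum>t\<in>S. c t * (\<eta> t y - \<eta> s y) * \<eta> t x)" using insert.hyps by simp
      finally show "(\<Sum>t\<in>S. c t * (\<eta> t y - \<eta> s y) * \<eta> t x) = 0" by simp
    qed (use insert.prems in auto)
    then show ?thesis using t y by auto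
  qed
  moreover have "c s = 0"
    using insert.prems(4)[OF one(1)] insert.prems(2) insert.hyps calculation by simp
  ultimately show ?case by auto
qed simp

definition indicator_exponent :: "'a set set \<Rightarrow> ('a set \<Rightarrow>\<^sub>0 nat)" where
  "indicator_exponent A = (\<Sum>\<xi>\<in>A. Poly_Mapping.single \<xi> 1)"

lemma lookup_indicator_exponent: "finite A \<Longrightarrow> Poly_Mapping.lookup (indicator_exponent A) \<xi> = (if \<xi> \<in> A then 1 else 0)"
  by (simp add: indicator_exponent_def lookup_sum lookup_single when_def sum.delta')

lemma keys_indicator_exponent: "finite A \<Longrightarrow> Poly_Mapping.keys (indicator_exponent A) = A"
  by (auto simp: in_keys_iff lookup_indicator_exponent split: if_splits)

lemma prod_coord: "(\<Prod>\<xi>\<in>A. coord \<xi>) = Poly_Mapping.single (indicator_exponent A) 1"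
  unfolding indicator_exponent_def
  by (induction A rule: infinite_finite_induct) (auto simp: coord_def mult_single)

lemma monomial_value_indicator: "finite A \<Longrightarrow> monomial_value (indicator_exponent A) x = (\<Prod>\<xi>\<in>A. x \<xi>)"
  by (simp add: monomial_value_def keys_indicator_exponent lookup_indicator_exponent)

text \<open>The equations depend only on the partition of the rays by level, so their algebra is
  developed for an arbitrary partition into nonempty blocks.\<close>

locale ray_partition =
  fixes \<Sigma> :: "'a::euclidean_space set set" and k :: nat and R :: "nat \<Rightarrow> 'a set set"
  assumes finite_rays: "finite (rays \<Sigma>)" and rays_eq: "rays \<Sigma> = (\<Union>j\<le>k. R j)"
    and disjoint: "\<And>i j. i \<le> k \<Longrightarrow> j \<le> k \<Longrightarrow> i \<noteq> j \<Longrightarrow> R i \<inter> R j = {}"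
    and nonempty: "\<And>j. j \<le> k \<Longrightarrow> R j \<noteq> {}"
begin

definition binomial :: "nat \<Rightarrow> 'a cone_poly" where
  "binomial i = (\<Prod>\<xi>\<in>R i. coord \<xi>) - (\<Prod>\<xi>\<in>R 0. coord \<xi>)"

definition binomial_ideal :: "nat \<Rightarrow> 'a cone_poly set" where
  "binomial_ideal j = Idl\<^bsub>cox_ring \<Sigma>\<^esub> (binomial ` {1..j})"

text \<open>A group under pointwise multiplication, of which the monomials are characters.\<close>

definition torus_zeros :: "nat \<Rightarrow> ('a set \<Rightarrow> complex) set" where
  "torus_zeros j = {x. (\<forall>\<xi>. x \<xi> \<noteq> 0) \<and> (\<forall>i\<in>{1..j}. (\<Prod>\<xi>\<in>R i. x \<xi>) = (\<Prod>\<xi>\<in>R 0. x \<xi>))}"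

lemma finite_R: "j \<le> k \<Longrightarrow> finite (R j)"
  using finite_rays rays_eq by (auto intro: finite_subset)

lemma R_subset: "j \<le> k \<Longrightarrow> R j \<subseteq> rays \<Sigma>"
  using rays_eq by auto

lemma binomial_eq:
  "binomial i = Poly_Mapping.single (indicator_exponent (R i)) 1 - Poly_Mapping.single (indicator_exponent (R 0)) 1"
  by (simp add: binomial_def prod_coord)

lemma single_carrier: "Poly_Mapping.keys a \<subseteq> rays \<Sigma> \<Longrightarrow> Poly_Mapping.single a c \<in> carrier (cox_ring \<Sigma>)"
  by (auto simp: carrier_cox_ring)

lemma binomial_carrier: "i \<le> k \<Longrightarrow> binomial i \<in> carrier (cox_ring \<Sigma>)"
  unfolding binomial_eq using R_subset[of i] R_subset[of 0] finite_R[of i] finite_R[of 0]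
  by (intro cox_ring_closed(4) single_carrier) (auto simp: keys_indicator_exponent)

lemma eval_binomial: "i \<le> k \<Longrightarrow> eval_poly (binomial i) x = (\<Prod>\<xi>\<in>R i. x \<xi>) - (\<Prod>\<xi>\<in>R 0. x \<xi>)"
  unfolding binomial_eq using finite_R[of i] finite_R[of 0]
  by (simp add: eval_poly_diff eval_poly_single monomial_value_indicator)

lemma binomials_carrier: "j \<le> k \<Longrightarrow> binomial ` {1..j} \<subseteq> carrier (cox_ring \<Sigma>)"
  using binomial_carrier by auto

lemma ideal_binomial: "j \<le> k \<Longrightarrow> ideal (binomial_ideal j) (cox_ring \<Sigma>)"
  unfolding binomial_ideal_def by (intro ring.genideal_ideal[OF ring_cox_ring] binomials_carrier)

lemma binomial_in_ideal: "j \<le> k \<Longrightarrow> i \<in> {1..j} \<Longrightarrow> binomial i \<in> binomial_ideal j"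
  unfolding binomial_ideal_def using ring.genideal_self[OF ring_cox_ring binomials_carrier] by blast

lemma binomial_ideal_carrier: "j \<le> k \<Longrightarrow> binomial_ideal j \<subseteq> carrier (cox_ring \<Sigma>)"
  by (meson additive_subgroup.a_subset ideal.axioms(1) ideal_binomial)

lemma binomial_ideal_vanishes_iff:
  assumes "j \<le> k"
  shows "(\<forall>g\<in>binomial_ideal j. eval_poly g x = 0) \<longleftrightarrow> (\<forall>i\<in>{1..j}. (\<Prod>\<xi>\<in>R i. x \<xi>) = (\<Prod>\<xi>\<in>R 0. x \<xi>))"
proof
  assume "\<forall>g\<in>binomial_ideal j. eval_poly g x = 0"
  then show "\<forall>i\<in>{1..j}. (\<Prod>\<xi>\<in>R i. x \<xi>) = (\<Prod>\<xi>\<in>R 0. x \<xi>)"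
    using binomial_in_ideal[OF assms] eval_binomial[of _ x] assms by fastforce
next
  assume *: "\<forall>i\<in>{1..j}. (\<Prod>\<xi>\<in>R i. x \<xi>) = (\<Prod>\<xi>\<in>R 0. x \<xi>)"
  have "binomial_ideal j \<subseteq> {g \<in> carrier (cox_ring \<Sigma>). eval_poly g x = 0}"
    unfolding binomial_ideal_def using * binomial_carrier eval_binomial[of _ x] assms
    by (intro ring.genideal_minimal[OF ring_cox_ring ideal_vanishing_at]) auto
  then show "\<forall>g\<in>binomial_ideal j. eval_poly g x = 0" by auto
qed

text \<open>These are the standard monomials when the product over \<open>R i\<close> is taken as
  the leading term of the \<open>i\<close>-th binomial.\<close>

definition normal :: "nat \<Rightarrow> ('a set \<Rightarrow>\<^sub>0 nat) \<Rightarrow> bool" where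
  "normal j a \<longleftrightarrow> Poly_Mapping.keys a \<subseteq> rays \<Sigma> \<and> (\<forall>i\<in>{1..j}. \<exists>\<xi>\<in>R i. Poly_Mapping.lookup a \<xi> = 0)"

text \<open>Replacing a full block \<open>R i\<close> by \<open>R 0\<close> changes the monomial by
  a multiple of the \<open>i\<close>-th binomial. The degree in the blocks 1 to \<open>j\<close>
  drops, because \<open>R i\<close> is nonempty and \<open>R 0\<close> is disjoint from these
  blocks.\<close>

lemma monomial_reduction:
  assumes j: "j \<le> k" and a: "Poly_Mapping.keys a \<subseteq> rays \<Sigma>"
  shows "\<exists>b. normal j b \<and> (\<forall>c. Poly_Mapping.single a c - Poly_Mapping.single b c \<in> binomial_ideal j)"
  using a
proof (induction "\<Sum>i\<in>{1..j}. \<Sum>\<xi>\<in>R i. Poly_Mapping.lookup a \<xi>" arbitrary: a rule: less_induct)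
  case less
  show ?case
  proof (cases "normal j a")
    case True
    then show ?thesis using cox_ideal_diff(4)[OF ideal_binomial[OF j] binomial_in_ideal[OF j] binomial_in_ideal[OF j]]
        additive_subgroup.zero_closed[OF ideal.axioms(1)[OF ideal_binomial[OF j]]]
      by (intro exI[of _ a]) auto
  next
    case False
    then obtain i where i: "i \<in> {1..j}" "\<And>\<xi>. \<xi> \<in> R i \<Longrightarrow> Poly_Mapping.lookup a \<xi> \<noteq> 0"
      using less.prems unfolding normal_def by auto
    have ik: "i \<le> k" "i \<noteq> 0" using i(1) j by auto
    note fin = finite_R[OF ik(1)] finite_R[of 0, simplified]
    define a' where "a' = a - indicator_exponent (R i)"
    have a': "a = a' + indicator_exponent (R i)"
      by (rule poly_mapping_eqI)
        (use i(2) fin in \<open>auto simp: a'_def lookup_add lookup_minus lookup_indicator_exponent Suc_le_eq\<close>)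
    define b where "b = a' + indicator_exponent (R 0)"
    have ka': "Poly_Mapping.keys a' \<subseteq> rays \<Sigma>"
      using less.prems unfolding a'_def by (auto simp: in_keys_iff lookup_minus subset_iff)
    have kb: "Poly_Mapping.keys b \<subseteq> rays \<Sigma>"
      unfolding b_def using ka' Poly_Mapping.keys_add[of a' "indicator_exponent (R 0)"] R_subset[of 0] fin
      by (auto simp: keys_indicator_exponent)
    have "(\<Sum>i\<in>{1..j}. \<Sum>\<xi>\<in>R i. Poly_Mapping.lookup b \<xi>) < (\<Sum>i\<in>{1..j}. \<Sum>\<xi>\<in>R i. Poly_Mapping.lookup a \<xi>)"
    proof (rule sum_strict_mono_ex1)
      have 0: "\<xi> \<notin> R 0" if "i' \<in> {1..j}" "\<xi> \<in> R i'" for i' \<xi>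
        using that disjoint[of i' 0] j by auto
      show "\<forall>i\<in>{1..j}. (\<Sum>\<xi>\<in>R i. Poly_Mapping.lookup b \<xi>) \<le> (\<Sum>\<xi>\<in>R i. Poly_Mapping.lookup a \<xi>)"
        using 0 fin by (auto intro!: sum_mono simp: a' b_def lookup_add lookup_indicator_exponent)
      have "(\<Sum>\<xi>\<in>R i. Poly_Mapping.lookup b \<xi>) < (\<Sum>\<xi>\<in>R i. Poly_Mapping.lookup a \<xi>)"
        using 0[OF i(1)] fin nonempty[OF ik(1)]
        by (intro sum_strict_mono) (auto simp: a' b_def lookup_add lookup_indicator_exponent)
      then show "\<exists>i\<in>{1..j}. (\<Sum>\<xi>\<in>R i. Poly_Mapping.lookup b \<xi>) < (\<Sum>\<xi>\<in>R i. Poly_Mapping.lookup a \<xi>)" using i(1) by blast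
    qed simp
    from less.hyps[OF this kb] obtain b' where b': "normal j b'"
      "\<And>c. Poly_Mapping.single b c - Poly_Mapping.single b' c \<in> binomial_ideal j" by blast
    have "Poly_Mapping.single a c - Poly_Mapping.single b' c \<in> binomial_ideal j" for c
    proof -
      have "Poly_Mapping.single a' c * binomial i \<in> binomial_ideal j"
        using binomial_in_ideal[OF j i(1)] by (intro cox_ideal_diff(3)[OF ideal_binomial[OF j]] single_carrier ka')
      then have "Poly_Mapping.single a c - Poly_Mapping.single b c \<in> binomial_ideal j"
        by (simp add: binomial_eq right_diff_distrib mult_single a' b_def)
      from cox_ideal_diff(2)[OF ideal_binomial[OF j] this b'(2)[of c]] show ?thesis by simp
    qed
    then show ?thesis using b'(1) by blast
  qed
qed

lemma torus_zeros_exp: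
  assumes "\<And>i. i \<in> {1..j} \<Longrightarrow> (\<Sum>\<xi>\<in>R i. w \<xi>) = (\<Sum>\<xi>\<in>R 0. w \<xi>)" "j \<le> k"
  shows "(\<lambda>\<xi>. exp (of_real (w \<xi>))) \<in> torus_zeros j"
proof -
  have "(\<Prod>\<xi>\<in>R i. exp (complex_of_real (w \<xi>))) = exp (of_real (\<Sum>\<xi>\<in>R i. w \<xi>))" if "i \<le> k" for i
    using finite_R[OF that] by (simp add: exp_sum)
  then have "(\<Prod>\<xi>\<in>R i. exp (complex_of_real (w \<xi>))) = (\<Prod>\<xi>\<in>R 0. exp (complex_of_real (w \<xi>)))" if "i \<in> {1..j}" for i
    using assms(1)[OF that] assms(2) that by (simp del: of_real_sum)
  then show ?thesis by (simp add: torus_zeros_def)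
qed

text \<open>Real weights with equal sums over the blocks 0 to \<open>j\<close> give points of the
  group by exponentiation. If two monomials agree at all of these, their exponent difference
  \<open>d\<close> is orthogonal to all such weights, and suitable weights force \<open>d\<close> to
  vanish on each block.\<close>

lemma normal_separated:
  assumes j: "j \<le> k" and a: "normal j a" and b: "normal j b" and ne: "a \<noteq> b"
  shows "\<exists>x\<in>torus_zeros j. monomial_value a x \<noteq> monomial_value b x"
proof (rule ccontr)
  assume "\<not> ?thesis"
  then have eq: "monomial_value a x = monomial_value b x" if "x \<in> torus_zeros j" for x using that by auto
  define d where "d \<xi> = real (Poly_Mapping.lookup a \<xi>) - real (Poly_Mapping.lookup b \<xi>)" for \<xi>
  have key: "(\<Sum>\<xi>\<in>rays \<Sigma>. w \<xi> * d \<xi>) = 0" if w: "\<And>i. i \<in> {1..j} \<Longrightarrow> (\<Sum>\<xi>\<in>R i. w \<xi>) = (\<Sum>\<xi>\<in>R 0. w \<xi>)" for w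
  proof -
    let ?x = "\<lambda>\<xi>. exp (complex_of_real (w \<xi>))"
    have mv: "monomial_value c ?x = of_real (exp (\<Sum>\<xi>\<in>rays \<Sigma>. real (Poly_Mapping.lookup c \<xi>) * w \<xi>))"
      if "Poly_Mapping.keys c \<subseteq> rays \<Sigma>" for c
      unfolding monomial_value_superset[OF finite_rays that] exp_sum[OF finite_rays]
      by (simp add: exp_of_nat_mult exp_of_real)
    have "exp (\<Sum>\<xi>\<in>rays \<Sigma>. real (Poly_Mapping.lookup a \<xi>) * w \<xi>) = exp (\<Sum>\<xi>\<in>rays \<Sigma>. real (Poly_Mapping.lookup b \<xi>) * w \<xi>)"
    proof -
      have "Poly_Mapping.keys a \<subseteq> rays \<Sigma>" "Poly_Mapping.keys b \<subseteq> rays \<Sigma>" using a b by (auto simp: normal_def)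
      note mv[OF this(1)] mv[OF this(2)] eq[OF torus_zeros_exp[OF w j]]
      then show ?thesis unfolding of_real_eq_iff[symmetric, where 'a = complex] by simp
    qed
    then show ?thesis by (simp add: d_def right_diff_distrib sum_subtractf mult.commute)
  qed
  have memR: "\<xi> \<notin> R i'" if "\<xi> \<in> R i" "i \<le> k" "i' \<le> k" "i \<noteq> i'" for \<xi> i i'
    using that disjoint[of i i'] by auto
  have ind: "(\<Sum>\<zeta>\<in>R i. if \<zeta> = \<xi> then 1 else 0) = (if \<xi> \<in> R i then 1 else (0::real))" if "i \<le> k" for i \<xi>
    using finite_R[OF that] by simp
  have d_R: "d \<xi> = 0" if i: "i \<in> {1..j}" and \<xi>: "\<xi> \<in> R i" for i \<xi>
  proof -
    have ik: "i \<le> k" using i j by auto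
    \<comment> \<open>The weight 1 at \<open>\<zeta>\<close> and -1 at \<open>\<xi>\<close> has zero
      sum over every block, so \<open>d\<close> is constant on the block.\<close>
    have const: "d \<zeta> = d \<xi>" if \<zeta>: "\<zeta> \<in> R i" for \<zeta>
    proof -
      have "(\<Sum>\<upsilon>\<in>R i'. (if \<upsilon> = \<zeta> then 1 else 0) - (if \<upsilon> = \<xi> then 1 else (0::real))) = 0" if "i' \<le> k" for i'
        using ind[OF that] memR[OF \<zeta> ik that] memR[OF \<xi> ik that] \<zeta> \<xi> by (cases "i' = i") (auto simp: sum_subtractf)
      then have "(\<Sum>\<upsilon>\<in>rays \<Sigma>. ((if \<upsilon> = \<zeta> then 1 else 0) - (if \<upsilon> = \<xi> then 1 else 0)) * d \<upsilon>) = 0"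
        using j by (intro key) auto
      moreover have "\<zeta> \<in> rays \<Sigma>" "\<xi> \<in> rays \<Sigma>" using R_subset[OF ik] \<zeta> \<xi> by auto
      ultimately show ?thesis
        using finite_rays by (simp add: left_diff_distrib sum_subtractf if_distrib[of "\<lambda>c. c * _"] cong: if_cong)
    qed
    \<comment> \<open>Normality makes the constant zero: \<open>d\<close> is at most 0 where
      \<open>a\<close> has exponent 0, and at least 0 where \<open>b\<close> has.\<close>
    obtain \<xi>a \<xi>b where "\<xi>a \<in> R i" "Poly_Mapping.lookup a \<xi>a = 0" "\<xi>b \<in> R i" "Poly_Mapping.lookup b \<xi>b = 0"
      using a b i unfolding normal_def by blast
    then show ?thesis using const[of \<xi>a] const[of \<xi>b] by (simp add: d_def)
  qed
  \<comment> \<open>The sums over blocks beyond \<open>j\<close> are not constrained, so a single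
    unit weight is admissible.\<close>
  have d_free: "d \<xi> = 0" if i: "i \<le> k" "i > j" and \<xi>: "\<xi> \<in> R i" for i \<xi>
  proof -
    have "(\<Sum>\<upsilon>\<in>R i'. if \<upsilon> = \<xi> then 1 else (0::real)) = 0" if "i' \<le> j" for i'
      using ind[of i'] memR[OF \<xi>, of i'] that i by auto
    then have "(\<Sum>\<upsilon>\<in>rays \<Sigma>. (if \<upsilon> = \<xi> then 1 else 0) * d \<upsilon>) = 0" by (intro key) auto
    moreover have "\<xi> \<in> rays \<Sigma>" using R_subset[OF i(1)] \<xi> by auto
    ultimately show ?thesis using finite_rays by (simp add: if_distrib[of "\<lambda>c. c * _"] cong: if_cong)
  qed
  have d_0: "d \<xi> = 0" if \<xi>: "\<xi> \<in> R 0" for \<xi>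
  proof -
    have "\<exists>\<zeta>. \<zeta> \<in> R i" if "i \<le> k" for i using nonempty[OF that] by blast
    then obtain y where y: "\<And>i. i \<le> k \<Longrightarrow> y i \<in> R i" by metis
    \<comment> \<open>A unit weight in block 0 has to be balanced by one in each of the blocks 1 to
      \<open>j\<close>, where \<open>d\<close> is already known to be zero.\<close>
    define w where "w \<upsilon> = (if \<upsilon> = \<xi> \<or> \<upsilon> \<in> y ` {1..j} then 1 else (0::real))" for \<upsilon>
    have w1: "(\<Sum>\<upsilon>\<in>R i. w \<upsilon>) = 1" if i: "i \<le> j" for i
    proof -
      define z where "z = (if i = 0 then \<xi> else y i)"
      have ik: "i \<le> k" using i j by auto
      have "w \<upsilon> = (if \<upsilon> = z then 1 else 0)" if \<upsilon>: "\<upsilon> \<in> R i" for \<upsilon>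
      proof -
        have eq: "i' = i" if "\<upsilon> = y i'" "i' \<in> {1..j}" for i'
          using that \<upsilon> memR[OF \<upsilon> ik, of i'] y[of i'] j by auto
        have i0: "i = 0" if "\<upsilon> = \<xi>" using that memR[OF \<upsilon> ik, of 0] \<xi> by auto
        show ?thesis
        proof (cases "i = 0")
          case True
          then have "\<upsilon> \<notin> y ` {1..j}" using eq by fastforce
          then show ?thesis using True by (simp add: w_def z_def)
        next
          case False
          then have "\<upsilon> \<noteq> \<xi>" "i \<in> {1..j}" using i0 i by auto
          then have "\<upsilon> \<in> y ` {1..j} \<longleftrightarrow> \<upsilon> = y i" using eq by blast
          then show ?thesis using False \<open>\<upsilon> \<noteq> \<xi>\<close> by (simp add: w_def z_def)
        qed
      qed
      then have "(\<Sum>\<upsilon>\<in>R i. w \<upsilon>) = (\<Sum>\<upsilon>\<in>R i. if \<upsilon> = z then 1 else 0)" by (intro sum.cong) auto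
      also have "\<dots> = 1" using ind[OF ik, of z] y[OF ik] \<xi> by (auto simp: z_def)
      finally show ?thesis .
    qed
    have "(\<Sum>\<upsilon>\<in>rays \<Sigma>. w \<upsilon> * d \<upsilon>) = 0" using w1 by (intro key) auto
    moreover have "w \<upsilon> * d \<upsilon> = (if \<upsilon> = \<xi> then d \<upsilon> else 0)" for \<upsilon>
      using d_R y j by (auto simp: w_def)
    moreover have "\<xi> \<in> rays \<Sigma>" using R_subset[of 0] \<xi> by auto
    ultimately show ?thesis using finite_rays by simp
  qed
  have "Poly_Mapping.lookup a \<xi> = Poly_Mapping.lookup b \<xi>" for \<xi>
  proof (cases "\<xi> \<in> rays \<Sigma>")
    case True
    then obtain i where i: "i \<le> k" "\<xi> \<in> R i" using rays_eq by auto
    have "d \<xi> = 0"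
    proof (cases "i = 0")
      case True
      then show ?thesis using d_0 i by simp
    next
      case False
      then show ?thesis using d_R[of i \<xi>] d_free[of i \<xi>] i by (cases "i \<le> j") auto
    qed
    then show ?thesis by (simp add: d_def)
  next
    case False
    then show ?thesis using a b unfolding normal_def by (metis in_keys_iff subsetD)
  qed
  then show False using ne poly_mapping_eqI by blast
qed

theorem binomial_ideal_iff:
  assumes j: "j \<le> k" and g: "g \<in> carrier (cox_ring \<Sigma>)"
  shows "g \<in> binomial_ideal j \<longleftrightarrow> (\<forall>x\<in>torus_zeros j. eval_poly g x = 0)"
proof
  assume "g \<in> binomial_ideal j"
  then show "\<forall>x\<in>torus_zeros j. eval_poly g x = 0"
    using binomial_ideal_vanishes_iff[OF j] by (auto simp: torus_zeros_def)
next
  assume g0: "\<forall>x\<in>torus_zeros j. eval_poly g x = 0"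
  let ?K = "Poly_Mapping.keys g" and ?l = "Poly_Mapping.lookup g"
  have "\<exists>b. normal j b \<and> (\<forall>c. Poly_Mapping.single a c - Poly_Mapping.single b c \<in> binomial_ideal j)" if "a \<in> ?K" for a
    using that g monomial_reduction[OF j] by (auto simp: carrier_cox_ring)
  then obtain nf where nf: "\<And>a. a \<in> ?K \<Longrightarrow> normal j (nf a)"
    "\<And>a c. a \<in> ?K \<Longrightarrow> Poly_Mapping.single a c - Poly_Mapping.single (nf a) c \<in> binomial_ideal j" by metis
  \<comment> \<open>Different monomials may share a normal form; their coefficients are then added
    in \<open>h\<close> and may cancel.\<close>
  define h where "h = (\<Sum>a\<in>?K. Poly_Mapping.single (nf a) (?l a))"
  have sumI: "(\<Sum>a\<in>A. F a) \<in> binomial_ideal j" if "finite A" "\<And>a. a \<in> A \<Longrightarrow> F a \<in> binomial_ideal j" for A :: "('a set \<Rightarrow>\<^sub>0 nat) set" and F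
    using that
  proof (induction A rule: finite_induct)
    case empty
    then show ?case using additive_subgroup.zero_closed[OF ideal.axioms(1)[OF ideal_binomial[OF j]]] by simp
  qed (auto intro: cox_ideal_diff(2)[OF ideal_binomial[OF j]])
  have gh: "g - h = (\<Sum>a\<in>?K. Poly_Mapping.single a (?l a) - Poly_Mapping.single (nf a) (?l a))"
    unfolding h_def sum_subtractf using poly_mapping_expansion[of g] by simp
  have ghI: "g - h \<in> binomial_ideal j"
    unfolding gh by (rule sumI) (auto intro: nf)
  have h0: "eval_poly h x = 0" if x: "x \<in> torus_zeros j" for x
  proof -
    have "eval_poly (g - h) x = 0" using ghI x binomial_ideal_vanishes_iff[OF j] by (auto simp: torus_zeros_def)
    then show ?thesis using g0 x by (simp add: eval_poly_diff)
  qed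
  have "Poly_Mapping.keys h \<subseteq> nf ` ?K"
    unfolding h_def using Poly_Mapping.keys_sum[of "\<lambda>a. Poly_Mapping.single (nf a) (?l a)" ?K] by (auto split: if_splits)
  then have normal: "normal j b" if "b \<in> Poly_Mapping.keys h" for b using that nf(1) by auto
  have "\<forall>b\<in>Poly_Mapping.keys h. Poly_Mapping.lookup h b = 0"
  proof (rule characters_independent[where \<eta> = monomial_value and G = "torus_zeros j"
        and m = "\<lambda>x y \<rho>. x \<rho> * y \<rho>" and u = "\<lambda>_. 1"])
    show "monomial_value s (\<lambda>\<rho>. x \<rho> * y \<rho>) = monomial_value s x * monomial_value s y" for s x y
      by (rule monomial_value_mult)
    show "\<exists>x\<in>torus_zeros j. monomial_value s x \<noteq> monomial_value t x"
      if "s \<in> Poly_Mapping.keys h" "t \<in> Poly_Mapping.keys h" "s \<noteq> t" for s t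
      using that normal normal_separated[OF j] by auto
    show "(\<Sum>s\<in>Poly_Mapping.keys h. Poly_Mapping.lookup h s * monomial_value s x) = 0" if "x \<in> torus_zeros j" for x
      using h0[OF that] by (simp add: eval_poly_monomial_value)
  qed (auto simp: torus_zeros_def prod.distrib monomial_value_def)
  then have "h = 0" by (auto intro!: poly_mapping_eqI simp: in_keys_iff)
  then show "g \<in> binomial_ideal j" using ghI by simp
qed

lemma isCont_eval_poly_upd: "isCont (\<lambda>s. eval_poly g (x(y := x y * s))) s0"
proof -
  have "isCont (\<lambda>s. (x(y := x y * s)) \<rho>) s0" for \<rho>
    by (cases "\<rho> = y") (auto intro!: continuous_intros)
  then show ?thesis unfolding eval_poly_def by (intro continuous_intros) auto
qed

text \<open>Off a hyperplane in the direction of a variable of the \<open>i\<close>-th monomial, the \<open>i\<close>-th binomial does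
  not vanish; this variable is not involved in the previous binomials.\<close>

lemma binomial_nonzerodivisor:
  assumes i: "i \<in> {1..k}" and g: "g \<in> carrier (cox_ring \<Sigma>)"
    and fg: "binomial i * g \<in> binomial_ideal (i - 1)"
  shows "g \<in> binomial_ideal (i - 1)"
proof -
  have ik: "i \<le> k" and i1k: "i - 1 \<le> k" using i by auto
  have "eval_poly g x = 0" if x: "x \<in> torus_zeros (i - 1)" for x
  proof (rule ccontr)
    assume nz: "eval_poly g x \<noteq> 0"
    obtain y where y: "y \<in> R i" using nonempty[OF ik] by blast
    define P where "P = (\<Prod>\<xi>\<in>R i. x \<xi>)"
    define Q where "Q = (\<Prod>\<xi>\<in>R 0. x \<xi>)"
    have P: "P \<noteq> 0" using x finite_R[OF ik] by (auto simp: P_def torus_zeros_def)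
    let ?x = "\<lambda>s. x(y := x y * s)"
    have other: "(\<Prod>\<xi>\<in>R i'. ?x s \<xi>) = (\<Prod>\<xi>\<in>R i'. x \<xi>)" if "i' \<le> k" "i' \<noteq> i" for i' s
      using y disjoint[OF that(1) ik that(2)] by (intro prod.cong) auto
    have same: "(\<Prod>\<xi>\<in>R i. ?x s \<xi>) = s * P" for s
      unfolding P_def using finite_R[OF ik] y by (simp add: prod.remove[of "R i" y])
    \<comment> \<open>For \<open>s = 0\<close> the point leaves the torus, and for
      \<open>s = Q / P\<close> the \<open>i\<close>-th binomial vanishes. At every other
      \<open>s\<close> the binomial is nonzero while its product with \<open>g\<close> is
      zero.\<close>
    have zero: "eval_poly g (?x s) = 0" if s: "s \<noteq> 0" "s \<noteq> Q / P" for s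
    proof -
      have "?x s \<in> torus_zeros (i - 1)"
        using x s(1) other i by (auto simp: torus_zeros_def)
      then have "eval_poly (binomial i) (?x s) * eval_poly g (?x s) = 0"
        using binomial_ideal_iff[OF i1k, of "binomial i * g"] fg binomial_ideal_carrier[OF i1k]
        unfolding eval_poly_mult[symmetric] by blast
      moreover have "eval_poly (binomial i) (?x s) = s * P - Q"
        using other[of 0 s] same[of s] i by (simp add: eval_binomial[OF ik] Q_def)
      ultimately show ?thesis using s P by (auto simp: field_simps)
    qed
    have "eval_poly g (?x 1) \<noteq> 0" using nz by simp
    then obtain e where e: "e > 0" "\<And>s. dist 1 s < e \<Longrightarrow> eval_poly g (?x s) \<noteq> 0"
      using continuous_at_avoid[OF isCont_eval_poly_upd, of g x y 1 0] by blast
    have "infinite (ball (1::complex) e)" using uncountable_ball[OF e(1)] countable_finite by blast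
    then have "\<not> ball 1 e \<subseteq> {0, Q / P}" by (meson finite.simps finite_subset)
    then obtain s where "s \<in> ball 1 e" "s \<noteq> 0" "s \<noteq> Q / P" by blast
    then show False using e(2)[of s] zero[of s] by simp
  qed
  then show ?thesis using binomial_ideal_iff[OF i1k g] by blast
qed

lemma regular_sequence_binomials: "regular_sequence (cox_ring \<Sigma>) k binomial"
  unfolding regular_sequence_def
proof (intro conjI ballI impI)
  fix i g assume i: "i \<in> {1..k}" and g: "g \<in> carrier (cox_ring \<Sigma>)"
    and fg: "binomial i \<otimes>\<^bsub>cox_ring \<Sigma>\<^esub> g \<in> Idl\<^bsub>cox_ring \<Sigma>\<^esub> (binomial ` {1..<i})"
  have "{1..<i} = {1..i - 1}" using i by auto
  then show "g \<in> Idl\<^bsub>cox_ring \<Sigma>\<^esub> (binomial ` {1..<i})"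
    using binomial_nonzerodivisor[OF i g] fg by (simp add: binomial_ideal_def)
next
  have "\<forall>g\<in>binomial_ideal k. eval_poly g (\<lambda>_. 1) = 0"
    using binomial_ideal_vanishes_iff[of k "\<lambda>_. 1"] by auto
  then have "1 \<notin> binomial_ideal k" using eval_poly_1 by (metis zero_neq_one)
  moreover have "1 \<in> carrier (cox_ring \<Sigma>)" by (simp add: carrier_cox_ring)
  ultimately show "Idl\<^bsub>cox_ring \<Sigma>\<^esub> (binomial ` {1..k}) \<noteq> carrier (cox_ring \<Sigma>)"
    unfolding binomial_ideal_def by auto
qed

text \<open>The polynomials vanishing on a set of points form a radical ideal, and
  \<open>binomial_ideal_iff\<close> presents the ideal in this way.\<close>

lemma radical_ideal_binomials: "radical_ideal (cox_ring \<Sigma>) (binomial_ideal k)"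
  unfolding radical_ideal_def
proof (intro conjI ballI allI impI)
  show "ideal (binomial_ideal k) (cox_ring \<Sigma>)" by (rule ideal_binomial) simp
  fix g and n :: nat assume g: "g \<in> carrier (cox_ring \<Sigma>)" and gn: "g [^]\<^bsub>cox_ring \<Sigma>\<^esub> n \<in> binomial_ideal k"
  have pow: "eval_poly (g ^ n) x = eval_poly g x ^ n" for x
    by (induction n) (simp_all add: eval_poly_1 eval_poly_mult)
  have "eval_poly (g ^ n) x = 0" if "x \<in> torus_zeros k" for x
    using gn that binomial_ideal_vanishes_iff[of k x] by (auto simp: cox_ring_pow torus_zeros_def)
  then show "g \<in> binomial_ideal k"
    using binomial_ideal_iff[of k g] g pow by auto
qed

end

section \<open>Toric closed embeddings\<close>

lemma (in chart_fan) openin_toricE: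
  assumes "openin (toric_topology L \<Sigma>) W" "\<sigma> \<in> \<Sigma>" "\<gamma> \<in> chart L \<sigma>" "chart_point L \<Sigma> \<sigma> \<gamma> \<in> W"
  obtains f where "f \<in> chart_functions L \<sigma>" "f \<gamma> \<noteq> 0"
    "\<And>\<delta>. \<delta> \<in> chart L \<sigma> \<Longrightarrow> f \<delta> \<noteq> 0 \<Longrightarrow> chart_point L \<Sigma> \<sigma> \<delta> \<in> W"
proof -
  have "\<exists>f\<in>chart_functions L \<sigma>. f \<gamma> \<noteq> 0 \<and> (\<forall>\<delta>\<in>chart L \<sigma>. f \<delta> \<noteq> 0 \<longrightarrow> chart_point L \<Sigma> \<sigma> \<delta> \<in> W)"
    using assms unfolding openin_toric_iff by simp
  then show ?thesis using that by blast
qed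

text \<open>\<open>\<psi>\<close> is the adjoint of \<open>\<phi>\<close>, and the pairs \<open>(\<sigma>, \<sigma>')\<close> in \<open>\<C>\<close> are cones with \<open>\<phi>\<close> mapping \<open>\<sigma>\<close> into
  \<open>\<sigma>'\<close> for which the map of charts \<open>U\<^sub>\<sigma> \<rightarrow> U\<^sub>\<sigma>\<^sub>'\<close> is a closed embedding.\<close>

locale toric_embedding = dom: chart_fan L \<Sigma> + cod: chart_fan L' \<Sigma>'
  for L :: "'a::euclidean_space set" and \<Sigma> and L' :: "'b::euclidean_space set" and \<Sigma>' +
  fixes \<phi> :: "'a \<Rightarrow> 'b" and \<psi> :: "'b \<Rightarrow> 'a" and \<C> :: "('a set \<times> 'b set) set"
  assumes \<psi>_dual: "m' \<in> dual_lattice L' \<Longrightarrow> \<psi> m' \<in> dual_lattice L"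
    and dual_map_eq: "m' \<in> dual_lattice L' \<Longrightarrow> dual_map L \<phi> m' = \<psi> m'"
    and \<psi>_0: "\<psi> 0 = 0" and \<psi>_add: "\<psi> (m + n) = \<psi> m + \<psi> n"
    and adjoint: "m' \<in> dual_lattice L' \<Longrightarrow> \<psi> m' \<bullet> v = m' \<bullet> \<phi> v"
    and \<C>: "(\<sigma>, \<sigma>') \<in> \<C> \<Longrightarrow> \<sigma> \<in> \<Sigma> \<and> \<sigma>' \<in> \<Sigma>' \<and> \<phi> ` \<sigma> \<subseteq> \<sigma>'"
    and cover: "\<tau> \<in> \<Sigma> \<Longrightarrow> \<exists>(\<sigma>, \<sigma>')\<in>\<C>. \<tau> \<subseteq> \<sigma>"
    and cover': "\<tau>' \<in> \<Sigma>' \<Longrightarrow> \<exists>(\<sigma>, \<sigma>')\<in>\<C>. \<tau>' \<subseteq> \<sigma>'"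
    and separation2: "(\<sigma>, \<sigma>') \<in> \<C> \<Longrightarrow> (\<tau>, \<tau>') \<in> \<C> \<Longrightarrow>
      \<exists>m. localizes L' \<sigma>' (\<sigma>' \<inter> \<tau>') m \<and> localizes L \<sigma> (\<sigma> \<inter> \<tau>) (\<psi> m)"
    and lift: "(\<sigma>, \<sigma>') \<in> \<C> \<Longrightarrow> l \<in> dual_monoid L \<sigma> \<Longrightarrow> \<exists>l'\<in>dual_monoid L' \<sigma>'. \<psi> l' = l"
begin

definition push :: "'b set \<Rightarrow> ('a \<Rightarrow> complex) \<Rightarrow> 'b \<Rightarrow> complex" where
  "push \<sigma>' \<gamma> = (\<lambda>m'\<in>dual_monoid L' \<sigma>'. \<gamma> (\<psi> m'))"

abbreviation morphism :: "'a toric_point \<Rightarrow> 'b toric_point" where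
  "morphism \<equiv> toric_morphism L \<Sigma> L' \<Sigma>' \<phi>"

abbreviation image :: "'b toric_point set" where
  "image \<equiv> morphism ` toric_points L \<Sigma>"

lemma \<psi>_monoid: "\<phi> ` \<sigma> \<subseteq> \<sigma>' \<Longrightarrow> m' \<in> dual_monoid L' \<sigma>' \<Longrightarrow> \<psi> m' \<in> dual_monoid L \<sigma>"
  by (auto simp: dual_monoid_def \<psi>_dual adjoint)

lemma \<psi>_scale: "\<psi> (of_nat c *\<^sub>R m) = of_nat c *\<^sub>R \<psi> m"
  by (induction c) (auto simp: \<psi>_0 \<psi>_add scaleR_add_left)

lemma push_chart:
  assumes "\<phi> ` \<sigma> \<subseteq> \<sigma>'" "\<gamma> \<in> chart L \<sigma>"
  shows "push \<sigma>' \<gamma> \<in> chart L' \<sigma>'"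
  unfolding push_def using \<psi>_monoid[OF assms(1)]
  by (intro chartI) (auto simp: \<psi>_0 \<psi>_add chartD(1)[OF assms(2)] intro!: chartD(2)[OF assms(2)])

lemma push_apply: "m' \<in> dual_monoid L' \<sigma>' \<Longrightarrow> push \<sigma>' \<gamma> m' = \<gamma> (\<psi> m')"
  by (simp add: push_def)

lemma push_dual_map: "(\<lambda>m'\<in>dual_monoid L' \<sigma>'. \<gamma> (dual_map L \<phi> m')) = push \<sigma>' \<gamma>"
  unfolding push_def by (intro restrict_ext) (simp add: dual_map_eq dual_monoid_dual_lattice)

lemma push_restrict:
  assumes "\<phi> ` \<sigma> \<subseteq> \<sigma>'" "\<tau>' \<subseteq> \<sigma>'"
  shows "push \<sigma>' (restrict \<delta> (dual_monoid L \<sigma>)) = restrict (push \<tau>' \<delta>) (dual_monoid L' \<sigma>')"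
  unfolding push_def using \<psi>_monoid[OF assms(1)] dual_monoid_antimono[OF assms(2), of L']
  by (intro ext) (auto simp: restrict_def)

text \<open>The definite description in the toric morphism has to be unique: two presentations of a
  point meet over the intersection of their cones, and \<open>push\<close> commutes with
  restriction.\<close>

lemma morphism_chart_point:
  assumes \<sigma>: "\<sigma> \<in> \<Sigma>" "\<gamma> \<in> chart L \<sigma>" "\<sigma>' \<in> \<Sigma>'" "\<phi> ` \<sigma> \<subseteq> \<sigma>'"
  shows "morphism (chart_point L \<Sigma> \<sigma> \<gamma>) = chart_point L' \<Sigma>' \<sigma>' (push \<sigma>' \<gamma>)"
  unfolding toric_morphism_def push_dual_map
proof (rule the_equality)
  show "\<exists>\<tau>\<in>\<Sigma>. \<exists>\<delta>\<in>chart L \<tau>. \<exists>\<tau>'\<in>\<Sigma>'. chart_point L \<Sigma> \<sigma> \<gamma> = chart_point L \<Sigma> \<tau> \<delta> \<and> \<phi> ` \<tau> \<subseteq> \<tau>' \<and>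
      chart_point L' \<Sigma>' \<sigma>' (push \<sigma>' \<gamma>) = chart_point L' \<Sigma>' \<tau>' (push \<tau>' \<delta>)"
    using assms by blast
  fix q assume "\<exists>\<tau>\<in>\<Sigma>. \<exists>\<delta>\<in>chart L \<tau>. \<exists>\<tau>'\<in>\<Sigma>'. chart_point L \<Sigma> \<sigma> \<gamma> = chart_point L \<Sigma> \<tau> \<delta> \<and> \<phi> ` \<tau> \<subseteq> \<tau>' \<and>
      q = chart_point L' \<Sigma>' \<tau>' (push \<tau>' \<delta>)"
  then obtain \<tau> \<delta> \<tau>' where \<tau>: "\<tau> \<in> \<Sigma>" "\<delta> \<in> chart L \<tau>" "\<tau>' \<in> \<Sigma>'" "chart_point L \<Sigma> \<sigma> \<gamma> = chart_point L \<Sigma> \<tau> \<delta>"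
    "\<phi> ` \<tau> \<subseteq> \<tau>'" "q = chart_point L' \<Sigma>' \<tau>' (push \<tau>' \<delta>)" by blast
  then obtain \<epsilon> where \<epsilon>: "\<epsilon> \<in> chart L (\<sigma> \<inter> \<tau>)" "restrict \<epsilon> (dual_monoid L \<sigma>) = \<gamma>" "restrict \<epsilon> (dual_monoid L \<tau>) = \<delta>"
    using dom.chart_point_eq_iff[OF \<sigma>(1,2) \<tau>(1,2)] by blast
  have sub: "\<phi> ` (\<sigma> \<inter> \<tau>) \<subseteq> \<sigma>' \<inter> \<tau>'" using \<sigma>(4) \<tau>(5) by blast
  have "restrict (push (\<sigma>' \<inter> \<tau>') \<epsilon>) (dual_monoid L' \<sigma>') = push \<sigma>' \<gamma>"
    unfolding \<epsilon>(2)[symmetric] using push_restrict[OF \<sigma>(4), of "\<sigma>' \<inter> \<tau>'" \<epsilon>] by simp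
  moreover have "restrict (push (\<sigma>' \<inter> \<tau>') \<epsilon>) (dual_monoid L' \<tau>') = push \<tau>' \<delta>"
    unfolding \<epsilon>(3)[symmetric] using push_restrict[OF \<tau>(5), of "\<sigma>' \<inter> \<tau>'" \<epsilon>] by simp
  ultimately show "q = chart_point L' \<Sigma>' \<sigma>' (push \<sigma>' \<gamma>)"
    unfolding \<tau>(6)
    using cod.chart_point_eq_iff[OF \<tau>(3) push_chart[OF \<tau>(5,2)] \<sigma>(3) push_chart[OF \<sigma>(4,2)]]
      push_chart[OF sub \<epsilon>(1)] by (metis Int_commute)
qed

lemma point_in_\<C>:
  assumes "p \<in> toric_points L \<Sigma>"
  obtains \<sigma> \<sigma>' \<gamma> where "(\<sigma>, \<sigma>') \<in> \<C>" "\<gamma> \<in> chart L \<sigma>" "p = chart_point L \<Sigma> \<sigma> \<gamma>"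
proof -
  obtain \<tau> \<delta> where \<tau>: "\<tau> \<in> \<Sigma>" "\<delta> \<in> chart L \<tau>" "p = chart_point L \<Sigma> \<tau> \<delta>" using dom.toric_pointsE[OF assms] .
  obtain \<sigma> \<sigma>' where c: "(\<sigma>, \<sigma>') \<in> \<C>" "\<tau> \<subseteq> \<sigma>" using cover[OF \<tau>(1)] by blast
  show ?thesis
    using dom.chart_point_restrict[of \<sigma> \<tau> \<delta>] \<C>[OF c(1)] \<tau> c restrict_chart[OF \<tau>(2) c(2)] that by metis
qed

lemma morphism_\<C>:
  "(\<sigma>, \<sigma>') \<in> \<C> \<Longrightarrow> \<gamma> \<in> chart L \<sigma> \<Longrightarrow> morphism (chart_point L \<Sigma> \<sigma> \<gamma>) = chart_point L' \<Sigma>' \<sigma>' (push \<sigma>' \<gamma>)"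
  using \<C> morphism_chart_point by blast

lemma image_subset: "image \<subseteq> toric_points L' \<Sigma>'"
proof clarify
  fix p assume "p \<in> toric_points L \<Sigma>"
  then obtain \<sigma> \<sigma>' \<gamma> where p: "(\<sigma>, \<sigma>') \<in> \<C>" "\<gamma> \<in> chart L \<sigma>" "p = chart_point L \<Sigma> \<sigma> \<gamma>" using point_in_\<C> by blast
  then show "morphism p \<in> toric_points L' \<Sigma>'"
    unfolding p(3) morphism_\<C>[OF p(1,2)]
    using \<C>[OF p(1)] by (intro cod.chart_point_in_points push_chart[OF _ p(2)]) auto
qed

text \<open>Equality of the images only provides a common point over
  \<open>\<sigma>1' \<inter> \<sigma>2'\<close>. One character \<open>m\<close> localizes to the
  target overlap while \<open>\<psi> m\<close> localizes to the source overlap, so nonvanishing at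
  the image puts the first source point over \<open>\<sigma>1 \<inter> \<sigma>2\<close>.\<close>

lemma inj_on_morphism: "inj_on morphism (toric_points L \<Sigma>)"
proof (rule inj_onI)
  fix p1 p2 assume "p1 \<in> toric_points L \<Sigma>" "p2 \<in> toric_points L \<Sigma>" and eq: "morphism p1 = morphism p2"
  obtain \<sigma>1 \<sigma>1' \<gamma>1 where 1: "(\<sigma>1, \<sigma>1') \<in> \<C>" "\<gamma>1 \<in> chart L \<sigma>1" "p1 = chart_point L \<Sigma> \<sigma>1 \<gamma>1"
    using point_in_\<C>[OF \<open>p1 \<in> toric_points L \<Sigma>\<close>] .
  obtain \<sigma>2 \<sigma>2' \<gamma>2 where 2: "(\<sigma>2, \<sigma>2') \<in> \<C>" "\<gamma>2 \<in> chart L \<sigma>2" "p2 = chart_point L \<Sigma> \<sigma>2 \<gamma>2"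
    using point_in_\<C>[OF \<open>p2 \<in> toric_points L \<Sigma>\<close>] .
  have C1: "\<sigma>1 \<in> \<Sigma>" "\<sigma>1' \<in> \<Sigma>'" "\<phi> ` \<sigma>1 \<subseteq> \<sigma>1'" and C2: "\<sigma>2 \<in> \<Sigma>" "\<sigma>2' \<in> \<Sigma>'" "\<phi> ` \<sigma>2 \<subseteq> \<sigma>2'"
    using \<C> 1(1) 2(1) by auto
  have "chart_point L' \<Sigma>' \<sigma>1' (push \<sigma>1' \<gamma>1) = chart_point L' \<Sigma>' \<sigma>2' (push \<sigma>2' \<gamma>2)"
    using eq unfolding 1(3) 2(3) morphism_\<C>[OF 1(1,2)] morphism_\<C>[OF 2(1,2)] .
  then obtain \<delta>' where \<delta>': "\<delta>' \<in> chart L' (\<sigma>1' \<inter> \<sigma>2')" "restrict \<delta>' (dual_monoid L' \<sigma>1') = push \<sigma>1' \<gamma>1"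
    "restrict \<delta>' (dual_monoid L' \<sigma>2') = push \<sigma>2' \<gamma>2"
    using cod.chart_point_eq_iff[OF C1(2) push_chart[OF C1(3) 1(2)] C2(2) push_chart[OF C2(3) 2(2)]] by blast
  have d1: "\<delta>' n = \<gamma>1 (\<psi> n)" if "n \<in> dual_monoid L' \<sigma>1'" for n
    using fun_cong[OF \<delta>'(2), of n] that by (simp add: push_apply)
  have d2: "\<delta>' n = \<gamma>2 (\<psi> n)" if "n \<in> dual_monoid L' \<sigma>2'" for n
    using fun_cong[OF \<delta>'(3), of n] that by (simp add: push_apply)
  obtain m where m: "localizes L' \<sigma>1' (\<sigma>1' \<inter> \<sigma>2') m" "localizes L \<sigma>1 (\<sigma>1 \<inter> \<sigma>2) (\<psi> m)"
    using separation2[OF 1(1) 2(1)] by blast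
  have nz: "\<gamma>1 (\<psi> m) \<noteq> 0" using localizes_unit[OF m(1) \<delta>'(1)] d1[OF localizesD(2)[OF m(1)]] by simp
  obtain \<delta> where \<delta>: "\<delta> \<in> chart L (\<sigma>1 \<inter> \<sigma>2)" "restrict \<delta> (dual_monoid L \<sigma>1) = \<gamma>1"
    using localizes_extend[OF m(2) 1(2) nz] .
  have dd: "\<delta> n = \<gamma>1 n" if "n \<in> dual_monoid L \<sigma>1" for n using fun_cong[OF \<delta>(2), of n] that by simp
  have "\<delta> n = \<gamma>2 n" if n: "n \<in> dual_monoid L \<sigma>2" for n
  proof -
    \<comment> \<open>A lift of \<open>n\<close> is shifted by a multiple of \<open>m\<close> into
      the monoid of \<open>\<sigma>1'\<close>, where the common image point is known through
      \<open>\<gamma>1\<close>.\<close>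
    obtain n' where n': "n' \<in> dual_monoid L' \<sigma>2'" "\<psi> n' = n" using lift[OF 2(1) n] by blast
    have n'': "n' \<in> dual_monoid L' (\<sigma>1' \<inter> \<sigma>2')" using n'(1) dual_monoid_antimono[of "\<sigma>1' \<inter> \<sigma>2'" \<sigma>2' L'] by auto
    obtain c :: nat where c: "n' + of_nat c *\<^sub>R m \<in> dual_monoid L' \<sigma>1'" using m(1) n'' unfolding localizes_def by blast
    have pc: "n + of_nat c *\<^sub>R \<psi> m \<in> dual_monoid L \<sigma>1" using \<psi>_monoid[OF C1(3) c] by (simp add: \<psi>_add \<psi>_scale n'(2))
    have nn: "n \<in> dual_monoid L (\<sigma>1 \<inter> \<sigma>2)" using n dual_monoid_antimono[of "\<sigma>1 \<inter> \<sigma>2" \<sigma>2 L] by auto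
    have "\<delta> n * \<delta> (\<psi> m) ^ c = \<delta> (n + of_nat c *\<^sub>R \<psi> m)"
      using chartD(2)[OF \<delta>(1) nn dual_monoid_scale[OF localizesD(3)[OF m(2)]]] chart_scale[OF \<delta>(1) localizesD(3)[OF m(2)]] by simp
    also have "\<dots> = \<delta>' (n' + of_nat c *\<^sub>R m)" using dd[OF pc] d1[OF c] by (simp add: \<psi>_add \<psi>_scale n'(2))
    also have "\<dots> = \<delta>' n' * \<delta>' m ^ c"
      using chartD(2)[OF \<delta>'(1) n'' dual_monoid_scale[OF localizesD(3)[OF m(1)]]] chart_scale[OF \<delta>'(1) localizesD(3)[OF m(1)]] by simp
    also have "\<dots> = \<gamma>2 n * \<delta> (\<psi> m) ^ c"
      using d2[OF n'(1)] n'(2) d1[OF localizesD(2)[OF m(1)]] dd[OF localizesD(2)[OF m(2)]] by simp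
    finally show ?thesis using nz dd[OF localizesD(2)[OF m(2)]] by simp
  qed
  then have "restrict \<delta> (dual_monoid L \<sigma>2) = \<gamma>2"
    using extensionalityI[OF restrict_extensional chartD(3)[OF 2(2)]] by simp
  then show "p1 = p2"
    unfolding 1(3) 2(3) using dom.chart_point_eq_iff[OF C1(1) 1(2) C2(1) 2(2)] \<delta> by blast
qed

text \<open>As \<open>\<psi>\<close> maps the monoids onto each other, a homomorphism that is
  constant on its fibres descends; \<open>s\<close> is any section of \<open>\<psi>\<close>.\<close>

lemma push_factor:
  assumes c: "(\<sigma>, \<sigma>') \<in> \<C>" and \<gamma>': "\<gamma>' \<in> chart L' \<sigma>'"
    and eq: "\<And>n n'. n \<in> dual_monoid L' \<sigma>' \<Longrightarrow> n' \<in> dual_monoid L' \<sigma>' \<Longrightarrow> \<psi> n = \<psi> n' \<Longrightarrow> \<gamma>' n = \<gamma>' n'"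
  obtains \<gamma> where "\<gamma> \<in> chart L \<sigma>" "\<gamma>' = push \<sigma>' \<gamma>"
proof -
  obtain s where s: "\<And>n. n \<in> dual_monoid L \<sigma> \<Longrightarrow> s n \<in> dual_monoid L' \<sigma>' \<and> \<psi> (s n) = n"
    using lift[OF c] by metis
  note sub = \<C>[OF c]
  define \<gamma> where "\<gamma> = restrict (\<lambda>n. \<gamma>' (s n)) (dual_monoid L \<sigma>)"
  show ?thesis
  proof
    show "\<gamma> \<in> chart L \<sigma>"
      unfolding \<gamma>_def
    proof (rule chartI)
      have "\<gamma>' (s 0) = \<gamma>' 0" using s[OF dual_monoid_0] by (intro eq dual_monoid_0) (auto simp: \<psi>_0)
      then show "\<gamma>' (s 0) = 1" using chartD(1)[OF \<gamma>'] by simp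
      fix n n' assume n: "n \<in> dual_monoid L \<sigma>" "n' \<in> dual_monoid L \<sigma>"
      have "\<gamma>' (s (n + n')) = \<gamma>' (s n + s n')"
        using s[OF n(1)] s[OF n(2)] s[OF dual_monoid_add[OF n]] by (intro eq dual_monoid_add) (auto simp: \<psi>_add)
      then show "\<gamma>' (s (n + n')) = \<gamma>' (s n) * \<gamma>' (s n')"
        using s[OF n(1)] s[OF n(2)] chartD(2)[OF \<gamma>'] by simp
    qed
    show "\<gamma>' = push \<sigma>' \<gamma>"
    proof (rule extensionalityI[OF chartD(3)[OF \<gamma>']])
      show "push \<sigma>' \<gamma> \<in> extensional (dual_monoid L' \<sigma>')" by (simp add: push_def)
      fix n assume n: "n \<in> dual_monoid L' \<sigma>'"
      then have "\<psi> n \<in> dual_monoid L \<sigma>" using \<psi>_monoid sub by blast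
      then show "\<gamma>' n = push \<sigma>' \<gamma> n" using s n by (auto simp: push_apply \<gamma>_def intro!: eq)
    qed
  qed
qed

text \<open>The point of the source may be presented through another pair of cones. Constancy on the
  fibres of \<open>\<psi>\<close> is therefore checked on the overlap, after multiplication by a
  power of an inverted character.\<close>

lemma image_chart:
  assumes c: "(\<sigma>, \<sigma>') \<in> \<C>" and \<gamma>': "\<gamma>' \<in> chart L' \<sigma>'" and im: "chart_point L' \<Sigma>' \<sigma>' \<gamma>' \<in> image"
  obtains \<gamma> where "\<gamma> \<in> chart L \<sigma>" "\<gamma>' = push \<sigma>' \<gamma>"
proof (rule push_factor[OF c \<gamma>'])
  obtain p where p: "p \<in> toric_points L \<Sigma>" "chart_point L' \<Sigma>' \<sigma>' \<gamma>' = morphism p" using im by blast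
  obtain \<tau> \<tau>' \<beta> where t: "(\<tau>, \<tau>') \<in> \<C>" "\<beta> \<in> chart L \<tau>" "p = chart_point L \<Sigma> \<tau> \<beta>"
    using point_in_\<C>[OF p(1)] .
  have eq: "chart_point L' \<Sigma>' \<sigma>' \<gamma>' = chart_point L' \<Sigma>' \<tau>' (push \<tau>' \<beta>)"
    using p(2) morphism_\<C>[OF t(1,2)] t(3) by simp
  note C = \<C>[OF c] \<C>[OF t(1)]
  obtain \<delta> where \<delta>: "\<delta> \<in> chart L' (\<sigma>' \<inter> \<tau>')" "restrict \<delta> (dual_monoid L' \<sigma>') = \<gamma>'"
    "restrict \<delta> (dual_monoid L' \<tau>') = push \<tau>' \<beta>"
    using cod.chart_point_eq_iff[of \<sigma>' \<gamma>' \<tau>' "push \<tau>' \<beta>"] C \<gamma>' t(2) push_chart eq by blast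
  obtain m where m: "localizes L' \<tau>' (\<sigma>' \<inter> \<tau>') m" using cod.separation[of \<sigma>' \<tau>'] C by blast
  have sub: "dual_monoid L' \<sigma>' \<subseteq> dual_monoid L' (\<sigma>' \<inter> \<tau>')" by (rule dual_monoid_antimono) auto
  fix n n' assume n: "n \<in> dual_monoid L' \<sigma>'" "n' \<in> dual_monoid L' \<sigma>'" "\<psi> n = \<psi> n'"
  obtain c0 :: nat where c0: "\<And>l c. l \<in> {n, n'} \<Longrightarrow> c \<ge> c0 \<Longrightarrow> l + of_nat c *\<^sub>R m \<in> dual_monoid L' \<tau>'"
    using localizes_ge_finite[OF m, of "{n, n'}"] n sub by auto
  have "\<delta> l * \<delta> m ^ c0 = \<beta> (\<psi> l + of_nat c0 *\<^sub>R \<psi> m)" if l: "l \<in> {n, n'}" for l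
  proof -
    have "l \<in> dual_monoid L' (\<sigma>' \<inter> \<tau>')" using l n sub by auto
    then have "\<delta> l * \<delta> m ^ c0 = \<delta> (l + of_nat c0 *\<^sub>R m)"
      using chartD(2)[OF \<delta>(1) _ dual_monoid_scale[OF localizesD(3)[OF m]]] chart_scale[OF \<delta>(1) localizesD(3)[OF m]] by simp
    also have "\<dots> = push \<tau>' \<beta> (l + of_nat c0 *\<^sub>R m)"
      using fun_cong[OF \<delta>(3), of "l + of_nat c0 *\<^sub>R m"] c0[OF l order_refl] by simp
    finally show ?thesis using c0[OF l order_refl] by (simp add: push_apply \<psi>_add \<psi>_scale)
  qed
  then have "\<delta> n = \<delta> n'" using n(3) localizes_unit[OF m \<delta>(1)] by (metis insertCI mult_cancel_right power_not_zero)
  then show "\<gamma>' n = \<gamma>' n'" using \<delta>(2) n by (metis restrict_apply')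
qed (rule that)

lemma push_in_image:
  "(\<sigma>, \<sigma>') \<in> \<C> \<Longrightarrow> \<gamma> \<in> chart L \<sigma> \<Longrightarrow> chart_point L' \<Sigma>' \<sigma>' (push \<sigma>' \<gamma>) \<in> image"
  using morphism_\<C> \<C> dom.chart_point_in_points by (metis image_eqI)

text \<open>By the factorization criterion, a point outside the image distinguishes two characters
  with the same image under \<open>\<psi>\<close>. The difference of these characters is a chart
  function whose nonvanishing set misses the image.\<close>

lemma closedin_image: "closedin (toric_topology L' \<Sigma>') image"
  unfolding closedin_def cod.topspace_toric cod.openin_toric_iff
proof (intro conjI ballI impI image_subset)
  show "toric_points L' \<Sigma>' - image \<subseteq> toric_points L' \<Sigma>'" by auto
  fix \<tau> \<delta> assume \<tau>: "\<tau> \<in> \<Sigma>'" "\<delta> \<in> chart L' \<tau>" and ni: "chart_point L' \<Sigma>' \<tau> \<delta> \<in> toric_points L' \<Sigma>' - image"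
  obtain \<sigma> \<sigma>' where c: "(\<sigma>, \<sigma>') \<in> \<C>" "\<tau> \<subseteq> \<sigma>'" using cover'[OF \<tau>(1)] by blast
  note C = \<C>[OF c(1)]
  have cp: "chart_point L' \<Sigma>' \<tau> \<epsilon> = chart_point L' \<Sigma>' \<sigma>' (restrict \<epsilon> (dual_monoid L' \<sigma>'))" if "\<epsilon> \<in> chart L' \<tau>" for \<epsilon>
    using cod.chart_point_restrict[of \<sigma>' \<tau> \<epsilon>] C c(2) \<tau>(1) that by simp
  have "\<exists>n n'. n \<in> dual_monoid L' \<sigma>' \<and> n' \<in> dual_monoid L' \<sigma>' \<and> \<psi> n = \<psi> n' \<and> \<delta> n \<noteq> \<delta> n'"
  proof (rule ccontr)
    assume "\<not> ?thesis"
    then obtain \<gamma> where "\<gamma> \<in> chart L \<sigma>" "restrict \<delta> (dual_monoid L' \<sigma>') = push \<sigma>' \<gamma>"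
      using push_factor[OF c(1) restrict_chart[OF \<tau>(2) c(2)]] by (metis restrict_apply')
    then show False using ni cp[OF \<tau>(2)] push_in_image[OF c(1)] by simp
  qed
  then obtain n n' where n: "n \<in> dual_monoid L' \<sigma>'" "n' \<in> dual_monoid L' \<sigma>'" "\<psi> n = \<psi> n'" "\<delta> n \<noteq> \<delta> n'" by blast
  have sub: "dual_monoid L' \<sigma>' \<subseteq> dual_monoid L' \<tau>" by (rule dual_monoid_antimono[OF c(2)])
  show "\<exists>f\<in>chart_functions L' \<tau>. f \<delta> \<noteq> 0 \<and>
      (\<forall>\<epsilon>\<in>chart L' \<tau>. f \<epsilon> \<noteq> 0 \<longrightarrow> chart_point L' \<Sigma>' \<tau> \<epsilon> \<in> toric_points L' \<Sigma>' - image)"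
  proof (intro bexI conjI ballI impI)
    show "(\<lambda>\<gamma>. \<gamma> n - \<gamma> n') \<in> chart_functions L' \<tau>" using n sub by (intro chart_functions_diff_characters) auto
    show "\<delta> n - \<delta> n' \<noteq> 0" using n by simp
    fix \<epsilon> assume \<epsilon>: "\<epsilon> \<in> chart L' \<tau>" "\<epsilon> n - \<epsilon> n' \<noteq> 0"
    have "chart_point L' \<Sigma>' \<tau> \<epsilon> \<notin> image"
    proof
      assume "chart_point L' \<Sigma>' \<tau> \<epsilon> \<in> image"
      then obtain \<gamma> where \<gamma>: "\<gamma> \<in> chart L \<sigma>" "restrict \<epsilon> (dual_monoid L' \<sigma>') = push \<sigma>' \<gamma>"
        using image_chart[OF c(1) restrict_chart[OF \<epsilon>(1) c(2)]] cp[OF \<epsilon>(1)] by metis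
      have "\<epsilon> l = \<gamma> (\<psi> l)" if "l \<in> dual_monoid L' \<sigma>'" for l
        using fun_cong[OF \<gamma>(2), of l] that by (simp add: push_apply)
      then show False using n \<epsilon>(2) by simp
    qed
    then show "chart_point L' \<Sigma>' \<tau> \<epsilon> \<in> toric_points L' \<Sigma>' - image" using cod.chart_point_in_points \<tau>(1) \<epsilon>(1) by blast
  qed
qed

lemma chart_function_pull:
  assumes "\<phi> ` \<sigma> \<subseteq> \<sigma>'" "F' \<in> chart_functions L' \<sigma>'"
  obtains F where "F \<in> chart_functions L \<sigma>" "\<And>\<gamma>. F \<gamma> = F' (push \<sigma>' \<gamma>)"
proof -
  obtain A c where F': "finite A" "A \<subseteq> dual_monoid L' \<sigma>'" "F' = (\<lambda>\<gamma>. \<Sum>m\<in>A. c m * \<gamma> m)"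
    using chart_functionsE[OF assms(2)] .
  have "(\<lambda>\<gamma>. \<Sum>m\<in>A. c m * \<gamma> (\<psi> m)) \<in> chart_functions L \<sigma>"
    using F' \<psi>_monoid[OF assms(1)] by (intro chart_functionsI) auto
  moreover have "(\<Sum>m\<in>A. c m * \<gamma> (\<psi> m)) = F' (push \<sigma>' \<gamma>)" for \<gamma>
    unfolding F'(3) using F'(2) by (intro sum.cong) (auto simp: push_apply)
  ultimately show ?thesis using that by blast
qed

text \<open>Functions on a chart of the source extend to the chart of the target; this is what makes
  the inverse map continuous and regular.\<close>

lemma chart_function_lift:
  assumes "(\<sigma>, \<sigma>') \<in> \<C>" "F \<in> chart_functions L \<sigma>"
  obtains F' where "F' \<in> chart_functions L' \<sigma>'" "\<And>\<gamma>. F' (push \<sigma>' \<gamma>) = F \<gamma>"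
proof -
  obtain A c where F: "finite A" "A \<subseteq> dual_monoid L \<sigma>" "F = (\<lambda>\<gamma>. \<Sum>m\<in>A. c m * \<gamma> m)"
    using chart_functionsE[OF assms(2)] .
  obtain s where s: "\<And>n. n \<in> dual_monoid L \<sigma> \<Longrightarrow> s n \<in> dual_monoid L' \<sigma>' \<and> \<psi> (s n) = n"
    using lift[OF assms(1)] by metis
  have "(\<lambda>\<gamma>. \<Sum>m\<in>A. c m * \<gamma> (s m)) \<in> chart_functions L' \<sigma>'"
    using F s by (intro chart_functionsI) auto
  moreover have "(\<Sum>m\<in>A. c m * push \<sigma>' \<gamma> (s m)) = F \<gamma>" for \<gamma>
    unfolding F(3) using F(2) s by (intro sum.cong) (auto simp: push_apply)
  ultimately show ?thesis using that by blast
qed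

lemma domain_chart:
  assumes "\<tau> \<in> \<Sigma>"
  obtains \<sigma>' where "\<sigma>' \<in> \<Sigma>'" "\<phi> ` \<tau> \<subseteq> \<sigma>'"
proof -
  obtain \<sigma> \<sigma>' where c: "(\<sigma>, \<sigma>') \<in> \<C>" "\<tau> \<subseteq> \<sigma>" using cover[OF assms] by blast
  then show ?thesis using \<C>[OF c(1)] that[of \<sigma>'] by blast
qed

abbreviation "image_variety \<equiv> subvariety (toric_variety L' \<Sigma>') image"

lemma zariski_image: "zariski image_variety = subtopology (toric_topology L' \<Sigma>') image"
  by (simp add: subvariety_def toric_variety_def)

lemma zariski_toric: "zariski (toric_variety L \<Sigma>) = toric_topology L \<Sigma>"
  by (simp add: toric_variety_def)

lemma continuous_morphism: "continuous_map (toric_topology L \<Sigma>) (subtopology (toric_topology L' \<Sigma>') image) morphism"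
proof -
  have "continuous_map (toric_topology L \<Sigma>) (toric_topology L' \<Sigma>') morphism"
    unfolding continuous_map_def
  proof (intro conjI allI impI)
    show "morphism \<in> topspace (toric_topology L \<Sigma>) \<rightarrow> topspace (toric_topology L' \<Sigma>')"
      using image_subset unfolding dom.topspace_toric cod.topspace_toric by auto
    fix W assume W: "openin (toric_topology L' \<Sigma>') W"
    show "openin (toric_topology L \<Sigma>) {p \<in> topspace (toric_topology L \<Sigma>). morphism p \<in> W}"
      unfolding dom.openin_toric_iff dom.topspace_toric
    proof (intro conjI ballI impI)
      fix \<sigma> \<gamma> assume \<sigma>: "\<sigma> \<in> \<Sigma>" "\<gamma> \<in> chart L \<sigma>" and "chart_point L \<Sigma> \<sigma> \<gamma> \<in> {p \<in> toric_points L \<Sigma>. morphism p \<in> W}"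
      then have mW: "morphism (chart_point L \<Sigma> \<sigma> \<gamma>) \<in> W" by auto
      obtain \<sigma>' where \<sigma>': "\<sigma>' \<in> \<Sigma>'" "\<phi> ` \<sigma> \<subseteq> \<sigma>'" using domain_chart[OF \<sigma>(1)] .
      have mp: "morphism (chart_point L \<Sigma> \<sigma> \<delta>) = chart_point L' \<Sigma>' \<sigma>' (push \<sigma>' \<delta>)" if "\<delta> \<in> chart L \<sigma>" for \<delta>
        by (rule morphism_chart_point[OF \<sigma>(1) that \<sigma>'])
      obtain f where f: "f \<in> chart_functions L' \<sigma>'" "f (push \<sigma>' \<gamma>) \<noteq> 0"
        "\<And>\<delta>. \<delta> \<in> chart L' \<sigma>' \<Longrightarrow> f \<delta> \<noteq> 0 \<Longrightarrow> chart_point L' \<Sigma>' \<sigma>' \<delta> \<in> W"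
        by (rule cod.openin_toricE[OF W \<sigma>'(1) push_chart[OF \<sigma>'(2) \<sigma>(2)] mW[unfolded mp[OF \<sigma>(2)]]]) (rule that; assumption)
      obtain F where F: "F \<in> chart_functions L \<sigma>" "\<And>\<gamma>. F \<gamma> = f (push \<sigma>' \<gamma>)" by (rule chart_function_pull[OF \<sigma>'(2) f(1)]) (rule that; assumption)
      show "\<exists>f\<in>chart_functions L \<sigma>. f \<gamma> \<noteq> 0 \<and>
          (\<forall>\<delta>\<in>chart L \<sigma>. f \<delta> \<noteq> 0 \<longrightarrow> chart_point L \<Sigma> \<sigma> \<delta> \<in> {p \<in> toric_points L \<Sigma>. morphism p \<in> W})"
        using F f push_chart[OF \<sigma>'(2)] mp dom.chart_point_in_points[OF \<sigma>(1)] by (intro bexI[of _ F]) auto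
    qed auto
  qed
  then show ?thesis
    by (rule continuous_map_into_subtopology) (auto simp: dom.topspace_toric)
qed

definition inverse_morphism :: "'b toric_point \<Rightarrow> 'a toric_point" where
  "inverse_morphism = inv_into (toric_points L \<Sigma>) morphism"

lemma inverse_morphism: "p \<in> toric_points L \<Sigma> \<Longrightarrow> inverse_morphism (morphism p) = p"
  unfolding inverse_morphism_def by (rule inv_into_f_f[OF inj_on_morphism])

lemma topspace_image: "topspace (subtopology (toric_topology L' \<Sigma>') image) = image"
  using image_subset cod.topspace_toric by auto

lemma continuous_inverse_morphism:
  "continuous_map (subtopology (toric_topology L' \<Sigma>') image) (toric_topology L \<Sigma>) inverse_morphism"
  unfolding continuous_map_def topspace_image
proof (intro conjI allI impI)
  show "inverse_morphism \<in> image \<rightarrow> topspace (toric_topology L \<Sigma>)"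
    unfolding dom.topspace_toric by (auto simp: inverse_morphism)
  fix W assume W: "openin (toric_topology L \<Sigma>) W"
  then have WX: "W \<subseteq> toric_points L \<Sigma>" unfolding dom.openin_toric_iff by blast
  show "openin (subtopology (toric_topology L' \<Sigma>') image) {q \<in> image. inverse_morphism q \<in> W}"
  proof (subst openin_subopen, intro ballI)
    fix q assume q: "q \<in> {q \<in> image. inverse_morphism q \<in> W}"
    then obtain p where p: "p \<in> toric_points L \<Sigma>" "q = morphism p" "p \<in> W" by (auto simp: inverse_morphism)
    obtain \<sigma> \<sigma>' \<gamma> where c: "(\<sigma>, \<sigma>') \<in> \<C>" "\<gamma> \<in> chart L \<sigma>" "p = chart_point L \<Sigma> \<sigma> \<gamma>" using point_in_\<C>[OF p(1)] .
    note C = \<C>[OF c(1)]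
    obtain F where F: "F \<in> chart_functions L \<sigma>" "F \<gamma> \<noteq> 0" "\<And>\<delta>. \<delta> \<in> chart L \<sigma> \<Longrightarrow> F \<delta> \<noteq> 0 \<Longrightarrow> chart_point L \<Sigma> \<sigma> \<delta> \<in> W"
      by (rule dom.openin_toricE[OF W conjunct1[OF C] c(2) p(3)[unfolded c(3)]]) (rule that; assumption)
    obtain F' where F': "F' \<in> chart_functions L' \<sigma>'" "\<And>\<gamma>. F' (push \<sigma>' \<gamma>) = F \<gamma>" by (rule chart_function_lift[OF c(1) F(1)]) (rule that; assumption)
    let ?T = "cod.principal_open \<sigma>' F' \<inter> image"
    have "openin (subtopology (toric_topology L' \<Sigma>') image) ?T"
      unfolding openin_subtopology using cod.openin_principal_open[of \<sigma>' F'] C F'(1) by blast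
    moreover have "q \<in> ?T"
      using cod.chart_point_in_principal_open[of \<sigma>' "push \<sigma>' \<gamma>" F'] C c push_chart F(2) F'(2) p
        morphism_\<C>[OF c(1,2)] by auto
    moreover have "?T \<subseteq> {q \<in> image. inverse_morphism q \<in> W}"
    proof
      fix r assume r: "r \<in> ?T"
      then obtain \<gamma>' where \<gamma>': "\<gamma>' \<in> chart L' \<sigma>'" "F' \<gamma>' \<noteq> 0" "r = chart_point L' \<Sigma>' \<sigma>' \<gamma>'"
        by (auto simp: cod.principal_open_def)
      then obtain \<delta> where \<delta>: "\<delta> \<in> chart L \<sigma>" "\<gamma>' = push \<sigma>' \<delta>" using image_chart[OF c(1)] r by blast
      then have "r = morphism (chart_point L \<Sigma> \<sigma> \<delta>)" using \<gamma>' morphism_\<C>[OF c(1)] by simp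
      then show "r \<in> {q \<in> image. inverse_morphism q \<in> W}"
        using r F(3)[OF \<delta>(1)] \<gamma>' \<delta> F'(2) dom.chart_point_in_points C by (auto simp: inverse_morphism)
    qed
    ultimately show "\<exists>T. openin (subtopology (toric_topology L' \<Sigma>') image) T \<and> q \<in> T \<and> T \<subseteq> {q \<in> image. inverse_morphism q \<in> W}"
      by blast
  qed
qed

lemma homeomorphic_image:
  "homeomorphic_maps (toric_topology L \<Sigma>) (subtopology (toric_topology L' \<Sigma>') image) morphism inverse_morphism"
  unfolding homeomorphic_maps_def
  using continuous_morphism continuous_inverse_morphism
  by (auto simp: dom.topspace_toric topspace_image inverse_morphism)

lemma toric_regularD:
  assumes "regular (toric_variety K \<Upsilon>) W f" "\<sigma> \<in> \<Upsilon>" "\<gamma> \<in> chart K \<sigma>" "chart_point K \<Upsilon> \<sigma> \<gamma> \<in> W"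
  obtains g h where "g \<in> chart_functions K \<sigma>" "h \<in> chart_functions K \<sigma>" "h \<gamma> \<noteq> 0"
    "\<And>\<delta>. \<delta> \<in> chart K \<sigma> \<Longrightarrow> chart_point K \<Upsilon> \<sigma> \<delta> \<in> W \<Longrightarrow> h \<delta> \<noteq> 0 \<Longrightarrow> f (chart_point K \<Upsilon> \<sigma> \<delta>) = g \<delta> / h \<delta>"
proof -
  have "\<exists>g\<in>chart_functions K \<sigma>. \<exists>h\<in>chart_functions K \<sigma>. h \<gamma> \<noteq> 0 \<and>
     (\<forall>\<delta>\<in>chart K \<sigma>. chart_point K \<Upsilon> \<sigma> \<delta> \<in> W \<and> h \<delta> \<noteq> 0 \<longrightarrow> f (chart_point K \<Upsilon> \<sigma> \<delta>) = g \<delta> / h \<delta>)"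
    using assms unfolding toric_variety_def variety.select_convs by blast
  then show ?thesis using that by blast
qed

lemma is_morphism_morphism: "is_morphism (toric_variety L \<Sigma>) image_variety morphism"
  unfolding is_morphism_def zariski_image zariski_toric dom.topspace_toric
proof (intro conjI allI impI continuous_morphism)
  fix W f assume "openin (subtopology (toric_topology L' \<Sigma>') image) W \<and> regular image_variety W f"
  then have f: "\<And>q. q \<in> W \<Longrightarrow> \<exists>W' g. openin (toric_topology L' \<Sigma>') W' \<and> q \<in> W' \<and> regular (toric_variety L' \<Sigma>') W' g \<and>
      (\<forall>r\<in>W \<inter> W'. f r = g r)" by (simp add: subvariety_def toric_variety_def)
  show "regular (toric_variety L \<Sigma>) {p \<in> toric_points L \<Sigma>. morphism p \<in> W} (f \<circ> morphism)"
    unfolding toric_variety_def variety.select_convs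
  proof (intro ballI impI)
    fix \<sigma> \<gamma> assume \<sigma>: "\<sigma> \<in> \<Sigma>" "\<gamma> \<in> chart L \<sigma>" and "chart_point L \<Sigma> \<sigma> \<gamma> \<in> {p \<in> toric_points L \<Sigma>. morphism p \<in> W}"
    then have mW: "morphism (chart_point L \<Sigma> \<sigma> \<gamma>) \<in> W" by auto
    obtain \<sigma>' where \<sigma>': "\<sigma>' \<in> \<Sigma>'" "\<phi> ` \<sigma> \<subseteq> \<sigma>'" using domain_chart[OF \<sigma>(1)] .
    have mp: "morphism (chart_point L \<Sigma> \<sigma> \<delta>) = chart_point L' \<Sigma>' \<sigma>' (push \<sigma>' \<delta>)" if "\<delta> \<in> chart L \<sigma>" for \<delta>
      by (rule morphism_chart_point[OF \<sigma>(1) that \<sigma>'])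
    obtain W' g where W': "openin (toric_topology L' \<Sigma>') W'" "morphism (chart_point L \<Sigma> \<sigma> \<gamma>) \<in> W'"
      "regular (toric_variety L' \<Sigma>') W' g" "\<And>r. r \<in> W \<Longrightarrow> r \<in> W' \<Longrightarrow> f r = g r"
      using f[OF mW] by blast
    note pc = push_chart[OF \<sigma>'(2)]
    have inW': "chart_point L' \<Sigma>' \<sigma>' (push \<sigma>' \<gamma>) \<in> W'" using W'(2) mp[OF \<sigma>(2)] by simp
    obtain g1 h1 where g1: "g1 \<in> chart_functions L' \<sigma>'" "h1 \<in> chart_functions L' \<sigma>'" "h1 (push \<sigma>' \<gamma>) \<noteq> 0"
      "\<And>\<delta>. \<delta> \<in> chart L' \<sigma>' \<Longrightarrow> chart_point L' \<Sigma>' \<sigma>' \<delta> \<in> W' \<Longrightarrow> h1 \<delta> \<noteq> 0 \<Longrightarrow> g (chart_point L' \<Sigma>' \<sigma>' \<delta>) = g1 \<delta> / h1 \<delta>"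
      by (rule toric_regularD[OF W'(3) \<sigma>'(1) pc[OF \<sigma>(2)] inW']) (rule that; assumption)
    obtain h2 where h2: "h2 \<in> chart_functions L' \<sigma>'" "h2 (push \<sigma>' \<gamma>) \<noteq> 0"
      "\<And>\<delta>. \<delta> \<in> chart L' \<sigma>' \<Longrightarrow> h2 \<delta> \<noteq> 0 \<Longrightarrow> chart_point L' \<Sigma>' \<sigma>' \<delta> \<in> W'"
      by (rule cod.openin_toricE[OF W'(1) \<sigma>'(1) pc[OF \<sigma>(2)] inW']) (rule that; assumption)
    \<comment> \<open>Numerator and denominator are multiplied by \<open>h2\<close>, so that the
      quotient is only used at points of \<open>W'\<close>, where \<open>g\<close> represents
      \<open>f\<close>.\<close>
    obtain G where G: "G \<in> chart_functions L' \<sigma>'" "\<And>\<delta>. \<delta> \<in> chart L' \<sigma>' \<Longrightarrow> G \<delta> = g1 \<delta> * h2 \<delta>"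
      using chart_functions_mult[OF g1(1) h2(1)] by blast
    obtain H where H: "H \<in> chart_functions L' \<sigma>'" "\<And>\<delta>. \<delta> \<in> chart L' \<sigma>' \<Longrightarrow> H \<delta> = h1 \<delta> * h2 \<delta>"
      using chart_functions_mult[OF g1(2) h2(1)] by blast
    obtain G' where G': "G' \<in> chart_functions L \<sigma>" "\<And>\<gamma>. G' \<gamma> = G (push \<sigma>' \<gamma>)" by (rule chart_function_pull[OF \<sigma>'(2) G(1)]) (rule that; assumption)
    obtain H' where H': "H' \<in> chart_functions L \<sigma>" "\<And>\<gamma>. H' \<gamma> = H (push \<sigma>' \<gamma>)" by (rule chart_function_pull[OF \<sigma>'(2) H(1)]) (rule that; assumption)
    show "\<exists>g\<in>chart_functions L \<sigma>. \<exists>h\<in>chart_functions L \<sigma>. h \<gamma> \<noteq> 0 \<and>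
       (\<forall>\<delta>\<in>chart L \<sigma>. chart_point L \<Sigma> \<sigma> \<delta> \<in> {p \<in> toric_points L \<Sigma>. morphism p \<in> W} \<and> h \<delta> \<noteq> 0 \<longrightarrow>
          (f \<circ> morphism) (chart_point L \<Sigma> \<sigma> \<delta>) = g \<delta> / h \<delta>)"
    proof (rule bexI[OF _ G'(1)], rule bexI[OF _ H'(1)], intro conjI ballI impI)
      show "H' \<gamma> \<noteq> 0" using H'(2) H(2)[OF pc[OF \<sigma>(2)]] g1(3) h2(2) by simp
      fix \<delta> assume \<delta>: "\<delta> \<in> chart L \<sigma>"
        "chart_point L \<Sigma> \<sigma> \<delta> \<in> {p \<in> toric_points L \<Sigma>. morphism p \<in> W} \<and> H' \<delta> \<noteq> 0"
      then have nz: "h1 (push \<sigma>' \<delta>) \<noteq> 0" "h2 (push \<sigma>' \<delta>) \<noteq> 0" using H'(2) H(2)[OF pc[OF \<delta>(1)]] by auto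
      have "morphism (chart_point L \<Sigma> \<sigma> \<delta>) \<in> W'" using h2(3)[OF pc[OF \<delta>(1)] nz(2)] mp[OF \<delta>(1)] by simp
      then have "f (morphism (chart_point L \<Sigma> \<sigma> \<delta>)) = g1 (push \<sigma>' \<delta>) / h1 (push \<sigma>' \<delta>)"
        using W'(4) \<delta>(2) g1(4)[OF pc[OF \<delta>(1)] _ nz(1)] mp[OF \<delta>(1)] by auto
      then show "(f \<circ> morphism) (chart_point L \<Sigma> \<sigma> \<delta>) = G' \<delta> / H' \<delta>"
        using nz G'(2) H'(2) G(2)[OF pc[OF \<delta>(1)]] H(2)[OF pc[OF \<delta>(1)]] by simp
    qed
  qed
qed

lemma is_morphism_inverse: "is_morphism image_variety (toric_variety L \<Sigma>) inverse_morphism"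
  unfolding is_morphism_def zariski_image zariski_toric topspace_image
proof (intro conjI allI impI continuous_inverse_morphism)
  fix W f assume W: "openin (toric_topology L \<Sigma>) W \<and> regular (toric_variety L \<Sigma>) W f"
  let ?V = "{q \<in> image. inverse_morphism q \<in> W}"
  have "\<exists>W' g. openin (toric_topology L' \<Sigma>') W' \<and> q \<in> W' \<and> regular (toric_variety L' \<Sigma>') W' g \<and>
      (\<forall>r\<in>?V \<inter> W'. (f \<circ> inverse_morphism) r = g r)" if q: "q \<in> ?V" for q
  proof -
    obtain p where p: "p \<in> toric_points L \<Sigma>" "q = morphism p" "p \<in> W" using q by (auto simp: inverse_morphism)
    obtain \<sigma> \<sigma>' \<gamma> where c: "(\<sigma>, \<sigma>') \<in> \<C>" "\<gamma> \<in> chart L \<sigma>" "p = chart_point L \<Sigma> \<sigma> \<gamma>" using point_in_\<C>[OF p(1)] .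
    have C: "\<sigma> \<in> \<Sigma>" "\<sigma>' \<in> \<Sigma>'" "\<phi> ` \<sigma> \<subseteq> \<sigma>'" using \<C>[OF c(1)] by auto
    obtain G H where GH: "G \<in> chart_functions L \<sigma>" "H \<in> chart_functions L \<sigma>" "H \<gamma> \<noteq> 0"
      "\<And>\<delta>. \<delta> \<in> chart L \<sigma> \<Longrightarrow> chart_point L \<Sigma> \<sigma> \<delta> \<in> W \<Longrightarrow> H \<delta> \<noteq> 0 \<Longrightarrow> f (chart_point L \<Sigma> \<sigma> \<delta>) = G \<delta> / H \<delta>"
      by (rule toric_regularD[OF conjunct2[OF W] C(1) c(2) p(3)[unfolded c(3)]]) (rule that; assumption)
    obtain G' where G': "G' \<in> chart_functions L' \<sigma>'" "\<And>\<gamma>. G' (push \<sigma>' \<gamma>) = G \<gamma>" by (rule chart_function_lift[OF c(1) GH(1)]) (rule that; assumption)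
    obtain H' where H': "H' \<in> chart_functions L' \<sigma>'" "\<And>\<gamma>. H' (push \<sigma>' \<gamma>) = H \<gamma>" by (rule chart_function_lift[OF c(1) GH(2)]) (rule that; assumption)
    \<comment> \<open>A point of the chart is identified with its homomorphism, so that the quotient
      of the lifted functions becomes a function of points.\<close>
    define pt where "pt r = (THE \<gamma>'. \<gamma>' \<in> chart L' \<sigma>' \<and> r = chart_point L' \<Sigma>' \<sigma>' \<gamma>')" for r
    have pt: "pt (chart_point L' \<Sigma>' \<sigma>' \<gamma>') = \<gamma>'" if "\<gamma>' \<in> chart L' \<sigma>'" for \<gamma>'
      unfolding pt_def using that cod.chart_point_inj[OF C(2)] by (intro the_equality) auto
    define F where "F r = G' (pt r) / H' (pt r)" for r
    let ?W' = "cod.principal_open \<sigma>' H'"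
    have "openin (toric_topology L' \<Sigma>') ?W'" by (rule cod.openin_principal_open[OF C(2) H'(1)])
    moreover have "q \<in> ?W'"
      using cod.chart_point_in_principal_open[OF C(2) push_chart[OF C(3) c(2)]] GH(3) H'(2) p(2) c(3)
        morphism_\<C>[OF c(1,2)] by simp
    moreover have "regular (toric_variety L' \<Sigma>') ?W' F"
      by (rule cod.regular_quotient[OF C(2) G'(1) H'(1)]) (auto simp: F_def pt)
    moreover have "(f \<circ> inverse_morphism) r = F r" if r: "r \<in> ?V \<inter> ?W'" for r
    proof -
      obtain \<gamma>' where \<gamma>': "\<gamma>' \<in> chart L' \<sigma>'" "H' \<gamma>' \<noteq> 0" "r = chart_point L' \<Sigma>' \<sigma>' \<gamma>'"
        using r by (auto simp: cod.principal_open_def)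
      then obtain \<delta> where \<delta>: "\<delta> \<in> chart L \<sigma>" "\<gamma>' = push \<sigma>' \<delta>" using image_chart[OF c(1)] r by blast
      then have "r = morphism (chart_point L \<Sigma> \<sigma> \<delta>)" using \<gamma>' morphism_\<C>[OF c(1)] by simp
      then have inv: "inverse_morphism r = chart_point L \<Sigma> \<sigma> \<delta>"
        using dom.chart_point_in_points[OF C(1) \<delta>(1)] by (simp add: inverse_morphism)
      have "f (chart_point L \<Sigma> \<sigma> \<delta>) = G \<delta> / H \<delta>" using GH(4)[OF \<delta>(1)] r inv \<gamma>'(2) \<delta>(2) H'(2) by simp
      then show ?thesis using inv \<gamma>' \<delta> by (simp add: F_def pt G'(2) H'(2))
    qed
    ultimately show ?thesis by blast
  qed
  then show "regular image_variety ?V (f \<circ> inverse_morphism)"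
    by (simp add: subvariety_def toric_variety_def)
qed

theorem closed_embedding: "is_closed_embedding (toric_variety L \<Sigma>) (toric_variety L' \<Sigma>') morphism"
proof -
  have "zariski (toric_variety L' \<Sigma>') = toric_topology L' \<Sigma>'" by (simp add: toric_variety_def)
  moreover have "\<forall>q\<in>image. morphism (inverse_morphism q) = q" by (auto simp: inverse_morphism)
  ultimately show ?thesis
    unfolding is_closed_embedding_def is_isomorphism_def zariski_toric dom.topspace_toric zariski_image topspace_image
    using closedin_image is_morphism_morphism is_morphism_inverse inverse_morphism by auto
qed

end

section \<open>Fans given by generators of their cones\<close>

abbreviation cone_of :: "'a::euclidean_space set \<Rightarrow> 'a set" where
  "cone_of S \<equiv> convex_cone hull S"

text \<open>Separation encodes that two cones meet in the cone of their common generators; with the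
  empty set as second argument it says that the cones are pointed. The last condition provides
  generators for faces.\<close>

locale rational_fan = lattice L for L :: "'a::euclidean_space set" +
  fixes \<G> :: "'a set set"
  assumes generators: "S \<in> \<G> \<Longrightarrow> finite S \<and> S \<subseteq> L"
    and empty_generators: "{} \<in> \<G>"
    and real_separation: "S \<in> \<G> \<Longrightarrow> S' \<in> \<G> \<Longrightarrow>
      \<exists>a. (\<forall>w\<in>S - S'. 0 < a \<bullet> w) \<and> (\<forall>w\<in>S \<inter> S'. a \<bullet> w = 0) \<and> (\<forall>w\<in>S' - S. a \<bullet> w < 0)"
    and face_generators: "S \<in> \<G> \<Longrightarrow> (\<forall>w\<in>S. 0 \<le> a \<bullet> w) \<Longrightarrow> {w \<in> S. a \<bullet> w = 0} \<in> \<G>"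
begin

definition fan :: "'a set set" where
  "fan = cone_of ` \<G>"

lemma cone_in_fan: "S \<in> \<G> \<Longrightarrow> cone_of S \<in> fan"
  by (simp add: fan_def)

lemma Int_generators:
  assumes "S \<in> \<G>" "S' \<in> \<G>"
  shows "S \<inter> S' \<in> \<G>" "cone_of S \<inter> cone_of S' = cone_of (S \<inter> S')"
proof -
  obtain a where a: "\<forall>w\<in>S - S'. 0 < a \<bullet> w" "\<forall>w\<in>S \<inter> S'. a \<bullet> w = 0" "\<forall>w\<in>S' - S. a \<bullet> w < 0"
    using real_separation[OF assms] by blast
  have nn: "0 \<le> a \<bullet> w" if "w \<in> S" for w using a that by (cases "w \<in> S'") (auto simp: less_imp_le)
  have np: "0 \<le> (- a) \<bullet> w" if "w \<in> S'" for w using a that by (cases "w \<in> S") (auto simp: less_imp_le)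
  have eq: "{w \<in> S. a \<bullet> w = 0} = S \<inter> S'" using a by force
  then show "S \<inter> S' \<in> \<G>" using face_generators[OF assms(1), of a] nn by auto
  show "cone_of S \<inter> cone_of S' = cone_of (S \<inter> S')"
  proof
    show "cone_of S \<inter> cone_of S' \<subseteq> cone_of (S \<inter> S')"
    proof
      fix x assume x: "x \<in> cone_of S \<inter> cone_of S'"
      then have "0 \<le> a \<bullet> x" "0 \<le> (- a) \<bullet> x"
        using convex_cone_hull_nonneg[of x S a] convex_cone_hull_nonneg[of x S' "- a"] nn np by auto
      then have "x \<in> cone_of S \<inter> {x. a \<bullet> x = 0}" using x by (simp add: inner_minus_left)
      then show "x \<in> cone_of (S \<inter> S')"
        using convex_cone_hull_Int_hyperplane[of S a] generators[OF assms(1)] nn eq by simp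
    qed
  qed (auto intro: hull_mono subsetD[OF hull_mono])
qed

text \<open>The separating functional is positive at a generator of \<open>S\<close> outside
  \<open>S'\<close> and nonpositive on the cone of \<open>S'\<close>.\<close>

lemma cone_subset_iff:
  assumes "S \<in> \<G>" "S' \<in> \<G>"
  shows "cone_of S \<subseteq> cone_of S' \<longleftrightarrow> S \<subseteq> S'"
proof
  assume sub: "cone_of S \<subseteq> cone_of S'"
  obtain a where a: "\<forall>w\<in>S - S'. 0 < a \<bullet> w" "\<forall>w\<in>S \<inter> S'. a \<bullet> w = 0" "\<forall>w\<in>S' - S. a \<bullet> w < 0"
    using real_separation[OF assms] by blast
  show "S \<subseteq> S'"
  proof (rule ccontr)
    assume "\<not> S \<subseteq> S'"
    then obtain w where w: "w \<in> S" "w \<notin> S'" by blast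
    have "w \<in> cone_of S'" using sub hull_subset[of S convex_cone] w(1) by blast
    moreover have "0 \<le> (- a) \<bullet> v" if "v \<in> S'" for v using a that by (cases "v \<in> S") (auto simp: less_imp_le)
    ultimately have "0 \<le> (- a) \<bullet> w" by (rule convex_cone_hull_nonneg)
    moreover have "0 < a \<bullet> w" using a(1) w by blast
    ultimately show False by (simp add: inner_minus_left)
  qed
qed (rule hull_mono)

lemma cone_eq_iff: "S \<in> \<G> \<Longrightarrow> S' \<in> \<G> \<Longrightarrow> cone_of S = cone_of S' \<longleftrightarrow> S = S'"
  using cone_subset_iff by (metis subset_antisym subset_refl)

lemma lattice_separation:
  assumes "S \<in> \<G>" "S' \<in> \<G>"
  obtains m where "m \<in> dual_lattice L" "\<And>w. w \<in> S - S' \<Longrightarrow> 0 < m \<bullet> w" "\<And>w. w \<in> S \<inter> S' \<Longrightarrow> m \<bullet> w = 0"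
    "\<And>w. w \<in> S' - S \<Longrightarrow> m \<bullet> w < 0"
proof -
  obtain a where a: "\<forall>w\<in>S - S'. 0 < a \<bullet> w" "\<forall>w\<in>S \<inter> S'. a \<bullet> w = 0" "\<forall>w\<in>S' - S. a \<bullet> w < 0"
    using real_separation[OF assms] by blast
  note gen = generators[OF assms(1)] generators[OF assms(2)]
  have neg: "- w \<in> L" if "w \<in> L" for w using lattice_scale[OF that, of "-1"] by simp
  obtain m where m: "m \<in> dual_lattice L" "\<And>w. w \<in> S \<inter> S' \<Longrightarrow> m \<bullet> w = 0"
    "\<And>w. w \<in> (S - S') \<union> uminus ` (S' - S) \<Longrightarrow> 0 < m \<bullet> w"
  proof (rule lattice_functional[of "S \<inter> S'" "(S - S') \<union> uminus ` (S' - S)" a])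
    show "S - S' \<union> uminus ` (S' - S) \<subseteq> L" using gen neg by auto
  qed (use gen a in auto)
  show ?thesis
  proof (rule that[OF m(1)])
    show "m \<bullet> w < 0" if "w \<in> S' - S" for w using m(3)[of "- w"] that by simp
  qed (use m in auto)
qed

lemma dual_monoid_cone: "dual_monoid L (cone_of S) = {m \<in> dual_lattice L. \<forall>w\<in>S. 0 \<le> m \<bullet> w}"
  using hull_subset[of S convex_cone] convex_cone_hull_nonneg[of _ S] unfolding dual_monoid_def by blast

text \<open>A large multiple of \<open>m\<close> compensates the negative values of \<open>n\<close>
  at the generators where \<open>m\<close> is positive; at the others \<open>n\<close> is already
  nonnegative.\<close>

lemma localizes_cone:
  assumes S: "S \<in> \<G>" and m: "m \<in> dual_lattice L" "\<And>w. w \<in> S \<Longrightarrow> 0 \<le> m \<bullet> w"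
  shows "localizes L (cone_of S) (cone_of {w \<in> S. m \<bullet> w = 0}) m"
  unfolding localizes_def dual_monoid_cone
proof (intro conjI ballI)
  show "cone_of {w \<in> S. m \<bullet> w = 0} \<subseteq> cone_of S" by (rule hull_mono) auto
  fix n assume n: "n \<in> {n \<in> dual_lattice L. \<forall>w\<in>{w \<in> S. m \<bullet> w = 0}. 0 \<le> n \<bullet> w}"
  define q where "q = (\<Sum>w\<in>S. \<bar>n \<bullet> w\<bar> / (m \<bullet> w))"
  have "0 \<le> (n + of_nat (nat \<lceil>q\<rceil>) *\<^sub>R m) \<bullet> w" if w: "w \<in> S" for w
  proof (cases "m \<bullet> w = 0")
    case True
    then show ?thesis using n w by (simp add: inner_add_left)
  next
    case False
    then have mw: "0 < m \<bullet> w" using m(2)[OF w] by simp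
    have "\<bar>n \<bullet> w\<bar> / (m \<bullet> w) \<le> q"
      unfolding q_def using w generators[OF S] m(2) by (intro member_le_sum) auto
    also have "q \<le> of_nat (nat \<lceil>q\<rceil>)" by linarith
    finally have "\<bar>n \<bullet> w\<bar> \<le> of_nat (nat \<lceil>q\<rceil>) * (m \<bullet> w)" using mw by (simp add: field_simps)
    then show ?thesis by (simp add: inner_add_left)
  qed
  then show "\<exists>c::nat. n + of_nat c *\<^sub>R m \<in> {m \<in> dual_lattice L. \<forall>w\<in>S. 0 \<le> m \<bullet> w}"
    using n m(1) by (intro exI[of _ "nat \<lceil>q\<rceil>"]) (auto intro!: dual_lattice_add dual_lattice_scale)
qed (use m in \<open>auto intro: dual_lattice_minus\<close>)

lemma localizes_separation:
  assumes S: "S \<in> \<G>" "S' \<in> \<G>" and m: "m \<in> dual_lattice L" "\<And>w. w \<in> S - S' \<Longrightarrow> 0 < m \<bullet> w" "\<And>w. w \<in> S \<inter> S' \<Longrightarrow> m \<bullet> w = 0"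
  shows "localizes L (cone_of S) (cone_of S \<inter> cone_of S') m"
proof -
  have "{w \<in> S. m \<bullet> w = 0} = S \<inter> S'" using m by force
  moreover have "0 \<le> m \<bullet> w" if "w \<in> S" for w using m that by (cases "w \<in> S'") (auto simp: less_imp_le)
  ultimately show ?thesis using localizes_cone[OF S(1) m(1)] Int_generators(2)[OF S] by metis
qed

sublocale toric_fan L fan
proof
  fix \<sigma> \<sigma>' assume "\<sigma> \<in> fan" "\<sigma>' \<in> fan"
  then obtain S S' where S: "S \<in> \<G>" "S' \<in> \<G>" "\<sigma> = cone_of S" "\<sigma>' = cone_of S'" by (auto simp: fan_def)
  show "\<sigma> \<inter> \<sigma>' \<in> fan" using Int_generators[OF S(1,2)] S by (auto simp: fan_def)
  obtain m where m: "m \<in> dual_lattice L" "\<And>w. w \<in> S - S' \<Longrightarrow> 0 < m \<bullet> w" "\<And>w. w \<in> S \<inter> S' \<Longrightarrow> m \<bullet> w = 0"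
    "\<And>w. w \<in> S' - S \<Longrightarrow> m \<bullet> w < 0" using lattice_separation[OF S(1,2)] by blast
  have "localizes L \<sigma> (\<sigma> \<inter> \<sigma>') m" unfolding S by (rule localizes_separation[OF S(1,2)]) (use m in auto)
  moreover have "localizes L \<sigma>' (\<sigma>' \<inter> \<sigma>) (- m)"
    unfolding S by (rule localizes_separation[OF S(2,1)]) (use m in \<open>auto intro: dual_lattice_minus\<close>)
  ultimately show "\<exists>m. localizes L \<sigma> (\<sigma> \<inter> \<sigma>') m \<and> localizes L \<sigma>' (\<sigma> \<inter> \<sigma>') (- m)"
    by (auto simp: Int_commute)
next
  show "{0} \<in> fan" using cone_in_fan[OF empty_generators] by simp
qed

text \<open>The cone of \<open>S\<close> is the smallest one whose chart contains \<open>p\<close>.\<close>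

lemma orbit_of_point:
  assumes "p \<in> toric_points L fan"
  obtains S \<delta> where "S \<in> \<G>" "\<delta> \<in> chart L (cone_of S)" "p = chart_point L fan (cone_of S) \<delta>"
    "\<And>m. m \<in> dual_monoid L (cone_of S) \<Longrightarrow> \<delta> m \<noteq> 0 \<longleftrightarrow> (\<forall>w\<in>S. m \<bullet> w = 0)"
proof -
  obtain \<sigma> \<gamma> where \<sigma>: "\<sigma> \<in> fan" "\<gamma> \<in> chart L \<sigma>" "p = chart_point L fan \<sigma> \<gamma>" using toric_pointsE[OF assms] .
  then obtain S where S: "S \<in> \<G>" "\<sigma> = cone_of S" by (auto simp: fan_def)
  have fS: "finite S" using generators[OF S(1)] by simp
  let ?P = "\<lambda>m. m \<in> dual_monoid L \<sigma> \<and> \<gamma> m \<noteq> 0"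
  \<comment> \<open>Among the characters that do not vanish at the point, \<open>m0\<close> is zero
    on the fewest generators. Inverting it leads to the chart of the smallest possible face.\<close>
  define m0 where "m0 = arg_min (\<lambda>m. card {w \<in> S. m \<bullet> w = 0}) ?P"
  have "?P 0" using dual_monoid_0 chartD(1)[OF \<sigma>(2)] by simp
  then have m0: "?P m0" and min: "\<And>m. ?P m \<Longrightarrow> card {w \<in> S. m0 \<bullet> w = 0} \<le> card {w \<in> S. m \<bullet> w = 0}"
    unfolding m0_def using arg_min_nat_lemma[of ?P 0 "\<lambda>m. card {w \<in> S. m \<bullet> w = 0}"] by auto
  have m0S: "0 \<le> m0 \<bullet> w" if "w \<in> S" for w using m0 that dual_monoid_cone S(2) by auto
  define T where "T = {w \<in> S. m0 \<bullet> w = 0}"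
  have TG: "T \<in> \<G>" unfolding T_def using face_generators[OF S(1)] m0S by auto
  have loc: "localizes L \<sigma> (cone_of T) m0"
    unfolding T_def S(2) using m0 m0S by (intro localizes_cone[OF S(1)]) (auto simp: dual_monoid_def)
  obtain \<delta> where \<delta>: "\<delta> \<in> chart L (cone_of T)" "restrict \<delta> (dual_monoid L \<sigma>) = \<gamma>"
    using localizes_extend[OF loc \<sigma>(2)] m0 by blast
  have "p = chart_point L fan (cone_of T) \<delta>"
    using chart_point_restrict[OF \<sigma>(1) cone_in_fan[OF TG] localizesD(1)[OF loc] \<delta>(1)] \<delta>(2) \<sigma>(3) by simp
  moreover have "\<delta> n \<noteq> 0 \<longleftrightarrow> (\<forall>w\<in>T. n \<bullet> w = 0)" if n: "n \<in> dual_monoid L (cone_of T)" for n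
  proof
    assume "\<forall>w\<in>T. n \<bullet> w = 0"
    then have "- n \<in> dual_monoid L (cone_of T)"
      using n unfolding dual_monoid_cone by (auto intro: dual_lattice_minus)
    then show "\<delta> n \<noteq> 0" by (rule chart_unit[OF \<delta>(1) n])
  next
    assume nz: "\<delta> n \<noteq> 0"
    obtain c :: nat where c: "n + of_nat c *\<^sub>R m0 \<in> dual_monoid L \<sigma>" using loc n unfolding localizes_def by blast
    \<comment> \<open>The extra copy of \<open>m0\<close> ensures that a generator orthogonal to
      \<open>l\<close> is orthogonal to \<open>m0\<close> and to \<open>n\<close>
      separately.\<close>
    define l where "l = n + of_nat (Suc c) *\<^sub>R m0"
    have le: "l = (n + of_nat c *\<^sub>R m0) + m0" by (simp add: l_def scaleR_add_left)
    have l: "l \<in> dual_monoid L \<sigma>" unfolding le using dual_monoid_add[OF c] m0 by blast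
    have "\<gamma> l = \<delta> n * \<delta> m0 ^ Suc c"
      using \<delta>(2) l chartD(2)[OF \<delta>(1) n dual_monoid_scale[OF localizesD(3)[OF loc]]]
        chart_scale[OF \<delta>(1) localizesD(3)[OF loc]] unfolding l_def by (metis restrict_apply')
    then have "\<gamma> l \<noteq> 0" using nz localizes_unit[OF loc \<delta>(1)] by simp
    then have "card T \<le> card {w \<in> S. l \<bullet> w = 0}" using min[of l] l T_def by simp
    moreover have sub: "{w \<in> S. l \<bullet> w = 0} \<subseteq> {w \<in> T. n \<bullet> w = 0}"
    proof
      fix w assume w: "w \<in> {w \<in> S. l \<bullet> w = 0}"
      have "0 \<le> (n + of_nat c *\<^sub>R m0) \<bullet> w" using c w unfolding S(2) dual_monoid_cone by auto
      moreover have "l \<bullet> w = (n + of_nat c *\<^sub>R m0) \<bullet> w + m0 \<bullet> w" unfolding le by (rule inner_add_left)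
      ultimately have "m0 \<bullet> w = 0" "(n + of_nat c *\<^sub>R m0) \<bullet> w = 0" using w m0S[of w] by auto
      then show "w \<in> {w \<in> T. n \<bullet> w = 0}" using w by (simp add: T_def inner_add_left)
    qed
    moreover have "finite T" using fS by (simp add: T_def)
    ultimately have "{w \<in> S. l \<bullet> w = 0} = T"
      by (intro card_seteq) auto
    then show "\<forall>w\<in>T. n \<bullet> w = 0" using sub by blast
  qed
  ultimately show ?thesis using that TG \<delta>(1) by blast
qed

end

section \<open>Rays and homogeneous coordinates\<close>

text \<open>A dual vector of value 1 at a generator certifies primitivity: a multiple of the
  generator is a lattice point only if the factor, which is its pairing with that vector, is an
  integer.\<close>

locale ray_fan = rational_fan +
  assumes finite_generators: "finite (\<Union>\<G>)"
    and singleton_generators: "w \<in> \<Union>\<G> \<Longrightarrow> {w} \<in> \<G>"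
    and primitive: "w \<in> \<Union>\<G> \<Longrightarrow> \<exists>m\<in>dual_lattice L. m \<bullet> w = 1"
begin

abbreviation ray :: "'a \<Rightarrow> 'a set" where
  "ray w \<equiv> cone_of {w}"

lemma ray_eq: "ray w = {c *\<^sub>R w | c. 0 \<le> c}"
  by (subst convex_cone_hull_finite) auto

lemma ray_subset_cone_iff: "S \<in> \<G> \<Longrightarrow> w \<in> \<Union>\<G> \<Longrightarrow> ray w \<subseteq> cone_of S \<longleftrightarrow> w \<in> S"
  using cone_subset_iff[OF singleton_generators] by simp

lemma inj_on_ray: "inj_on ray (\<Union>\<G>)"
  using cone_eq_iff singleton_generators by (intro inj_onI) auto

lemma generator_nonzero: "w \<in> \<Union>\<G> \<Longrightarrow> w \<noteq> 0"
  using primitive by force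

lemma generator_lattice: "w \<in> \<Union>\<G> \<Longrightarrow> w \<in> L"
  using generators by blast

text \<open>A one-dimensional cone has only one generator: two of them would be proportional, with a
  negative factor by the separation of their rays and a positive one by pointedness.\<close>

lemma rays_fan: "rays fan = ray ` \<Union>\<G>"
proof
  show "ray ` \<Union>\<G> \<subseteq> rays fan"
  proof
    fix \<rho> assume "\<rho> \<in> ray ` \<Union>\<G>"
    then obtain w where w: "w \<in> \<Union>\<G>" "\<rho> = ray w" by blast
    have "dim (ray w) = 1"
    proof -
      have "ray w \<subseteq> span {w}" by (auto simp: ray_eq span_singleton)
      then have "span (ray w) = span {w}"
        using hull_subset[of "{w}" convex_cone] by (metis span_eq span_superset subset_trans span_mono)
      then have "dim (ray w) = dim {w}" by (metis dim_span)
      then show ?thesis using generator_nonzero[OF w(1)] by simp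
    qed
    then show "\<rho> \<in> rays fan" using w cone_in_fan[OF singleton_generators[OF w(1)]] by (simp add: rays_def)
  qed
  show "rays fan \<subseteq> ray ` \<Union>\<G>"
  proof
    fix \<rho> assume "\<rho> \<in> rays fan"
    then obtain S where S: "S \<in> \<G>" "\<rho> = cone_of S" "dim (cone_of S) = 1" by (auto simp: rays_def fan_def)
    have "S \<noteq> {}" using S(3) by auto
    then obtain w where w: "w \<in> S" by blast
    have SC: "S \<subseteq> cone_of S" by (rule hull_subset)
    have "w' = w" if w': "w' \<in> S" for w'
    proof (rule ccontr)
      assume ne: "w' \<noteq> w"
      have W: "w \<in> \<Union>\<G>" "w' \<in> \<Union>\<G>" using w w' S(1) by auto
      have "cone_of S \<subseteq> span {w}"
        by (rule card_ge_dim_independent) (use SC w S(3) generator_nonzero[OF W(1)] in auto)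
      then obtain c where c: "w' = c *\<^sub>R w" using SC w' by (auto simp: span_singleton)
      obtain a where a: "0 < a \<bullet> w" "a \<bullet> w' < 0"
        using real_separation[OF singleton_generators[OF W(1)] singleton_generators[OF W(2)]] ne by auto
      obtain b where b: "0 < b \<bullet> w" "0 < b \<bullet> w'"
        using real_separation[OF S(1) empty_generators] w w' by auto
      have "c * (a \<bullet> w) < 0" "0 < c * (b \<bullet> w)" using a(2) b(2) by (auto simp: c)
      then show False using a(1) b(1) by (simp add: mult_less_0_iff zero_less_mult_iff)
    qed
    then have "S = {w}" using w by blast
    then show "\<rho> \<in> ray ` \<Union>\<G>" using S by auto
  qed
qed

lemma finite_rays_fan: "finite (rays fan)"
  unfolding rays_fan using finite_generators by simp

lemma primitive_generator_ray:
  assumes w: "w \<in> \<Union>\<G>"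
  shows "primitive_generator L (ray w) = w"
proof -
  obtain m where m: "m \<in> dual_lattice L" "m \<bullet> w = 1" using primitive[OF w] by blast
  have eq: "ray w \<inter> L = range (\<lambda>n::nat. real n *\<^sub>R w)"
  proof
    show "range (\<lambda>n::nat. real n *\<^sub>R w) \<subseteq> ray w \<inter> L"
      using lattice_scale[OF generator_lattice[OF w], of "int _"] by (auto simp: ray_eq)
    show "ray w \<inter> L \<subseteq> range (\<lambda>n::nat. real n *\<^sub>R w)"
    proof
      fix x assume x: "x \<in> ray w \<inter> L"
      then obtain c where c: "x = c *\<^sub>R w" "0 \<le> c" by (auto simp: ray_eq)
      have "c = m \<bullet> x" using m(2) by (simp add: c)
      then have "c \<in> \<int>" using dual_lattice_inner[OF m(1)] x by simp
      then have "c = real (nat \<lfloor>c\<rfloor>)" using c(2) by (auto elim: Ints_cases)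
      then have "x = real (nat \<lfloor>c\<rfloor>) *\<^sub>R w" using c(1) by simp
      then show "x \<in> range (\<lambda>n::nat. real n *\<^sub>R w)" by blast
    qed
  qed
  show ?thesis
    unfolding primitive_generator_def
  proof (rule the_equality)
    show "w \<noteq> 0 \<and> ray w \<inter> L = range (\<lambda>n::nat. real n *\<^sub>R w)" using eq generator_nonzero[OF w] by simp
    fix v assume v: "v \<noteq> 0 \<and> ray w \<inter> L = range (\<lambda>n::nat. real n *\<^sub>R v)"
    have r: "range (\<lambda>n::nat. real n *\<^sub>R v) = range (\<lambda>n::nat. real n *\<^sub>R w)" using v eq by simp
    have self: "u \<in> range (\<lambda>n::nat. real n *\<^sub>R u)" for u :: 'a by (rule range_eqI[of _ _ 1]) simp
    obtain n :: nat where n: "v = real n *\<^sub>R w" using self[of v] unfolding r by blast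
    obtain n' :: nat where n': "w = real n' *\<^sub>R v" using self[of w] unfolding r[symmetric] by blast
    have "1 *\<^sub>R w = real n' *\<^sub>R real n *\<^sub>R w" using n' unfolding n by simp
    then have "1 *\<^sub>R w = (real n' * real n) *\<^sub>R w" by simp
    then have "real (n' * n) = real 1" using generator_nonzero[OF w] unfolding scaleR_cancel_right by simp
    then have "n = 1" unfolding of_nat_eq_iff by simp
    then show "v = w" using n by simp
  qed
qed

lemma ray_primitive_generator:
  assumes "\<rho> \<in> rays fan"
  shows "ray (primitive_generator L \<rho>) = \<rho>"
proof -
  obtain w where "w \<in> \<Union>\<G>" "\<rho> = ray w" using assms rays_fan by blast
  then show ?thesis by (simp only: primitive_generator_ray)
qed

lemma prod_rays: "(\<Prod>\<rho>\<in>rays fan. F \<rho> (primitive_generator L \<rho>)) = (\<Prod>w\<in>\<Union>\<G>. F (ray w) w)"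
  unfolding rays_fan by (subst prod.reindex[OF inj_on_ray]) (auto intro!: prod.cong simp: primitive_generator_ray)

lemma prod_outside_cone_nonzero:
  assumes "S \<in> \<G>"
  shows "(\<Prod>\<rho>\<in>{\<rho> \<in> rays fan. \<not> \<rho> \<subseteq> cone_of S}. x \<rho>) \<noteq> (0::complex) \<longleftrightarrow> (\<forall>w\<in>\<Union>\<G> - S. x (ray w) \<noteq> 0)"
proof -
  have "{\<rho> \<in> rays fan. \<not> \<rho> \<subseteq> cone_of S} = ray ` (\<Union>\<G> - S)"
    unfolding rays_fan using ray_subset_cone_iff[OF assms] by blast
  then show ?thesis using finite_generators by (simp add: prod_zero_iff)
qed

text \<open>Cox's quotient in one chart, with coordinates indexed by the generators of the rays
  instead of the rays.\<close>

definition cox_point :: "'a set \<Rightarrow> ('a \<Rightarrow> complex) \<Rightarrow> 'a \<Rightarrow> complex" where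
  "cox_point S X = (\<lambda>m\<in>dual_monoid L (cone_of S). \<Prod>w\<in>\<Union>\<G>. X w powi \<lfloor>m \<bullet> w\<rfloor>)"

lemma dual_monoid_floor:
  assumes "m \<in> dual_monoid L (cone_of S)" "w \<in> \<Union>\<G>"
  shows "of_int \<lfloor>m \<bullet> w\<rfloor> = m \<bullet> w" "w \<in> S \<Longrightarrow> 0 \<le> \<lfloor>m \<bullet> w\<rfloor>"
proof -
  have m: "m \<in> dual_lattice L" "\<And>w. w \<in> S \<Longrightarrow> 0 \<le> m \<bullet> w" using assms(1) unfolding dual_monoid_cone by auto
  show "of_int \<lfloor>m \<bullet> w\<rfloor> = m \<bullet> w" by (rule dual_lattice_floor[OF m(1) generator_lattice[OF assms(2)]])
  show "0 \<le> \<lfloor>m \<bullet> w\<rfloor>" if "w \<in> S" using m(2)[OF that] by simp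
qed

lemma cox_point_chart:
  assumes X: "\<And>w. w \<in> \<Union>\<G> - S \<Longrightarrow> X w \<noteq> 0"
  shows "cox_point S X \<in> chart L (cone_of S)"
  unfolding cox_point_def
proof (rule chartI)
  fix m m' assume m: "m \<in> dual_monoid L (cone_of S)" "m' \<in> dual_monoid L (cone_of S)"
  have "X w powi \<lfloor>(m + m') \<bullet> w\<rfloor> = X w powi \<lfloor>m \<bullet> w\<rfloor> * X w powi \<lfloor>m' \<bullet> w\<rfloor>" if w: "w \<in> \<Union>\<G>" for w
  proof -
    note fl = dual_monoid_floor[OF m(1) w] dual_monoid_floor[OF m(2) w]
    have "of_int \<lfloor>(m + m') \<bullet> w\<rfloor> = (of_int (\<lfloor>m \<bullet> w\<rfloor> + \<lfloor>m' \<bullet> w\<rfloor>) :: real)"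
      unfolding of_int_add dual_monoid_floor(1)[OF dual_monoid_add[OF m] w] fl(1) fl(3) by (rule inner_add_left)
    then have e: "\<lfloor>(m + m') \<bullet> w\<rfloor> = \<lfloor>m \<bullet> w\<rfloor> + \<lfloor>m' \<bullet> w\<rfloor>" by (simp only: of_int_eq_iff)
    show ?thesis
    proof (cases "X w = 0")
      case False
      then show ?thesis unfolding e by (simp add: power_int_add)
    next
      \<comment> \<open>A coordinate can be zero only at a generator in \<open>S\<close>. There both
        exponents are nonnegative, so they cannot cancel to \<open>0 powi 0 = 1\<close>.\<close>
      case True
      then have "w \<in> S" using X w by blast
      then show ?thesis unfolding e using fl(2,4)
        by (auto simp: power_int_def nat_add_distrib power_add)
    qed
  qed
  then show "(\<Prod>w\<in>\<Union>\<G>. X w powi \<lfloor>(m + m') \<bullet> w\<rfloor>) = (\<Prod>w\<in>\<Union>\<G>. X w powi \<lfloor>m \<bullet> w\<rfloor>) * (\<Prod>w\<in>\<Union>\<G>. X w powi \<lfloor>m' \<bullet> w\<rfloor>)"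
    by (simp add: prod.distrib)
qed simp

text \<open>Coordinates outside \<open>S\<close> or outside \<open>S'\<close> are nonzero, so the
  same formula defines a point over the common face, which restricts to both.\<close>

lemma cox_point_unique:
  assumes S: "S \<in> \<G>" "S' \<in> \<G>" and X: "\<And>w. w \<in> \<Union>\<G> - S \<Longrightarrow> X w \<noteq> 0" "\<And>w. w \<in> \<Union>\<G> - S' \<Longrightarrow> X w \<noteq> 0"
  shows "chart_point L fan (cone_of S) (cox_point S X) = chart_point L fan (cone_of S') (cox_point S' X)"
proof -
  have "cox_point (S \<inter> S') X \<in> chart L (cone_of S \<inter> cone_of S')"
    unfolding Int_generators(2)[OF S] using X by (intro cox_point_chart) blast
  moreover have "restrict (cox_point (S \<inter> S') X) (dual_monoid L (cone_of T)) = cox_point T X" if "T \<in> {S, S'}" for T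
  proof -
    have "cone_of (S \<inter> S') \<subseteq> cone_of T" using that by (intro hull_mono) auto
    from dual_monoid_antimono[OF this, of L] show ?thesis unfolding cox_point_def by (intro ext) (auto simp: restrict_def)
  qed
  ultimately show ?thesis
    by (subst chart_point_eq_iff[OF cone_in_fan[OF S(1)] cox_point_chart[OF X(1)] cone_in_fan[OF S(2)] cox_point_chart[OF X(2)]])
      (auto intro!: bexI[of _ "cox_point (S \<inter> S') X"])
qed

lemma cox_quotient_eq:
  assumes S: "S \<in> \<G>" and x: "\<And>w. w \<in> \<Union>\<G> - S \<Longrightarrow> x (ray w) \<noteq> 0"
  shows "cox_quotient L fan x = chart_point L fan (cone_of S) (cox_point S (\<lambda>w. x (ray w)))"
proof -
  have cp: "(\<lambda>m\<in>dual_monoid L (cone_of T). \<Prod>\<rho>\<in>rays fan. x \<rho> powi \<lfloor>m \<bullet> primitive_generator L \<rho>\<rfloor>) = cox_point T (\<lambda>w. x (ray w))" for T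
    unfolding cox_point_def using prod_rays[of "\<lambda>\<rho> v. x \<rho> powi \<lfloor>_ \<bullet> v\<rfloor>"] by (intro restrict_ext) simp
  show ?thesis
    unfolding cox_quotient_def
  proof (rule the_equality)
    show "\<exists>\<sigma>\<in>fan. (\<Prod>\<rho>\<in>{\<rho> \<in> rays fan. \<not> \<rho> \<subseteq> \<sigma>}. x \<rho>) \<noteq> 0 \<and>
        chart_point L fan (cone_of S) (cox_point S (\<lambda>w. x (ray w))) = chart_point L fan \<sigma>
          (\<lambda>m\<in>dual_monoid L \<sigma>. \<Prod>\<rho>\<in>rays fan. x \<rho> powi \<lfloor>m \<bullet> primitive_generator L \<rho>\<rfloor>)"
      using x S cp by (intro bexI[OF _ cone_in_fan[OF S]] conjI) (simp_all add: prod_outside_cone_nonzero)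
    fix p assume "\<exists>\<sigma>\<in>fan. (\<Prod>\<rho>\<in>{\<rho> \<in> rays fan. \<not> \<rho> \<subseteq> \<sigma>}. x \<rho>) \<noteq> 0 \<and>
        p = chart_point L fan \<sigma> (\<lambda>m\<in>dual_monoid L \<sigma>. \<Prod>\<rho>\<in>rays fan. x \<rho> powi \<lfloor>m \<bullet> primitive_generator L \<rho>\<rfloor>)"
    then obtain T where T: "T \<in> \<G>" "(\<Prod>\<rho>\<in>{\<rho> \<in> rays fan. \<not> \<rho> \<subseteq> cone_of T}. x \<rho>) \<noteq> 0"
      "p = chart_point L fan (cone_of T) (cox_point T (\<lambda>w. x (ray w)))" unfolding fan_def cp[symmetric] by blast
    have "x (ray w) \<noteq> 0" if "w \<in> \<Union>\<G> - T" for w using T(2) that unfolding prod_outside_cone_nonzero[OF T(1)] by blast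
    then show "p = chart_point L fan (cone_of S) (cox_point S (\<lambda>w. x (ray w)))"
      unfolding T(3) using cox_point_unique[OF T(1) S, of "\<lambda>w. x (ray w)"] x by blast
  qed
qed

definition coordinates :: "('a \<Rightarrow> complex) \<Rightarrow> 'a set \<Rightarrow> complex" where
  "coordinates X = (\<lambda>\<rho>\<in>rays fan. X (primitive_generator L \<rho>))"

lemma coordinates_ray: "w \<in> \<Union>\<G> \<Longrightarrow> coordinates X (ray w) = X w"
  by (simp add: coordinates_def rays_fan primitive_generator_ray)

lemma cox_point_cong: "(\<And>w. w \<in> \<Union>\<G> \<Longrightarrow> X w = Y w) \<Longrightarrow> cox_point S X = cox_point S Y"
  unfolding cox_point_def by (auto intro!: restrict_ext prod.cong)

lemma zero_locus_iff:
  "p \<in> zero_locus L fan I \<longleftrightarrow> (\<exists>S\<in>\<G>. \<exists>X. (\<forall>w\<in>\<Union>\<G> - S. X w \<noteq> 0) \<and>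
     p = chart_point L fan (cone_of S) (cox_point S X) \<and> (\<forall>f\<in>I. eval_poly f (coordinates X) = 0))"
proof
  assume "p \<in> zero_locus L fan I"
  then obtain x where x: "x \<in> (rays fan \<rightarrow>\<^sub>E UNIV) - exceptional_set fan" "cox_quotient L fan x = p" "\<forall>f\<in>I. eval_poly f x = 0"
    by (auto simp: zero_locus_def)
  then obtain S where S: "S \<in> \<G>" "\<forall>w\<in>\<Union>\<G> - S. x (ray w) \<noteq> 0"
    using prod_outside_cone_nonzero unfolding exceptional_set_def fan_def by blast
  have "coordinates (\<lambda>w. x (ray w)) = x"
    using x(1) by (intro extensionalityI[of _ "rays fan"]) (auto simp: coordinates_def ray_primitive_generator PiE_def)
  then show "\<exists>S\<in>\<G>. \<exists>X. (\<forall>w\<in>\<Union>\<G> - S. X w \<noteq> 0) \<and>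
     p = chart_point L fan (cone_of S) (cox_point S X) \<and> (\<forall>f\<in>I. eval_poly f (coordinates X) = 0)"
    using S x cox_quotient_eq[OF S(1), of x] by (intro bexI[OF _ S(1)] exI[of _ "\<lambda>w. x (ray w)"]) auto
next
  assume "\<exists>S\<in>\<G>. \<exists>X. (\<forall>w\<in>\<Union>\<G> - S. X w \<noteq> 0) \<and>
     p = chart_point L fan (cone_of S) (cox_point S X) \<and> (\<forall>f\<in>I. eval_poly f (coordinates X) = 0)"
  then obtain S X where S: "S \<in> \<G>" "\<forall>w\<in>\<Union>\<G> - S. X w \<noteq> 0"
     "p = chart_point L fan (cone_of S) (cox_point S X)" "\<forall>f\<in>I. eval_poly f (coordinates X) = 0" by blast
  have nz: "coordinates X (ray w) \<noteq> 0" if "w \<in> \<Union>\<G> - S" for w using that S(2) coordinates_ray by simp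
  have "cox_quotient L fan (coordinates X) = p"
    using cox_quotient_eq[OF S(1), of "coordinates X"] nz S(3)
      cox_point_cong[of "\<lambda>w. coordinates X (ray w)" X S] coordinates_ray by simp
  moreover have "coordinates X \<notin> exceptional_set fan"
    using prod_outside_cone_nonzero[OF S(1), of "coordinates X"] nz cone_in_fan[OF S(1)]
    unfolding exceptional_set_def by blast
  moreover have "p \<in> toric_points L fan"
    unfolding S(3) using S(2) by (intro chart_point_in_points cone_in_fan[OF S(1)] cox_point_chart) auto
  moreover have "coordinates X \<in> rays fan \<rightarrow>\<^sub>E UNIV" by (simp add: coordinates_def)
  ultimately show "p \<in> zero_locus L fan I" unfolding zero_locus_def using S(4) by blast
qed

end

section \<open>Minkowski decompositions of a reflexive polytope\<close>

text \<open>A factor above all ratios of \<open>q\<close> to \<open>p\<close> lets \<open>p\<close>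
  dominate where it is positive and leaves the decision to \<open>q\<close> where \<open>p\<close>
  is zero. In this way a face of a face is cut out by a single functional.\<close>

lemma finite_perturbation:
  fixes p q :: "'a \<Rightarrow> real"
  assumes "finite S" "\<And>w. w \<in> S \<Longrightarrow> 0 \<le> p w" "\<And>w. w \<in> S \<Longrightarrow> p w = 0 \<Longrightarrow> 0 \<le> q w"
  obtains C0 where "\<And>C w. C \<ge> C0 \<Longrightarrow> w \<in> S \<Longrightarrow> 0 \<le> C * p w + q w"
    "\<And>C w. C \<ge> C0 \<Longrightarrow> w \<in> S \<Longrightarrow> C * p w + q w = 0 \<longleftrightarrow> p w = 0 \<and> q w = 0"
proof -
  define C0 where "C0 = (\<Sum>w\<in>S. \<bar>q w\<bar> / p w) + 1"
  have pos: "0 < C * p w + q w" if "C \<ge> C0" "w \<in> S" "p w \<noteq> 0" for C w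
  proof -
    have pw: "0 < p w" using assms(2)[OF that(2)] that(3) by simp
    have "\<bar>q w\<bar> / p w \<le> (\<Sum>w\<in>S. \<bar>q w\<bar> / p w)"
      using assms(1,2) that(2) by (intro member_le_sum) auto
    then have "\<bar>q w\<bar> / p w < C" using that(1) by (simp add: C0_def)
    then have "\<bar>q w\<bar> < C * p w" using pw by (simp add: field_simps)
    then show ?thesis by linarith
  qed
  show ?thesis
  proof (rule that[of C0])
    fix C w assume C: "C \<ge> C0" "w \<in> S"
    show "0 \<le> C * p w + q w" using pos[OF C] assms(3)[OF C(2)] by (cases "p w = 0") auto
    show "C * p w + q w = 0 \<longleftrightarrow> p w = 0 \<and> q w = 0" using pos[OF C] by (cases "p w = 0") auto
  qed
qed

lemma independent_if_dual:
  fixes B :: "'a::euclidean_space set"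
  assumes "\<And>b. b \<in> B \<Longrightarrow> \<exists>d. d \<bullet> b \<noteq> 0 \<and> (\<forall>b'\<in>B - {b}. d \<bullet> b' = 0)"
  shows "independent B"
  unfolding dependent_def
proof clarify
  fix b assume b: "b \<in> B" "b \<in> span (B - {b})"
  obtain d where d: "d \<bullet> b \<noteq> 0" "\<forall>b'\<in>B - {b}. d \<bullet> b' = 0" using assms[OF b(1)] by blast
  have "d \<bullet> x = 0" if "x \<in> span (B - {b})" for x
    using that by (induction rule: span_induct_alt) (use d(2) in \<open>auto simp: inner_add_right\<close>)
  then show False using b(2) d(1) by blast
qed

lemma sum_split_0: "(\<Sum>i\<le>k. f i) = f 0 + (\<Sum>i=1..k. f i)" for f :: "nat \<Rightarrow> 'a::comm_monoid_add"
proof -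
  have "{..k} = insert 0 {1..k}" by auto
  then show ?thesis by simp
qed

locale reflexive_minkowski =
  fixes N \<Delta> :: "'a::euclidean_space set" and k :: nat and e :: "nat \<Rightarrow> 'b::euclidean_space" and D :: "nat \<Rightarrow> 'a set"
  assumes lattice_N: "is_lattice N" and span_N: "span N = UNIV"
    and inj_e: "inj_on e {1..k}" and e_Basis: "e ` {1..k} \<subseteq> Basis"
    and reflexive: "reflexive_polytope N \<Delta>"
    and lattice_D: "\<And>i. i \<le> k \<Longrightarrow> lattice_polytope N (D i)"
    and decomposition: "dual_polytope \<Delta> = (\<Sum>i\<le>k. D i)"
begin

abbreviation "P \<equiv> dual_polytope \<Delta>"

sublocale N: lattice N
  by unfold_locales (rule lattice_N)

lemma lattice_polytopeD:
  assumes "lattice_polytope N Q"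
  shows "polyhedron Q" "compact Q" "convex Q" "finite {v. v extreme_point_of Q}"
    "\<And>v. v extreme_point_of Q \<Longrightarrow> v \<in> N" "Q = convex hull {v. v extreme_point_of Q}"
proof -
  obtain V where V: "finite V" "V \<subseteq> N" "Q = convex hull V" using assms by (auto simp: lattice_polytope_def)
  show "polyhedron Q" unfolding V(3) by (rule polyhedron_convex_hull[OF V(1)])
  then show "finite {v. v extreme_point_of Q}" by (rule finite_polyhedron_extreme_points)
  show "compact Q" unfolding V(3) by (rule finite_imp_compact_convex_hull[OF V(1)])
  show "convex Q" unfolding V(3) by (rule convex_convex_hull)
  show "v \<in> N" if "v extreme_point_of Q" for v using extreme_point_of_convex_hull that V by blast
  show "Q = convex hull {v. v extreme_point_of Q}"
    using \<open>compact Q\<close> \<open>convex Q\<close> by (rule Krein_Milman_Minkowski)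
qed

lemma lattice_P: "lattice_polytope N P"
  using reflexive by (simp add: reflexive_polytope_def)

lemmas P_polytope = lattice_polytopeD[OF lattice_P]
lemmas D_polytope = lattice_polytopeD[OF lattice_D]

text \<open>If all vectors of \<open>\<Delta>\<close> have norm at most \<open>B\<close>, the
  Cauchy-Schwarz inequality puts the ball of radius \<open>1 / B\<close> into the dual.\<close>

lemma zero_interior: "0 \<in> interior P"
proof -
  obtain V where V: "finite V" "\<Delta> = convex hull V" using reflexive by (auto simp: reflexive_polytope_def lattice_polytope_def)
  have "bounded \<Delta>" unfolding V(2) using finite_imp_compact_convex_hull[OF V(1)] compact_imp_bounded by blast
  then obtain B where B: "B > 0" "\<And>m. m \<in> \<Delta> \<Longrightarrow> norm m \<le> B" by (auto simp: bounded_pos)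
  have "ball 0 (1 / B) \<subseteq> P"
  proof
    fix n :: 'a assume n: "n \<in> ball 0 (1 / B)"
    have "-1 \<le> m \<bullet> n" if m: "m \<in> \<Delta>" for m
    proof -
      have "\<bar>m \<bullet> n\<bar> \<le> norm m * norm n" by (rule Cauchy_Schwarz_ineq2)
      also have "\<dots> \<le> B * (1 / B)" using B m n by (intro mult_mono) auto
      finally show ?thesis using B(1) by simp
    qed
    then show "n \<in> P" by (simp add: dual_polytope_def)
  qed
  then show ?thesis using B(1) by (intro interiorI[of "ball 0 (1 / B)"]) auto
qed

lemma zero_in_P: "0 \<in> P"
  using zero_interior interior_subset by blast

lemma small_multiple_in_P: "\<exists>r>0. r *\<^sub>R x \<in> P"
proof -
  obtain d where d: "d > 0" "ball 0 d \<subseteq> P" using zero_interior by (auto simp: mem_interior)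
  define r where "r = d / (norm x + 1) / 2"
  have np: "norm x + 1 > 0" using norm_ge_zero[of x] by linarith
  have "r > 0" using d np by (simp add: r_def)
  moreover have "norm (r *\<^sub>R x) < d"
  proof -
    have "norm (r *\<^sub>R x) = d * (norm x / (norm x + 1)) / 2" using d np by (simp add: r_def)
    also have "\<dots> \<le> d * 1 / 2" using d np by (intro divide_right_mono mult_left_mono) auto
    also have "\<dots> < d" using d by simp
    finally show ?thesis .
  qed
  ultimately show ?thesis using d(2) by (intro exI[of _ r]) (auto simp: dist_norm)
qed

lemma span_P: "span P = UNIV"
proof -
  have "x \<in> span P" for x
  proof -
    obtain r where r: "r > 0" "r *\<^sub>R x \<in> P" using small_multiple_in_P by blast
    then have "(1 / r) *\<^sub>R (r *\<^sub>R x) \<in> span P" by (intro span_scale span_base)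
    then show ?thesis using r by simp
  qed
  then show ?thesis by blast
qed

lemma sum_in_P: "(\<And>i. i \<le> k \<Longrightarrow> f i \<in> D i) \<Longrightarrow> (\<Sum>i\<le>k. f i) \<in> P"
  unfolding decomposition set_sum_alt[OF finite_atMost] by blast

lemma sum_set_elem:
  assumes "x \<in> (\<Sum>i\<le>k. A i)"
  obtains f where "\<And>i. i \<le> k \<Longrightarrow> f i \<in> A i" "x = (\<Sum>i\<le>k. f i)"
  using assms unfolding set_sum_alt[OF finite_atMost] by blast

definition ext :: "nat \<Rightarrow> 'a set" where
  "ext i = {v. v extreme_point_of D i}"

lemma ext: "i \<le> k \<Longrightarrow> finite (ext i)" "i \<le> k \<Longrightarrow> ext i \<subseteq> N" "i \<le> k \<Longrightarrow> D i = convex hull ext i"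
    "i \<le> k \<Longrightarrow> ext i \<subseteq> D i"
  using D_polytope unfolding ext_def by (auto simp: extreme_point_of_def)

lemma ext_nonempty: "i \<le> k \<Longrightarrow> ext i \<noteq> {}"
proof
  assume i: "i \<le> k" and "ext i = {}"
  then have "D i = {}" using ext(3) by simp
  obtain f where "\<And>i. i \<le> k \<Longrightarrow> f i \<in> D i" using zero_in_P sum_set_elem unfolding decomposition by metis
  then show False using i \<open>D i = {}\<close> by blast
qed

text \<open>The support function of the \<open>i\<close>-th summand, in the convention of
  minima.\<close>

definition \<mu> :: "nat \<Rightarrow> 'a \<Rightarrow> real" where
  "\<mu> i m = Min ((\<bullet>) m ` ext i)"

lemma \<mu>_le: "i \<le> k \<Longrightarrow> v \<in> D i \<Longrightarrow> \<mu> i m \<le> m \<bullet> v"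
proof -
  assume i: "i \<le> k" and v: "v \<in> D i"
  have "convex hull ext i \<subseteq> {v. m \<bullet> v \<ge> \<mu> i m}"
    using ext(1)[OF i] by (intro hull_minimal convex_halfspace_ge) (auto simp: \<mu>_def)
  then show ?thesis using v ext(3)[OF i] by auto
qed

lemma \<mu>_attained:
  assumes "i \<le> k"
  obtains v where "v \<in> ext i" "m \<bullet> v = \<mu> i m"
proof -
  have "\<mu> i m \<in> (\<bullet>) m ` ext i" unfolding \<mu>_def using ext(1)[OF assms] ext_nonempty[OF assms] by (intro Min_in) auto
  then show ?thesis using that by auto
qed

lemma \<mu>_scale:
  assumes "i \<le> k" "r > 0"
  shows "\<mu> i (r *\<^sub>R m) = r * \<mu> i m"
proof (rule antisym)
  obtain v where "v \<in> ext i" "m \<bullet> v = \<mu> i m" using \<mu>_attained[OF assms(1)] .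
  then show "\<mu> i (r *\<^sub>R m) \<le> r * \<mu> i m" using \<mu>_le[OF assms(1), of v "r *\<^sub>R m"] ext(4)[OF assms(1)] by auto
  obtain v where "v \<in> ext i" "(r *\<^sub>R m) \<bullet> v = \<mu> i (r *\<^sub>R m)" using \<mu>_attained[OF assms(1)] .
  moreover have "r * \<mu> i m \<le> r * (m \<bullet> v)"
    using \<mu>_le[OF assms(1), of v m] ext(4)[OF assms(1)] assms(2) \<open>v \<in> ext i\<close> by (intro mult_left_mono) auto
  ultimately show "r * \<mu> i m \<le> \<mu> i (r *\<^sub>R m)" by simp
qed

text \<open>The functionals \<open>m\<close> with minimum \<open>-1\<close> on \<open>P\<close> parametrize the nonempty proper faces of \<open>P\<close>.\<close>

definition supports :: "'a set" where
  "supports = {m. (\<Sum>i\<le>k. \<mu> i m) = -1}"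

definition face :: "'a \<Rightarrow> 'a set" where
  "face m = {v \<in> P. m \<bullet> v = -1}"

definition summand_face :: "'a \<Rightarrow> nat \<Rightarrow> 'a set" where
  "summand_face m i = {v \<in> D i. m \<bullet> v = \<mu> i m}"

lemma supports_ge: "m \<in> supports \<Longrightarrow> v \<in> P \<Longrightarrow> -1 \<le> m \<bullet> v"
proof -
  assume m: "m \<in> supports" and v: "v \<in> P"
  then obtain f where f: "\<And>i. i \<le> k \<Longrightarrow> f i \<in> D i" "v = (\<Sum>i\<le>k. f i)"
    using sum_set_elem unfolding decomposition by blast
  have "(\<Sum>i\<le>k. \<mu> i m) \<le> (\<Sum>i\<le>k. m \<bullet> f i)" using f(1) by (intro sum_mono \<mu>_le) auto
  then show ?thesis using m f(2) by (simp add: supports_def inner_sum_right)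
qed

text \<open>Since \<open>P\<close> contains a small positive multiple of \<open>- l\<close>, the
  minimum of \<open>l\<close> on \<open>P\<close> is negative and can be rescaled to -1.\<close>

lemma supports_scale:
  assumes "l \<noteq> 0"
  obtains r where "r > 0" "r *\<^sub>R l \<in> supports"
proof -
  obtain s where s: "s > 0" "s *\<^sub>R (- l) \<in> P" using small_multiple_in_P by blast
  then obtain f where f: "\<And>i. i \<le> k \<Longrightarrow> f i \<in> D i" "s *\<^sub>R (- l) = (\<Sum>i\<le>k. f i)"
    using sum_set_elem unfolding decomposition by blast
  have "(\<Sum>i\<le>k. \<mu> i l) \<le> (\<Sum>i\<le>k. l \<bullet> f i)" using f(1) by (intro sum_mono \<mu>_le) auto
  also have "\<dots> = l \<bullet> (s *\<^sub>R (- l))" unfolding f(2) by (simp add: inner_sum_right)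
  also have "\<dots> < 0" using s assms by simp
  finally have neg: "(\<Sum>i\<le>k. \<mu> i l) < 0" .
  define r where "r = -1 / (\<Sum>i\<le>k. \<mu> i l)"
  have r: "r > 0" using neg by (simp add: r_def divide_neg_neg)
  have "(\<Sum>i\<le>k. \<mu> i (r *\<^sub>R l)) = r * (\<Sum>i\<le>k. \<mu> i l)" using r by (simp add: \<mu>_scale sum_distrib_left)
  also have "\<dots> = -1" using neg by (simp add: r_def)
  finally show ?thesis using that[OF r] by (simp add: supports_def)
qed

lemma supports_nonempty: "supports \<noteq> {}"
proof -
  obtain b :: 'a where "b \<in> Basis" using nonempty_Basis by blast
  then show ?thesis using supports_scale[of b] nonzero_Basis by blast
qed

lemma sum_in_face:
  assumes "m \<in> supports" "\<And>i. i \<le> k \<Longrightarrow> f i \<in> summand_face m i"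
  shows "(\<Sum>i\<le>k. f i) \<in> face m"
proof -
  have "(\<Sum>i\<le>k. m \<bullet> f i) = (\<Sum>i\<le>k. \<mu> i m)" using assms(2) by (intro sum.cong) (auto simp: summand_face_def)
  then show ?thesis using assms sum_in_P[of f] by (simp add: face_def supports_def inner_sum_right summand_face_def)
qed

text \<open>The excesses of the summands over their minima are nonnegative and sum to zero.\<close>

lemma face_summands:
  assumes m: "m \<in> supports" and f: "\<And>i. i \<le> k \<Longrightarrow> f i \<in> D i" and v: "(\<Sum>i\<le>k. f i) \<in> face m" and i: "i \<le> k"
  shows "f i \<in> summand_face m i"
proof -
  have "(\<Sum>i\<le>k. m \<bullet> f i - \<mu> i m) = 0"
    using v m by (simp add: face_def supports_def inner_sum_right sum_subtractf)
  then have "m \<bullet> f i - \<mu> i m = 0"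
    using \<mu>_le f i by (subst (asm) sum_nonneg_eq_0_iff) auto
  then show ?thesis using f[OF i] by (simp add: summand_face_def)
qed

lemma face_elem:
  assumes "m \<in> supports" "v \<in> face m"
  obtains f where "\<And>i. i \<le> k \<Longrightarrow> f i \<in> summand_face m i" "v = (\<Sum>i\<le>k. f i)"
proof -
  have "v \<in> (\<Sum>i\<le>k. D i)" using assms(2) decomposition by (simp add: face_def)
  then obtain f where f: "\<And>i. i \<le> k \<Longrightarrow> f i \<in> D i" "v = (\<Sum>i\<le>k. f i)" using sum_set_elem by blast
  show ?thesis
  proof (rule that[OF _ f(2)])
    show "f i \<in> summand_face m i" if "i \<le> k" for i
      using face_summands[of m f i, OF assms(1) f(1) _ that] assms(2) f(2) by simp
  qed
qed

lemma face_eq_sum: "m \<in> supports \<Longrightarrow> face m = (\<Sum>i\<le>k. summand_face m i)"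
proof
  assume m: "m \<in> supports"
  show "face m \<subseteq> (\<Sum>i\<le>k. summand_face m i)"
  proof
    fix v assume "v \<in> face m"
    then obtain f where "\<And>i. i \<le> k \<Longrightarrow> f i \<in> summand_face m i" "v = (\<Sum>i\<le>k. f i)" using face_elem[OF m] by blast
    then show "v \<in> (\<Sum>i\<le>k. summand_face m i)" unfolding set_sum_alt[OF finite_atMost] by blast
  qed
  show "(\<Sum>i\<le>k. summand_face m i) \<subseteq> face m"
    unfolding set_sum_alt[OF finite_atMost] using sum_in_face[OF m] by auto
qed

lemma summand_face_face_of: "i \<le> k \<Longrightarrow> summand_face m i face_of D i"
  using face_of_Int_supporting_hyperplane_ge[of "D i" "\<mu> i m" m] D_polytope(3)[of i] \<mu>_le[of i]
  by (simp add: summand_face_def Int_def conj_commute)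

lemma summand_face_ext:
  assumes "i \<le> k"
  obtains v where "v \<in> ext i" "v \<in> summand_face m i"
  using \<mu>_attained[OF assms, of m] ext(4)[OF assms] by (auto simp: summand_face_def)

lemma face_nonempty: "m \<in> supports \<Longrightarrow> face m \<noteq> {}"
proof -
  assume m: "m \<in> supports"
  have "\<exists>v. v \<in> summand_face m i" if "i \<le> k" for i using summand_face_ext[OF that] by metis
  then obtain f where "\<And>i. i \<le> k \<Longrightarrow> f i \<in> summand_face m i" by metis
  then show ?thesis using sum_in_face[OF m] by blast
qed

lemma face_proper: "m \<in> supports \<Longrightarrow> face m \<in> proper_faces P"
proof -
  assume m: "m \<in> supports"
  have "face m face_of P"
    using face_of_Int_supporting_hyperplane_ge[of P "-1" m] P_polytope(3) supports_ge[OF m]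
    by (simp add: face_def Int_def)
  moreover have "0 \<notin> face m" by (simp add: face_def)
  ultimately show ?thesis using zero_in_P by (auto simp: proper_faces_def)
qed

lemma proper_face_cases:
  assumes "\<Gamma> \<in> proper_faces P"
  obtains "\<Gamma> = {}" | m where "m \<in> supports" "\<Gamma> = face m"
proof (cases "\<Gamma> = {}")
  case False
  have "\<Gamma> exposed_face_of P" using assms exposed_face_of_polyhedron[OF P_polytope(1)] by (simp add: proper_faces_def)
  then obtain a b where ab: "a \<noteq> 0" "P \<subseteq> {x. a \<bullet> x \<le> b}" "\<Gamma> = P \<inter> {x. a \<bullet> x = b}"
    using assms False unfolding exposed_face_of proper_faces_def by auto
  obtain r where r: "r > 0" "r *\<^sub>R a \<in> P" using small_multiple_in_P by blast
  have "0 < r * (a \<bullet> a)" using r ab(1) by simp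
  also have "\<dots> \<le> b" using ab(2) r(2) by auto
  finally have b: "b > 0" .
  \<comment> \<open>The supporting level \<open>b\<close> is positive because \<open>P\<close>
    contains a neighbourhood of 0, so it can be normalized; the sign turns the maximum into a
    minimum.\<close>
  define m where "m = (-1 / b) *\<^sub>R a"
  have mv: "m \<bullet> v = - (a \<bullet> v) / b" for v by (simp add: m_def)
  have ge: "-1 \<le> m \<bullet> v" if "v \<in> P" for v using ab(2) that b by (auto simp: mv field_simps)
  have \<Gamma>: "\<Gamma> = face m" unfolding face_def ab(3) using b by (auto simp: mv field_simps)
  obtain v where v: "v \<in> P" "m \<bullet> v = -1" using False \<Gamma> by (auto simp: face_def)
  then obtain f where f: "\<And>i. i \<le> k \<Longrightarrow> f i \<in> D i" "v = (\<Sum>i\<le>k. f i)"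
    using sum_set_elem unfolding decomposition by blast
  have "(\<Sum>i\<le>k. \<mu> i m) \<le> (\<Sum>i\<le>k. m \<bullet> f i)" using f(1) by (intro sum_mono \<mu>_le) auto
  then have le: "(\<Sum>i\<le>k. \<mu> i m) \<le> -1" using v(2) f(2) by (simp add: inner_sum_right)
  have "\<exists>w. w \<in> ext i \<and> m \<bullet> w = \<mu> i m" if "i \<le> k" for i using \<mu>_attained[OF that, of m] by metis
  then obtain g where g: "\<And>i. i \<le> k \<Longrightarrow> g i \<in> ext i" "\<And>i. i \<le> k \<Longrightarrow> m \<bullet> g i = \<mu> i m" by metis
  have "-1 \<le> m \<bullet> (\<Sum>i\<le>k. g i)" using g(1) ext(4) by (intro ge sum_in_P) auto
  then have "-1 \<le> (\<Sum>i\<le>k. \<mu> i m)" using g(2) by (simp add: inner_sum_right)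
  then have "m \<in> supports" using le by (simp add: supports_def)
  then show ?thesis using that(2) \<Gamma> by blast
qed (rule that(1))

text \<open>Cancellation for Minkowski sums of compact convex sets makes the induced decomposition unique.\<close>

lemma induced_decomposition_unique:
  assumes m: "m \<in> supports" and ind: "induced_decomposition k D (face m) F" and i: "i \<le> k"
  shows "F i = summand_face m i"
proof -
  have F: "\<And>i. i \<le> k \<Longrightarrow> F i face_of D i" and sumF: "face m = (\<Sum>i\<le>k. F i)"
    using ind by (auto simp: induced_decomposition_def)
  have FD: "F i \<subseteq> D i" if "i \<le> k" for i using face_of_imp_subset[OF F[OF that]] .
  obtain v0 where "v0 \<in> (\<Sum>i\<le>k. F i)" using face_nonempty[OF m] sumF by auto
  then obtain f0 where f0: "\<And>i. i \<le> k \<Longrightarrow> f0 i \<in> F i" using sum_set_elem by metis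
  have memF: "(\<Sum>i\<le>k. f i) \<in> face m" if "\<And>i. i \<le> k \<Longrightarrow> f i \<in> F i" for f
    unfolding sumF set_sum_alt[OF finite_atMost] using that by blast
  have sub: "F j \<subseteq> summand_face m j" if j: "j \<le> k" for j
  proof
    fix v assume v: "v \<in> F j"
    define f where "f = f0(j := v)"
    have f: "f i \<in> F i" if "i \<le> k" for i using f0 that v by (simp add: f_def)
    have "f j \<in> summand_face m j"
      by (rule face_summands[OF m _ memF j]) (use f FD in auto)
    then show "v \<in> summand_face m j" by (simp add: f_def)
  qed
  moreover have "summand_face m i \<subseteq> F i"
  proof (rule ccontr)
    assume "\<not> summand_face m i \<subseteq> F i"
    then obtain v where v: "v \<in> summand_face m i" "v \<notin> F i" by blast
    have comp: "compact (F j)" if "j \<le> k" for j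
      using face_of_imp_compact[OF D_polytope(3)[OF that] D_polytope(2)[OF that] F[OF that]] .
    obtain a b where ab: "a \<bullet> v < b" "\<forall>x\<in>F i. a \<bullet> x > b"
      using separating_hyperplane_closed_point[OF face_of_imp_convex[OF F[OF i]] compact_imp_closed[OF comp[OF i]] v(2)] by blast
    have "\<exists>x\<in>F j. \<forall>y\<in>F j. a \<bullet> x \<le> a \<bullet> y" if "j \<le> k" for j
      using f0[OF that] by (intro continuous_attains_inf comp[OF that]) (auto intro: continuous_intros)
    then obtain g where g: "\<And>j. j \<le> k \<Longrightarrow> g j \<in> F j" "\<And>j y. j \<le> k \<Longrightarrow> y \<in> F j \<Longrightarrow> a \<bullet> g j \<le> a \<bullet> y" by metis
    \<comment> \<open>Replacing the \<open>i\<close>-th minimizer by \<open>v\<close> gives a point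
      of the face at which \<open>a\<close> is smaller than at any sum of points of the
      \<open>F j\<close>, a contradiction.\<close>
    define h where "h = g(i := v)"
    have "h j \<in> summand_face m j" if "j \<le> k" for j
      using that v(1) sub[OF that] g(1)[OF that] by (auto simp: h_def)
    then have "(\<Sum>j\<le>k. h j) \<in> (\<Sum>i\<le>k. F i)" using sum_in_face[OF m, of h] sumF by blast
    then obtain f where f: "\<And>j. j \<le> k \<Longrightarrow> f j \<in> F j" "(\<Sum>j\<le>k. h j) = (\<Sum>j\<le>k. f j)" using sum_set_elem by metis
    have "(\<Sum>j\<le>k. a \<bullet> h j) < (\<Sum>j\<le>k. a \<bullet> f j)"
    proof (rule sum_strict_mono_ex1)
      show "\<forall>j\<in>{..k}. a \<bullet> h j \<le> a \<bullet> f j" using ab f(1) g(2) i by (force simp: h_def)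
      have "a \<bullet> v < a \<bullet> f i" using ab f(1)[OF i] by force
      then show "\<exists>j\<in>{..k}. a \<bullet> h j < a \<bullet> f j" using i by (intro bexI[of _ i]) (auto simp: h_def)
    qed simp
    then show False using arg_cong[OF f(2), of "\<lambda>x. a \<bullet> x"] by (simp add: inner_sum_right)
  qed
  ultimately show ?thesis using i by blast
qed

lemma induced_decomposition_face:
  "m \<in> supports \<Longrightarrow> induced_decomposition k D (face m) (summand_face m)"
  unfolding induced_decomposition_def
  using summand_face_face_of face_eq_sum face_nonempty by blast

subsection \<open>The fan of faces\<close>

definition vertices :: "'a set" where
  "vertices = {v. v extreme_point_of P}"

definition face_generators :: "'a set set" where
  "face_generators = (\<lambda>\<Gamma>. vertices \<inter> \<Gamma>) ` proper_faces P"

lemma face_hull_vertices: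
  assumes "\<Gamma> \<in> proper_faces P"
  shows "\<Gamma> = convex hull (vertices \<inter> \<Gamma>)"
proof -
  have f: "\<Gamma> face_of P" using assms by (simp add: proper_faces_def)
  have "\<Gamma> = convex hull {v. v extreme_point_of \<Gamma>}"
    by (intro Krein_Milman_Minkowski face_of_imp_compact[OF P_polytope(3,2) f] face_of_imp_convex[OF f])
  also have "{v. v extreme_point_of \<Gamma>} = vertices \<inter> \<Gamma>"
    using extreme_point_of_face[OF f] by (auto simp: vertices_def)
  finally show ?thesis .
qed

lemma cone_of_vertices:
  assumes "\<Gamma> \<in> proper_faces P"
  shows "cone_of (vertices \<inter> \<Gamma>) = cone_of \<Gamma>"
proof
  show "cone_of (vertices \<inter> \<Gamma>) \<subseteq> cone_of \<Gamma>" by (rule hull_mono) auto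
  have "\<Gamma> \<subseteq> cone_of (vertices \<inter> \<Gamma>)"
    using face_hull_vertices[OF assms] convex_hull_subset_convex_cone_hull by blast
  then show "cone_of \<Gamma> \<subseteq> cone_of (vertices \<inter> \<Gamma>)" by (intro hull_minimal convex_cone_convex_cone_hull)
qed

lemma proper_face_supporting:
  assumes "\<Gamma> \<in> proper_faces P"
  obtains m where "\<And>v. v \<in> P \<Longrightarrow> -1 \<le> m \<bullet> v" "\<Gamma> = {v \<in> P. m \<bullet> v = -1}"
proof (rule proper_face_cases[OF assms])
  assume "\<Gamma> = {}"
  then show ?thesis using that[of 0] by simp
next
  fix m assume "m \<in> supports" "\<Gamma> = face m"
  then show ?thesis using that[of m] supports_ge by (simp add: face_def)
qed

sublocale \<Sigma>: rational_fan N face_generators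
proof
  show "finite S \<and> S \<subseteq> N" if "S \<in> face_generators" for S
    using that P_polytope(4,5) by (auto simp: face_generators_def vertices_def)
  have "{} \<in> proper_faces P" using zero_in_P by (auto simp: proper_faces_def)
  then show "{} \<in> face_generators" by (force simp: face_generators_def)
next
  fix S S' assume "S \<in> face_generators" "S' \<in> face_generators"
  then obtain \<Gamma> \<Gamma>' where \<Gamma>: "\<Gamma> \<in> proper_faces P" "S = vertices \<inter> \<Gamma>" "\<Gamma>' \<in> proper_faces P" "S' = vertices \<inter> \<Gamma>'"
    by (auto simp: face_generators_def)
  obtain m where m: "\<And>v. v \<in> P \<Longrightarrow> -1 \<le> m \<bullet> v" "\<Gamma> = {v \<in> P. m \<bullet> v = -1}" using proper_face_supporting[OF \<Gamma>(1)] by blast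
  obtain m' where m': "\<And>v. v \<in> P \<Longrightarrow> -1 \<le> m' \<bullet> v" "\<Gamma>' = {v \<in> P. m' \<bullet> v = -1}" using proper_face_supporting[OF \<Gamma>(3)] by blast
  show "\<exists>a. (\<forall>w\<in>S - S'. 0 < a \<bullet> w) \<and> (\<forall>w\<in>S \<inter> S'. a \<bullet> w = 0) \<and> (\<forall>w\<in>S' - S. a \<bullet> w < 0)"
  \<comment> \<open>Where \<open>m\<close> has the value -1, the difference has the value
    \<open>m' \<bullet> w + 1\<close>, which is nonnegative on \<open>P\<close> and zero exactly on
    \<open>\<Gamma>'\<close>; the other side is symmetric.\<close>
  proof (intro exI[of _ "m' - m"] conjI ballI)
    show "0 < (m' - m) \<bullet> w" if "w \<in> S - S'" for w
      using that m(2) m'(1)[of w] m'(2) \<Gamma> by (auto simp: inner_diff_left less_le)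
    show "(m' - m) \<bullet> w = 0" if "w \<in> S \<inter> S'" for w
      using that m(2) m'(2) \<Gamma> by (auto simp: inner_diff_left)
    show "(m' - m) \<bullet> w < 0" if "w \<in> S' - S" for w
      using that m(2) m(1)[of w] m'(2) \<Gamma> by (auto simp: inner_diff_left less_le)
  qed
next
  fix S and a :: 'a assume "S \<in> face_generators" and a: "\<forall>w\<in>S. 0 \<le> a \<bullet> w"
  then obtain \<Gamma> where \<Gamma>: "\<Gamma> \<in> proper_faces P" "S = vertices \<inter> \<Gamma>" by (auto simp: face_generators_def)
  have fP: "\<Gamma> face_of P" "\<Gamma> \<noteq> P" using \<Gamma>(1) by (auto simp: proper_faces_def)
  have "convex hull (vertices \<inter> \<Gamma>) \<subseteq> {v. a \<bullet> v \<ge> 0}"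
    using a \<Gamma>(2) by (intro hull_minimal convex_halfspace_ge) auto
  then have "\<And>v. v \<in> \<Gamma> \<Longrightarrow> a \<bullet> v \<ge> 0" using face_hull_vertices[OF \<Gamma>(1)] by auto
  then have "\<Gamma> \<inter> {v. a \<bullet> v = 0} face_of \<Gamma>"
    by (intro face_of_Int_supporting_hyperplane_ge face_of_imp_convex[OF fP(1)])
  then have "\<Gamma> \<inter> {v. a \<bullet> v = 0} \<in> proper_faces P"
    using face_of_trans[OF _ fP(1)] fP face_of_imp_subset[OF fP(1)] unfolding proper_faces_def by blast
  moreover have "{w \<in> S. a \<bullet> w = 0} = vertices \<inter> (\<Gamma> \<inter> {v. a \<bullet> v = 0})" using \<Gamma>(2) by auto
  ultimately show "{w \<in> S. a \<bullet> w = 0} \<in> face_generators" unfolding face_generators_def by (rule rev_image_eqI)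
qed

lemma face_fan_eq: "\<Sigma>.fan = face_fan P"
proof -
  have "\<Sigma>.fan = cone_of ` face_generators" by (rule \<Sigma>.fan_def)
  then show ?thesis
    unfolding face_generators_def face_fan_def image_image Setcompr_eq_image
    using cone_of_vertices by (simp cong: image_cong)
qed

subsection \<open>The Cayley fan\<close>

definition \<epsilon> :: "nat \<Rightarrow> 'b" where
  "\<epsilon> i = (if i = 0 then - (\<Sum>j=1..k. e j) else e i)"

lemma e_inner: "i \<in> {1..k} \<Longrightarrow> j \<in> {1..k} \<Longrightarrow> e i \<bullet> e j = (if i = j then 1 else 0)"
proof -
  assume ij: "i \<in> {1..k}" "j \<in> {1..k}"
  have "e i \<in> Basis" "e j \<in> Basis" using e_Basis ij by blast+
  then show ?thesis using inj_onD[OF inj_e _ ij] by (auto simp: inner_Basis)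
qed

lemma e_\<epsilon>: "i \<in> {1..k} \<Longrightarrow> j \<le> k \<Longrightarrow> e i \<bullet> \<epsilon> j = (if j = 0 then -1 else if i = j then 1 else 0)"
proof -
  assume i: "i \<in> {1..k}" and j: "j \<le> k"
  have "(\<Sum>l=1..k. e i \<bullet> e l) = (\<Sum>l=1..k. if i = l then 1 else 0)"
    using i by (intro sum.cong) (auto simp: e_inner)
  also have "\<dots> = 1" using i by simp
  finally show ?thesis using i j by (simp add: \<epsilon>_def e_inner inner_sum_right)
qed

lemma sum_\<epsilon>: "(\<Sum>i\<le>k. \<epsilon> i) = 0"
proof -
  have "(\<Sum>i=1..k. \<epsilon> i) = (\<Sum>i=1..k. e i)" by (intro sum.cong) (auto simp: \<epsilon>_def)
  then show ?thesis unfolding sum_split_0 by (simp add: \<epsilon>_def)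
qed

lemma inj_\<epsilon>: "inj_on \<epsilon> {..k}"
proof (rule inj_onI)
  fix i j assume ij: "i \<in> {..k}" "j \<in> {..k}" "\<epsilon> i = \<epsilon> j"
  show "i = j"
  proof (cases "i = 0")
    case True
    show ?thesis
    proof (rule ccontr)
      assume "i \<noteq> j"
      then show False using ij True e_\<epsilon>[of j i] e_\<epsilon>[of j j] by auto
    qed
  next
    case False
    then show ?thesis using ij e_\<epsilon>[of i i] e_\<epsilon>[of i j] by (auto split: if_splits)
  qed
qed

text \<open>A functional that adds the constant \<open>u i\<close> at level \<open>i\<close>,
  provided that these constants sum to zero, as the vectors \<open>\<epsilon> i\<close> do.\<close>

definition functional :: "'a \<Rightarrow> (nat \<Rightarrow> real) \<Rightarrow> 'a \<times> 'b" where
  "functional l u = (l, \<Sum>i=1..k. u i *\<^sub>R e i)"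

lemma functional_inner:
  assumes "i \<le> k" "(\<Sum>j\<le>k. u j) = 0"
  shows "functional l u \<bullet> (v, \<epsilon> i) = l \<bullet> v + u i"
proof -
  have "(\<Sum>j=1..k. u j * (e j \<bullet> \<epsilon> i)) = u i"
  proof (cases "i = 0")
    case True
    then have "(\<Sum>j=1..k. u j * (e j \<bullet> \<epsilon> i)) = (\<Sum>j=1..k. - u j)" by (intro sum.cong) (auto simp: e_\<epsilon>)
    then show ?thesis using assms(2) True unfolding sum_split_0 by (simp add: sum_negf)
  next
    case False
    then have "(\<Sum>j=1..k. u j * (e j \<bullet> \<epsilon> i)) = (\<Sum>j=1..k. if j = i then u j else 0)"
      using assms(1) by (intro sum.cong) (auto simp: e_\<epsilon>)
    then show ?thesis using assms(1) False by simp
  qed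
  then show ?thesis by (simp add: functional_def inner_sum_left)
qed

definition W :: "('a \<times> 'b) set" where
  "W = (\<Union>i\<le>k. (\<lambda>v. (v, \<epsilon> i)) ` ext i)"

definition cayley_generators :: "'a \<Rightarrow> ('a \<times> 'b) set" where
  "cayley_generators m = {(v, \<epsilon> i) | v i. i \<le> k \<and> v \<in> ext i \<and> m \<bullet> v = \<mu> i m}"

lemma W_iff: "i \<le> k \<Longrightarrow> (v, \<epsilon> i) \<in> W \<longleftrightarrow> v \<in> ext i"
  unfolding W_def using inj_onD[OF inj_\<epsilon>] by fastforce

lemma WE:
  assumes "w \<in> W"
  obtains v i where "i \<le> k" "v \<in> ext i" "w = (v, \<epsilon> i)"
  using assms unfolding W_def by blast

lemma cayley_generators_iff: "i \<le> k \<Longrightarrow> (v, \<epsilon> i) \<in> cayley_generators m \<longleftrightarrow> v \<in> ext i \<and> m \<bullet> v = \<mu> i m"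
  unfolding cayley_generators_def using inj_onD[OF inj_\<epsilon>] by fastforce

lemma cayley_generators_subset: "cayley_generators m \<subseteq> W"
  unfolding cayley_generators_def W_def by blast

lemma finite_W: "finite W"
  unfolding W_def using ext(1) by auto

text \<open>On the generators of the cone of a face, every function that is affine on each \<open>D i\<close> with the
  same linear part is linear.\<close>

lemma prescribed_functional:
  assumes "m \<in> supports"
  obtains h where "\<And>i v. i \<le> k \<Longrightarrow> m \<bullet> v = \<mu> i m \<Longrightarrow> h \<bullet> (v, \<epsilon> i) = l \<bullet> v + b i"
proof -
  define t where "t = (\<Sum>i\<le>k. b i)"
  \<comment> \<open>Since the minima \<open>\<mu> i m\<close> sum to -1, these constants sum to
    zero. Where \<open>m \<bullet> v = \<mu> i m\<close>, the added term is undone by subtracting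
    \<open>t\<close> times \<open>m\<close> from the linear part.\<close>
  define u where "u i = b i + t * \<mu> i m" for i
  have "(\<Sum>i\<le>k. u i) = 0"
    using assms by (simp add: u_def sum.distrib sum_distrib_left[symmetric] supports_def t_def)
  then show ?thesis
    using that[of "functional (l - t *\<^sub>R m) u"] by (simp add: functional_inner u_def inner_diff_left)
qed

text \<open>The summand 1 at level 0 balances the total -1 of the minima. It is the same for all
  \<open>m\<close>, so a difference of two such functionals compares only the excesses over the
  minima.\<close>

definition support_functional :: "'a \<Rightarrow> 'a \<times> 'b" where
  "support_functional m = functional (- m) (\<lambda>i. \<mu> i m + (if i = 0 then 1 else 0))"

lemma support_functional_inner:
  assumes "m \<in> supports" "i \<le> k"
  shows "support_functional m \<bullet> (v, \<epsilon> i) = (if i = 0 then 1 else 0) - (m \<bullet> v - \<mu> i m)"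
proof -
  have "(\<Sum>i\<le>k. \<mu> i m + (if i = 0 then 1 else 0)) = 0"
    using assms(1) by (simp add: sum.distrib supports_def sum.delta)
  then show ?thesis unfolding support_functional_def by (simp add: functional_inner[OF assms(2)])
qed

lemma support_functional_separates:
  assumes m: "m \<in> supports" "m' \<in> supports" and w: "w \<in> cayley_generators m"
  shows "0 \<le> (support_functional m - support_functional m') \<bullet> w"
    "(support_functional m - support_functional m') \<bullet> w = 0 \<longleftrightarrow> w \<in> cayley_generators m'"
proof -
  obtain v i where v: "i \<le> k" "v \<in> ext i" "w = (v, \<epsilon> i)" using w cayley_generators_subset WE by blast
  have eq: "(support_functional m - support_functional m') \<bullet> w = m' \<bullet> v - \<mu> i m'"
    using w v by (simp add: inner_diff_left support_functional_inner m cayley_generators_iff)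
  show "0 \<le> (support_functional m - support_functional m') \<bullet> w"
    unfolding eq using \<mu>_le[OF v(1), of v m'] ext(4)[OF v(1)] v(2) by auto
  show "(support_functional m - support_functional m') \<bullet> w = 0 \<longleftrightarrow> w \<in> cayley_generators m'"
    unfolding eq using v by (simp add: cayley_generators_iff)
qed

text \<open>The fan also contains the faces of the cones over faces of \<open>P\<close>; each is
  recorded by a functional that is nonnegative on the generators.\<close>

definition cayley_generator_sets :: "('a \<times> 'b) set set" where
  "cayley_generator_sets = {{w \<in> cayley_generators m. a \<bullet> w = 0} | m a. m \<in> supports \<and> (\<forall>w\<in>cayley_generators m. 0 \<le> a \<bullet> w)}"

lemma cayley_generator_setsI:
  "m \<in> supports \<Longrightarrow> (\<And>w. w \<in> cayley_generators m \<Longrightarrow> 0 \<le> a \<bullet> w) \<Longrightarrow> {w \<in> cayley_generators m. a \<bullet> w = 0} \<in> cayley_generator_sets"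
  unfolding cayley_generator_sets_def by blast

lemma cayley_generator_setsE:
  assumes "S \<in> cayley_generator_sets"
  obtains m a where "m \<in> supports" "\<And>w. w \<in> cayley_generators m \<Longrightarrow> 0 \<le> a \<bullet> w" "S = {w \<in> cayley_generators m. a \<bullet> w = 0}"
  using assms unfolding cayley_generator_sets_def by blast

lemma cayley_generators_in_sets: "m \<in> supports \<Longrightarrow> cayley_generators m \<in> cayley_generator_sets"
  using cayley_generator_setsI[of m 0] by simp

section \<open>The lattice of the target\<close>

abbreviation N' :: "('a \<times> 'b) set" where
  "N' \<equiv> N \<times> int_span (e ` {1..k})"

definition basis' :: "('a \<times> 'b) set" where
  "basis' = (\<lambda>b. (b, 0)) ` N.basis \<union> (\<lambda>i. (0, e i)) ` {1..k}"

lemma finite_basis': "finite basis'"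
  unfolding basis'_def using N.finite_basis by simp

lemma disjoint_basis': "(\<lambda>b. (b, 0)) ` N.basis \<inter> (\<lambda>i. (0, e i)) ` {1..k} = {}"
proof -
  have "e i \<noteq> 0" if "i \<in> {1..k}" for i using e_inner[OF that that] by auto
  then show ?thesis by force
qed

lemma independent_basis': "independent basis'"
proof (rule independent_if_dual)
  fix x assume "x \<in> basis'"
  then consider b where "b \<in> N.basis" "x = (b, 0)" | i where "i \<in> {1..k}" "x = (0, e i)" unfolding basis'_def by blast
  then show "\<exists>d. d \<bullet> x \<noteq> 0 \<and> (\<forall>y\<in>basis' - {x}. d \<bullet> y = 0)"
  proof cases
    case 1
    have "(N.dual_basis b, 0) \<bullet> y = 0" if y: "y \<in> basis' - {x}" for y
    proof -
      from y consider b' where "b' \<in> N.basis" "y = (b', 0)" "b' \<noteq> b" | i where "y = (0, e i)"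
        using 1 unfolding basis'_def by blast
      then show ?thesis using N.dual_basis_inner[OF 1(1)] by cases auto
    qed
    moreover have "(N.dual_basis b, 0) \<bullet> x \<noteq> 0" using 1 N.dual_basis_inner[OF 1(1,1)] by simp
    ultimately show ?thesis by blast
  next
    case 2
    have "(0, e i) \<bullet> y = 0" if y: "y \<in> basis' - {x}" for y
    proof -
      from y consider j where "j \<in> {1..k}" "y = (0, e j)" "j \<noteq> i" | b where "y = (b, 0)"
        using 2 unfolding basis'_def by blast
      then show ?thesis using e_inner[OF 2(1)] by cases auto
    qed
    moreover have "(0, e i) \<bullet> x \<noteq> 0" using 2 e_inner[OF 2(1,1)] by simp
    ultimately show ?thesis by blast
  qed
qed

lemma N_iff: "x \<in> N \<longleftrightarrow> (\<exists>c. x = (\<Sum>b\<in>N.basis. of_int (c b) *\<^sub>R b))"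
proof -
  have "x \<in> N \<longleftrightarrow> x \<in> int_span N.basis" by (subst (1) N.basis(2)) (rule refl)
  then show ?thesis unfolding int_span_def by auto
qed

lemma int_span_basis': "int_span basis' = N'"
proof
  have split: "(\<Sum>x\<in>basis'. of_int (c x) *\<^sub>R x) =
      ((\<Sum>b\<in>N.basis. of_int (c (b, 0)) *\<^sub>R b), (\<Sum>y\<in>e ` {1..k}. of_int (c (0, y)) *\<^sub>R y))" for c
  proof -
    have i1: "inj_on (\<lambda>b. (b, 0::'b)) N.basis" by (auto simp: inj_on_def)
    have i2: "inj_on (Pair (0::'a)) (e ` {1..k})" by (auto simp: inj_on_def)
    have im: "(\<lambda>i. (0, e i)) ` {1..k} = Pair (0::'a) ` (e ` {1..k})" by auto
    show ?thesis
      unfolding basis'_def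
      by (subst sum.union_disjoint[OF _ _ disjoint_basis'])
        (simp_all add: N.finite_basis im sum.reindex[OF i1] sum.reindex[OF i2] o_def prod_eq_iff fst_sum snd_sum
          del: One_nat_def)
  qed
  show "int_span basis' \<subseteq> N'"
  proof
    fix z assume "z \<in> int_span basis'"
    then obtain c where "z = (\<Sum>x\<in>basis'. of_int (c x) *\<^sub>R x)" unfolding int_span_def by blast
    then show "z \<in> N'" unfolding split int_span_def by (auto simp: N_iff)
  qed
  show "N' \<subseteq> int_span basis'"
  proof clarify
    fix x y assume "x \<in> N" "y \<in> int_span (e ` {1..k})"
    then obtain c d where "x = (\<Sum>b\<in>N.basis. of_int (c b) *\<^sub>R b)" "y = (\<Sum>y\<in>e ` {1..k}. of_int (d y) *\<^sub>R y)"
      unfolding N_iff int_span_def by blast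
    \<comment> \<open>The two kinds of basis vectors are told apart by whether the second component
      is zero.\<close>
    moreover define c' where "c' z = (if snd z = 0 then c (fst z) else d (snd z))" for z :: "'a \<times> 'b"
    moreover have "c' (0, z) = d z" if z: "z \<in> e ` {1..k}" for z
    proof -
      obtain i where "i \<in> {1..k}" "z = e i" using z by blast
      then have "z \<noteq> 0" using e_inner[of i i] by auto
      then show ?thesis by (simp add: c'_def)
    qed
    ultimately have "(x, y) = (\<Sum>z\<in>basis'. of_int (c' z) *\<^sub>R z)" unfolding split by (simp cong: sum.cong)
    then show "(x, y) \<in> int_span basis'" unfolding int_span_def by blast
  qed
qed

lemma is_lattice_N': "is_lattice N'"
  unfolding is_lattice_def using independent_basis' int_span_basis' by metis

lemma dim_N': "dim N' = DIM('a) + k"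
proof -
  have "dim N' = card basis'"
    unfolding int_span_basis'[symmetric]
    using dim_span[of "int_span basis'"] span_int_span[OF finite_basis'] dim_eq_card_independent[OF independent_basis']
    by (metis dim_span)
  also have "\<dots> = card N.basis + k"
  proof -
    have "inj_on (\<lambda>i. (0::'a, e i)) {1..k}" using inj_onD[OF inj_e] by (intro inj_onI) blast
    moreover have "inj_on (\<lambda>b. (b, 0::'b)) N.basis" by (auto simp: inj_on_def)
    ultimately show ?thesis
      unfolding basis'_def using card_Un_disjoint[OF _ _ disjoint_basis'] N.finite_basis by (simp add: card_image)
  qed
  also have "card N.basis = DIM('a)" using N.card_basis dim_span[of N] span_N by simp
  finally show ?thesis .
qed

lemma fst_dual_lattice: "m \<in> dual_lattice N' \<Longrightarrow> fst m \<in> dual_lattice N"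
proof -
  assume m: "m \<in> dual_lattice N'"
  have "fst m \<bullet> n \<in> \<int>" if "n \<in> N" for n
    using dual_lattice_inner[OF m, of "(n, 0)"] that int_span_0 by (cases m) auto
  then show ?thesis by (simp add: dual_lattice_def span_N)
qed

lemma \<epsilon>_in_int_span: "i \<le> k \<Longrightarrow> \<epsilon> i \<in> int_span (e ` {1..k})"
proof (cases "i = 0")
  case True
  have "(\<Sum>j\<in>J. e j) \<in> int_span (e ` {1..k})" if "finite J" "J \<subseteq> {1..k}" for J
    using that
    by (induction J rule: finite_induct) (simp_all add: int_span_0 int_span_add int_span_base del: One_nat_def)
  from int_span_scale[OF this[of "{1..k}"], of "-1"] show ?thesis using True by (simp add: \<epsilon>_def)
next
  case False
  assume "i \<le> k"
  then show ?thesis using False by (simp add: \<epsilon>_def int_span_base)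
qed

lemma W_subset_N': "W \<subseteq> N'"
  unfolding W_def using ext(2) \<epsilon>_in_int_span by blast

lemma functional_dual_lattice:
  assumes "l \<in> dual_lattice N" "\<And>i. u i \<in> \<int>"
  shows "functional l u \<in> dual_lattice N'"
proof -
  have "functional l u \<in> span N'"
  proof -
    have 1: "(b, 0) \<in> span N'" if "b \<in> N.basis" for b
      using that N.basis_subset int_span_0 by (intro span_base) auto
    have "(x, 0) \<in> span N'" if "x \<in> span N.basis" for x
      using that
    proof (induction rule: span_induct_alt)
      case (step c b y)
      have "c *\<^sub>R (b, 0) + (y, 0) \<in> span N'" using step 1 by (intro span_add span_scale) auto
      then show ?case by simp
    qed (simp add: span_zero zero_prod_def[symmetric])
    then have "(l, 0) \<in> span N'" using span_N N.span_lattice by auto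
    moreover have "(\<Sum>i=1..k. u i *\<^sub>R (0, e i)) \<in> span N'"
      using N.lattice_0 by (intro span_sum span_scale span_base) (auto intro: int_span_base)
    ultimately have "(l, 0) + (\<Sum>i=1..k. u i *\<^sub>R (0, e i)) \<in> span N'" by (rule span_add)
    moreover have "functional l u = (l, 0) + (\<Sum>i=1..k. u i *\<^sub>R (0, e i))"
      by (simp add: functional_def prod_eq_iff fst_sum snd_sum)
    ultimately show ?thesis by simp
  qed
  moreover have "functional l u \<bullet> n \<in> \<int>" if n: "n \<in> N'" for n
  proof -
    obtain x y where n': "n = (x, y)" "x \<in> N" "y \<in> int_span (e ` {1..k})" using n by auto
    have "e i \<bullet> y \<in> \<int>" if i: "i \<in> {1..k}" for i
    proof -
      obtain c where y: "y = (\<Sum>z\<in>e ` {1..k}. of_int (c z) *\<^sub>R z)" using n'(3) unfolding int_span_def by blast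
      have "e i \<bullet> y = (\<Sum>z\<in>e ` {1..k}. of_int (c z) * (e i \<bullet> z))" by (simp add: y inner_sum_right)
      also have "\<dots> \<in> \<int>" using e_inner[OF i] by (intro Ints_sum) auto
      finally show ?thesis .
    qed
    then have "(\<Sum>i=1..k. u i * (e i \<bullet> y)) \<in> \<int>" using assms(2) by (intro Ints_sum Ints_mult) auto
    moreover have "l \<bullet> x \<in> \<int>" by (rule dual_lattice_inner[OF assms(1) n'(2)])
    ultimately have "l \<bullet> x + (\<Sum>i=1..k. u i * (e i \<bullet> y)) \<in> \<int>" by (intro Ints_add)
    then show ?thesis using n'(1) by (simp add: functional_def inner_sum_left)
  qed
  ultimately show ?thesis by (simp add: dual_lattice_def)
qed

end

section \<open>Rays and faces of the Cayley fan\<close>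

context reflexive_minkowski
begin

lemma ext_exposed:
  assumes i: "i \<le> k" and v: "v \<in> ext i"
  obtains l where "\<And>x. x \<in> D i \<Longrightarrow> x \<noteq> v \<Longrightarrow> l \<bullet> v < l \<bullet> x"
proof -
  have "{v} exposed_face_of D i"
    using v exposed_face_of_polyhedron[OF D_polytope(1)[OF i]] by (simp add: ext_def face_of_singleton)
  then obtain a b where ab: "D i \<subseteq> {x. a \<bullet> x \<le> b}" "{v} = D i \<inter> {x. a \<bullet> x = b}" unfolding exposed_face_of_def by blast
  have "(- a) \<bullet> v < (- a) \<bullet> x" if x: "x \<in> D i" "x \<noteq> v" for x
  proof -
    have "a \<bullet> v = b" using ab(2) by blast
    moreover have "a \<bullet> x \<noteq> b" "a \<bullet> x \<le> b" using ab x by blast+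
    ultimately show ?thesis by simp
  qed
  then show ?thesis by (rule that)
qed

text \<open>A functional exposing the vertex in its summand is rescaled into
  \<open>supports\<close>; positive scaling preserves the minimal faces.\<close>

lemma W_in_cayley_generators:
  assumes "w \<in> W"
  obtains m where "m \<in> supports" "w \<in> cayley_generators m"
proof -
  obtain v i where v: "i \<le> k" "v \<in> ext i" "w = (v, \<epsilon> i)" using WE[OF assms] .
  obtain l where l: "\<And>x. x \<in> D i \<Longrightarrow> x \<noteq> v \<Longrightarrow> l \<bullet> v < l \<bullet> x" using ext_exposed[OF v(1,2)] by blast
  have \<mu>l: "\<mu> i l = l \<bullet> v"
  proof (rule antisym)
    show "\<mu> i l \<le> l \<bullet> v" using \<mu>_le[OF v(1)] ext(4)[OF v(1)] v(2) by blast
    obtain x where "x \<in> ext i" "l \<bullet> x = \<mu> i l" using \<mu>_attained[OF v(1)] .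
    then show "l \<bullet> v \<le> \<mu> i l" using l[of x] ext(4)[OF v(1)] by (cases "x = v") auto
  qed
  show ?thesis
  proof (cases "l = 0")
    \<comment> \<open>The zero functional exposes a vertex only if the summand is a single point,
      and then every supporting functional selects it.\<close>
    case True
    then have Dv: "\<And>x. x \<in> D i \<Longrightarrow> x = v" using l by fastforce
    obtain m where m: "m \<in> supports" using supports_nonempty by blast
    obtain x where "x \<in> ext i" "m \<bullet> x = \<mu> i m" using \<mu>_attained[OF v(1)] .
    then have "m \<bullet> v = \<mu> i m" using Dv ext(4)[OF v(1)] by blast
    then show ?thesis using that[OF m] v by (simp add: cayley_generators_iff)
  next
    case False
    then obtain r where r: "r > 0" "r *\<^sub>R l \<in> supports" using supports_scale by blast
    then show ?thesis using that[OF r(2)] v \<mu>l by (simp add: cayley_generators_iff \<mu>_scale)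
  qed
qed

text \<open>A functional with value 1 at all generators over a face exists, so these cones are
  pointed and have the zero cone as a face.\<close>

lemma empty_cayley_generators: "{} \<in> cayley_generator_sets"
proof -
  obtain m where m: "m \<in> supports" using supports_nonempty by blast
  obtain h where h: "\<And>i v. i \<le> k \<Longrightarrow> m \<bullet> v = \<mu> i m \<Longrightarrow> h \<bullet> (v, \<epsilon> i) = 0 \<bullet> v + 1"
    using prescribed_functional[OF m, of 0 "\<lambda>_. 1"] by blast
  then have h1: "h \<bullet> w = 1" if "w \<in> cayley_generators m" for w
    using that unfolding cayley_generators_def by auto
  then have "{w \<in> cayley_generators m. h \<bullet> w = 0} = {}" by auto
  moreover have "{w \<in> cayley_generators m. h \<bullet> w = 0} \<in> cayley_generator_sets"
    by (rule cayley_generator_setsI[OF m]) (simp add: h1)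
  ultimately show ?thesis by (simp only:)
qed

lemma singleton_cayley_generators:
  assumes "w \<in> W"
  shows "{w} \<in> cayley_generator_sets"
proof -
  obtain m where m: "m \<in> supports" "w \<in> cayley_generators m" using W_in_cayley_generators[OF assms] .
  obtain v i where v: "i \<le> k" "v \<in> ext i" "w = (v, \<epsilon> i)" using WE[OF assms] .
  obtain l where l: "\<And>x. x \<in> D i \<Longrightarrow> x \<noteq> v \<Longrightarrow> l \<bullet> v < l \<bullet> x" using ext_exposed[OF v(1,2)] by blast
  \<comment> \<open>At level \<open>i\<close> the functional is the excess of \<open>l\<close> over
    its minimum at \<open>v\<close>; at the other levels the constant \<open>1 - \<mu> j l\<close>
    makes it at least 1.\<close>
  obtain h where h: "\<And>j x. j \<le> k \<Longrightarrow> m \<bullet> x = \<mu> j m \<Longrightarrow> h \<bullet> (x, \<epsilon> j) = l \<bullet> x + (if j = i then - (l \<bullet> v) else 1 - \<mu> j l)"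
    using prescribed_functional[OF m(1), of l "\<lambda>j. if j = i then - (l \<bullet> v) else 1 - \<mu> j l"] by blast
  have hw: "0 \<le> h \<bullet> w' \<and> (h \<bullet> w' = 0 \<longleftrightarrow> w' = w)" if w': "w' \<in> cayley_generators m" for w'
  proof -
    obtain x j where x: "j \<le> k" "x \<in> ext j" "w' = (x, \<epsilon> j)" "m \<bullet> x = \<mu> j m"
      using w' unfolding cayley_generators_def by blast
    have hx: "h \<bullet> w' = l \<bullet> x + (if j = i then - (l \<bullet> v) else 1 - \<mu> j l)" using h[OF x(1,4)] x(3) by simp
    show ?thesis
    proof (cases "j = i")
      case True
      then have "x \<noteq> v \<Longrightarrow> l \<bullet> v < l \<bullet> x" using l ext(4)[OF v(1)] x(2) by blast
      then show ?thesis using hx True x v by (cases "x = v") auto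
    next
      case False
      then have "\<epsilon> j \<noteq> \<epsilon> i" using inj_onD[OF inj_\<epsilon>, of j i] x(1) v(1) by auto
      moreover have "\<mu> j l \<le> l \<bullet> x" using \<mu>_le[OF x(1)] ext(4)[OF x(1)] x(2) by blast
      ultimately show ?thesis using hx False x v by auto
    qed
  qed
  have "{w' \<in> cayley_generators m. h \<bullet> w' = 0} = {w}" using hw m(2) by blast
  moreover have "{w' \<in> cayley_generators m. h \<bullet> w' = 0} \<in> cayley_generator_sets"
    by (rule cayley_generator_setsI[OF m(1)]) (use hw in blast)
  ultimately show ?thesis by (simp only:)
qed

lemma Union_cayley_generator_sets: "\<Union>cayley_generator_sets = W"
proof
  show "W \<subseteq> \<Union>cayley_generator_sets" using singleton_cayley_generators by blast
  show "\<Union>cayley_generator_sets \<subseteq> W"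
  proof clarify
    fix w S assume "w \<in> S" "S \<in> cayley_generator_sets"
    then obtain m where "w \<in> cayley_generators m" by (auto elim: cayley_generator_setsE)
    then show "w \<in> W" using cayley_generators_subset by blast
  qed
qed

text \<open>Vertices of a reflexive polytope are primitive, since every facet lies at lattice distance one.\<close>

lemma vertex_facet:
  assumes v: "v extreme_point_of P"
  obtains m where "m \<in> dual_lattice N" "m \<bullet> v = -1"
proof -
  have "lattice_polytope (dual_lattice N) \<Delta>" using reflexive by (simp add: reflexive_polytope_def)
  then obtain V where V: "finite V" "V \<subseteq> dual_lattice N" "\<Delta> = convex hull V"
    unfolding lattice_polytope_def by blast
  have vP: "v \<in> P" using v by (simp add: extreme_point_of_def)
  have ge: "0 \<le> m \<bullet> v + 1" if "m \<in> V" for m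
    using vP hull_subset[of V convex] that V(3) by (force simp: dual_polytope_def)
  show ?thesis
  proof (cases "\<exists>m\<in>V. m \<bullet> v = -1")
    case True
    then show ?thesis using that V(2) by blast
  next
    \<comment> \<open>If no vector of \<open>V\<close> has the value -1 at \<open>v\<close>, then
      \<open>v\<close> can be stretched by a factor \<open>1 + 1 / C\<close> without leaving
      \<open>P\<close>, and lies strictly between 0 and the stretched point \<open>u\<close>.
      Finiteness of \<open>V\<close> allows a common \<open>C\<close>.\<close>
    case False
    obtain C0 where C0: "\<And>C m. C \<ge> C0 \<Longrightarrow> m \<in> V \<Longrightarrow> 0 \<le> C * (m \<bullet> v + 1) + m \<bullet> v"
    proof (rule finite_perturbation[OF V(1), of "\<lambda>m. m \<bullet> v + 1" "\<lambda>m. m \<bullet> v"])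
      show "0 \<le> m \<bullet> v" if "m \<in> V" "m \<bullet> v + 1 = 0" for m using that False by force
    qed (use ge in auto)
    define C where "C = max C0 1"
    have C: "C \<ge> C0" "C > 0" by (auto simp: C_def)
    define u where "u = (1 + 1 / C) *\<^sub>R v"
    have "V \<subseteq> {m. u \<bullet> m \<ge> -1}"
    proof clarify
      fix m assume m: "m \<in> V"
      show "u \<bullet> m \<ge> -1" using C0[OF C(1) m] C(2) by (simp add: u_def inner_commute[of v] field_simps)
    qed
    then have "convex hull V \<subseteq> {m. u \<bullet> m \<ge> -1}" by (intro hull_minimal convex_halfspace_ge)
    then have uP: "u \<in> P" using V(3) by (auto simp: dual_polytope_def inner_commute)
    have v0: "v \<noteq> 0" using extreme_point_not_in_interior[OF v] zero_interior by blast
    have "v = (1 - C / (C + 1)) *\<^sub>R 0 + (C / (C + 1)) *\<^sub>R u"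
    proof -
      have "C / (C + 1) * (1 + 1 / C) = 1" using C(2) by (simp add: divide_simps)
      then have "(C / (C + 1)) *\<^sub>R u = 1 *\<^sub>R v" unfolding u_def scaleR_scaleR by (simp only:)
      then show ?thesis by (simp only: scaleR_zero_right add_0_left scaleR_one)
    qed
    moreover have "0 < C / (C + 1)" "C / (C + 1) < 1" using C(2) by auto
    moreover have "0 \<noteq> u"
    proof -
      have "1 + 1 / C > 0" using C(2) by (simp add: add_pos_pos)
      then show ?thesis using v0 by (simp add: u_def)
    qed
    ultimately have "v \<in> open_segment 0 u" unfolding in_segment by blast
    then show ?thesis using v zero_in_P uP unfolding extreme_point_of_def by blast
  qed
qed

text \<open>For positive \<open>k\<close> some coordinate of the level vector is 1 or -1. For
  \<open>k = 0\<close> the generators are the vertices of \<open>P\<close>, and reflexivity supplies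
  the functional.\<close>

lemma primitive_W:
  assumes "w \<in> W"
  shows "\<exists>m\<in>dual_lattice N'. m \<bullet> w = 1"
proof -
  obtain v i where v: "i \<le> k" "v \<in> ext i" "w = (v, \<epsilon> i)" using WE[OF assms] .
  show ?thesis
  proof (cases "k = 0")
    case True
    then have "D 0 = P" using decomposition by simp
    then obtain m where m: "m \<in> dual_lattice N" "m \<bullet> v = -1" using vertex_facet[of v] v True by (auto simp: ext_def)
    have "functional (- m) (\<lambda>_. 0) \<bullet> w = 1" using functional_inner[OF v(1), of "\<lambda>_. 0" "- m" v] v m(2) by simp
    then show ?thesis using functional_dual_lattice[of "- m" "\<lambda>_. 0"] dual_lattice_minus[OF m(1)] by auto
  next
    case False
    define j where "j = (if i = 0 then 1 else i)"
    define s where "s = (if i = 0 then -1 else 1 :: real)"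
    have j: "j \<in> {1..k}" using v False by (auto simp: j_def)
    have "(\<Sum>l=1..k. (if l = j then s else 0) *\<^sub>R e l) = s *\<^sub>R e j"
      using j by (simp add: if_distrib[of "\<lambda>c. c *\<^sub>R _"] cong: if_cong)
    then have "functional 0 (\<lambda>l. if l = j then s else 0) = (0, s *\<^sub>R e j)" by (simp add: functional_def)
    moreover have "(0, s *\<^sub>R e j) \<bullet> w = 1" using e_\<epsilon>[OF j v(1)] v(3) by (auto simp: j_def s_def)
    moreover have "functional 0 (\<lambda>l. if l = j then s else 0) \<in> dual_lattice N'"
      by (rule functional_dual_lattice) (auto simp: dual_lattice_0 s_def)
    ultimately show ?thesis by auto
  qed
qed

sublocale \<Sigma>': ray_fan N' cayley_generator_sets
proof
  show "is_lattice N'" by (rule is_lattice_N')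
  show "{} \<in> cayley_generator_sets" by (rule empty_cayley_generators)
  show "finite (\<Union>cayley_generator_sets)" unfolding Union_cayley_generator_sets by (rule finite_W)
  show "finite S \<and> S \<subseteq> N'" if "S \<in> cayley_generator_sets" for S
  proof -
    have "S \<subseteq> W" using that Union_cayley_generator_sets by blast
    then show ?thesis using finite_W W_subset_N' finite_subset by blast
  qed
  show "{w} \<in> cayley_generator_sets" if "w \<in> \<Union>cayley_generator_sets" for w
    using singleton_cayley_generators that unfolding Union_cayley_generator_sets .
  show "\<exists>m\<in>dual_lattice N'. m \<bullet> w = 1" if "w \<in> \<Union>cayley_generator_sets" for w
    using primitive_W that unfolding Union_cayley_generator_sets .
next
  fix S S' assume SS': "S \<in> cayley_generator_sets" "S' \<in> cayley_generator_sets"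
  obtain m a where S: "m \<in> supports" "\<And>w. w \<in> cayley_generators m \<Longrightarrow> 0 \<le> a \<bullet> w" "S = {w \<in> cayley_generators m. a \<bullet> w = 0}"
    by (rule cayley_generator_setsE[OF SS'(1)]) (rule that; assumption)
  obtain m' a' where S': "m' \<in> supports" "\<And>w. w \<in> cayley_generators m' \<Longrightarrow> 0 \<le> a' \<bullet> w" "S' = {w \<in> cayley_generators m'. a' \<bullet> w = 0}"
    by (rule cayley_generator_setsE[OF SS'(2)]) (rule that; assumption)
  define s where "s = support_functional m - support_functional m'"
  have s: "0 \<le> s \<bullet> w" "s \<bullet> w = 0 \<longleftrightarrow> w \<in> cayley_generators m'" if "w \<in> cayley_generators m" for w
    unfolding s_def using support_functional_separates[OF S(1) S'(1) that] by auto
  have ms: "- s = support_functional m' - support_functional m" by (simp add: s_def)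
  have s': "0 \<le> (- s) \<bullet> w" "(- s) \<bullet> w = 0 \<longleftrightarrow> w \<in> cayley_generators m" if "w \<in> cayley_generators m'" for w
    unfolding ms using support_functional_separates[OF S'(1) S(1) that] by auto
  have fin: "finite (cayley_generators m)" for m using cayley_generators_subset finite_W finite_subset by blast
  obtain C1 where C1: "\<And>C w. C \<ge> C1 \<Longrightarrow> w \<in> cayley_generators m \<Longrightarrow> 0 \<le> C * (s \<bullet> w) + a' \<bullet> w"
    "\<And>C w. C \<ge> C1 \<Longrightarrow> w \<in> cayley_generators m \<Longrightarrow> C * (s \<bullet> w) + a' \<bullet> w = 0 \<longleftrightarrow> s \<bullet> w = 0 \<and> a' \<bullet> w = 0"
    by (rule finite_perturbation[OF fin[of m], of "\<lambda>w. s \<bullet> w" "\<lambda>w. a' \<bullet> w"]) (use s S'(2) in auto)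
  obtain C2 where C2: "\<And>C w. C \<ge> C2 \<Longrightarrow> w \<in> cayley_generators m' \<Longrightarrow> 0 \<le> C * ((- s) \<bullet> w) + a \<bullet> w"
    "\<And>C w. C \<ge> C2 \<Longrightarrow> w \<in> cayley_generators m' \<Longrightarrow> C * ((- s) \<bullet> w) + a \<bullet> w = 0 \<longleftrightarrow> (- s) \<bullet> w = 0 \<and> a \<bullet> w = 0"
    by (rule finite_perturbation[OF fin[of m'], of "\<lambda>w. (- s) \<bullet> w" "\<lambda>w. a \<bullet> w"]) (use s' S(2) in auto)
  define C where "C = max C1 C2"
  have C: "C \<ge> C1" "C \<ge> C2" by (auto simp: C_def)
  \<comment> \<open>A large multiple of \<open>s\<close> separates the two full cones, and
    \<open>a' - a\<close> separates the chosen faces where \<open>s\<close> is zero. As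
    \<open>a\<close> vanishes on \<open>S\<close> and \<open>a'\<close> on \<open>S'\<close>, only
    one correction has to be dominated at a time.\<close>
  let ?n = "C *\<^sub>R s + a' - a"
  have n: "?n \<bullet> w = C * (s \<bullet> w) + a' \<bullet> w" if "w \<in> S" for w
    using that S(3) by (simp add: inner_add_left inner_diff_left)
  have n': "- (?n \<bullet> w) = C * ((- s) \<bullet> w) + a \<bullet> w" if "w \<in> S'" for w
    using that S'(3) by (simp add: inner_add_left inner_diff_left)
  show "\<exists>a. (\<forall>w\<in>S - S'. 0 < a \<bullet> w) \<and> (\<forall>w\<in>S \<inter> S'. a \<bullet> w = 0) \<and> (\<forall>w\<in>S' - S. a \<bullet> w < 0)"
  proof (intro exI[of _ ?n] conjI ballI)
    fix w assume w: "w \<in> S - S'"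
    then have wm: "w \<in> cayley_generators m" using S(3) by blast
    have "\<not> (s \<bullet> w = 0 \<and> a' \<bullet> w = 0)" using w s(2)[OF wm] S'(3) by blast
    then have "C * (s \<bullet> w) + a' \<bullet> w \<noteq> 0" using C1(2)[OF C(1) wm] by blast
    moreover have "?n \<bullet> w = C * (s \<bullet> w) + a' \<bullet> w" using n w by blast
    ultimately show "0 < ?n \<bullet> w" using C1(1)[OF C(1) wm] by linarith
  next
    fix w assume w: "w \<in> S \<inter> S'"
    then have wm: "w \<in> cayley_generators m" "w \<in> cayley_generators m'" "a' \<bullet> w = 0" using S(3) S'(3) by auto
    then show "?n \<bullet> w = 0" using n[of w] w s(2)[OF wm(1)] by (metis IntD1 add_0 mult_zero_right)
  next
    fix w assume w: "w \<in> S' - S"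
    then have wm: "w \<in> cayley_generators m'" using S'(3) by blast
    have "\<not> ((- s) \<bullet> w = 0 \<and> a \<bullet> w = 0)" using w s'(2)[OF wm] S(3) by blast
    then have "C * ((- s) \<bullet> w) + a \<bullet> w \<noteq> 0" using C2(2)[OF C(2) wm] by blast
    moreover have "- (?n \<bullet> w) = C * ((- s) \<bullet> w) + a \<bullet> w" using n' w by blast
    ultimately show "?n \<bullet> w < 0" using C2(1)[OF C(2) wm] by linarith
  qed
next
  fix S and b :: "'a \<times> 'b" assume SG: "S \<in> cayley_generator_sets" and b: "\<forall>w\<in>S. 0 \<le> b \<bullet> w"
  obtain m a where S: "m \<in> supports" "\<And>w. w \<in> cayley_generators m \<Longrightarrow> 0 \<le> a \<bullet> w" "S = {w \<in> cayley_generators m. a \<bullet> w = 0}"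
    by (rule cayley_generator_setsE[OF SG]) (rule that; assumption)
  have fin: "finite (cayley_generators m)" using cayley_generators_subset finite_W finite_subset by blast
  obtain C where C': "\<And>C' w. C' \<ge> C \<Longrightarrow> w \<in> cayley_generators m \<Longrightarrow> 0 \<le> C' * (a \<bullet> w) + b \<bullet> w"
    "\<And>C' w. C' \<ge> C \<Longrightarrow> w \<in> cayley_generators m \<Longrightarrow> C' * (a \<bullet> w) + b \<bullet> w = 0 \<longleftrightarrow> a \<bullet> w = 0 \<and> b \<bullet> w = 0"
    by (rule finite_perturbation[OF fin, of "\<lambda>w. a \<bullet> w" "\<lambda>w. b \<bullet> w"]) (use S b in auto)
  note C = C'[OF order_refl]
  have "{w \<in> S. b \<bullet> w = 0} = {w \<in> cayley_generators m. (C *\<^sub>R a + b) \<bullet> w = 0}"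
    unfolding S(3) using C(2) by (auto simp: inner_add_left)
  also have "\<dots> \<in> cayley_generator_sets"
    using C(1) by (intro cayley_generator_setsI[OF S(1)]) (simp add: inner_add_left)
  finally show "{w \<in> S. b \<bullet> w = 0} \<in> cayley_generator_sets" .
qed

abbreviation cone' :: "'a \<Rightarrow> ('a \<times> 'b) set" where
  "cone' m \<equiv> cone_of (cayley_generators m)"

lemma summand_in_cone:
  assumes i: "i \<le> k" and v: "v \<in> summand_face m i"
  shows "(v, \<epsilon> i) \<in> cone' m"
proof -
  have f: "summand_face m i face_of D i" by (rule summand_face_face_of[OF i])
  have "summand_face m i = convex hull {v. v extreme_point_of summand_face m i}"
    by (intro Krein_Milman_Minkowski face_of_imp_compact[OF D_polytope(3)[OF i] D_polytope(2)[OF i] f] face_of_imp_convex[OF f])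
  also have "{v. v extreme_point_of summand_face m i} = ext i \<inter> summand_face m i"
    using extreme_point_of_face[OF f] by (auto simp: ext_def)
  finally have "v \<in> convex hull (ext i \<inter> summand_face m i)" using v by blast
  then have "(v, \<epsilon> i) \<in> convex hull ((ext i \<inter> summand_face m i) \<times> {\<epsilon> i})"
    by (simp add: convex_hull_Times)
  also have "\<dots> \<subseteq> convex hull (cayley_generators m)"
    by (rule hull_mono) (use i in \<open>auto simp: cayley_generators_iff summand_face_def\<close>)
  also have "\<dots> \<subseteq> cone' m" by (rule convex_hull_subset_convex_cone_hull)
  finally show ?thesis .
qed

lemma sum_in_cone:
  assumes "\<And>i. i \<le> k \<Longrightarrow> f i \<in> cone_of S"
  shows "(\<Sum>i\<le>k. f i) \<in> cone_of S"
proof -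
  have "(\<Sum>i\<in>J. f i) \<in> cone_of S" if "finite J" "J \<subseteq> {..k}" for J
    using that assms
    by (induction J rule: finite_induct) (auto intro: convex_cone_hull_add convex_cone_hull_contains_0)
  then show ?thesis by blast
qed

lemma pair_sum_\<epsilon>: "(\<Sum>i\<le>k. (f i, \<epsilon> i)) = (\<Sum>i\<le>k. f i, 0)"
  by (simp add: prod_eq_iff fst_sum snd_sum sum_\<epsilon>)

text \<open>One point from each level is added up, and the second components cancel.\<close>

lemma face_in_cone:
  assumes "m \<in> supports" "v \<in> face m"
  shows "(v, 0) \<in> cone' m"
proof -
  obtain f where f: "\<And>i. i \<le> k \<Longrightarrow> f i \<in> summand_face m i" "v = (\<Sum>i\<le>k. f i)" using face_elem[OF assms] by blast
  have "(\<Sum>i\<le>k. (f i, \<epsilon> i)) \<in> cone' m" using summand_in_cone f(1) by (intro sum_in_cone) auto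
  then show ?thesis using f(2) by (simp add: pair_sum_\<epsilon>)
qed

lemma cayley_cone_eq:
  assumes F: "\<And>i. i \<le> k \<Longrightarrow> F i = summand_face m i"
  shows "cayley_cone k e F = cone' m"
proof -
  let ?X = "(\<lambda>v. (v, - (\<Sum>i=1..k. e i))) ` F 0 \<union> (\<Union>i\<in>{1..k}. (\<lambda>v. (v, e i)) ` F i)"
  have X: "?X = (\<Union>i\<le>k. (\<lambda>v. (v, \<epsilon> i)) ` summand_face m i)"
  proof -
    have "{..k} = insert 0 {1..k}" by auto
    then have "(\<Union>i\<le>k. (\<lambda>v. (v, \<epsilon> i)) ` summand_face m i) = (\<lambda>v. (v, \<epsilon> 0)) ` summand_face m 0 \<union>
        (\<Union>i\<in>{1..k}. (\<lambda>v. (v, \<epsilon> i)) ` summand_face m i)" by simp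
    then show ?thesis using F by (auto simp: \<epsilon>_def)
  qed
  have "?X \<subseteq> cone' m" unfolding X using summand_in_cone by blast
  moreover have "cayley_generators m \<subseteq> ?X"
    unfolding X cayley_generators_def summand_face_def using ext(4) by blast
  ultimately show ?thesis
    unfolding cayley_cone_def
    by (intro subset_antisym hull_minimal convex_cone_convex_cone_hull) (auto intro: hull_inc)
qed

lemma cayley_fan_eq: "\<Sigma>'.fan = cayley_fan k e D"
proof
  show "\<Sigma>'.fan \<subseteq> cayley_fan k e D"
  proof
    fix \<tau> assume "\<tau> \<in> \<Sigma>'.fan"
    then obtain S where S: "S \<in> cayley_generator_sets" "\<tau> = cone_of S" by (auto simp: \<Sigma>'.fan_def)
    obtain m a where ma: "m \<in> supports" "\<And>w. w \<in> cayley_generators m \<Longrightarrow> 0 \<le> a \<bullet> w" "S = {w \<in> cayley_generators m. a \<bullet> w = 0}"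
      by (rule cayley_generator_setsE[OF S(1)]) (rule that; assumption)
    have fin: "finite (cayley_generators m)" using cayley_generators_subset finite_W finite_subset by blast
    have "\<tau> = cone' m \<inter> {x. a \<bullet> x = 0}"
      unfolding S(2) ma(3) using convex_cone_hull_Int_hyperplane[OF fin ma(2)] by simp
    moreover have "0 \<le> a \<bullet> x" if "x \<in> cone' m" for x by (rule convex_cone_hull_nonneg[OF that ma(2)])
    ultimately have "\<tau> face_of cone' m" by (simp add: face_of_Int_supporting_hyperplane_ge convex_convex_cone_hull)
    moreover have "\<tau> \<noteq> {}" using S(2) convex_cone_hull_nonempty by metis
    ultimately show "\<tau> \<in> cayley_fan k e D"
      unfolding cayley_fan_def decomposition[symmetric]
      using face_proper[OF ma(1)] induced_decomposition_face[OF ma(1)] cayley_cone_eq[of "summand_face m" m]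
      by (intro CollectI conjI bexI[of _ "face m"] exI[of _ "summand_face m"]) simp_all
  qed
  show "cayley_fan k e D \<subseteq> \<Sigma>'.fan"
  proof
    fix \<tau> assume "\<tau> \<in> cayley_fan k e D"
    then obtain \<Gamma> F where \<tau>: "\<tau> \<noteq> {}" "\<Gamma> \<in> proper_faces P" "induced_decomposition k D \<Gamma> F" "\<tau> face_of cayley_cone k e F"
      unfolding cayley_fan_def decomposition[symmetric] by blast
    show "\<tau> \<in> \<Sigma>'.fan"
    proof (rule proper_face_cases[OF \<tau>(2)])
      assume "\<Gamma> = {}"
      then have "F i = {}" if "i \<le> k" for i using \<tau>(3) that by (simp add: induced_decomposition_def)
      then have "cayley_cone k e F = {0}" by (simp add: cayley_cone_def)
      then have "\<tau> \<subseteq> {0}" using face_of_imp_subset[OF \<tau>(4)] by simp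
      then have "\<tau> = {0}" using \<tau>(1) by blast
      then show ?thesis using \<Sigma>'.zero_cone by simp
    next
      fix m assume m: "m \<in> supports" "\<Gamma> = face m"
      have "cayley_cone k e F = cone' m"
        using induced_decomposition_unique[OF m(1)] \<tau>(3) m(2) by (intro cayley_cone_eq) blast
      then have "\<tau> face_of cone' m" using \<tau>(4) by simp
      have fin: "finite (cayley_generators m)" using cayley_generators_subset finite_W finite_subset by blast
      have "\<tau> exposed_face_of cone' m"
        using exposed_face_of_polyhedron[OF polyhedron_convex_cone_hull[OF fin]] \<open>\<tau> face_of cone' m\<close> by blast
      then obtain a b where ab: "cone' m \<subseteq> {x. a \<bullet> x \<le> b}" "\<tau> = cone' m \<inter> {x. a \<bullet> x = b}"
        unfolding exposed_face_of_def by blast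
      obtain x where x: "x \<in> cone' m" "a \<bullet> x = b" using \<tau>(1) ab(2) by blast
      \<comment> \<open>A cone contains 0 and is closed under doubling, so the level
        \<open>b\<close> of an exposed face is zero.\<close>
      have "2 *\<^sub>R x \<in> cone' m" by (rule convex_cone_hull_mul[OF x(1)]) simp
      then have "2 * b \<le> b" using ab(1) x(2) by auto
      moreover have "0 \<le> b" using ab(1) convex_cone_hull_contains_0[of "cayley_generators m"] by auto
      ultimately have b: "b = 0" by simp
      have nn: "0 \<le> (- a) \<bullet> w" if "w \<in> cayley_generators m" for w
        using ab(1) b hull_inc[OF that, of convex_cone] by auto
      have "\<tau> = cone' m \<inter> {x. (- a) \<bullet> x = 0}" using ab(2) b by simp
      also have "\<dots> = cone_of {w \<in> cayley_generators m. (- a) \<bullet> w = 0}"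
        by (rule convex_cone_hull_Int_hyperplane[OF fin nn])
      finally have "\<tau> = cone_of {w \<in> cayley_generators m. (- a) \<bullet> w = 0}" .
      moreover have "{w \<in> cayley_generators m. (- a) \<bullet> w = 0} \<in> cayley_generator_sets"
        by (rule cayley_generator_setsI[OF m(1) nn])
      ultimately show ?thesis using \<Sigma>'.cone_in_fan by simp
    qed
  qed
qed

subsection \<open>The embedding\<close>

abbreviation cone :: "'a \<Rightarrow> 'a set" where
  "cone m \<equiv> cone_of (vertices \<inter> face m)"

lemma face_generators_face: "m \<in> supports \<Longrightarrow> vertices \<inter> face m \<in> face_generators"
  unfolding face_generators_def using face_proper by blast

lemma cone_in_cone':
  assumes m: "m \<in> supports" and v: "v \<in> cone m"
  shows "(v, 0) \<in> cone' m"
proof -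
  have "convex_cone {v. (v, 0) \<in> cone' m}"
  proof (rule iffD2[OF convex_cone_iff], intro conjI ballI allI impI)
    show "0 \<in> {v. (v, 0) \<in> cone' m}"
      using convex_cone_hull_contains_0[of "cayley_generators m"] by (simp add: zero_prod_def)
    show "x + y \<in> {v. (v, 0) \<in> cone' m}" if "x \<in> {v. (v, 0) \<in> cone' m}" "y \<in> {v. (v, 0) \<in> cone' m}" for x y
      using convex_cone_hull_add[of "(x, 0)" "cayley_generators m" "(y, 0)"] that by simp
    show "c *\<^sub>R x \<in> {v. (v, 0) \<in> cone' m}" if "x \<in> {v. (v, 0) \<in> cone' m}" "0 \<le> c" for x c
      using convex_cone_hull_mul[of "(x, 0)" "cayley_generators m" c] that by simp
  qed
  moreover have "vertices \<inter> face m \<subseteq> {v. (v, 0) \<in> cone' m}" using face_in_cone[OF m] by blast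
  ultimately have "cone m \<subseteq> {v. (v, 0) \<in> cone' m}" by (intro hull_minimal)
  then show ?thesis using v by blast
qed

lemma face_generators_cases:
  assumes "S \<in> face_generators"
  obtains "S = {}" | m where "m \<in> supports" "S = vertices \<inter> face m"
proof -
  obtain \<Gamma> where \<Gamma>: "\<Gamma> \<in> proper_faces P" "S = vertices \<inter> \<Gamma>" using assms by (auto simp: face_generators_def)
  show ?thesis by (rule proper_face_cases[OF \<Gamma>(1)]) (use \<Gamma>(2) that in auto)
qed

definition cone_pairs :: "('a set \<times> ('a \<times> 'b) set) set" where
  "cone_pairs = (\<lambda>m. (cone m, cone' m)) ` supports"

text \<open>The first component of a functional separating the large cones also separates the small
  ones. It can vanish at a vertex of \<open>face m\<close> only if this vertex, at height 0, lies in
  the cone of the common generators; the two support functionals agree there, so the vertex belongs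
  to \<open>face m'\<close>.\<close>

lemma cone_separation:
  assumes m: "m \<in> supports" "m' \<in> supports"
  shows "\<exists>n. localizes N' (cone' m) (cone' m \<inter> cone' m') n \<and> localizes N (cone m) (cone m \<inter> cone m') (fst n)"
proof -
  let ?S = "cayley_generators m" and ?S' = "cayley_generators m'"
  note G = cayley_generators_in_sets[OF m(1)] cayley_generators_in_sets[OF m(2)]
  obtain n where n: "n \<in> dual_lattice N'" "\<And>w. w \<in> ?S - ?S' \<Longrightarrow> 0 < n \<bullet> w" "\<And>w. w \<in> ?S \<inter> ?S' \<Longrightarrow> n \<bullet> w = 0"
    "\<And>w. w \<in> ?S' - ?S \<Longrightarrow> n \<bullet> w < 0"
    using \<Sigma>'.lattice_separation[OF G] by blast
  have nonneg: "0 \<le> n \<bullet> w" if "w \<in> ?S" for w using n(2,3) that by (cases "w \<in> ?S'") (auto simp: less_imp_le)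
  have nonpos: "0 \<le> (- n) \<bullet> w" if "w \<in> ?S'" for w using n(3,4) that by (cases "w \<in> ?S") (auto simp: less_imp_le)
  have zero: "{w \<in> ?S. n \<bullet> w = 0} = ?S \<inter> ?S'" using n(2,3) by force
  have fin: "finite ?S" using cayley_generators_subset finite_W finite_subset by blast
  have "localizes N (cone m) (cone m \<inter> cone m') (fst n)"
  proof (rule \<Sigma>.localizes_separation[OF face_generators_face[OF m(1)] face_generators_face[OF m(2)] fst_dual_lattice[OF n(1)]])
    fix v assume v: "v \<in> vertices \<inter> face m - vertices \<inter> face m'"
    have c: "(v, 0) \<in> cone' m" using face_in_cone[OF m(1)] v by blast
    have eq: "fst n \<bullet> v = n \<bullet> (v, 0)" by (cases n) simp
    have "0 \<le> n \<bullet> (v, 0)" by (rule convex_cone_hull_nonneg[OF c nonneg])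
    moreover have "n \<bullet> (v, 0) \<noteq> 0"
    proof
      assume "n \<bullet> (v, 0) = 0"
      then have x: "(v, 0) \<in> cone_of (?S \<inter> ?S')"
        using c convex_cone_hull_Int_hyperplane[OF fin nonneg] zero by auto
      let ?s = "support_functional m - support_functional m'"
      have z: "?s \<bullet> w = 0" if "w \<in> ?S \<inter> ?S'" for w using support_functional_separates(2)[OF m] that by blast
      have "0 \<le> ?s \<bullet> (v, 0)" "0 \<le> (- ?s) \<bullet> (v, 0)"
        by (rule convex_cone_hull_nonneg[OF x]; simp add: z inner_minus_left del: minus_diff_eq)+
      then have "?s \<bullet> (v, 0) = 0" by (simp add: inner_minus_left del: minus_diff_eq)
      then have "m \<bullet> v = m' \<bullet> v" by (simp add: support_functional_def functional_def inner_diff_left)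
      then have "v \<in> face m'" using v by (simp add: face_def)
      then show False using v by blast
    qed
    ultimately show "0 < fst n \<bullet> v" unfolding eq by simp
  next
    fix v assume v: "v \<in> vertices \<inter> face m \<inter> (vertices \<inter> face m')"
    have eq: "fst n \<bullet> v = n \<bullet> (v, 0)" by (cases n) simp
    have "0 \<le> n \<bullet> (v, 0)" using face_in_cone[OF m(1)] v by (intro convex_cone_hull_nonneg[OF _ nonneg]) auto
    moreover have "0 \<le> (- n) \<bullet> (v, 0)" using face_in_cone[OF m(2)] v by (intro convex_cone_hull_nonneg[OF _ nonpos]) auto
    ultimately show "fst n \<bullet> v = 0" unfolding eq by (simp add: inner_minus_left)
  qed
  moreover have "localizes N' (cone' m) (cone' m \<inter> cone' m') n"
    by (rule \<Sigma>'.localizes_separation[OF G n(1)]) (use n in auto)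
  ultimately show ?thesis by blast
qed

text \<open>A functional that is nonnegative on a face lifts to the cone of the Cayley fan by subtracting its
  minima on the summands, which are integers.\<close>

lemma dual_monoid_lift:
  assumes m: "m \<in> supports" and n: "n \<in> dual_monoid N (cone m)"
  shows "\<exists>n'\<in>dual_monoid N' (cone' m). fst n' = n"
proof -
  have nM: "n \<in> dual_lattice N" by (rule dual_monoid_dual_lattice[OF n])
  define E where "E i = {v \<in> ext i. m \<bullet> v = \<mu> i m}" for i
  define \<nu> where "\<nu> i = Min ((\<bullet>) n ` E i)" for i
  have fin: "finite (E i)" "E i \<noteq> {}" if "i \<le> k" for i
    using ext(1)[OF that] \<mu>_attained[OF that, of m] by (auto simp: E_def)
  have "\<exists>v. v \<in> E i \<and> n \<bullet> v = \<nu> i" if "i \<le> k" for i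
  proof -
    have "\<nu> i \<in> (\<bullet>) n ` E i" unfolding \<nu>_def using fin[OF that] by (intro Min_in) auto
    then show ?thesis by auto
  qed
  then obtain f where f: "\<And>i. i \<le> k \<Longrightarrow> f i \<in> E i" "\<And>i. i \<le> k \<Longrightarrow> n \<bullet> f i = \<nu> i" by metis
  have "f i \<in> summand_face m i" if "i \<le> k" for i
    using f(1)[OF that] ext(4)[OF that] by (auto simp: E_def summand_face_def)
  then have "(\<Sum>i\<le>k. f i) \<in> face m" by (rule sum_in_face[OF m])
  then have "(\<Sum>i\<le>k. f i) \<in> cone m"
    using cone_of_vertices[OF face_proper[OF m]] hull_inc[of _ "face m" convex_cone] by blast
  then have "0 \<le> n \<bullet> (\<Sum>i\<le>k. f i)" using n by (simp add: dual_monoid_def)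
  then have sum\<nu>: "0 \<le> (\<Sum>i\<le>k. \<nu> i)" using f(2) by (simp add: inner_sum_right)
  have int: "\<nu> i \<in> \<int>" if "i \<le> k" for i
    using f[OF that] dual_lattice_inner[OF nM, of "f i"] ext(2)[OF that] by (auto simp: E_def)
  define s where "s = (\<Sum>i\<le>k. \<nu> i)"
  \<comment> \<open>The shift by \<open>- \<nu> i\<close> brings the minimum at level
    \<open>i\<close> to zero. The nonnegative sum \<open>s\<close> of the minima is added back at
    level 0, so that the shifts sum to zero.\<close>
  define u where "u i = (if i \<le> k then - \<nu> i + (if i = 0 then s else 0) else 0)" for i
  have u0: "(\<Sum>i\<le>k. u i) = 0"
    by (simp add: u_def sum_subtractf s_def)
  have "functional n u \<in> dual_lattice N'"
    by (rule functional_dual_lattice[OF nM]) (use int in \<open>auto simp: u_def s_def intro!: Ints_add Ints_minus Ints_sum\<close>)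
  moreover have "0 \<le> functional n u \<bullet> w" if w: "w \<in> cayley_generators m" for w
  proof -
    obtain v i where v: "i \<le> k" "v \<in> E i" "w = (v, \<epsilon> i)" using w unfolding cayley_generators_def E_def by blast
    have "\<nu> i \<le> n \<bullet> v" unfolding \<nu>_def using fin(1)[OF v(1)] v(2) by simp
    moreover have "- \<nu> i \<le> u i" using v(1) sum\<nu> by (auto simp: u_def s_def)
    moreover have "functional n u \<bullet> w = n \<bullet> v + u i" unfolding v(3) by (rule functional_inner[OF v(1) u0])
    ultimately show ?thesis by linarith
  qed
  ultimately have "functional n u \<in> dual_monoid N' (cone' m)" unfolding \<Sigma>'.dual_monoid_cone by blast
  then show ?thesis by (intro bexI[of _ "functional n u"]) (simp add: functional_def)
qed

sublocale emb: toric_embedding N \<Sigma>.fan N' \<Sigma>'.fan "\<lambda>n. (n, 0)" fst cone_pairs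
proof
  show "fst m' \<in> dual_lattice N" if "m' \<in> dual_lattice N'" for m' by (rule fst_dual_lattice[OF that])
  show "dual_map N (\<lambda>n. (n, 0)) m' = fst m'" if m': "m' \<in> dual_lattice N'" for m'
    unfolding dual_map_def
  proof (rule the_equality)
    show "fst m' \<in> dual_lattice N \<and> (\<forall>n\<in>N. fst m' \<bullet> n = m' \<bullet> (n, 0))"
      using fst_dual_lattice[OF m'] by (cases m') simp
    fix m assume "m \<in> dual_lattice N \<and> (\<forall>n\<in>N. m \<bullet> n = m' \<bullet> (n, 0))"
    then show "m = fst m'" by (intro eq_on_span_if_inner_eq[of _ N]) (auto simp: span_N inner_prod_def)
  qed
  show "fst m' \<bullet> v = m' \<bullet> (v, 0)" for m' v by (cases m') simp
  show "\<sigma> \<in> \<Sigma>.fan \<and> \<sigma>' \<in> \<Sigma>'.fan \<and> (\<lambda>n. (n, 0)) ` \<sigma> \<subseteq> \<sigma>'" if "(\<sigma>, \<sigma>') \<in> cone_pairs" for \<sigma> \<sigma>'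
    using that cone_in_cone' \<Sigma>.cone_in_fan[OF face_generators_face] \<Sigma>'.cone_in_fan[OF cayley_generators_in_sets]
    by (auto simp: cone_pairs_def)
  show "\<exists>(\<sigma>, \<sigma>')\<in>cone_pairs. \<tau> \<subseteq> \<sigma>" if "\<tau> \<in> \<Sigma>.fan" for \<tau>
  proof -
    obtain S where S: "S \<in> face_generators" "\<tau> = cone_of S" using \<open>\<tau> \<in> \<Sigma>.fan\<close> by (auto simp: \<Sigma>.fan_def)
    have "\<exists>m\<in>supports. S \<subseteq> vertices \<inter> face m"
      by (rule face_generators_cases[OF S(1)]) (use supports_nonempty in auto)
    then obtain m where m: "m \<in> supports" "S \<subseteq> vertices \<inter> face m" by blast
    have "\<tau> \<subseteq> cone m" unfolding S(2) by (rule hull_mono[OF m(2)])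
    then show ?thesis using m(1) by (auto simp: cone_pairs_def)
  qed
  show "\<exists>(\<sigma>, \<sigma>')\<in>cone_pairs. \<tau>' \<subseteq> \<sigma>'" if "\<tau>' \<in> \<Sigma>'.fan" for \<tau>'
  proof -
    obtain S where S: "S \<in> cayley_generator_sets" "\<tau>' = cone_of S" using \<open>\<tau>' \<in> \<Sigma>'.fan\<close> by (auto simp: \<Sigma>'.fan_def)
    then obtain m where m: "m \<in> supports" "S \<subseteq> cayley_generators m" unfolding cayley_generator_sets_def by blast
    have "\<tau>' \<subseteq> cone' m" unfolding S(2) by (rule hull_mono[OF m(2)])
    then show ?thesis using m(1) by (auto simp: cone_pairs_def)
  qed
  show "\<exists>n. localizes N' \<sigma>' (\<sigma>' \<inter> \<tau>') n \<and> localizes N \<sigma> (\<sigma> \<inter> \<tau>) (fst n)"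
    if "(\<sigma>, \<sigma>') \<in> cone_pairs" "(\<tau>, \<tau>') \<in> cone_pairs" for \<sigma> \<sigma>' \<tau> \<tau>'
    using that cone_separation by (auto simp: cone_pairs_def)
  show "\<exists>l'\<in>dual_monoid N' \<sigma>'. fst l' = l" if "(\<sigma>, \<sigma>') \<in> cone_pairs" "l \<in> dual_monoid N \<sigma>" for \<sigma> \<sigma>' l
    using that dual_monoid_lift by (auto simp: cone_pairs_def)
qed auto

end

section \<open>The image as a complete intersection\<close>

lemma prod_power_int_sum:
  fixes x :: complex
  assumes "x \<noteq> 0" "finite I"
  shows "(\<Prod>i\<in>I. x powi z i) = x powi (\<Sum>i\<in>I. z i)"
  using assms(2) by (induction I rule: finite_induct) (simp_all add: power_int_add assms(1))

lemma prod_power_int_distrib: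
  fixes f :: "'i \<Rightarrow> complex"
  shows "(\<Prod>i\<in>I. f i powi n) = (\<Prod>i\<in>I. f i) powi n"
  by (induction I rule: infinite_finite_induct) (simp_all add: power_int_mult_distrib)

lemma regular_sequence_cong:
  assumes "\<And>i. i \<in> {1..k} \<Longrightarrow> f i = g i"
  shows "regular_sequence R k f \<longleftrightarrow> regular_sequence R k g"
proof -
  have "f ` {1..<i} = g ` {1..<i}" if "i \<in> {1..k}" for i using assms that by (intro image_cong) auto
  moreover have "f ` {1..k} = g ` {1..k}" using assms by (intro image_cong) auto
  ultimately show ?thesis unfolding regular_sequence_def using assms by simp
qed

context reflexive_minkowski
begin

lemma inj_on_pair: "inj_on (\<lambda>v. (v, c)) A"
  by (auto simp: inj_on_def)

lemma W_disjoint: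
  assumes "i \<le> k" "j \<le> k" "i \<noteq> j"
  shows "(\<lambda>v. (v, \<epsilon> i)) ` ext i \<inter> (\<lambda>v. (v, \<epsilon> j)) ` ext j = {}"
proof -
  have "\<epsilon> i \<noteq> \<epsilon> j" using inj_onD[OF inj_\<epsilon>, of i j] assms by auto
  then show ?thesis by auto
qed

lemma prod_W: "(\<Prod>w\<in>W. F w) = (\<Prod>i\<le>k. \<Prod>v\<in>ext i. F (v, \<epsilon> i))"
  for F :: "'a \<times> 'b \<Rightarrow> 'c::comm_monoid_mult"
  unfolding W_def using ext(1) W_disjoint
  by (subst prod.UNION_disjoint) (auto simp: prod.reindex[OF inj_on_pair])

lemma sum_W: "(\<Sum>w\<in>W. F w) = (\<Sum>i\<le>k. \<Sum>v\<in>ext i. F (v, \<epsilon> i))"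
  for F :: "'a \<times> 'b \<Rightarrow> 'c::comm_monoid_add"
  unfolding W_def using ext(1) W_disjoint
  by (subst sum.UNION_disjoint) (auto simp: sum.reindex[OF inj_on_pair])

definition ray_class :: "nat \<Rightarrow> ('a \<times> 'b) set set" where
  "ray_class i = (\<lambda>v. \<Sigma>'.ray (v, \<epsilon> i)) ` ext i"

lemma inj_on_ray_W: "inj_on \<Sigma>'.ray W"
  using \<Sigma>'.inj_on_ray unfolding Union_cayley_generator_sets .

lemma inj_on_ray_ext: "i \<le> k \<Longrightarrow> inj_on (\<lambda>v. \<Sigma>'.ray (v, \<epsilon> i)) (ext i)"
proof (rule inj_onI)
  fix x y assume "i \<le> k" "x \<in> ext i" "y \<in> ext i" "\<Sigma>'.ray (x, \<epsilon> i) = \<Sigma>'.ray (y, \<epsilon> i)"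
  then show "x = y" using inj_onD[OF inj_on_ray_W, of "(x, \<epsilon> i)" "(y, \<epsilon> i)"] by (simp add: W_iff)
qed

lemma rays_eq: "rays \<Sigma>'.fan = \<Sigma>'.ray ` W"
  using \<Sigma>'.rays_fan unfolding Union_cayley_generator_sets .

sublocale R: ray_partition \<Sigma>'.fan k ray_class
proof
  show "finite (rays \<Sigma>'.fan)" by (rule \<Sigma>'.finite_rays_fan)
  show "rays \<Sigma>'.fan = (\<Union>j\<le>k. ray_class j)"
    unfolding rays_eq W_def ray_class_def by blast
  show "ray_class i \<inter> ray_class j = {}" if "i \<le> k" "j \<le> k" "i \<noteq> j" for i j
  proof (rule ccontr)
    assume "ray_class i \<inter> ray_class j \<noteq> {}"
    then obtain v x where vx: "v \<in> ext i" "x \<in> ext j" "\<Sigma>'.ray (v, \<epsilon> i) = \<Sigma>'.ray (x, \<epsilon> j)"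
      unfolding ray_class_def by blast
    then have "(v, \<epsilon> i) = (x, \<epsilon> j)" using that by (intro inj_onD[OF inj_on_ray_W vx(3)]) (simp_all add: W_iff)
    then show False using inj_onD[OF inj_\<epsilon>, of i j] that by auto
  qed
  show "ray_class j \<noteq> {}" if "j \<le> k" for j
    using ext_nonempty[OF that] by (simp add: ray_class_def)
qed

lemma primitive_generator_W: "w \<in> W \<Longrightarrow> primitive_generator N' (\<Sigma>'.ray w) = w"
  using \<Sigma>'.primitive_generator_ray unfolding Union_cayley_generator_sets .

lemma prod_coordinates:
  assumes "i \<le> k"
  shows "(\<Prod>\<xi>\<in>ray_class i. \<Sigma>'.coordinates X \<xi>) = (\<Prod>v\<in>ext i. X (v, \<epsilon> i))"
proof -
  have "\<Sigma>'.coordinates X (\<Sigma>'.ray w) = X w" if "w \<in> W" for w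
    using \<Sigma>'.coordinates_ray that unfolding Union_cayley_generator_sets .
  then show ?thesis
    unfolding ray_class_def using assms
    by (subst prod.reindex[OF inj_on_ray_ext[OF assms]]) (auto simp: W_iff intro!: prod.cong)
qed

lemma e_pairing: "i \<in> {1..k} \<Longrightarrow> j \<le> k \<Longrightarrow> (0, e i) \<bullet> (v, \<epsilon> j) = (if j = 0 then -1 else if i = j then 1 else 0)"
  for v :: 'a
  by (simp add: e_\<epsilon>)

lemma cayley_equation_eq:
  assumes i: "i \<in> {1..k}"
  shows "cayley_equation N' \<Sigma>'.fan e i = R.binomial i"
proof -
  have pg: "(0, e i) \<bullet> primitive_generator N' (\<Sigma>'.ray (v, \<epsilon> j)) = (if j = 0 then -1 else if i = j then 1 else 0)"
    if "j \<le> k" "v \<in> ext j" for j v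
    using primitive_generator_W[of "(v, \<epsilon> j)"] that e_pairing[OF i that(1), of v] by (simp add: W_iff)
  have "{\<xi> \<in> rays \<Sigma>'.fan. (0, e i) \<bullet> primitive_generator N' \<xi> > 0} = ray_class i"
  proof (rule subset_antisym; rule subsetI)
    fix \<xi> assume x: "\<xi> \<in> {\<xi> \<in> rays \<Sigma>'.fan. (0, e i) \<bullet> primitive_generator N' \<xi> > 0}"
    then obtain j v where v: "j \<le> k" "v \<in> ext j" "\<xi> = \<Sigma>'.ray (v, \<epsilon> j)" unfolding rays_eq using WE by blast
    then have "j = i" using pg[OF v(1,2)] x by (auto split: if_splits)
    then show "\<xi> \<in> ray_class i" using v by (simp add: ray_class_def)
  next
    fix \<xi> assume "\<xi> \<in> ray_class i"
    then obtain v where v: "v \<in> ext i" "\<xi> = \<Sigma>'.ray (v, \<epsilon> i)" unfolding ray_class_def by blast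
    then show "\<xi> \<in> {\<xi> \<in> rays \<Sigma>'.fan. (0, e i) \<bullet> primitive_generator N' \<xi> > 0}"
      using pg[of i v] i R.R_subset[of i] by (auto simp: ray_class_def)
  qed
  moreover have "{\<xi> \<in> rays \<Sigma>'.fan. (0, e i) \<bullet> primitive_generator N' \<xi> < 0} = ray_class 0"
  proof (rule subset_antisym; rule subsetI)
    fix \<xi> assume x: "\<xi> \<in> {\<xi> \<in> rays \<Sigma>'.fan. (0, e i) \<bullet> primitive_generator N' \<xi> < 0}"
    then obtain j v where v: "j \<le> k" "v \<in> ext j" "\<xi> = \<Sigma>'.ray (v, \<epsilon> j)" unfolding rays_eq using WE by blast
    then have "j = 0" using pg[OF v(1,2)] x by (auto split: if_splits)
    then show "\<xi> \<in> ray_class 0" using v by (simp add: ray_class_def)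
  next
    fix \<xi> assume "\<xi> \<in> ray_class 0"
    then obtain v where v: "v \<in> ext 0" "\<xi> = \<Sigma>'.ray (v, \<epsilon> 0)" unfolding ray_class_def by blast
    then show "\<xi> \<in> {\<xi> \<in> rays \<Sigma>'.fan. (0, e i) \<bullet> primitive_generator N' \<xi> < 0}"
      using pg[of 0 v] i R.R_subset[of 0] by (auto simp: ray_class_def)
  qed
  ultimately show ?thesis unfolding cayley_equation_def R.binomial_def by simp
qed

lemma e_dual_lattice: "i \<in> {1..k} \<Longrightarrow> (0, e i) \<in> dual_lattice N'"
proof -
  assume i: "i \<in> {1..k}"
  have "(\<Sum>l=1..k. (if l = i then 1 else 0) *\<^sub>R e l) = e i"
    using i by (simp add: if_distrib[of "\<lambda>c. c *\<^sub>R _"] cong: if_cong)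
  then have "functional 0 (\<lambda>l. if l = i then 1 else 0) = (0, e i)" by (simp add: functional_def)
  moreover have "functional 0 (\<lambda>l. if l = i then 1 else 0) \<in> dual_lattice N'"
    by (rule functional_dual_lattice) (auto simp: dual_lattice_0)
  ultimately show ?thesis by simp
qed

text \<open>The exponent vectors of the two monomials differ by the image of the character
  \<open>(0, e i)\<close>, which pairs to 1 with the generators of level \<open>i\<close>, to -1
  with those of level 0 and to 0 with the others. Translation by this character permutes the dual
  lattice.\<close>

lemma homogeneous_binomial:
  assumes i: "i \<in> {1..k}"
  shows "homogeneous N' \<Sigma>'.fan (R.binomial i)"
proof -
  let ?a = "indicator_exponent (ray_class i)" and ?b = "indicator_exponent (ray_class 0)"
  have ik: "i \<le> k" "i \<noteq> 0" using i by auto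
  define g where "g c m = (\<lambda>\<rho>\<in>rays \<Sigma>'.fan. int (Poly_Mapping.lookup c \<rho>) + \<lfloor>m \<bullet> primitive_generator N' \<rho>\<rfloor>)" for c and m :: "'a \<times> 'b"
  have g: "g ?a m = g ?b (m + (0, e i))" for m
    unfolding g_def
  proof (rule restrict_ext)
    fix \<rho> assume \<rho>: "\<rho> \<in> rays \<Sigma>'.fan"
    then obtain j v where v: "j \<le> k" "v \<in> ext j" "\<rho> = \<Sigma>'.ray (v, \<epsilon> j)" unfolding rays_eq using WE by blast
    have pg: "primitive_generator N' \<rho> = (v, \<epsilon> j)" using primitive_generator_W[of "(v, \<epsilon> j)"] v by (simp add: W_iff)
    have mem: "\<rho> \<in> ray_class l \<longleftrightarrow> l = j" if "l \<le> k" for l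
      using R.disjoint[OF that v(1)] v unfolding ray_class_def by blast
    have "(m + (0, e i)) \<bullet> (v, \<epsilon> j) = m \<bullet> (v, \<epsilon> j) + of_int (if j = 0 then -1 else if i = j then 1 else 0)"
      using e_pairing[OF i v(1), of v] by (simp only: inner_add_left) simp
    then have "\<lfloor>(m + (0, e i)) \<bullet> (v, \<epsilon> j)\<rfloor> = \<lfloor>m \<bullet> (v, \<epsilon> j)\<rfloor> + (if j = 0 then -1 else if i = j then 1 else 0)"
      by (simp only: floor_add_int)
    then show "int (Poly_Mapping.lookup ?a \<rho>) + \<lfloor>m \<bullet> primitive_generator N' \<rho>\<rfloor> =
        int (Poly_Mapping.lookup ?b \<rho>) + \<lfloor>(m + (0, e i)) \<bullet> primitive_generator N' \<rho>\<rfloor>"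
      unfolding pg using mem[OF ik(1)] mem[of 0] ik R.finite_R[OF ik(1)] R.finite_R[of 0]
      by (auto simp: lookup_indicator_exponent)
  qed
  have cd: "class_degree N' \<Sigma>'.fan c = g c ` dual_lattice N'" for c
    unfolding class_degree_def g_def ..
  have "class_degree N' \<Sigma>'.fan ?a = class_degree N' \<Sigma>'.fan ?b"
  proof -
    have "g ?a ` dual_lattice N' = g ?b ` ((\<lambda>m. m + (0, e i)) ` dual_lattice N')"
      unfolding image_image g ..
    also have "(\<lambda>m. m + (0, e i)) ` dual_lattice N' = dual_lattice N'"
    proof
      show "(\<lambda>m. m + (0, e i)) ` dual_lattice N' \<subseteq> dual_lattice N'" using e_dual_lattice[OF i] dual_lattice_add by blast
      show "dual_lattice N' \<subseteq> (\<lambda>m. m + (0, e i)) ` dual_lattice N'"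
      proof
        fix m assume "m \<in> dual_lattice N'"
        then have "m - (0, e i) \<in> dual_lattice N'" using e_dual_lattice[OF i] by (rule dual_lattice_diff)
        then show "m \<in> (\<lambda>m. m + (0, e i)) ` dual_lattice N'" by (rule rev_image_eqI) simp
      qed
    qed
    finally show ?thesis unfolding cd .
  qed
  moreover have "Poly_Mapping.keys (R.binomial i) \<subseteq> {?a, ?b}"
    unfolding R.binomial_eq by (auto simp: in_keys_iff lookup_minus lookup_single when_def split: if_splits)
  ultimately show ?thesis unfolding homogeneous_def by (intro exI[of _ "class_degree N' \<Sigma>'.fan ?b"]) auto
qed

text \<open>As the vectors \<open>\<epsilon> i\<close> sum to zero, so do the contributions of the
  second component of \<open>l\<close> at the levels. Functionals with the same first component
  differ only in these contributions.\<close>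

lemma floor_pairing:
  assumes l: "l \<in> dual_lattice N'"
  obtains z where "(\<Sum>i\<le>k. z i) = (0::int)" "\<And>i v. i \<le> k \<Longrightarrow> v \<in> N \<Longrightarrow> \<lfloor>l \<bullet> (v, \<epsilon> i)\<rfloor> = \<lfloor>fst l \<bullet> v\<rfloor> + z i"
proof -
  define z where "z i = \<lfloor>snd l \<bullet> \<epsilon> i\<rfloor>" for i
  have z: "of_int (z i) = snd l \<bullet> \<epsilon> i" if "i \<le> k" for i
    using dual_lattice_floor[OF l, of "(0, \<epsilon> i)"] N.lattice_0 \<epsilon>_in_int_span[OF that] by (cases l) (simp add: z_def)
  show ?thesis
  proof (rule that[of z])
    have "of_int (\<Sum>i\<le>k. z i) = (\<Sum>i\<le>k. snd l \<bullet> \<epsilon> i)" using z by simp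
    also have "\<dots> = 0" by (simp add: inner_sum_right[symmetric] sum_\<epsilon>)
    finally show "(\<Sum>i\<le>k. z i) = 0" by (simp only: of_int_eq_0_iff)
    fix i v assume i: "i \<le> k" and "v \<in> N"
    have "l \<bullet> (v, \<epsilon> i) = fst l \<bullet> v + of_int (z i)" unfolding z[OF i] by (cases l) simp
    then show "\<lfloor>l \<bullet> (v, \<epsilon> i)\<rfloor> = \<lfloor>fst l \<bullet> v\<rfloor> + z i" by simp
  qed
qed

lemma cox_point_W: "n \<in> dual_monoid N' (cone_of S) \<Longrightarrow> \<Sigma>'.cox_point S X n = (\<Prod>w\<in>W. X w powi \<lfloor>n \<bullet> w\<rfloor>)"
  unfolding \<Sigma>'.cox_point_def Union_cayley_generator_sets by simp

text \<open>If the common value of the monomials is zero, a vanishing coordinate in each class of rays forces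
  the second component of a character that does not vanish at the point.\<close>

lemma zero_locus_in_image:
  assumes S: "S \<in> cayley_generator_sets" and X: "\<And>w. w \<in> W - S \<Longrightarrow> X w \<noteq> 0"
    and eq: "\<And>i. i \<in> {1..k} \<Longrightarrow> (\<Prod>v\<in>ext i. X (v, \<epsilon> i)) = (\<Prod>v\<in>ext 0. X (v, \<epsilon> 0))"
  shows "chart_point N' \<Sigma>'.fan (cone_of S) (\<Sigma>'.cox_point S X) \<in> emb.image"
proof -
  \<comment> \<open>The point is viewed in the chart of the whole cone over \<open>face m\<close>,
    because the factorization criterion is available for the pairs in
    \<open>cone_pairs\<close>.\<close>
  obtain m where m: "m \<in> supports" "S \<subseteq> cayley_generators m" using S unfolding cayley_generator_sets_def by blast
  let ?T = "cayley_generators m"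
  have T: "?T \<in> cayley_generator_sets" by (rule cayley_generators_in_sets[OF m(1)])
  have XT: "X w \<noteq> 0" if "w \<in> W - ?T" for w using X that m(2) by blast
  have cp: "chart_point N' \<Sigma>'.fan (cone_of S) (\<Sigma>'.cox_point S X) = chart_point N' \<Sigma>'.fan (cone' m) (\<Sigma>'.cox_point ?T X)"
    by (rule \<Sigma>'.cox_point_unique[OF S T]; unfold Union_cayley_generator_sets) (fact X XT)+
  have ch: "\<Sigma>'.cox_point ?T X \<in> chart N' (cone' m)"
    by (rule \<Sigma>'.cox_point_chart; unfold Union_cayley_generator_sets) (fact XT)
  have pair: "(cone m, cone' m) \<in> cone_pairs" using m(1) by (auto simp: cone_pairs_def)
  define Q where "Q i = (\<Prod>v\<in>ext i. X (v, \<epsilon> i))" for i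
  have Q: "Q i = Q 0" if "i \<le> k" for i using eq[of i] that by (cases "i = 0") (auto simp: Q_def)
  obtain \<gamma> where "\<gamma> \<in> chart N (cone m)" "\<Sigma>'.cox_point ?T X = emb.push (cone' m) \<gamma>"
  proof (rule emb.push_factor[OF pair ch])
    fix l l' assume l: "l \<in> dual_monoid N' (cone' m)" "l' \<in> dual_monoid N' (cone' m)" "fst l = fst l'"
    define A where "A v = \<lfloor>fst l \<bullet> v\<rfloor>" for v
    \<comment> \<open>The exponent at a generator is the sum of a part \<open>A\<close> common to
      \<open>l\<close> and \<open>l'\<close> and an integer that depends only on the level.\<close>
    define shifted where "shifted n y \<longleftrightarrow> (\<forall>i\<le>k. \<forall>v\<in>N. \<lfloor>n \<bullet> (v, \<epsilon> i)\<rfloor> = A v + y i)" for n y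
    obtain z where "(\<Sum>i\<le>k. z i) = (0::int)" "\<And>i v. i \<le> k \<Longrightarrow> v \<in> N \<Longrightarrow> \<lfloor>l \<bullet> (v, \<epsilon> i)\<rfloor> = \<lfloor>fst l \<bullet> v\<rfloor> + z i"
      by (rule floor_pairing[OF dual_monoid_dual_lattice[OF l(1)]]) (rule that; assumption)
    then have z: "(\<Sum>i\<le>k. z i) = 0" "shifted l z" unfolding shifted_def A_def by auto
    obtain z' where "(\<Sum>i\<le>k. z' i) = (0::int)" "\<And>i v. i \<le> k \<Longrightarrow> v \<in> N \<Longrightarrow> \<lfloor>l' \<bullet> (v, \<epsilon> i)\<rfloor> = \<lfloor>fst l' \<bullet> v\<rfloor> + z' i"
      by (rule floor_pairing[OF dual_monoid_dual_lattice[OF l(2)]]) (rule that; assumption)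
    then have z': "(\<Sum>i\<le>k. z' i) = 0" "shifted l' z'" unfolding shifted_def A_def l(3) by auto
    have val: "\<Sigma>'.cox_point ?T X n = (\<Prod>i\<le>k. \<Prod>v\<in>ext i. X (v, \<epsilon> i) powi (A v + y i))"
      if n: "n \<in> dual_monoid N' (cone' m)" and y: "shifted n y" for n y
      unfolding cox_point_W[OF n] prod_W using y ext(2) by (intro prod.cong refl) (auto simp: subset_iff shifted_def)
    show "\<Sigma>'.cox_point ?T X l = \<Sigma>'.cox_point ?T X l'"
    proof (cases "Q 0 = 0")
      case False
      have nz: "X (v, \<epsilon> i) \<noteq> 0" if "i \<le> k" "v \<in> ext i" for i v
        using Q[OF that(1)] False ext(1)[OF that(1)] that(2) unfolding Q_def by (metis prod_zero_iff)
      have "\<Sigma>'.cox_point ?T X n = (\<Prod>i\<le>k. \<Prod>v\<in>ext i. X (v, \<epsilon> i) powi A v)"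
        if n: "n \<in> dual_monoid N' (cone' m)" and y: "shifted n y"
          "(\<Sum>i\<le>k. y i) = 0" for n y
      proof -
        have "(\<Prod>v\<in>ext i. X (v, \<epsilon> i) powi (A v + y i)) = (\<Prod>v\<in>ext i. X (v, \<epsilon> i) powi A v) * Q 0 powi y i" if i: "i \<le> k" for i
        proof -
          have "(\<Prod>v\<in>ext i. X (v, \<epsilon> i) powi (A v + y i)) = (\<Prod>v\<in>ext i. X (v, \<epsilon> i) powi A v * X (v, \<epsilon> i) powi y i)"
            using nz[OF i] by (intro prod.cong refl) (simp add: power_int_add)
          then show ?thesis using Q[OF i] by (simp add: prod.distrib prod_power_int_distrib Q_def)
        qed
        moreover have "\<Sigma>'.cox_point ?T X n = (\<Prod>i\<le>k. \<Prod>v\<in>ext i. X (v, \<epsilon> i) powi (A v + y i))"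
          by (rule val[OF n y(1)])
        ultimately have "\<Sigma>'.cox_point ?T X n = (\<Prod>i\<le>k. (\<Prod>v\<in>ext i. X (v, \<epsilon> i) powi A v) * Q 0 powi y i)"
          by simp
        also have "\<dots> = (\<Prod>i\<le>k. \<Prod>v\<in>ext i. X (v, \<epsilon> i) powi A v)"
          using y(2) by (simp add: prod.distrib prod_power_int_sum[OF False])
        finally show ?thesis .
      qed
      note common = this
        show ?thesis by (rule trans[OF common[OF l(1) z(2,1)] common[OF l(2) z'(2,1), symmetric]])
    next
      case True
      have "\<exists>v\<in>ext i. X (v, \<epsilon> i) = 0" if "i \<le> k" for i
      proof -
        have "Q i = 0" using Q[OF that] True by simp
        then show ?thesis unfolding Q_def prod_zero_iff[OF ext(1)[OF that]] .
      qed
      then have "\<forall>i\<in>{..k}. \<exists>v. v \<in> ext i \<and> X (v, \<epsilon> i) = 0" by blast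
      then obtain x where "\<forall>i\<in>{..k}. x i \<in> ext i \<and> X (x i, \<epsilon> i) = 0" by (rule bchoice[THEN exE])
      then have x: "\<And>i. i \<le> k \<Longrightarrow> x i \<in> ext i" "\<And>i. i \<le> k \<Longrightarrow> X (x i, \<epsilon> i) = 0" by auto
      have xT: "(x i, \<epsilon> i) \<in> ?T" if "i \<le> k" for i using XT[of "(x i, \<epsilon> i)"] x[OF that] W_iff[OF that] by blast
      have xN: "x i \<in> N" if "i \<le> k" for i using x(1)[OF that] ext(2)[OF that] by blast
      have nonneg: "0 \<le> A (x i) + y i"
        if n: "n \<in> dual_monoid N' (cone' m)" and y: "shifted n y" and i: "i \<le> k" for n y i
      proof -
        have "0 \<le> n \<bullet> (x i, \<epsilon> i)" using n xT[OF i] unfolding \<Sigma>'.dual_monoid_cone by blast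
        then have "0 \<le> \<lfloor>n \<bullet> (x i, \<epsilon> i)\<rfloor>" by simp
        then show ?thesis using y i xN[OF i] unfolding shifted_def by simp
      qed
      have vanish: "\<Sigma>'.cox_point ?T X n = 0"
        if n: "n \<in> dual_monoid N' (cone' m)" and y: "shifted n y"
          and i: "i \<le> k" "A (x i) + y i \<noteq> 0" for n y i
      proof -
        have "X (x i, \<epsilon> i) powi (A (x i) + y i) = 0" using x(2)[OF i(1)] i(2) by simp
        then have "(\<Prod>v\<in>ext i. X (v, \<epsilon> i) powi (A v + y i)) = 0"
          using x(1)[OF i(1)] ext(1)[OF i(1)] by (meson prod_zero)
        then show ?thesis unfolding val[OF n y] using i(1) by (meson atMost_iff finite_atMost prod_zero)
      qed
      show ?thesis
      \<comment> \<open>This sum is the total exponent at the chosen zeros, both for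
        \<open>l\<close> and for \<open>l'\<close>. If it is nonzero, a zero coordinate occurs with
        nonzero exponent and both values are 0. Otherwise these nonnegative exponents are all 0,
        which determines the contribution of each level.\<close>
      proof (cases "(\<Sum>i\<le>k. A (x i)) = 0")
        case False
        have "\<Sigma>'.cox_point ?T X n = 0"
          if n: "n \<in> dual_monoid N' (cone' m)" and y: "shifted n y"
            "(\<Sum>i\<le>k. y i) = 0" for n y
        proof -
          have "(\<Sum>i\<le>k. A (x i) + y i) \<noteq> 0" using False y(2) by (simp add: sum.distrib)
          then obtain i where "i \<in> {..k}" "A (x i) + y i \<noteq> 0" by (rule sum.not_neutral_contains_not_neutral)
          then show ?thesis using vanish[OF n y(1)] by simp
        qed
        note common = this
        show ?thesis by (rule trans[OF common[OF l(1) z(2,1)] common[OF l(2) z'(2,1), symmetric]])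
      next
        case True
        have fixed: "y i = - A (x i)"
          if n: "n \<in> dual_monoid N' (cone' m)" and y: "shifted n y"
            "(\<Sum>i\<le>k. y i) = 0" and i: "i \<le> k" for n y i
        proof -
          have "(\<Sum>i\<le>k. A (x i) + y i) = 0" using True y(2) by (simp add: sum.distrib)
          then have "A (x i) + y i = 0"
            using nonneg[OF n y(1)] i by (subst (asm) sum_nonneg_eq_0_iff) auto
          then show ?thesis by simp
        qed
        have "z i = z' i" if "i \<le> k" for i
          using fixed[OF l(1) z(2,1) that] fixed[OF l(2) z'(2,1) that] by simp
        then show ?thesis unfolding val[OF l(1) z(2)] val[OF l(2) z'(2)] by simp
      qed
    qed
  qed (rule that; assumption)
  then show ?thesis unfolding cp using emb.push_in_image[OF pair] by simp
qed

text \<open>Points of \<open>P\<close> are sums of one point from each level, and \<open>P\<close>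
  spans the space. The coefficients serve to distribute a logarithm of a character over the ray
  generators.\<close>

lemma span_W: "(v, 0) \<in> span W"
proof -
  have "subspace {v. (v, 0) \<in> span W}"
  proof (rule subspaceI)
    show "0 \<in> {v. (v, 0) \<in> span W}" using span_zero[of W] by (simp add: zero_prod_def)
    show "x + y \<in> {v. (v, 0) \<in> span W}" if "x \<in> {v. (v, 0) \<in> span W}" "y \<in> {v. (v, 0) \<in> span W}" for x y
      using span_add[of "(x, 0)" W "(y, 0)"] that by simp
    show "c *\<^sub>R x \<in> {v. (v, 0) \<in> span W}" if "x \<in> {v. (v, 0) \<in> span W}" for c x
      using span_scale[of "(x, 0)" W c] that by simp
  qed
  moreover have "P \<subseteq> {v. (v, 0) \<in> span W}"
  proof
    fix v assume "v \<in> P"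
    then obtain f where f: "\<And>i. i \<le> k \<Longrightarrow> f i \<in> D i" "v = (\<Sum>i\<le>k. f i)"
      using sum_set_elem unfolding decomposition by blast
    have "(f i, \<epsilon> i) \<in> span W" if "i \<le> k" for i
    proof -
      have "(f i, \<epsilon> i) \<in> convex hull (ext i \<times> {\<epsilon> i})"
        using f(1)[OF that] ext(3)[OF that] by (simp add: convex_hull_Times)
      also have "\<dots> \<subseteq> convex hull W" by (rule hull_mono) (use that in \<open>auto simp: W_iff\<close>)
      also have "\<dots> \<subseteq> span W" by (rule convex_hull_subset_span)
      finally show ?thesis .
    qed
    then have "(\<Sum>i\<le>k. (f i, \<epsilon> i)) \<in> span W" by (intro span_sum) auto
    then show "v \<in> {v. (v, 0) \<in> span W}" using f(2) by (simp add: pair_sum_\<epsilon>)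
  qed
  ultimately have "span P \<subseteq> {v. (v, 0) \<in> span W}" by (intro span_minimal)
  then show ?thesis using span_P by blast
qed

lemma orthogonal_cone:
  assumes "x \<in> cone_of S" "\<And>w. w \<in> S \<Longrightarrow> n \<bullet> w = 0"
  shows "n \<bullet> x = 0"
  using convex_cone_hull_nonneg[OF assms(1), of n] convex_cone_hull_nonneg[OF assms(1), of "- n"] assms(2)
  by (simp add: inner_minus_left)

text \<open>The zero cone is lifted to the empty set, the cone of \<open>face m\<close> to all
  generators over the face. A functional in the dual monoid that vanishes on the face vanishes at
  each generator, which is one term of a sum of nonnegative values belonging to a point of the
  face.\<close>

lemma face_generators_lift:
  assumes "S \<in> face_generators"
  obtains T where "T \<in> cayley_generator_sets" "\<And>v. v \<in> cone_of S \<Longrightarrow> (v, 0) \<in> cone_of T"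
    "\<And>n. n \<in> dual_monoid N' (cone_of T) \<Longrightarrow> (\<forall>w\<in>T. n \<bullet> w = 0) \<longleftrightarrow> (\<forall>v\<in>S. fst n \<bullet> v = 0)"
    "T = {} \<or> (\<forall>i\<le>k. \<exists>v\<in>ext i. (v, \<epsilon> i) \<in> T)"
proof (rule face_generators_cases[OF assms])
  assume "S = {}"
  then show ?thesis using that[OF empty_cayley_generators] by (simp add: zero_prod_def)
next
  fix m assume m: "m \<in> supports" "S = vertices \<inter> face m"
  show ?thesis
  proof (rule that[OF cayley_generators_in_sets[OF m(1)]])
    show "(v, 0) \<in> cone' m" if "v \<in> cone_of S" for v using cone_in_cone'[OF m(1)] that m(2) by blast
    have "\<exists>v\<in>ext i. (v, \<epsilon> i) \<in> cayley_generators m" if i: "i \<le> k" for i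
    proof -
      obtain v where "v \<in> ext i" "m \<bullet> v = \<mu> i m" by (rule \<mu>_attained[OF i])
      then show ?thesis using cayley_generators_iff[OF i] by blast
    qed
    then show "cayley_generators m = {} \<or> (\<forall>i\<le>k. \<exists>v\<in>ext i. (v, \<epsilon> i) \<in> cayley_generators m)" by blast
    fix n assume n: "n \<in> dual_monoid N' (cone' m)"
    have fst_n: "fst n \<bullet> v = n \<bullet> (v, 0)" for v by (cases n) simp
    show "(\<forall>w\<in>cayley_generators m. n \<bullet> w = 0) \<longleftrightarrow> (\<forall>v\<in>S. fst n \<bullet> v = 0)"
    proof
      assume 0: "\<forall>w\<in>cayley_generators m. n \<bullet> w = 0"
      show "\<forall>v\<in>S. fst n \<bullet> v = 0"
      proof
        fix v assume "v \<in> S"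
        then have "(v, 0) \<in> cone' m" using face_in_cone[OF m(1)] m(2) by blast
        then show "fst n \<bullet> v = 0" unfolding fst_n by (rule orthogonal_cone) (use 0 in blast)
      qed
    next
      assume 0: "\<forall>v\<in>S. fst n \<bullet> v = 0"
      have face0: "fst n \<bullet> v = 0" if "v \<in> face m" for v
      proof (rule orthogonal_cone[of v S])
        show "v \<in> cone_of S"
          unfolding m(2) cone_of_vertices[OF face_proper[OF m(1)]] using that by (rule hull_inc)
      qed (use 0 in blast)
      show "\<forall>w\<in>cayley_generators m. n \<bullet> w = 0"
      proof
        fix w assume w: "w \<in> cayley_generators m"
        then obtain v i where v: "i \<le> k" "v \<in> ext i" "m \<bullet> v = \<mu> i m" "w = (v, \<epsilon> i)" unfolding cayley_generators_def by blast
        have "\<exists>x. x \<in> summand_face m j" if "j \<le> k" for j using summand_face_ext[OF that, of m] by blast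
        then obtain g where g: "\<And>j. j \<le> k \<Longrightarrow> g j \<in> summand_face m j" by metis
        define f where "f = g(i := v)"
        have f: "f j \<in> summand_face m j" if "j \<le> k" for j
          using g[OF that] v ext(4)[OF v(1)] by (auto simp: f_def summand_face_def)
        have "0 = n \<bullet> (\<Sum>j\<le>k. f j, 0)"
          using face0[OF sum_in_face[OF m(1) f]] unfolding fst_n by simp
        also have "\<dots> = (\<Sum>j\<le>k. n \<bullet> (f j, \<epsilon> j))" unfolding pair_sum_\<epsilon>[symmetric] by (simp add: inner_sum_right)
        finally have "(\<Sum>j\<le>k. n \<bullet> (f j, \<epsilon> j)) = 0" by simp
        moreover have "0 \<le> n \<bullet> (f j, \<epsilon> j)" if "j \<le> k" for j
          using n summand_in_cone[OF that f[OF that]] by (simp add: dual_monoid_def)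
        ultimately have "n \<bullet> (f i, \<epsilon> i) = 0" using v(1) by (subst (asm) sum_nonneg_eq_0_iff) auto
        then show "n \<bullet> w = 0" using v(4) by (simp add: f_def)
      qed
    qed
  qed
qed

text \<open>A point of the orbit of a cone is given by a character of the lattice orthogonal to the cone.  Its
  logarithm, written in terms of the generators of the rays, provides homogeneous coordinates.\<close>

lemma image_in_zero_locus:
  assumes q: "q \<in> toric_points N \<Sigma>.fan"
  obtains T X where "T \<in> cayley_generator_sets" "\<And>w. w \<in> W - T \<Longrightarrow> X w \<noteq> 0"
    "emb.morphism q = chart_point N' \<Sigma>'.fan (cone_of T) (\<Sigma>'.cox_point T X)"
    "\<And>i. i \<in> {1..k} \<Longrightarrow> (\<Prod>v\<in>ext i. X (v, \<epsilon> i)) = (\<Prod>v\<in>ext 0. X (v, \<epsilon> 0))"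
proof -
  obtain S \<delta> where S: "S \<in> face_generators" "\<delta> \<in> chart N (cone_of S)" "q = chart_point N \<Sigma>.fan (cone_of S) \<delta>"
    "\<And>m. m \<in> dual_monoid N (cone_of S) \<Longrightarrow> \<delta> m \<noteq> 0 \<longleftrightarrow> (\<forall>w\<in>S. m \<bullet> w = 0)"
    by (rule \<Sigma>.orbit_of_point[OF q]) (rule that; assumption)
  obtain T where T: "T \<in> cayley_generator_sets" "\<And>v. v \<in> cone_of S \<Longrightarrow> (v, 0) \<in> cone_of T"
    "\<And>n. n \<in> dual_monoid N' (cone_of T) \<Longrightarrow> (\<forall>w\<in>T. n \<bullet> w = 0) \<longleftrightarrow> (\<forall>v\<in>S. fst n \<bullet> v = 0)"
    "T = {} \<or> (\<forall>i\<le>k. \<exists>v\<in>ext i. (v, \<epsilon> i) \<in> T)"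
    by (rule face_generators_lift[OF S(1)]) (rule that; assumption)
  define A where "A = {m \<in> dual_lattice N. \<forall>v\<in>S. m \<bullet> v = 0}"
  have AD: "m \<in> dual_monoid N (cone_of S)" if "m \<in> A" for m
    using that unfolding A_def \<Sigma>.dual_monoid_cone by simp
  have char: "is_character A \<delta>"
    unfolding is_character_def
  proof (intro conjI ballI)
    show "0 \<in> A" by (simp add: A_def dual_lattice_0)
    show "- m \<in> A" if "m \<in> A" for m using that by (simp add: A_def dual_lattice_minus)
    show "m + m' \<in> A" if "m \<in> A" "m' \<in> A" for m m' using that by (simp add: A_def dual_lattice_add inner_add_left)
    show "\<delta> m \<noteq> 0" if "m \<in> A" for m using S(4)[OF AD[OF that]] that by (simp add: A_def)
    show "\<delta> (m + m') = \<delta> m * \<delta> m'" if "m \<in> A" "m' \<in> A" for m m' by (rule chartD(2)[OF S(2) AD AD]) fact+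
  qed
  obtain z where z: "\<And>m. m \<in> A \<Longrightarrow> \<delta> m = exp (\<Sum>b\<in>N.basis. of_real (m \<bullet> b) * z b)"
    by (rule N.character_exp[OF char]) (auto simp: A_def intro: that)
  have "\<exists>r. (b, 0) = (\<Sum>w\<in>W. r w *\<^sub>R w)" for b :: 'a
    using span_W[of b] unfolding span_finite[OF finite_W] by blast
  then obtain r where r: "\<And>b. (b, 0) = (\<Sum>w\<in>W. r b w *\<^sub>R w)" by metis
  \<comment> \<open>The logarithms are distributed by the coefficients \<open>r\<close> such that
    weighting them by the values of any functional \<open>n\<close> gives back the logarithm
    belonging to \<open>fst n\<close>.\<close>
  define \<zeta> where "\<zeta> w = (\<Sum>b\<in>N.basis. of_real (r b w) * z b)" for w
  have key: "(\<Sum>w\<in>W. of_real (n \<bullet> w) * \<zeta> w) = (\<Sum>b\<in>N.basis. of_real (fst n \<bullet> b) * z b)" for n :: "'a \<times> 'b"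
  proof -
    have "fst n \<bullet> b = (\<Sum>w\<in>W. r b w * (n \<bullet> w))" for b
    proof -
      have "fst n \<bullet> b = n \<bullet> (b, 0)" by (cases n) simp
      also have "\<dots> = n \<bullet> (\<Sum>w\<in>W. r b w *\<^sub>R w)" by (simp only: r[of b])
      finally show ?thesis by (simp add: inner_sum_right)
    qed
    then have "(\<Sum>b\<in>N.basis. of_real (fst n \<bullet> b) * z b) = (\<Sum>b\<in>N.basis. \<Sum>w\<in>W. of_real (n \<bullet> w) * (of_real (r b w) * z b))"
      by (intro sum.cong refl) (simp add: sum_distrib_left sum_distrib_right mult_ac)
    also have "\<dots> = (\<Sum>w\<in>W. of_real (n \<bullet> w) * \<zeta> w)" by (subst sum.swap) (simp add: \<zeta>_def sum_distrib_left)
    finally show ?thesis by simp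
  qed
  \<comment> \<open>The point lies in the orbit of the cone, so exactly the coordinates at the
    generators in \<open>T\<close> are set to zero.\<close>
  define X where "X w = (if w \<in> T then 0 else exp (\<zeta> w))" for w
  have sub: "(\<lambda>n. (n, 0)) ` cone_of S \<subseteq> cone_of T" using T(2) by blast
  have X0: "X w \<noteq> 0" if "w \<in> W - T" for w using that by (simp add: X_def)
  have "\<Sigma>'.cox_point T X = emb.push (cone_of T) \<delta>"
  proof (rule chart_eqI[of _ N' "cone_of T"])
    show "\<Sigma>'.cox_point T X \<in> chart N' (cone_of T)"
      by (rule \<Sigma>'.cox_point_chart; unfold Union_cayley_generator_sets) (fact X0)
    show "emb.push (cone_of T) \<delta> \<in> chart N' (cone_of T)" by (rule emb.push_chart[OF sub S(2)])
    fix n assume n: "n \<in> dual_monoid N' (cone_of T)"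
    have fl: "of_int \<lfloor>n \<bullet> w\<rfloor> = n \<bullet> w" if "w \<in> W" for w
      using dual_lattice_floor[OF dual_monoid_dual_lattice[OF n]] W_subset_N' that by blast
    have fn: "fst n \<in> dual_monoid N (cone_of S)" by (rule emb.\<psi>_monoid[OF sub n])
    show "\<Sigma>'.cox_point T X n = emb.push (cone_of T) \<delta> n"
      unfolding cox_point_W[OF n] emb.push_apply[OF n]
    proof (cases "\<forall>w\<in>T. n \<bullet> w = 0")
      case True
      then have "fst n \<in> A" using T(3)[OF n] fn dual_monoid_dual_lattice by (auto simp: A_def)
      have "X w powi \<lfloor>n \<bullet> w\<rfloor> = exp (of_real (n \<bullet> w) * \<zeta> w)" if w: "w \<in> W" for w
      proof (cases "w \<in> T")
        case False
        have "exp (\<zeta> w) powi \<lfloor>n \<bullet> w\<rfloor> = exp (of_int \<lfloor>n \<bullet> w\<rfloor> * \<zeta> w)" by (rule exp_power_int)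
        also have "(of_int \<lfloor>n \<bullet> w\<rfloor> :: complex) = of_real (n \<bullet> w)" using fl[OF w] by (metis of_real_of_int_eq)
        finally show ?thesis using False by (simp add: X_def)
      qed (use True in simp)
      then have "(\<Prod>w\<in>W. X w powi \<lfloor>n \<bullet> w\<rfloor>) = exp (\<Sum>w\<in>W. of_real (n \<bullet> w) * \<zeta> w)"
        by (simp add: exp_sum[OF finite_W])
      then show "(\<Prod>w\<in>W. X w powi \<lfloor>n \<bullet> w\<rfloor>) = \<delta> (fst n)" unfolding key using z[OF \<open>fst n \<in> A\<close>] by simp
    next
      case False
      then obtain w where w: "w \<in> T" "n \<bullet> w \<noteq> 0" by blast
      have wW: "w \<in> W" using w(1) T(1) Union_cayley_generator_sets by blast
      have "\<lfloor>n \<bullet> w\<rfloor> \<noteq> 0" using fl[OF wW] w(2) by auto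
      then have "X w powi \<lfloor>n \<bullet> w\<rfloor> = 0" using w(1) by (simp add: X_def)
      then have "(\<Prod>w\<in>W. X w powi \<lfloor>n \<bullet> w\<rfloor>) = 0" using wW finite_W by (meson prod_zero)
      moreover have "\<delta> (fst n) = 0" using S(4)[OF fn] T(3)[OF n] False by blast
      ultimately show "(\<Prod>w\<in>W. X w powi \<lfloor>n \<bullet> w\<rfloor>) = \<delta> (fst n)" by simp
    qed
  qed
  then have image: "emb.morphism q = chart_point N' \<Sigma>'.fan (cone_of T) (\<Sigma>'.cox_point T X)"
    unfolding S(3)
    using emb.morphism_chart_point[OF \<Sigma>.cone_in_fan[OF S(1)] S(2) \<Sigma>'.cone_in_fan[OF T(1)] sub] by simp
  have "(\<Prod>v\<in>ext i. X (v, \<epsilon> i)) = (\<Prod>v\<in>ext 0. X (v, \<epsilon> 0))" if i: "i \<in> {1..k}" for i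
  proof (cases "T = {}")
    case False
    \<comment> \<open>A nonempty \<open>T\<close> contains a generator of every level, so all the
      products vanish.\<close>
    have "(\<Prod>v\<in>ext j. X (v, \<epsilon> j)) = 0" if j: "j \<le> k" for j
    proof -
      obtain v where "v \<in> ext j" "(v, \<epsilon> j) \<in> T" using T(4) False j by blast
      then show ?thesis using ext(1)[OF j] by (intro prod_zero) (auto simp: X_def)
    qed
    then show ?thesis using i by simp
  next
    case True
    have ik: "i \<le> k" "i \<noteq> 0" using i by auto
    define s where "s j = (\<Sum>v\<in>ext j. \<zeta> (v, \<epsilon> j))" for j
    \<comment> \<open>The functional \<open>(0, e i)\<close> has first component zero, so the
      logarithms weighted by it sum to zero; this equates the logarithms of the products at level
      \<open>i\<close> and at level 0.\<close>
    have "0 = (\<Sum>w\<in>W. of_real ((0, e i) \<bullet> w) * \<zeta> w)" using key[of "(0, e i)"] by simp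
    also have "\<dots> = (\<Sum>j\<le>k. of_real (if j = 0 then -1 else if i = j then 1 else 0) * s j)"
      unfolding sum_W s_def sum_distrib_left using e_pairing[OF i] by (intro sum.cong refl) simp
    also have "\<dots> = - s 0 + (\<Sum>j=1..k. if i = j then s j else 0)"
      unfolding sum_split_0 by (intro arg_cong2[where f = "(+)"] sum.cong refl) auto
    also have "(\<Sum>j=1..k. if i = j then s j else 0) = s i" using i by simp
    finally have "s i = s 0" by simp
    moreover have "(\<Prod>v\<in>ext j. X (v, \<epsilon> j)) = exp (s j)" if "j \<le> k" for j
      using True ext(1)[OF that] by (simp add: X_def s_def exp_sum)
    ultimately show ?thesis using ik by simp
  qed
  with X0 image show ?thesis by (rule that[of T X, OF T(1)])
qed

lemma image_eq_zero_locus: "emb.image = zero_locus N' \<Sigma>'.fan (R.binomial_ideal k)"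
proof -
  have van: "(\<forall>f\<in>R.binomial_ideal k. eval_poly f (\<Sigma>'.coordinates X) = 0) \<longleftrightarrow>
      (\<forall>i\<in>{1..k}. (\<Prod>v\<in>ext i. X (v, \<epsilon> i)) = (\<Prod>v\<in>ext 0. X (v, \<epsilon> 0)))" for X
    unfolding R.binomial_ideal_vanishes_iff[OF order_refl] by (intro ball_cong refl) (simp only: prod_coordinates atLeastAtMost_iff zero_le)
  show ?thesis
  proof (rule subset_antisym; rule subsetI)
    fix p assume "p \<in> emb.image"
    then obtain q where q: "q \<in> toric_points N \<Sigma>.fan" "p = emb.morphism q" by blast
    obtain T X where T: "T \<in> cayley_generator_sets" "\<And>w. w \<in> W - T \<Longrightarrow> X w \<noteq> 0"
      "emb.morphism q = chart_point N' \<Sigma>'.fan (cone_of T) (\<Sigma>'.cox_point T X)"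
      "\<And>i. i \<in> {1..k} \<Longrightarrow> (\<Prod>v\<in>ext i. X (v, \<epsilon> i)) = (\<Prod>v\<in>ext 0. X (v, \<epsilon> 0))"
      by (rule image_in_zero_locus[OF q(1)]) (rule that; assumption)
    show "p \<in> zero_locus N' \<Sigma>'.fan (R.binomial_ideal k)"
      unfolding \<Sigma>'.zero_locus_iff van Union_cayley_generator_sets q(2)
      using T by (intro bexI[OF _ T(1)] exI[of _ X]) blast
  next
    fix p assume "p \<in> zero_locus N' \<Sigma>'.fan (R.binomial_ideal k)"
    then obtain S X where S: "S \<in> cayley_generator_sets" "\<forall>w\<in>W - S. X w \<noteq> 0"
      "p = chart_point N' \<Sigma>'.fan (cone_of S) (\<Sigma>'.cox_point S X)"
      "\<forall>i\<in>{1..k}. (\<Prod>v\<in>ext i. X (v, \<epsilon> i)) = (\<Prod>v\<in>ext 0. X (v, \<epsilon> 0))"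
      unfolding \<Sigma>'.zero_locus_iff van Union_cayley_generator_sets by blast
    show "p \<in> emb.image" unfolding S(3) by (rule zero_locus_in_image[OF S(1)]) (use S in auto)
  qed
qed

theorem complete_intersection_image:
  "complete_intersection N' \<Sigma>'.fan k (cayley_equation N' \<Sigma>'.fan e) emb.image"
proof -
  let ?f = "cayley_equation N' \<Sigma>'.fan e"
  have im: "?f ` {1..k} = R.binomial ` {1..k}" using cayley_equation_eq by (intro image_cong) auto
  have I: "Idl\<^bsub>cox_ring \<Sigma>'.fan\<^esub> (?f ` {1..k}) = R.binomial_ideal k" unfolding im R.binomial_ideal_def ..
  have "?f i \<in> carrier (cox_ring \<Sigma>'.fan) \<and> homogeneous N' \<Sigma>'.fan (?f i)" if "i \<in> {1..k}" for i
    unfolding cayley_equation_eq[OF that] using R.binomial_carrier[of i] homogeneous_binomial[OF that] that by simp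
  moreover have "regular_sequence (cox_ring \<Sigma>'.fan) k ?f"
    using regular_sequence_cong[of k ?f R.binomial] cayley_equation_eq R.regular_sequence_binomials by blast
  moreover have "krull_dim (subtopology (toric_topology N' \<Sigma>'.fan) emb.image) = enat DIM('a)"
  proof -
    \<comment> \<open>The image is homeomorphic to the source variety, so its dimension is the rank
      of \<open>N\<close>.\<close>
    have "krull_dim (subtopology (toric_topology N' \<Sigma>'.fan) emb.image) = krull_dim (toric_topology N \<Sigma>.fan)"
      by (rule krull_dim_homeomorphic[OF emb.homeomorphic_image, symmetric])
    also have "\<dots> = enat (dim N)" by (rule \<Sigma>.krull_dim_toric)
    also have "dim N = DIM('a)" using dim_span[of N] span_N by simp
    finally show ?thesis .
  qed
  moreover have "krull_dim (toric_topology N' \<Sigma>'.fan) = enat (DIM('a) + k)"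
    unfolding \<Sigma>'.krull_dim_toric dim_N' ..
  ultimately show ?thesis
    unfolding complete_intersection_def I
    using R.radical_ideal_binomials image_eq_zero_locus emb.closedin_image by blast
qed

end

theorem theorem7p1:
  fixes N \<Delta> :: "'a::euclidean_space set"
    and k :: nat
    and e :: "nat \<Rightarrow> 'b::euclidean_space"
    and D :: "nat \<Rightarrow> 'a set"
  defines "N' \<equiv> N \<times> int_span (e ` {1..k})"
    and "\<Sigma> \<equiv> face_fan (dual_polytope \<Delta>)"
    and "\<Sigma>' \<equiv> cayley_fan k e D"
  assumes "is_lattice N" and "span N = UNIV"
    and "inj_on e {1..k}" and "e ` {1..k} \<subseteq> Basis"
    and "reflexive_polytope N \<Delta>"
    and "\<And>i. i \<le> k \<Longrightarrow> lattice_polytope N (D i)"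
    and "dual_polytope \<Delta> = (\<Sum>i\<le>k. D i)"
  shows "is_closed_embedding (toric_variety N \<Sigma>) (toric_variety N' \<Sigma>')
           (toric_morphism N \<Sigma> N' \<Sigma>' (\<lambda>n. (n, 0))) \<and>
         complete_intersection N' \<Sigma>' k (cayley_equation N' \<Sigma>' e)
           (toric_morphism N \<Sigma> N' \<Sigma>' (\<lambda>n. (n, 0)) ` points (toric_variety N \<Sigma>))"
proof -
  interpret reflexive_minkowski N \<Delta> k e D
    by unfold_locales (use assms in auto)
  have "points (toric_variety N (face_fan (dual_polytope \<Delta>))) = toric_points N (face_fan (dual_polytope \<Delta>))"
    unfolding face_fan_eq[symmetric] emb.zariski_toric by (rule \<Sigma>.topspace_toric)
  then show ?thesis
    unfolding N'_def \<Sigma>_def \<Sigma>'_def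
    using emb.closed_embedding complete_intersection_image
    unfolding face_fan_eq cayley_fan_eq by simp
qed

end
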